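(* Let $l,m,n$ be positive integers with $m\le n$, let $U$ be an open subset of $\mathbb R^n$, let $V$ be an $m$-dimensional rectifiable varifold in $U$ such that $\|\delta V\|$ is a Radon measure, and let $f\in\mathbf T(V,\mathbb R^l)$. Then the following four statements hold. (1) If $A=U\cap\{z:f(z)=0\}$, then $V\mathbf Df(z)=0$ for $\|V\|$ almost all $z\in A$. (2) If $k$ is a positive integer, $g:U\to\mathbb R^k$ is locally Lipschitzian, and $h(z)=(f(z),g(z))$ for $z\in\operatorname{dmn}f$, then $h\in\mathbf T(V,\mathbb R^l\times\mathbb R^k)$ and, for $\|V\|$ almost all $z$, $V\mathbf Dh(z)(v)=(V\mathbf Df(z)(v),V\mathbf Dg(z)(v))$ whenever $v\in\mathbb R^n$. (3) If $g:U\to\mathbb R^l$ is locally Lipschitzian, then $f+g\in\mathbf T(V,\mathbb R^l)$ and $V\mathbf D(f+g)(z)=V\mathbf Df(z)+V\mathbf Dg(z)$ for $\|V\|$ almost all $z$. (4) If $f\in\mathbf L_1^{\mathrm{loc}}(\|V\|,\mathbb R^l)$, $V\mathbf Df\in\mathbf L_1^{\mathrm{loc}}(\|V\|,\operatorname{Hom}(\mathbb R^n,\mathbb R^l))$, and $g:U\to\mathbb R$ is locally Lipschitzian, then $gf\in\mathbf T(V,\mathbb R^l)$ and $$V\mathbf D(gf)(z)=V\mathbf Dg(z)\,f(z)+g(z)\,V\mathbf Df(z)\quad\text{for }\|V\|\text{ almost all }z.$$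
   Context: $\mathbf G(n,m)$ is the set of $m$-dimensional linear subspaces of $\mathbb R^n$; $S_\natural$ is the orthogonal projection onto $S$; $\sigma\bullet\tau=\operatorname{trace}(\sigma^*\circ\tau)$, $|\sigma|^2=\sigma\bullet\sigma$; $\langle v,\lambda\rangle=\lambda(v)$. $\mathbf L^{\mathrm{loc}}_1$ means integrable on compact subsets of $U$. Measurable functions may be defined only almost everywhere; $\operatorname{dmn}f$ is the domain of $f$. For $\lambda\in\operatorname{Hom}(\mathbb R^n,\mathbb R)$ and $y\in\mathbb R^l$, $\lambda\,y$ is the map $v\mapsto\lambda(v)y$. An $m$-dimensional varifold $V$ in $U$ is a Radon measure over $U\times\mathbf G(n,m)$, with weight $\|V\|(A)=V(A\times\mathbf G(n,m))$. It is rectifiable if $V(k)=\sum_{i=1}^\infty c_i\int_{E_i}k(z,\operatorname{Tan}(M_i,z))\,d\mathscr H^m z$ for continuous compactly supported $k$, with $0<c_i<\infty$ and $E_i$ Borel subsets of $m$-dimensional $C^1$ submanifolds $M_i$. First variation $\delta V(g)=\int Dg(z)\bullet S_\natural\,dV(z,S)$ for $g\in C_c^\infty(U,\mathbb R^n)$, with total variation measure $\|\delta V\|$; if the latter is Radon, $\delta V$ is extended by $\mathbf L_1(\|\delta V\|)$-continuity to $\mathbf L_1(\|\delta V\|,\mathbb R^n)$. $\mathbf T(V,\mathbb R^l)$ is the set of $\mathbb R^l$ valued $\|V\|+\|\delta V\|$ measurable functions $f$ with domain contained in $U$ for which there is a $\|V\|$ measurable $\operatorname{Hom}(\mathbb R^n,\mathbb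 R^l)$ valued $F$ such that (i) $\int_{K\cap\{|f|\le s\}}|F|\,d\|V\|<\infty$ for compact $K\subset U$, $0\le s<\infty$; (ii) for $\theta\in C_c^\infty(U,\mathbb R^n)$ and $\eta\in C^\infty(\mathbb R^l,\mathbb R)$ with $\operatorname{spt}D\eta$ compact, $$\delta V((\eta\circ f)\theta)=\int\eta(f(z))S_\natural\bullet D\theta(z)\,dV(z,S)+\int\langle\theta(z),D\eta(f(z))\circ F(z)\rangle\,d\|V\|z.$$ $F$ is $\|V\|$ almost unique and is denoted $V\mathbf Df$. Locally Lipschitzian functions $g:U\to\mathbb R^k$ belong to $\mathbf T(V,\mathbb R^k)$ (with $V\mathbf Dg(z)$ equal, for $\|V\|$ almost all $z$, to the approximate differential of $g$ along the approximate tangent plane of $\|V\|$ at $z$ composed with the orthogonal projection onto that plane). *)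

theory Defs
  imports "HOL-Analysis.Analysis"
begin

section \<open>Smooth maps\<close>

text \<open>On open subsets of finite dimensional spaces this is the usual notion: all iterated
  directional derivatives up to order \<open>k\<close> exist and are continuous.\<close>

primrec Ck_on :: "nat \<Rightarrow> 'a::real_normed_vector set \<Rightarrow> ('a \<Rightarrow> 'b::real_normed_vector) \<Rightarrow> bool" where
  "Ck_on 0 S f \<longleftrightarrow> continuous_on S f"
| "Ck_on (Suc k) S f \<longleftrightarrow> (\<forall>x\<in>S. f differentiable (at x)) \<and>
     (\<forall>v. Ck_on k S (\<lambda>x. frechet_derivative f (at x) v))"

definition smooth :: "('a::real_normed_vector \<Rightarrow> 'b::real_normed_vector) \<Rightarrow> bool" where
  "smooth f \<longleftrightarrow> (\<forall>k. Ck_on k UNIV f)"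

text \<open>Elements of $C_c^\infty(U,\mathbf R^n)$ are represented by their extension by zero.\<close>

definition test_fields :: "'a::real_normed_vector set \<Rightarrow> ('a \<Rightarrow> 'a) set" where
  "test_fields U = {g. smooth g \<and> compact (closure {z. g z \<noteq> 0}) \<and> closure {z. g z \<noteq> 0} \<subseteq> U}"

definition locally_lipschitz_on :: "'a::metric_space set \<Rightarrow> ('a \<Rightarrow> 'b::metric_space) \<Rightarrow> bool" where
  "locally_lipschitz_on U g \<longleftrightarrow> (\<forall>x\<in>U. \<exists>r>0. \<exists>L. L-lipschitz_on (ball x r \<inter> U) g)"


section \<open>Linear maps and the Grassmannian\<close>

definition hom_inner :: "(real^'n \<Rightarrow> 'b::euclidean_space) \<Rightarrow> (real^'n \<Rightarrow> 'b) \<Rightarrow> real" where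
  "hom_inner \<sigma> \<tau> = trace (matrix (adjoint \<sigma> \<circ> \<tau>))"

definition hom_norm :: "(real^'n \<Rightarrow> 'b::euclidean_space) \<Rightarrow> real" where
  "hom_norm \<sigma> = sqrt (hom_inner \<sigma> \<sigma>)"

definition orth_proj :: "'a::euclidean_space set \<Rightarrow> 'a \<Rightarrow> 'a" where
  "orth_proj S x = (THE y. y \<in> S \<and> (\<forall>w\<in>S. (x - y) \<bullet> w = 0))"

definition grassmannian :: "nat \<Rightarrow> 'a::euclidean_space set set" where
  "grassmannian m = {S. subspace S \<and> dim S = m}"

definition grassmannian_top :: "nat \<Rightarrow> 'a::euclidean_space set topology" where
  "grassmannian_top m =
     pullback_topology (grassmannian m) (\<lambda>S. Blinfun (orth_proj S)) euclidean"


section \<open>Radon measures\<close>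

definition borel_of :: "'a topology \<Rightarrow> 'a measure" where
  "borel_of X = sigma (topspace X) {A. openin X A}"

lemma space_borel_of [simp]: "space (borel_of X) = topspace X"
  by (auto simp: borel_of_def intro!: space_measure_of dest: openin_subset)

lemma sets_borel_of: "sets (borel_of X) = sigma_sets (topspace X) {A. openin X A}"
  by (auto simp: borel_of_def intro!: sets_measure_of dest: openin_subset)

lemma sets_borel_of_top_of_set:
  assumes "open U"
  shows "sets (borel_of (top_of_set U)) = sets (restrict_space borel U)"
proof -
  have "{A. openin (top_of_set U) A} = (\<inter>) U ` {S. open S}"
    by (auto simp: openin_open)
  then show ?thesis
    using sigma_sets_Int[of U UNIV "{S. open S}"] assms
    by (simp add: sets_borel_of sets_restrict_space borel_def sigma_sets.Basic)
qed

text \<open>The spaces occurring below are locally compact with a countable base. There, a Radon measure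
  is determined by its restriction to the Borel sets, which is an arbitrary Borel measure that is
  finite on compact sets; the measurable sets of the corresponding outer measure are those of the
  completion. Accordingly, $\mu$ measurability always refers to \<^const>\<open>completion\<close>.\<close>

definition radon_measure :: "'a topology \<Rightarrow> 'a measure \<Rightarrow> bool" where
  "radon_measure X M \<longleftrightarrow> space M = topspace X \<and> sets M = sets (borel_of X) \<and>
     (\<forall>K. compactin X K \<longrightarrow> emeasure M K < \<infinity>)"


section \<open>Hausdorff measure, submanifolds, tangent cones\<close>

text \<open>Federer's normalisation: \<^term>\<open>unit_ball_vol (real m)\<close> is the volume of the unit ball of
  $\mathbf R^m$. Only dimensions $m \ge 1$ are used, so empty covering sets contribute zero.\<close>

definition hausdorff_outer :: "nat \<Rightarrow> 'a::euclidean_space set \<Rightarrow> ennreal" where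
  "hausdorff_outer m A = (SUP \<delta>\<in>{0<..}.
     INF C\<in>{C :: nat \<Rightarrow> 'a set. A \<subseteq> (\<Union>i. C i) \<and> (\<forall>i. bounded (C i) \<and> diameter (C i) \<le> \<delta>)}.
       \<Sum>i. ennreal (unit_ball_vol (real m) * (diameter (C i) / 2) ^ m))"

definition hausdorff_measure :: "nat \<Rightarrow> 'a::euclidean_space measure" where
  "hausdorff_measure m = measure_of UNIV (sets borel) (hausdorff_outer m)"

definition C1_submanifold :: "nat \<Rightarrow> 'a::euclidean_space set \<Rightarrow> bool" where
  "C1_submanifold m M \<longleftrightarrow> (\<forall>b\<in>M. \<exists>T W (\<sigma> :: 'a \<Rightarrow> 'a) (\<tau> :: 'a \<Rightarrow> 'a) Z.
     open T \<and> b \<in> T \<and> open W \<and> homeomorphism T W \<sigma> \<tau> \<and> Ck_on 1 T \<sigma> \<and> Ck_on 1 W \<tau> \<and>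
     Z \<in> grassmannian m \<and> \<sigma> ` (M \<inter> T) = Z \<inter> W)"

definition tangent_cone :: "'a::euclidean_space set \<Rightarrow> 'a \<Rightarrow> 'a set" where
  "tangent_cone S a = {v. \<forall>\<epsilon>>0. \<exists>x\<in>S. \<exists>r>0. norm (x - a) < \<epsilon> \<and> norm (r *\<^sub>R (x - a) - v) < \<epsilon>}"


section \<open>Varifolds\<close>

definition varifold_top :: "nat \<Rightarrow> 'a::euclidean_space set \<Rightarrow> ('a \<times> 'a set) topology" where
  "varifold_top m U = prod_topology (top_of_set U) (grassmannian_top m)"

definition varifold :: "nat \<Rightarrow> 'a::euclidean_space set \<Rightarrow> ('a \<times> 'a set) measure \<Rightarrow> bool" where
  "varifold m U V \<longleftrightarrow> radon_measure (varifold_top m U) V"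

definition weight :: "'a::euclidean_space set \<Rightarrow> ('a \<times> 'a set) measure \<Rightarrow> 'a measure" where
  "weight U V = distr V (borel_of (top_of_set U)) fst"

text \<open>Finiteness of the integrals over the sets \<open>E i\<close>, implicit in the formula for \<open>V(k)\<close>, has to be
  stated because the Bochner integral of a non-integrable function is zero.\<close>

definition rectifiable_varifold ::
    "nat \<Rightarrow> 'a::euclidean_space set \<Rightarrow> ('a \<times> 'a set) measure \<Rightarrow> bool" where
  "rectifiable_varifold m U V \<longleftrightarrow> varifold m U V \<and>
    (\<exists>(c :: nat \<Rightarrow> real) E M.
      (\<forall>i. 0 < c i \<and> C1_submanifold m (M i) \<and> E i \<in> sets borel \<and> E i \<subseteq> M i \<and> E i \<subseteq> U) \<and>
      (\<forall>k. continuous_map (varifold_top m U) euclideanreal k \<and>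
           (\<exists>K. compactin (varifold_top m U) K \<and> (\<forall>p\<in>topspace (varifold_top m U) - K. k p = 0)) \<longrightarrow>
        (\<forall>i. set_integrable (hausdorff_measure m) (E i) (\<lambda>z. k (z, tangent_cone (M i) z))) \<and>
        (\<lambda>i. c i * (\<integral>z\<in>E i. k (z, tangent_cone (M i) z) \<partial>hausdorff_measure m))
          sums (\<integral>p. k p \<partial>V)))"

definition first_variation ::
    "((real^'n) \<times> (real^'n) set) measure \<Rightarrow> (real^'n \<Rightarrow> real^'n) \<Rightarrow> real" where
  "first_variation V g =
     (\<integral>(z, S). hom_inner (frechet_derivative g (at z)) (orth_proj S) \<partial>V)"

text \<open>On open \<open>G\<close> the total variation is the supremum of \<open>\<delta>V(g)\<close> over test fields supported in \<open>G\<close> of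
  length at most one (the negative values cut off by \<^const>\<open>ennreal\<close> are irrelevant, as \<open>g = 0\<close> is
  admissible); on other sets it is the infimum over open supersets.\<close>

definition total_variation_outer ::
    "(real^'n) set \<Rightarrow> ((real^'n) \<times> (real^'n) set) measure \<Rightarrow> (real^'n) set \<Rightarrow> ennreal" where
  "total_variation_outer U V A = (INF G\<in>{G. open G \<and> A \<subseteq> G \<and> G \<subseteq> U}.
     SUP g\<in>{g \<in> test_fields G. \<forall>z. norm (g z) \<le> 1}. ennreal (first_variation V g))"

definition total_variation ::
    "(real^'n) set \<Rightarrow> ((real^'n) \<times> (real^'n) set) measure \<Rightarrow> (real^'n) measure" where
  "total_variation U V =
     measure_of U (sets (borel_of (top_of_set U))) (total_variation_outer U V)"

text \<open>The extension of \<open>\<delta>V\<close> to \<open>g \<in> L\<^sub>1(\<parallel>\<delta>V\<parallel>, R\<^sup>n)\<close> by continuity (and density of the test fields),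
  meaningful when \<open>\<parallel>\<delta>V\<parallel>\<close> is a Radon measure.\<close>

definition first_variation_ext ::
    "(real^'n) set \<Rightarrow> ((real^'n) \<times> (real^'n) set) measure \<Rightarrow> (real^'n \<Rightarrow> real^'n) \<Rightarrow> real" where
  "first_variation_ext U V g = (THE L. \<exists>h. (\<forall>i. h i \<in> test_fields U) \<and>
     (\<lambda>i. \<integral>\<^sup>+ z. ennreal (norm (h i z - g z)) \<partial>completion (total_variation U V)) \<longlonglongrightarrow> 0 \<and>
     (\<lambda>i. first_variation V (h i)) \<longlonglongrightarrow> L)"

definition weight_plus_variation ::
    "(real^'n) set \<Rightarrow> ((real^'n) \<times> (real^'n) set) measure \<Rightarrow> (real^'n) measure" where
  "weight_plus_variation U V = measure_of U (sets (borel_of (top_of_set U)))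
     (\<lambda>A. emeasure (weight U V) A + emeasure (total_variation U V) A)"


section \<open>Generalised weakly differentiable functions\<close>

text \<open>Measurability of an almost everywhere defined function.\<close>

definition partial_measurable :: "'a measure \<Rightarrow> ('a \<rightharpoonup> 'b::topological_space) \<Rightarrow> bool" where
  "partial_measurable M f \<longleftrightarrow> dom f \<subseteq> space M \<and> (AE z in M. z \<in> dom f) \<and>
     (\<forall>E. open E \<longrightarrow> {z \<in> dom f. the (f z) \<in> E} \<in> sets (completion M))"

text \<open>In the integrals below, the value \<^term>\<open>the (f z)\<close> outside the domain of \<open>f\<close> occurs on a null set
  only. The derivative \<open>F\<close> is taken to be total; an almost everywhere defined measurable \<open>F\<close> may be
  extended arbitrarily over the remaining null set.\<close>

definition is_weak_derivative ::
    "(real^'n) set \<Rightarrow> ((real^'n) \<times> (real^'n) set) measure \<Rightarrow>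
     (real^'n \<rightharpoonup> 'b::euclidean_space) \<Rightarrow> (real^'n \<Rightarrow> (real^'n) \<Rightarrow>\<^sub>L 'b) \<Rightarrow> bool" where
  "is_weak_derivative U V f F \<longleftrightarrow>
     F \<in> borel_measurable (completion (weight U V)) \<and>
     (\<forall>K s. compact K \<and> K \<subseteq> U \<and> 0 \<le> s \<longrightarrow>
        (\<integral>\<^sup>+ z\<in>{z \<in> K \<inter> dom f. norm (the (f z)) \<le> s}.
            ennreal (hom_norm (blinfun_apply (F z))) \<partial>completion (weight U V)) < \<infinity>) \<and>
     (\<forall>\<theta> (\<eta> :: 'b \<Rightarrow> real).
        \<theta> \<in> test_fields U \<and> smooth \<eta> \<and>
        compact (closure {y. frechet_derivative \<eta> (at y) \<noteq> (\<lambda>v. 0)}) \<longrightarrow>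
        first_variation_ext U V (\<lambda>z. \<eta> (the (f z)) *\<^sub>R \<theta> z) =
          (\<integral>(z, S). \<eta> (the (f z)) * hom_inner (orth_proj S) (frechet_derivative \<theta> (at z))
              \<partial>completion V) +
          (\<integral>z. frechet_derivative \<eta> (at (the (f z))) (blinfun_apply (F z) (\<theta> z))
              \<partial>completion (weight U V)))"

definition weakly_differentiable ::
    "(real^'n) set \<Rightarrow> ((real^'n) \<times> (real^'n) set) measure \<Rightarrow>
     (real^'n \<rightharpoonup> 'b::euclidean_space) set" where
  "weakly_differentiable U V =
     {f. partial_measurable (weight_plus_variation U V) f \<and> (\<exists>F. is_weak_derivative U V f F)}"

text \<open>The derivative is determined up to null sets of the weight.\<close>

definition weak_derivative ::
    "(real^'n) set \<Rightarrow> ((real^'n) \<times> (real^'n) set) measure \<Rightarrow>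
     (real^'n \<rightharpoonup> 'b::euclidean_space) \<Rightarrow> real^'n \<Rightarrow> (real^'n) \<Rightarrow>\<^sub>L 'b" where
  "weak_derivative U V f = (SOME F. is_weak_derivative U V f F)"

text \<open>A function on \<open>U\<close> as a partial function with domain \<open>U\<close>.\<close>

definition on_domain :: "'a set \<Rightarrow> ('a \<Rightarrow> 'b) \<Rightarrow> ('a \<rightharpoonup> 'b)" where
  "on_domain U g = (\<lambda>z. if z \<in> U then Some (g z) else None)"

definition L1_loc :: "'a::topological_space set \<Rightarrow> 'a measure \<Rightarrow> ('a \<Rightarrow> 'b::real_normed_vector) \<Rightarrow> bool" where
  "L1_loc U M f \<longleftrightarrow> f \<in> borel_measurable (completion M) \<and>
     (\<forall>K. compact K \<and> K \<subseteq> U \<longrightarrow> (\<integral>\<^sup>+ z\<in>K. ennreal (norm (f z)) \<partial>completion M) < \<infinity>)"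

end

theory Submission
 imports Defs
begin

text \<open>
 Let \<open>P z\<close> be the mean of the projections \<^term>\<open>orth_proj S\<close> over the fibre of \<open>V\<close> at
 \<open>z\<close>, and \<open>tdiv \<theta> z\<close> the inner product of \<open>P z\<close> with the derivative of \<open>\<theta>\<close> at \<open>z\<close>. Then
 \<open>\<delta>V(\<theta>)\<close> is the integral of \<open>tdiv \<theta>\<close> with respect to the weight, and \<open>F\<close> is a weak derivative
 of \<open>f\<close> if
 \<open>\<delta>V((\<eta> \<circ> f)\<theta>) = \<integral> \<eta>(f) tdiv \<theta> + \<integral> D\<eta>(f)(F \<theta>)\<close> for all admissible \<open>\<theta>\<close> and \<open>\<eta>\<close>.
 All statements follow from a chain rule (\<open>chain_lipschitz\<close>): for locally Lipschitzian \<open>g\<close> there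
 is a map \<open>G\<close> such that, whenever \<open>\<Psi>(y, w)\<close> is smooth with \<open>D\<Psi>(y, w) = 0\<close> for large
 \<open>y\<close>, locally uniformly in \<open>w\<close>,
 \<open>\<delta>V(\<Psi>(f, g)\<theta>) = \<integral> \<Psi>(f, g) tdiv \<theta> + \<integral> D\<Psi>(f, g)(F \<theta>, G \<theta>)\<close>.

 If \<open>g\<close> is smooth and \<open>\<Psi>(y, w) = \<alpha>(y) \<beta>(w)\<close>, then this is the defining identity of \<open>F\<close> for the
 function \<open>\<alpha>\<close> and the test field \<open>\<beta>(g) \<theta>\<close>, by the product rule for \<open>tdiv\<close>, with \<open>G z\<close> the
 composition of \<open>P z\<close> and the derivative of \<open>g\<close> at \<open>z\<close>. Finite sums of such products approximate
 a general \<open>\<Psi>\<close> together with its derivative (\<open>tensor_approximation\<close>), hence the chain rule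
 for smooth \<open>g\<close> (\<open>chain_smooth\<close>). For locally Lipschitzian \<open>g\<close> one passes to the limit in
 smooth \<open>\<gamma>\<^sub>j\<close> converging to \<open>g\<close>. Bounds on the derivatives alone do not make their
 compositions with \<open>P\<close> converge. Therefore \<open>\<gamma>\<^sub>j\<close> is chosen as a near minimiser of a weighted
 \<open>L\<^sub>2\<close> norm of these compositions, among all smooth maps close to \<open>g\<close> with prescribed derivative
 bounds. By the parallelogram law, the compositions then converge almost everywhere
 (\<open>AE_convergent_selection\<close>, \<open>lipschitz_smooth_approximation\<close>), so that dominated convergence
 applies; the limit is \<open>G\<close>.

 Given the chain rule, pairs correspond to \<open>\<Psi> = \<eta>\<close> and sums to \<open>\<Psi>(y, w) = \<eta>(y + w)\<close>; with
 \<open>f = 0\<close> the latter says that \<open>G\<close> is a weak derivative of \<open>g\<close>. For products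
 (\<open>weak_diff_product\<close>), \<open>\<Psi>(y, w) = \<eta>(w \<tau>\<^sub>s(y))\<close> with truncations \<open>\<tau>\<^sub>s\<close> of the identity
 whose derivatives are bounded uniformly in \<open>s\<close>, and \<open>s\<close> tends to infinity; here local
 integrability of \<open>f\<close> and \<open>F\<close> provides the dominating function. The derivative vanishes on
 the zero set of \<open>f\<close> (\<open>weak_diff_zero_set\<close>), because in the identity for \<open>\<epsilon> \<eta>(y / \<epsilon>)\<close>,
 where \<open>D\<eta>(0)\<close> is a given linear functional, only the integral of \<open>D\<eta>(0)(F \<theta>)\<close> over that
 set survives as \<open>\<epsilon>\<close> tends to zero. Uniqueness of weak derivatives (\<open>weak_diff_unique\<close>)
 uses \<open>\<eta>\<close> that are linear on large balls.

 The left hand sides involve the extension of \<open>\<delta>V\<close> by continuity. It rests on the Radon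
 property of the weight (\<open>compact_grassmannian\<close>), on Caratheodory's construction of the total
 variation measure (\<open>outer_split\<close>), on the estimate of \<open>\<delta>V(\<theta>)\<close> by a multiple of the integral
 of \<open>norm \<theta>\<close> with respect to that measure (\<open>first_variation_le_integral\<close>), and on the
 density of test fields (\<open>radon_test_dense\<close>).
\<close>

abbreviation \<D> :: "('a::real_normed_vector \<Rightarrow> 'b::real_normed_vector) \<Rightarrow> 'a \<Rightarrow> 'a \<Rightarrow> 'b" where
 "\<D> f x \<equiv> frechet_derivative f (at x)"

abbreviation L1_dist :: "'a measure \<Rightarrow> ('a \<Rightarrow> 'b::real_normed_vector) \<Rightarrow> ('a \<Rightarrow> 'b) \<Rightarrow> ennreal" where
 "L1_dist M g h \<equiv> \<integral>\<^sup>+ z. ennreal (norm (g z - h z)) \<partial>M"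

section \<open>Calculus of smooth maps\<close>

lemma Ck_SucI:
 assumes "\<And>x. (f has_derivative f' x) (at x)" and "\<And>v. Ck_on k UNIV (\<lambda>x. f' x v)"
 shows "Ck_on (Suc k) UNIV f"
proof -
 have "\<D> f x = f' x" for x
  using frechet_derivative_at[OF assms(1)] by simp
 then show ?thesis
  using assms by (auto simp: differentiable_def)
qed

lemma Ck_SucD:
 assumes "Ck_on (Suc k) UNIV f"
 shows "(f has_derivative \<D> f x) (at x)"
  and "Ck_on k UNIV (\<lambda>x. \<D> f x v)"
 using assms by (auto simp: frechet_derivative_works)

lemma Ck_SucD_mono: "Ck_on (Suc k) UNIV f \<Longrightarrow> Ck_on k UNIV f"
proof (induction k arbitrary: f)
 case 0
 then show ?case
  by (auto intro!: continuous_at_imp_continuous_on differentiable_imp_continuous_within)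
next
 case (Suc k)
 show ?case
  by (rule Ck_SucI[OF Ck_SucD(1)[OF Suc.prems]]) (intro Suc.IH Ck_SucD(2)[OF Suc.prems])
qed

lemma Ck_const: "Ck_on k UNIV (\<lambda>x. c)"
 by (induction k arbitrary: c) (auto intro!: Ck_SucI[where f'="\<lambda>x v. 0"])

lemma Ck_linear:
 assumes "bounded_linear f"
 shows "Ck_on k UNIV f"
proof (cases k)
 case 0
 then show ?thesis using assms by (simp add: linear_continuous_on)
next
 case (Suc j)
 show ?thesis unfolding Suc
  by (rule Ck_SucI[where f'="\<lambda>x. f"])
    (auto intro: Ck_const bounded_linear_imp_has_derivative assms)
qed

lemma Ck_add: "Ck_on k UNIV f \<Longrightarrow> Ck_on k UNIV g \<Longrightarrow> Ck_on k UNIV (\<lambda>x. f x + g x)"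
proof (induction k arbitrary: f g)
 case 0
 then show ?case by (auto intro: continuous_on_add)
next
 case (Suc k)
 show ?case
  by (rule Ck_SucI[OF has_derivative_add[OF Ck_SucD(1)[OF Suc.prems(1)] Ck_SucD(1)[OF Suc.prems(2)]]])
    (intro Suc.IH Ck_SucD Suc.prems)
qed

lemma Ck_sum: "(\<And>i. i \<in> I \<Longrightarrow> Ck_on k UNIV (f i)) \<Longrightarrow> Ck_on k UNIV (\<lambda>x. \<Sum>i\<in>I. f i x)"
 by (induction I rule: infinite_finite_induct) (auto simp: Ck_const intro: Ck_add)

lemma (in bounded_bilinear) Ck_prod:
 "Ck_on k UNIV f \<Longrightarrow> Ck_on k UNIV g \<Longrightarrow> Ck_on k UNIV (\<lambda>x. prod (f x) (g x))"
proof (induction k arbitrary: f g)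
 case 0
 then show ?case by (auto intro: continuous_on)
next
 case (Suc k)
 show ?case
  by (rule Ck_SucI[OF FDERIV[OF Ck_SucD(1)[OF Suc.prems(1)] Ck_SucD(1)[OF Suc.prems(2)]]])
    (intro Ck_add Suc.IH Ck_SucD Suc.prems Ck_SucD_mono)
qed

lemma has_derivative_basis:
 fixes f :: "'a::euclidean_space \<Rightarrow> 'b::real_normed_vector"
 assumes "(f has_derivative f') F"
 shows "f' v = (\<Sum>b\<in>Basis. (v \<bullet> b) *\<^sub>R f' b)"
proof -
 interpret bounded_linear f' using assms by (rule has_derivative_bounded_linear)
 have "f' v = f' (\<Sum>b\<in>Basis. (v \<bullet> b) *\<^sub>R b)" by (simp add: euclidean_representation)
 then show ?thesis by (simp add: sum scaleR)
qed

lemma Ck_compose: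
 fixes f :: "'a::real_normed_vector \<Rightarrow> 'b::euclidean_space" and g :: "'b \<Rightarrow> 'c::real_normed_vector"
 shows "Ck_on k UNIV f \<Longrightarrow> Ck_on k UNIV g \<Longrightarrow> Ck_on k UNIV (\<lambda>x. g (f x))"
proof (induction k arbitrary: f g)
 case 0
 then show ?case by (auto intro: continuous_on_compose2)
next
 case (Suc k)
 let ?f' = "\<lambda>x. \<D> f x" and ?g' = "\<lambda>x. \<D> g x"
 note f' = Ck_SucD(1)[OF Suc.prems(1)] and g' = Ck_SucD(1)[OF Suc.prems(2)]
 show ?case
 proof (rule Ck_SucI)
  show "((\<lambda>x. g (f x)) has_derivative (\<lambda>v. \<Sum>b\<in>Basis. (?f' x v \<bullet> b) *\<^sub>R ?g' (f x) b)) (at x)" for x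
   using has_derivative_compose[OF f' g', of x]
   by (subst has_derivative_basis[OF g', symmetric])
  show "Ck_on k UNIV (\<lambda>x. \<Sum>b\<in>Basis. (?f' x v \<bullet> b) *\<^sub>R ?g' (f x) b)" for v
  proof (intro Ck_sum bounded_bilinear.Ck_prod[OF bounded_bilinear_scaleR]
    bounded_bilinear.Ck_prod[OF bounded_bilinear_inner] Ck_const)
   show "Ck_on k UNIV (\<lambda>x. ?f' x v)" by (intro Ck_SucD Suc.prems)
   show "Ck_on k UNIV (\<lambda>x. ?g' (f x) b)" for b
    using Suc.IH[OF Ck_SucD_mono[OF Suc.prems(1)] Ck_SucD(2)[OF Suc.prems(2)]] .
  qed
 qed
qed

lemma Ck_inverse:
 fixes f :: "'a::real_normed_vector \<Rightarrow> real"
 assumes "\<And>x. f x \<noteq> 0"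
 shows "Ck_on k UNIV f \<Longrightarrow> Ck_on k UNIV (\<lambda>x. inverse (f x))"
proof (induction k)
 case 0
 then show ?case using assms by (auto intro: continuous_on_inverse)
next
 case (Suc k)
 show ?case
 proof (rule Ck_SucI[OF Deriv.has_derivative_inverse[OF assms Ck_SucD(1)[OF Suc.prems]]])
  fix v
  have "Ck_on k UNIV (\<lambda>x. (-1) * (inverse (f x) * \<D> f x v * inverse (f x)))"
   by (intro bounded_bilinear.Ck_prod[OF bounded_bilinear_mult] Ck_const Suc.IH
     Ck_SucD[OF Suc.prems] Ck_SucD_mono[OF Suc.prems])
  then show "Ck_on k UNIV (\<lambda>x. - (inverse (f x) * \<D> f x v * inverse (f x)))"
   by simp
 qed
qed

lemma smooth_const [simp]: "smooth (\<lambda>x. c)"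
 by (simp add: smooth_def Ck_const)

lemma smooth_linear: "bounded_linear f \<Longrightarrow> smooth f"
 by (simp add: smooth_def Ck_linear)

lemma smooth_ident [simp]: "smooth (\<lambda>x. x)"
 by (rule smooth_linear[OF bounded_linear_ident])

lemma smooth_add: "smooth f \<Longrightarrow> smooth g \<Longrightarrow> smooth (\<lambda>x. f x + g x)"
 by (simp add: smooth_def Ck_add)

lemma smooth_sum: "(\<And>i. i \<in> I \<Longrightarrow> smooth (f i)) \<Longrightarrow> smooth (\<lambda>x. \<Sum>i\<in>I. f i x)"
 by (simp add: smooth_def Ck_sum)

lemma smooth_compose:
 fixes f :: "'a::real_normed_vector \<Rightarrow> 'b::euclidean_space"
 shows "smooth g \<Longrightarrow> smooth f \<Longrightarrow> smooth (\<lambda>x. g (f x))"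
 by (simp add: smooth_def Ck_compose)

lemma smooth_scaleR: "smooth f \<Longrightarrow> smooth g \<Longrightarrow> smooth (\<lambda>x. f x *\<^sub>R g x)"
 by (simp add: smooth_def bounded_bilinear.Ck_prod[OF bounded_bilinear_scaleR])

lemma smooth_mult:
 fixes f g :: "'a::real_normed_vector \<Rightarrow> real"
 shows "smooth f \<Longrightarrow> smooth g \<Longrightarrow> smooth (\<lambda>x. f x * g x)"
 by (simp add: smooth_def bounded_bilinear.Ck_prod[OF bounded_bilinear_mult])

lemma smooth_inner: "smooth f \<Longrightarrow> smooth g \<Longrightarrow> smooth (\<lambda>x. f x \<bullet> g x)"
 by (simp add: smooth_def bounded_bilinear.Ck_prod[OF bounded_bilinear_inner])

lemma smooth_minus: "smooth f \<Longrightarrow> smooth (\<lambda>x. - f x)"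
 using smooth_scaleR[OF smooth_const[of "-1"], of f] by simp

lemma smooth_diff: "smooth f \<Longrightarrow> smooth g \<Longrightarrow> smooth (\<lambda>x. f x - g x)"
 using smooth_add[OF _ smooth_minus, of f g] by simp

lemma smooth_prod:
 fixes f :: "'i \<Rightarrow> 'a::real_normed_vector \<Rightarrow> real"
 shows "(\<And>i. i \<in> I \<Longrightarrow> smooth (f i)) \<Longrightarrow> smooth (\<lambda>x. \<Prod>i\<in>I. f i x)"
 by (induction I rule: infinite_finite_induct) (auto intro: smooth_mult)

lemma smooth_inverse:
 fixes f :: "'a::real_normed_vector \<Rightarrow> real"
 shows "(\<And>x. f x \<noteq> 0) \<Longrightarrow> smooth f \<Longrightarrow> smooth (\<lambda>x. inverse (f x))"
 by (simp add: smooth_def Ck_inverse)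

lemma smooth_Pair:
 assumes "smooth f" "smooth g"
 shows "smooth (\<lambda>x. (f x, g x))"
proof -
 have k: "Ck_on k UNIV (\<lambda>x. (f x, 0::'c))" "Ck_on k UNIV (\<lambda>x. (0::'b, g x))" for k
 proof -
  have *: "Ck_on k UNIV (\<lambda>x. L (f x))" if "bounded_linear L" "Ck_on k UNIV f"
   for f :: "'a \<Rightarrow> 'd::real_normed_vector" and L :: "'d \<Rightarrow> 'e::real_normed_vector"
   using that(2)
  proof (induction k arbitrary: f)
   case 0
   then show ?case by (simp add: bounded_linear.continuous_on[OF that(1)])
  next
   case (Suc k)
   show ?case
    by (rule Ck_SucI[OF bounded_linear.has_derivative[OF that(1) Ck_SucD(1)[OF Suc.prems]]])
      (intro Suc.IH Ck_SucD[OF Suc.prems])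
  qed
  show "Ck_on k UNIV (\<lambda>x. (f x, 0::'c))" "Ck_on k UNIV (\<lambda>x. (0::'b, g x))"
   using assms by (auto simp: smooth_def
     intro: *[OF bounded_linear_Pair[OF bounded_linear_ident bounded_linear_zero]]
         *[OF bounded_linear_Pair[OF bounded_linear_zero bounded_linear_ident]])
 qed
 have "Ck_on k UNIV (\<lambda>x. (f x, 0::'c) + (0::'b, g x))" for k
  using Ck_add[OF k] .
 then show ?thesis by (simp add: smooth_def)
qed

lemma smooth_D:
 assumes "smooth f"
 shows "(f has_derivative \<D> f x) (at x)"
  and "smooth (\<lambda>x. \<D> f x v)"
  and "continuous_on S f"
  and "f differentiable (at x)"
  and "linear (\<D> f x)"
  and "bounded_linear (\<D> f x)"
proof -
 have C: "Ck_on (Suc k) UNIV f" for k using assms by (simp add: smooth_def)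
 show 1: "(f has_derivative \<D> f x) (at x)" using Ck_SucD(1)[OF C[of 0]] .
 show "smooth (\<lambda>x. \<D> f x v)" using Ck_SucD(2)[OF C] by (simp add: smooth_def)
 have "continuous_on UNIV f" using assms by (auto simp: smooth_def dest!: spec[of _ 0])
 then show "continuous_on S f" by (rule continuous_on_subset) simp
 show "f differentiable (at x)" using 1 by (auto simp: differentiable_def)
 show "bounded_linear (\<D> f x)" using 1 by (rule has_derivative_bounded_linear)
 then show "linear (\<D> f x)" by (rule bounded_linear.linear)
qed

lemmas smooth_continuous_D = smooth_D(3)[OF smooth_D(2)]

text \<open>The functions \<open>t\<^sup>-\<^sup>m exp (-1/t)\<close>, extended by zero, are stable under
 differentiation up to linear combination; hence all of them are smooth.\<close>

definition flat_exp :: "nat \<Rightarrow> real \<Rightarrow> real" where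
 "flat_exp m t = (if t \<le> 0 then 0 else inverse t ^ m * exp (- inverse t))"

lemma flat_exp_tendsto: "((\<lambda>t. flat_exp m t) \<longlongrightarrow> 0) (at 0)"
proof (rule filterlim_split_at)
 have "((\<lambda>t. (inverse t) ^ m / exp (inverse t)) \<longlongrightarrow> 0) (at_right (0::real))"
  by (rule filterlim_compose[OF tendsto_power_div_exp_0 filterlim_inverse_at_top_right])
 moreover have "eventually (\<lambda>t. (inverse t) ^ m / exp (inverse t) = flat_exp m t) (at_right (0::real))"
  by (auto simp: eventually_at_filter flat_exp_def exp_minus divide_inverse)
 ultimately show "((\<lambda>t. flat_exp m t) \<longlongrightarrow> 0) (at_right 0)"
  by (rule Lim_transform_eventually)
 show "((\<lambda>t. flat_exp m t) \<longlongrightarrow> 0) (at_left 0)"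
  by (rule Lim_transform_eventually[OF tendsto_const])
    (auto simp: eventually_at_filter flat_exp_def)
qed

lemma flat_exp_deriv:
 "(flat_exp m has_real_derivative flat_exp (m+2) t - m * flat_exp (m+1) t) (at t)"
proof -
 consider "t < 0" | "t = 0" | "t > 0" by linarith
 then show ?thesis
 proof cases
  case 1
  have "((\<lambda>t::real. 0) has_real_derivative 0) (at t)" by simp
  then have "(flat_exp m has_real_derivative 0) (at t)"
   by (rule DERIV_cong_ev[THEN iffD1, OF refl _ refl, rotated])
     (use 1 in \<open>auto intro!: eventually_mono[OF order_tendstoD(2)[OF tendsto_ident_at, of t 0]] simp: flat_exp_def eventually_nhds_conv_at\<close>)
  then show ?thesis using 1 by (simp add: flat_exp_def)
 next
  case 2
  have "(\<lambda>h. (flat_exp m (0 + h) - flat_exp m 0) / h) = flat_exp (Suc m)"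
   by (auto simp: flat_exp_def fun_eq_iff divide_inverse)
  then have "(flat_exp m has_real_derivative 0) (at 0)"
   unfolding DERIV_def using flat_exp_tendsto[of "Suc m"] by simp
  then show ?thesis
   using 2 by (simp add: flat_exp_def)
 next
  case 3
  have "((\<lambda>t. inverse t ^ m * exp (- inverse t)) has_real_derivative
    flat_exp (m+2) t - m * flat_exp (m+1) t) (at t)"
   using 3
   apply (auto intro!: derivative_eq_intros simp: flat_exp_def)
   apply (cases m)
    apply (auto simp: field_simps power2_eq_square)
   done
  then show ?thesis
   by (rule DERIV_cong_ev[THEN iffD1, OF refl _ refl, rotated])
     (use 3 in \<open>auto intro!: eventually_mono[OF order_tendstoD(1)[OF tendsto_ident_at, of 0 t]] simp: flat_exp_def eventually_nhds_conv_at\<close>)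
 qed
qed

lemma smooth_flat_exp: "smooth (flat_exp m)"
proof -
 have "Ck_on k UNIV (flat_exp m)" for k
 proof (induction k arbitrary: m)
  case 0
  show ?case
   using DERIV_isCont[OF flat_exp_deriv] by (simp add: continuous_at_imp_continuous_on)
 next
  case (Suc k)
  show ?case
  proof (rule Ck_SucI)
   show "(flat_exp m has_derivative (\<lambda>v. (flat_exp (m+2) t + (- m) * flat_exp (m+1) t) * v)) (at t)" for t
    using flat_exp_deriv[of m t] by (simp add: has_field_derivative_def)
   show "Ck_on k UNIV (\<lambda>t. (flat_exp (m+2) t + (- m) * flat_exp (m+1) t) * v)" for v
    by (intro bounded_bilinear.Ck_prod[OF bounded_bilinear_mult] Ck_add Ck_const Suc.IH)
  qed
 qed
 then show ?thesis by (simp add: smooth_def)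
qed

definition smooth_step :: "real \<Rightarrow> real" where
 "smooth_step t = flat_exp 0 t * inverse (flat_exp 0 t + flat_exp 0 (1 - t))"

lemma smooth_step_0: "t \<le> 0 \<Longrightarrow> smooth_step t = 0"
 and smooth_step_1: "1 \<le> t \<Longrightarrow> smooth_step t = 1"
 and smooth_step_ge_0: "0 \<le> smooth_step t"
 and smooth_step_le_1: "smooth_step t \<le> 1"
 by (auto simp: smooth_step_def flat_exp_def field_simps add_pos_pos)

lemma smooth_smooth_step: "smooth smooth_step"
proof -
 have nz: "flat_exp 0 t + flat_exp 0 (1 - t) \<noteq> 0" for t
  by (auto simp: flat_exp_def add_pos_pos less_imp_neq[symmetric])
 have "smooth (\<lambda>t. flat_exp 0 (1 - t))"
  by (intro smooth_compose[OF smooth_flat_exp] smooth_diff smooth_const smooth_ident)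
 then show ?thesis unfolding smooth_step_def[abs_def]
  by (intro smooth_mult smooth_inverse smooth_add smooth_flat_exp nz)
qed

text \<open>The argument of the step is \<open>1\<close> for \<open>norm (y - x) = r / 2\<close> and \<open>0\<close> for \<open>norm (y - x) = r\<close>;
 taking the square of the distance keeps the function smooth at \<open>x\<close>.\<close>

definition ball_bump :: "'a::real_inner \<Rightarrow> real \<Rightarrow> 'a \<Rightarrow> real" where
 "ball_bump x r y = smooth_step (4/3 - (4 / (3 * r\<^sup>2)) * ((y - x) \<bullet> (y - x)))"

lemma smooth_ball_bump: "smooth (ball_bump x r)"
proof -
 have "smooth (\<lambda>y. y - x)" by (intro smooth_diff smooth_const smooth_ident)
 then show ?thesis unfolding ball_bump_def[abs_def]
  by (intro smooth_compose[OF smooth_smooth_step] smooth_diff smooth_const smooth_mult smooth_inner smooth_ident)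
qed

lemma ball_bump_bounds: "0 \<le> ball_bump x r y" "ball_bump x r y \<le> 1"
 by (auto simp: ball_bump_def smooth_step_ge_0 smooth_step_le_1)

lemma ball_bump_1:
 assumes "0 < r" "norm (y - x) \<le> r / 2" shows "ball_bump x r y = 1"
proof -
 have "(y - x) \<bullet> (y - x) \<le> (r/2)\<^sup>2"
  using assms by (simp add: power2_norm_eq_inner[symmetric] power_mono)
 then show ?thesis using assms
  by (auto simp: ball_bump_def power_divide field_simps intro!: smooth_step_1)
qed

lemma ball_bump_0:
 assumes "0 < r" "r \<le> norm (y - x)" shows "ball_bump x r y = 0"
proof -
 have "r\<^sup>2 \<le> (y - x) \<bullet> (y - x)"
  using assms by (simp add: power2_norm_eq_inner[symmetric] power_mono)
 then show ?thesis using assms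
  by (auto simp: ball_bump_def power_divide field_simps intro!: smooth_step_0)
qed

lemma smooth_cutoff:
 fixes K :: "'a::euclidean_space set"
 assumes "compact K" "open G" "K \<subseteq> G"
 obtains u :: "'a \<Rightarrow> real" and C where "smooth u" "\<And>x. 0 \<le> u x" "\<And>x. u x \<le> 1"
  "\<And>x. x \<in> K \<Longrightarrow> u x = 1" "compact C" "C \<subseteq> G" "\<And>x. x \<notin> C \<Longrightarrow> u x = 0"
proof -
 have "\<forall>x\<in>K. \<exists>r>0. cball x r \<subseteq> G"
  using assms open_contains_cball by blast
 then obtain r where r: "\<And>x. x \<in> K \<Longrightarrow> r x > 0" "\<And>x. x \<in> K \<Longrightarrow> cball x (r x) \<subseteq> G"
  by metis
 have "K \<subseteq> (\<Union>x\<in>K. ball x (r x / 2))" using r by auto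
 then obtain D where D: "D \<subseteq> K" "finite D" "K \<subseteq> (\<Union>x\<in>D. ball x (r x / 2))"
  using compactE_image[OF \<open>compact K\<close>, of K "\<lambda>x. ball x (r x / 2)"] by auto
 define u where "u y = 1 - (\<Prod>x\<in>D. 1 - ball_bump x (r x) y)" for y
 show thesis
 proof (rule that[of u "\<Union>x\<in>D. cball x (r x)"])
  show "smooth u" unfolding u_def[abs_def]
   by (intro smooth_diff smooth_const smooth_prod smooth_ball_bump)
  show "0 \<le> u y" "u y \<le> 1" for y
   using ball_bump_bounds[of _ _ y] by (auto simp: u_def intro!: prod_le_1 prod_nonneg)
  show "u y = 1" if "y \<in> K" for y
  proof -
   obtain x where x: "x \<in> D" "dist x y < r x / 2" using subsetD[OF D(3) \<open>y \<in> K\<close>] unfolding UN_iff mem_ball by blast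
   then have "ball_bump x (r x) y = 1"
    using D r by (intro ball_bump_1) (auto simp: dist_norm norm_minus_commute)
   then have "(\<Prod>x\<in>D. 1 - ball_bump x (r x) y) = 0" using x D by auto
   then show ?thesis by (simp add: u_def)
  qed
  show "compact (\<Union>x\<in>D. cball x (r x))" using D by auto
  show "(\<Union>x\<in>D. cball x (r x)) \<subseteq> G" using r D by blast
  show "u y = 0" if "y \<notin> (\<Union>x\<in>D. cball x (r x))" for y
  proof -
   have "ball_bump x (r x) y = 0" if "x \<in> D" for x
    using D r \<open>y \<notin> _\<close> that by (intro ball_bump_0) (auto simp: dist_norm norm_minus_commute not_le)
   then show ?thesis by (simp add: u_def)
  qed
 qed
qed

lemma smooth_partition:
 fixes K :: "'a::euclidean_space set" and G :: "nat \<Rightarrow> 'a set"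
 assumes "compact K" "\<And>i. open (G i)" "K \<subseteq> (\<Union>i. G i)"
 obtains N and \<psi> :: "nat \<Rightarrow> 'a \<Rightarrow> real" and C where
  "\<And>i. smooth (\<psi> i)" "\<And>i x. 0 \<le> \<psi> i x" "\<And>i x. \<psi> i x \<le> 1"
  "\<And>i. compact (C i)" "\<And>i. C i \<subseteq> G i" "\<And>i x. x \<notin> C i \<Longrightarrow> \<psi> i x = 0"
  "\<And>x. x \<in> K \<Longrightarrow> (\<Sum>i<N. \<psi> i x) = 1"
proof -
 have "\<forall>x\<in>K. \<exists>i r. r>0 \<and> cball x r \<subseteq> G i"
  using assms open_contains_cball by (metis UN_E subsetD)
 then obtain j r where r: "\<And>x. x \<in> K \<Longrightarrow> r x > 0" "\<And>x. x \<in> K \<Longrightarrow> cball x (r x) \<subseteq> G (j x)"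
  by metis
 have "K \<subseteq> (\<Union>x\<in>K. ball x (r x))" using r by auto
 then obtain D where D: "D \<subseteq> K" "finite D" "K \<subseteq> (\<Union>x\<in>D. ball x (r x))"
  using compactE_image[OF \<open>compact K\<close>, of K "\<lambda>x. ball x (r x)"] by auto
 define Q where "Q i = (\<Union>x\<in>{x\<in>D. j x = i}. cball x (r x))" for i
 have Q1: "compact (Q i)" for i
  using D unfolding Q_def by (auto intro!: compact_UN)
 have Q2: "Q i \<subseteq> G i" for i
  using D r(2) unfolding Q_def by blast
 have "\<exists>u C. smooth u \<and> (\<forall>x. 0 \<le> u x \<and> u x \<le> (1::real)) \<and> (\<forall>x\<in>Q i. u x = 1) \<and>
   compact C \<and> C \<subseteq> G i \<and> (\<forall>x. x \<notin> C \<longrightarrow> u x = 0)" for i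
  using smooth_cutoff[OF Q1 assms(2) Q2, of i] by metis
 then obtain u C where u: "\<And>i. smooth (u i)" "\<And>i x. 0 \<le> u i x" "\<And>i x. u i x \<le> (1::real)"
  "\<And>i x. x \<in> Q i \<Longrightarrow> u i x = 1" "\<And>i. compact (C i)" "\<And>i. C i \<subseteq> G i" "\<And>i x. x \<notin> C i \<Longrightarrow> u i x = 0"
  by metis
 obtain N where N: "\<And>x. x \<in> D \<Longrightarrow> j x < N"
  using finite_nat_set_iff_bounded[of "j ` D"] D by auto
 define \<psi> where "\<psi> i x = u i x * (\<Prod>k<i. 1 - u k x)" for i x
 have sum: "(\<Sum>i<n. \<psi> i x) = 1 - (\<Prod>k<n. 1 - u k x)" for n x
  by (induction n) (auto simp: \<psi>_def algebra_simps)
 have p: "0 \<le> (\<Prod>k<i. 1 - u k x)" "(\<Prod>k<i. 1 - u k x) \<le> 1" for i x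
  using u by (auto intro!: prod_nonneg prod_le_1)
 show thesis
 proof (rule that[of \<psi> C N])
  show "smooth (\<psi> i)" for i unfolding \<psi>_def[abs_def]
   by (intro smooth_mult smooth_prod smooth_diff smooth_const u)
  show "0 \<le> \<psi> i x" for i x unfolding \<psi>_def using u p by auto
  show "\<psi> i x \<le> 1" for i x unfolding \<psi>_def using u p by (metis mult_le_one)
  show "compact (C i)" "C i \<subseteq> G i" for i using u by auto
  show "\<psi> i x = 0" if "x \<notin> C i" for i x using u(7)[OF that] by (simp add: \<psi>_def)
  show "(\<Sum>i<N. \<psi> i x) = 1" if x: "x \<in> K" for x
  proof -
   obtain y where y: "y \<in> D" "x \<in> ball y (r y)" using subsetD[OF D(3) x] unfolding UN_iff by blast
   then have "x \<in> Q (j y)" by (auto simp: Q_def intro!: bexI[of _ y])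
   then have "(\<Prod>k<N. 1 - u k x) = 0" using u(4) N[OF y(1)] by auto
   then show ?thesis by (simp add: sum)
  qed
 qed
qed

lemma test_fieldsI:
 fixes g :: "'a::euclidean_space \<Rightarrow> 'a"
 assumes "smooth g" "compact C" "C \<subseteq> U" "\<And>z. z \<notin> C \<Longrightarrow> g z = 0"
 shows "g \<in> test_fields U"
proof -
 have sub: "closure {z. g z \<noteq> 0} \<subseteq> C"
  using assms(4) by (intro closure_minimal compact_imp_closed[OF assms(2)]) auto
 then have "compact (closure {z. g z \<noteq> 0})"
  using compact_Int_closed[OF assms(2) closed_closure, of "{z. g z \<noteq> 0}"]
  by (simp only: Int_absorb1)
 with sub show ?thesis
  using assms(1,3) unfolding test_fields_def by blast
qed

lemma test_fieldsE:
 assumes "g \<in> test_fields U"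
 obtains C where "smooth g" "compact C" "C \<subseteq> U" "\<And>z. z \<notin> C \<Longrightarrow> g z = 0"
proof (rule that[of "closure {z. g z \<noteq> 0}"])
 show "g z = 0" if "z \<notin> closure {z. g z \<noteq> 0}" for z
  using that closure_subset[of "{z. g z \<noteq> 0}"] by auto
qed (use assms in \<open>auto simp: test_fields_def\<close>)

text \<open>The complement of a closed set is open, so that derivatives at its points only depend on the
 values there.\<close>

lemma frechet_derivative_zero_outside:
 fixes g :: "'a::real_normed_vector \<Rightarrow> 'b::real_normed_vector"
 assumes "closed C" "\<And>z. z \<notin> C \<Longrightarrow> g z = c" "z \<notin> C"
 shows "\<D> g z = (\<lambda>v. 0)"
proof -
 have "(g has_derivative (\<lambda>v. 0)) (at z)"
  by (rule has_derivative_transform_within_open[where f="\<lambda>_. c" and s="- C"])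
    (use assms in auto)
 from frechet_derivative_at[OF this] show ?thesis by simp
qed

lemma test_fields_mono: "U \<subseteq> W \<Longrightarrow> test_fields U \<subseteq> test_fields W"
 by (auto simp: test_fields_def)

lemma test_fields_0 [simp]: "(\<lambda>z. 0) \<in> test_fields U"
 by (auto simp: test_fields_def)

lemma test_fields_add:
 fixes g h :: "'a::euclidean_space \<Rightarrow> 'a"
 assumes "g \<in> test_fields U" "h \<in> test_fields U"
 shows "(\<lambda>z. g z + h z) \<in> test_fields U"
proof -
 obtain C where C: "smooth g" "compact C" "C \<subseteq> U" "\<And>z. z \<notin> C \<Longrightarrow> g z = 0" using test_fieldsE[OF assms(1)] by blast
 obtain D where D: "smooth h" "compact D" "D \<subseteq> U" "\<And>z. z \<notin> D \<Longrightarrow> h z = 0" using test_fieldsE[OF assms(2)] by blast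
 show ?thesis
  by (rule test_fieldsI[OF smooth_add[OF C(1) D(1)] compact_Un[OF C(2) D(2)]]) (use C D in auto)
qed

lemma test_fields_scaleR:
 fixes g :: "'a::euclidean_space \<Rightarrow> 'a"
 assumes "smooth u" "g \<in> test_fields U"
 shows "(\<lambda>z. u z *\<^sub>R g z) \<in> test_fields U"
proof -
 obtain C where C: "smooth g" "compact C" "C \<subseteq> U" "\<And>z. z \<notin> C \<Longrightarrow> g z = 0" using test_fieldsE[OF assms(2)] by blast
 show ?thesis
  by (rule test_fieldsI[OF smooth_scaleR[OF assms(1) C(1)] C(2,3)]) (simp add: C(4))
qed

lemma test_fields_scaleR_left:
 fixes g :: "'a::euclidean_space \<Rightarrow> 'a"
 assumes "smooth u" "compact C" "C \<subseteq> G" "\<And>z. z \<notin> C \<Longrightarrow> u z = (0::real)" "smooth g"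
 shows "(\<lambda>z. u z *\<^sub>R g z) \<in> test_fields G"
 by (rule test_fieldsI[OF smooth_scaleR[OF assms(1,5)] assms(2,3)]) (auto simp: assms(4))

lemma test_fields_diff:
 fixes g h :: "'a::euclidean_space \<Rightarrow> 'a"
 assumes "g \<in> test_fields U" "h \<in> test_fields U"
 shows "(\<lambda>z. g z - h z) \<in> test_fields U"
 using test_fields_add[OF assms(1) test_fields_scaleR[OF smooth_const[of "-1"] assms(2)]] by simp

lemma test_fields_sum:
 fixes g :: "'i \<Rightarrow> 'a::euclidean_space \<Rightarrow> 'a"
 shows "(\<And>i. i \<in> I \<Longrightarrow> g i \<in> test_fields U) \<Longrightarrow> (\<lambda>z. \<Sum>i\<in>I. g i z) \<in> test_fields U"
 by (induction I rule: infinite_finite_induct) (auto intro: test_fields_add)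


section \<open>Orthogonal projections and the Grassmannian\<close>

lemma hom_inner_eq:
 fixes \<sigma> \<tau> :: "real^'n \<Rightarrow> 'b::euclidean_space"
 assumes "linear \<sigma>"
 shows "hom_inner \<sigma> \<tau> = (\<Sum>i\<in>UNIV. \<sigma> (axis i 1) \<bullet> \<tau> (axis i 1))"
proof -
 have "(adjoint \<sigma> (\<tau> (axis i 1))) $ i = \<sigma> (axis i 1) \<bullet> \<tau> (axis i 1)" for i
  using adjoint_works[OF assms, of "axis i 1" "\<tau> (axis i 1)"] by (simp add: inner_axis')
 then show ?thesis
  by (simp add: hom_inner_def trace_def matrix_def)
qed

lemma orth_proj_eqI:
 assumes S: "subspace S" and "y \<in> S" "\<And>w. w \<in> S \<Longrightarrow> (x - y) \<bullet> w = 0"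
 shows "orth_proj S x = y"
 unfolding orth_proj_def
proof (rule the_equality)
 fix y' assume y': "y' \<in> S \<and> (\<forall>w\<in>S. (x - y') \<bullet> w = 0)"
 have "y - y' \<in> S" using S y' assms(2) by (simp add: subspace_diff)
 then have "(x - y') \<bullet> (y - y') - (x - y) \<bullet> (y - y') = 0" using y' assms by simp
 then have "(y - y') \<bullet> (y - y') = 0" by (simp add: inner_diff_left)
 then show "y' = y" by simp
qed (use assms in auto)

lemma orth_proj:
 assumes S: "subspace S"
 shows "orth_proj S x \<in> S" and "w \<in> S \<Longrightarrow> (x - orth_proj S x) \<bullet> w = 0"
proof -
 obtain y z where yz: "y \<in> span S" "\<And>w. w \<in> span S \<Longrightarrow> orthogonal z w" "x = y + z"
  using orthogonal_subspace_decomp_exists[of S x] by metis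
 have sp: "span S = S" using S by simp
 have zy: "x - y = z" using yz(3) by simp
 have "orth_proj S x = y"
 proof (rule orth_proj_eqI[OF S])
  show "y \<in> S" using yz(1) sp by simp
  show "(x - y) \<bullet> w = 0" if "w \<in> S" for w
   using yz(2)[of w] that unfolding sp zy orthogonal_def .
 qed
 then show "orth_proj S x \<in> S" "w \<in> S \<Longrightarrow> (x - orth_proj S x) \<bullet> w = 0"
  using yz(1) yz(2)[of w] zy sp by (auto simp: orthogonal_def)
qed

lemma linear_orth_proj:
 assumes S: "subspace S" shows "linear (orth_proj S)"
proof (rule linearI)
 show "orth_proj S (x + y) = orth_proj S x + orth_proj S y" for x y
 proof (rule orth_proj_eqI[OF S])
  show "(x + y - (orth_proj S x + orth_proj S y)) \<bullet> w = 0" if "w \<in> S" for w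
   using orth_proj(2)[OF S that, of x] orth_proj(2)[OF S that, of y]
   by (simp add: inner_diff_left inner_add_left)
 qed (simp add: orth_proj S subspace_add)
 show "orth_proj S (c *\<^sub>R x) = c *\<^sub>R orth_proj S x" for c x
 proof (rule orth_proj_eqI[OF S])
  show "(c *\<^sub>R x - c *\<^sub>R orth_proj S x) \<bullet> w = 0" if "w \<in> S" for w
   using orth_proj(2)[OF S that, of x] by (simp add: scaleR_diff_right[symmetric])
 qed (simp add: orth_proj S subspace_scale)
qed

lemma norm_orth_proj_le:
 assumes S: "subspace S" shows "norm (orth_proj S x) \<le> norm x"
proof -
 have "(x - orth_proj S x) \<bullet> orth_proj S x = 0" using orth_proj[OF S] by blast
 then have "orth_proj S x \<bullet> orth_proj S x = x \<bullet> orth_proj S x" by (simp add: inner_diff_left)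
 then have "norm (orth_proj S x) * norm (orth_proj S x) \<le> norm x * norm (orth_proj S x)"
  using norm_cauchy_schwarz[of x "orth_proj S x"] by (simp add: power2_norm_eq_inner[symmetric] power2_eq_square)
 then show ?thesis by (cases "orth_proj S x = 0") auto
qed

lemma topspace_grassmannian [simp]: "topspace (grassmannian_top m) = grassmannian m"
 by (simp add: grassmannian_top_def topspace_pullback_topology)

text \<open>The Grassmannian is a continuous image of the compact set of orthonormal frames, encoded
 as matrices with \<open>m\<close> orthonormal rows and all other rows zero.\<close>

lemma compact_grassmannian:
 assumes "m \<le> CARD('n)"
 shows "compactin (grassmannian_top m) (grassmannian m :: (real^'n) set set)"
proof -
 obtain I :: "'n set" where I: "card I = m"
  using assms obtain_subset_with_card_n[of m "UNIV :: 'n set"] by auto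
 have finI: "finite I" by simp
 \<comment> \<open>Exactly the rows with index in \<open>I\<close> are nonzero; fixing \<open>I\<close> makes their number \<open>m\<close>.\<close>
 define Fr where "Fr = {B :: real^'n^'n. \<forall>i j. B $ i \<bullet> B $ j = (if i = j \<and> i \<in> I then 1 else 0)}"
 have "closed Fr" unfolding Fr_def
  by (intro closed_Collect_all closed_Collect_eq continuous_intros)
 moreover have "bounded Fr"
 proof (rule boundedI)
  fix B assume "B \<in> Fr"
  then have "norm (B $ i) \<le> 1" for i by (auto simp: Fr_def norm_eq_sqrt_inner)
  then have "(\<Sum>i\<in>UNIV. norm (B $ i)) \<le> (\<Sum>i\<in>(UNIV::'n set). 1)" by (intro sum_mono)
  moreover have "norm B \<le> (\<Sum>i\<in>UNIV. norm (B $ i))"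
   unfolding norm_vec_def by (rule L2_set_le_sum) auto
  ultimately show "norm B \<le> real CARD('n)" by simp
 qed
 ultimately have Fr: "compact Fr" by (simp add: compact_eq_bounded_closed)
 define \<Phi> where "\<Phi> B = span (range (($) B))" for B :: "real^'n^'n"
 define T where "T B x = (\<Sum>i\<in>UNIV. (B $ i \<bullet> x) *\<^sub>R B $ i)" for B :: "real^'n^'n" and x
 have bl: "bounded_linear (T B)" for B
  unfolding T_def[abs_def]
  by (intro bounded_linear_sum bounded_linear_scaleR_const bounded_linear_inner_right)
 have proj: "orth_proj (\<Phi> B) x = T B x" if "B \<in> Fr" for B x
 proof (rule orth_proj_eqI)
  show "subspace (\<Phi> B)" by (simp add: \<Phi>_def)
  show "T B x \<in> \<Phi> B" unfolding T_def \<Phi>_def by (intro span_sum span_scale span_base) auto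
  have *: "B $ i \<bullet> B $ j = (if i = j \<and> i \<in> I then 1 else 0)" for i j using that by (simp add: Fr_def)
  have "(x - T B x) \<bullet> B $ j = 0" for j
  proof (cases "j \<in> I")
   case True
   have "T B x \<bullet> B $ j = (\<Sum>i\<in>UNIV. if i = j then B $ i \<bullet> x else 0)"
    unfolding T_def inner_sum_left by (intro sum.cong) (auto simp: * True)
   then show ?thesis by (simp add: inner_diff_left inner_diff_right inner_commute)
  next
   case False
   then have "B $ j = 0" using *[of j j] by simp
   then show ?thesis by simp
  qed
  then have "orthogonal (x - T B x) w" if "w \<in> range (($) B)" for w
   using that by (auto simp: orthogonal_def)
  then show "(x - T B x) \<bullet> w = 0" if "w \<in> \<Phi> B" for w
   using orthogonal_to_span[of w "range (($) B)" "x - T B x"] that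
   by (auto simp: \<Phi>_def orthogonal_def)
 qed
 have dim: "dim (\<Phi> B) = m" if "B \<in> Fr" for B
 proof -
  have *: "B $ i \<bullet> B $ j = (if i = j \<and> i \<in> I then 1 else 0)" for i j using that by (simp add: Fr_def)
  have z: "B $ i = 0" if "i \<notin> I" for i using *[of i i] that by simp
  have inj: "inj_on (($) B) I"
  proof (rule inj_onI)
   fix i j assume "i \<in> I" "j \<in> I" "B $ i = B $ j"
   then show "i = j" using *[of i j] *[of i i] by (auto split: if_splits)
  qed
  have sub: "range (($) B) \<subseteq> insert 0 (($) B ` I)" using z by auto
  have "span (range (($) B)) = span (($) B ` I)"
  proof (rule subset_antisym)
   show "span (range (($) B)) \<subseteq> span (($) B ` I)"
    using span_mono[OF sub] by (simp add: span_insert_0)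
   show "span (($) B ` I) \<subseteq> span (range (($) B))" by (intro span_mono) auto
  qed
  moreover have "independent (($) B ` I)"
  proof (rule pairwise_orthogonal_independent)
   show "pairwise orthogonal (($) B ` I)" by (auto simp: pairwise_def orthogonal_def *)
   show "0 \<notin> ($) B ` I"
   proof
    assume "0 \<in> ($) B ` I"
    then obtain i where "i \<in> I" "B $ i = 0" by auto
    then show False using *[of i i] by simp
   qed
  qed
  ultimately show ?thesis
   unfolding \<Phi>_def using inj I by (simp add: dim_eq_card_independent card_image)
 qed
 have "continuous_map (top_of_set Fr) (grassmannian_top m) \<Phi>"
  unfolding grassmannian_top_def
 proof (rule continuous_map_pullback')
  have "continuous_on Fr (\<lambda>B. Blinfun (T B))"
  proof (rule continuous_on_blinfun_componentwise)
   fix i :: "real^'n"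
   show "continuous_on Fr (\<lambda>B. blinfun_apply (Blinfun (T B)) i)"
    unfolding bounded_linear_Blinfun_apply[OF bl] unfolding T_def by (intro continuous_intros)
  qed
  moreover have "((\<lambda>S. Blinfun (orth_proj S)) \<circ> \<Phi>) B = Blinfun (T B)" if "B \<in> Fr" for B
  proof -
   have "orth_proj (\<Phi> B) = T B" using proj[OF that] by auto
   then show ?thesis by simp
  qed
  ultimately have "continuous_on Fr ((\<lambda>S. Blinfun (orth_proj S)) \<circ> \<Phi>)"
   by (metis (no_types, lifting) continuous_on_eq)
  then show "continuous_map (top_of_set Fr) euclidean ((\<lambda>S. Blinfun (orth_proj S)) \<circ> \<Phi>)"
   by simp
  show "topspace (top_of_set Fr) \<subseteq> \<Phi> -` grassmannian m"
   using dim by (auto simp: grassmannian_def \<Phi>_def)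
 qed
 then have "compactin (grassmannian_top m) (\<Phi> ` Fr)"
  using Fr by (intro image_compactin[of "top_of_set Fr"]) (auto simp: compactin_subtopology)
 moreover have "\<Phi> ` Fr = grassmannian m"
 proof (rule subset_antisym)
  show "\<Phi> ` Fr \<subseteq> grassmannian m" using dim by (auto simp: grassmannian_def \<Phi>_def)
  show "grassmannian m \<subseteq> \<Phi> ` Fr"
  proof
   fix S :: "(real^'n) set" assume "S \<in> grassmannian m"
   then have S: "subspace S" "dim S = m" by (auto simp: grassmannian_def)
   obtain D where D: "D \<subseteq> S" "pairwise orthogonal D" "\<And>x. x \<in> D \<Longrightarrow> norm x = 1"
    "independent D" "card D = dim S" "span D = S"
    using orthonormal_basis_subspace[OF S(1)] by metis
   have "finite D" using D(4) independent_imp_finite by blast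
   then obtain f where f: "bij_betw f I D"
    using finite_same_card_bij[OF finI] D(5) S(2) I by metis
   define B :: "real^'n^'n" where "B = (\<chi> i. if i \<in> I then f i else 0)"
   have B: "B $ i = (if i \<in> I then f i else 0)" for i by (simp add: B_def)
   have "B \<in> Fr" unfolding Fr_def mem_Collect_eq
   proof (intro allI)
    fix i j
    show "B $ i \<bullet> B $ j = (if i = j \<and> i \<in> I then 1 else 0)"
    proof (cases "i \<in> I \<and> j \<in> I")
     case True
     then have fij: "f i \<in> D" "f j \<in> D" using f by (auto simp: bij_betw_def)
     show ?thesis
     proof (cases "i = j")
      case True
      have "f i \<bullet> f i = 1" using D(3)[OF fij(1)] by (simp add: norm_eq_1)
      then show ?thesis using True \<open>i \<in> I \<and> j \<in> I\<close> B by simp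
     next
      case False
      then have "f i \<noteq> f j" using f \<open>i \<in> I \<and> j \<in> I\<close> by (auto simp: bij_betw_def inj_on_def)
      then have "f i \<bullet> f j = 0" using D(2) fij unfolding pairwise_def orthogonal_def by blast
      then show ?thesis using False \<open>i \<in> I \<and> j \<in> I\<close> B by simp
     qed
    next
     case False
     then show ?thesis using B by auto
    qed
   qed
   moreover have "\<Phi> B = S"
   proof -
    have "f ` I = D" using f by (simp add: bij_betw_def)
    have r1: "range (($) B) \<subseteq> insert 0 D"
    proof
     fix x assume "x \<in> range (($) B)"
     then obtain i where "x = B $ i" by auto
     then show "x \<in> insert 0 D" using \<open>f ` I = D\<close> B[of i] by (cases "i \<in> I") auto
    qed
    have r2: "D \<subseteq> range (($) B)"
    proof
     fix x assume "x \<in> D"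
     then obtain i where "i \<in> I" "x = f i" using \<open>f ` I = D\<close> by auto
     then have "x = B $ i" using B by simp
     then show "x \<in> range (($) B)" by blast
    qed
    have "span (range (($) B)) \<subseteq> span (insert 0 D)" "span D \<subseteq> span (range (($) B))"
     using span_mono[OF r1] span_mono[OF r2] by auto
    then show ?thesis using D(6) unfolding \<Phi>_def span_insert_0 by blast
   qed
   ultimately show "S \<in> \<Phi> ` Fr" by blast
  qed
 qed
 ultimately show ?thesis by simp
qed

section \<open>Radon measures on an open set\<close>

lemma radon_sets:
 fixes M :: "'a::euclidean_space measure"
 assumes "radon_measure (top_of_set U) M" "open U"
 shows "sets M = sets (restrict_space borel U)" "space M = U"
 using assms sets_borel_of_top_of_set[OF assms(2)] by (auto simp: radon_measure_def)

lemma radon_borel_set: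
 fixes M :: "'a::euclidean_space measure"
 assumes "radon_measure (top_of_set U) M" "open U" "A \<in> sets borel" "A \<subseteq> U"
 shows "A \<in> sets M"
 using assms by (auto simp: radon_sets sets_restrict_space image_iff intro!: bexI[of _ A])

lemma radon_compact:
 fixes M :: "'a::euclidean_space measure"
 assumes "radon_measure (top_of_set U) M" "open U" "compact K" "K \<subseteq> U"
 shows "K \<in> sets M" "emeasure M K < \<infinity>"
proof -
 show "K \<in> sets M" by (rule radon_borel_set[OF assms(1,2) borel_compact[OF assms(3)] assms(4)])
 have "compactin (top_of_set U) K" using assms(3,4) by (simp add: compactin_subtopology)
 then show "emeasure M K < \<infinity>" using assms(1) unfolding radon_measure_def by blast
qed

lemma radon_sigma_finite:
 fixes M :: "'a::euclidean_space measure"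
 assumes M: "radon_measure (top_of_set U) M" and U: "open U"
 shows "sigma_finite_measure M"
proof -
 obtain C :: "nat \<Rightarrow> 'a set"
  where C: "\<And>n. compact (C n)" "\<And>n. C n \<subseteq> U" "\<Union>(range C) = U"
  using open_Union_compact_subsets[OF U] by metis
 show ?thesis
 proof (rule sigma_finite_measure.intro, rule exI[of _ "range C"], intro conjI ballI)
  show "range C \<subseteq> sets M" using radon_compact(1)[OF M U C(1,2)] by auto
  show "\<Union>(range C) = space M" using C radon_sets[OF M U] by simp
  show "emeasure M a \<noteq> \<infinity>" if "a \<in> range C" for a
   using that radon_compact(2)[OF M U C(1,2)] by (auto simp: less_top)
 qed auto
qed

lemma radon_continuous_measurable:
 fixes M :: "'a::euclidean_space measure" and f :: "'a \<Rightarrow> 'b::topological_space"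
 assumes "radon_measure (top_of_set U) M" "open U" "continuous_on U f"
 shows "f \<in> borel_measurable M"
 using borel_measurable_continuous_on_restrict[OF assms(3)] radon_sets[OF assms(1,2)]
 by (simp cong: measurable_cong_sets)

lemma radon_integrable_bounded:
 fixes M :: "'a::euclidean_space measure" and f :: "'a \<Rightarrow> 'b::{banach, second_countable_topology}"
 assumes "radon_measure (top_of_set U) M" "open U" "f \<in> borel_measurable (completion M)"
  "compact K" "K \<subseteq> U" "\<And>z. z \<in> K \<Longrightarrow> norm (f z) \<le> B" "\<And>z. z \<in> U \<Longrightarrow> z \<notin> K \<Longrightarrow> f z = 0"
 shows "integrable (completion M) f"
proof (rule integrableI_bounded_set[where A=K and B=B])
 show "K \<in> sets (completion M)" "emeasure (completion M) K < \<infinity>"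
  using radon_compact[OF assms(1,2,4,5)] by auto
 show "AE x in completion M. x \<notin> K \<longrightarrow> f x = 0"
  using assms radon_sets[OF assms(1,2)] by (intro AE_I2) auto
qed (use assms in auto)

lemma borel_of_measurable:
 assumes "continuous_map X euclidean f" "sets M = sets (borel_of X)" "space M = topspace X"
 shows "f \<in> borel_measurable M"
proof (rule borel_measurableI)
 fix S :: "'b set" assume "open S"
 then have "openin X {x \<in> topspace X. f x \<in> S}"
  by (intro openin_continuous_map_preimage[OF assms(1)]) simp
 moreover have "{x \<in> topspace X. f x \<in> S} = f -` S \<inter> space M" using assms(3) by auto
 ultimately show "f -` S \<inter> space M \<in> sets M"
  by (simp add: assms(2) sets_borel_of sigma_sets.Basic)
qed


section \<open>Averages over the fibres of the weight\<close>

text \<open>A conditional expectation, expressed as a density on the base: the two push-forwards of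
 \<open>1 + q\<close> and \<open>1 - q\<close> are absolutely continuous and add up to twice the base measure, so
 that the density of the first lies between zero and two.\<close>

lemma fibre_mean:
 fixes q :: "'a \<Rightarrow> real"
 assumes f[measurable]: "f \<in> measurable M B" and sf: "sigma_finite_measure (distr M B f)"
  and q[measurable]: "q \<in> borel_measurable M" and q1: "\<And>x. x \<in> space M \<Longrightarrow> \<bar>q x\<bar> \<le> 1"
 obtains r where "r \<in> borel_measurable (distr M B f)" "\<And>y. \<bar>r y\<bar> \<le> 1"
  "\<And>a :: 'b \<Rightarrow> real. integrable (distr M B f) a \<Longrightarrow>
    (\<integral>x. a (f x) * q x \<partial>M) = (\<integral>y. a y * r y \<partial>distr M B f)"
proof -
 let ?N = "distr M B f"
 interpret N: sigma_finite_measure ?N by (rule sf)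
 \<comment> \<open>Only \<open>c = 1\<close> and \<open>c = -1\<close> are used; both densities are nonnegative as \<open>\<bar>q\<bar> \<le> 1\<close>.\<close>
 define D where "D c = distr (density M (\<lambda>x. ennreal (1 + c * q x))) B f" for c
 have f': "f \<in> measurable (density M g) B" for g using f by (simp add: measurable_def)
 have sets_D: "sets (D c) = sets ?N" for c by (simp add: D_def)
 have em_D: "emeasure (D c) A = (\<integral>\<^sup>+x. ennreal (1 + c * q x) * indicator (f -` A \<inter> space M) x \<partial>M)"
  if "A \<in> sets B" for A c
  using that measurable_sets[OF f that] by (simp add: D_def emeasure_distr[OF f'] emeasure_density)
 have ac: "absolutely_continuous ?N (D c)" for c
  unfolding absolutely_continuous_def
 proof
  fix A assume A: "A \<in> null_sets ?N"
  then have AB: "A \<in> sets B" by auto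
  have "f -` A \<inter> space M \<in> null_sets M"
   using A AB measurable_sets[OF f AB] by (auto simp: null_sets_def emeasure_distr[OF f])
  then have "AE x in M. x \<notin> f -` A \<inter> space M" by (rule AE_not_in)
  then have "AE x in M. ennreal (1 + c * q x) * indicator (f -` A \<inter> space M) x = 0"
   by eventually_elim auto
  then have "emeasure (D c) A = (\<integral>\<^sup>+x. 0 \<partial>M)"
   unfolding em_D[OF AB] by (intro nn_integral_cong_AE) auto
  then show "A \<in> null_sets (D c)" using AB by (auto simp: null_sets_def D_def)
 qed
 define R where "R c = RN_deriv ?N (D c)" for c
 have R[measurable]: "R c \<in> borel_measurable ?N" for c by (simp add: R_def)
 have dR: "density ?N (R c) = D c" for c
  unfolding R_def by (rule N.density_RN_deriv[OF ac sets_D])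
 have "density ?N (\<lambda>y. R 1 y + R (-1) y) = density ?N (\<lambda>y. 2)"
 proof (rule measure_eqI)
  fix A assume "A \<in> sets (density ?N (\<lambda>y. R 1 y + R (-1) y))"
  then have A: "A \<in> sets B" by simp
  have [measurable]: "f -` A \<inter> space M \<in> sets M" using measurable_sets[OF f A] .
  have "emeasure (density ?N (\<lambda>y. R 1 y + R (-1) y)) A
    = emeasure (density ?N (R 1)) A + emeasure (density ?N (R (-1))) A"
   using A R by (intro emeasure_density_add[symmetric]) auto
  also have "\<dots> = (\<integral>\<^sup>+x. ennreal (1 + 1 * q x) * indicator (f -` A \<inter> space M) x
    + ennreal (1 + (-1) * q x) * indicator (f -` A \<inter> space M) x \<partial>M)"
   unfolding dR em_D[OF A] by (intro nn_integral_add[symmetric]) auto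
  also have "\<dots> = (\<integral>\<^sup>+x. 2 * indicator (f -` A \<inter> space M) x \<partial>M)"
  proof (rule nn_integral_cong)
   fix x assume "x \<in> space M"
   then have "- 1 \<le> q x" "q x \<le> 1" using q1[of x] by auto
   then have "ennreal (1 + 1 * q x) + ennreal (1 + (-1) * q x) = ennreal ((1 + 1 * q x) + (1 + (-1) * q x))"
    by (intro ennreal_plus[symmetric]) auto
   also have "\<dots> = 2" by simp
   finally show "ennreal (1 + 1 * q x) * indicator (f -` A \<inter> space M) x
    + ennreal (1 + (-1) * q x) * indicator (f -` A \<inter> space M) x = 2 * indicator (f -` A \<inter> space M) x"
    by (simp only: distrib_right[symmetric])
  qed
  also have "\<dots> = 2 * emeasure M (f -` A \<inter> space M)" by (simp add: nn_integral_cmult_indicator)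
  also have "\<dots> = emeasure (density ?N (\<lambda>y. 2)) A"
   using A by (subst emeasure_density_const) (auto simp: emeasure_distr[OF f])
  finally show "emeasure (density ?N (\<lambda>y. R 1 y + R (-1) y)) A = emeasure (density ?N (\<lambda>y. 2)) A" .
 qed simp
 then have R2: "AE y in ?N. R 1 y + R (-1) y = 2"
  by (rule N.density_unique[rotated 2]) auto
 define r where "r y = enn2real (min 2 (R 1 y)) - 1" for y
 have r[measurable]: "r \<in> borel_measurable ?N" unfolding r_def[abs_def] by measurable
 have e2: "0 \<le> enn2real (min 2 t)" "enn2real (min 2 t) \<le> 2" for t :: ennreal
  using enn2real_mono[of "min 2 t" 2] by auto
 have r1: "\<bar>r y\<bar> \<le> 1" for y using e2[of "R 1 y"] by (simp add: r_def abs_le_iff)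
 have "AE y in ?N. R 1 y = ennreal (1 + r y)"
  using R2
 proof eventually_elim
  case (elim y)
  have "R 1 y \<le> R 1 y + R (-1) y" by (rule add_increasing2) auto
  then have "R 1 y \<le> 2" using elim by simp
  moreover then have "R 1 y < top" using le_less_trans[of "R 1 y" 2 top] by simp
  ultimately show ?case by (simp add: r_def min.absorb2)
 qed
 then have D1: "D 1 = density ?N (\<lambda>y. ennreal (1 + r y))"
  unfolding dR[symmetric] by (intro density_cong) auto
 have r0: "0 \<le> 1 + r y" for y using r1[of y] by (simp add: abs_le_iff)
 show thesis
 proof (rule that[OF r r1])
  fix a :: "'b \<Rightarrow> real" assume a: "integrable ?N a"
  then have am[measurable]: "a \<in> borel_measurable B"
   by (metis borel_measurable_integrable measurable_distr_eq1)
  have ai: "integrable M (\<lambda>x. a (f x))" using a f by (simp add: integrable_distr_eq)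
  have qi: "integrable M (\<lambda>x. a (f x) * q x)"
  proof (rule Bochner_Integration.integrable_bound[OF ai])
   show "AE x in M. norm (a (f x) * q x) \<le> norm (a (f x))"
    using q1 by (intro AE_I2) (simp add: abs_mult mult_left_le)
  qed simp
  have ri: "integrable ?N (\<lambda>y. a y * r y)"
  proof (rule Bochner_Integration.integrable_bound[OF a])
   show "AE x in ?N. norm (a x * r x) \<le> norm (a x)"
    using r1 by (intro AE_I2) (simp add: abs_mult mult_left_le)
  qed simp
  have q0: "AE x in M. 0 \<le> 1 + 1 * q x"
   using q1 by (intro AE_I2) (fastforce simp: abs_le_iff)
  have "(\<integral>x. (1 + 1 * q x) *\<^sub>R a (f x) \<partial>M) = (\<integral>x. a (f x) \<partial>density M (\<lambda>x. ennreal (1 + 1 * q x)))"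
   using q0 by (intro integral_density[symmetric]) auto
  also have "\<dots> = (\<integral>y. a y \<partial>D 1)"
   unfolding D_def by (rule integral_distr[symmetric, OF f' am])
  also have "\<dots> = (\<integral>y. (1 + r y) *\<^sub>R a y \<partial>?N)"
   unfolding D1 using r0 by (intro integral_density) auto
  finally have "(\<integral>x. a (f x) + a (f x) * q x \<partial>M) = (\<integral>y. a y + a y * r y \<partial>?N)"
   by (simp add: algebra_simps)
  then have "(\<integral>x. a (f x) \<partial>M) + (\<integral>x. a (f x) * q x \<partial>M) = (\<integral>y. a y \<partial>?N) + (\<integral>y. a y * r y \<partial>?N)"
   using ai qi a ri by simp
  moreover have "(\<integral>x. a (f x) \<partial>M) = (\<integral>y. a y \<partial>?N)" by (rule integral_distr[symmetric, OF f am])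
  ultimately show "(\<integral>x. a (f x) * q x \<partial>M) = (\<integral>y. a y * r y \<partial>?N)" by simp
 qed
qed

lemma test_field_derivative_bound:
 assumes "\<theta> \<in> test_fields U"
 obtains K B where "compact K" "K \<subseteq> U" "0 \<le> B" "\<And>z. norm (\<theta> z) \<le> B" "\<And>z. z \<notin> K \<Longrightarrow> \<theta> z = 0"
  "\<And>z i j. \<bar>\<D> \<theta> z (axis j 1 :: real^'n) $ i\<bar> \<le> B"
  "\<And>z v. z \<notin> K \<Longrightarrow> \<D> \<theta> z v = 0"
proof -
 obtain K where K: "smooth \<theta>" "compact K" "K \<subseteq> U" "\<And>z. z \<notin> K \<Longrightarrow> \<theta> z = 0"
  using test_fieldsE[OF assms] by blast
 have D0: "\<D> \<theta> z = (\<lambda>v. 0)" if "z \<notin> K" for z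
  by (rule frechet_derivative_zero_outside[where C=K and c=0])
    (use K(2,4) that in \<open>auto simp: compact_imp_closed\<close>)
 have "\<exists>B\<ge>0. \<forall>z\<in>K. norm (h z) \<le> B" if "continuous_on K h" for h :: "real^'n \<Rightarrow> real^'n"
 proof -
  have "bounded (h ` K)" using compact_continuous_image[OF that K(2)] by (rule compact_imp_bounded)
  then obtain B where "\<forall>y\<in>h ` K. norm y \<le> B" unfolding bounded_iff by blast
  then show ?thesis by (intro exI[of _ "max B 0"]) auto
 qed
 note bd = this
 obtain B0 where B0: "B0 \<ge> 0" "\<And>z. z \<in> K \<Longrightarrow> norm (\<theta> z) \<le> B0" using bd[OF smooth_D(3)[OF K(1)]] by blast
 have "\<exists>B\<ge>0. \<forall>z\<in>K. norm (\<D> \<theta> z (axis j 1)) \<le> B" for j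
  using bd[OF smooth_continuous_D[OF K(1)]] by blast
 then obtain B where B: "\<And>j. B j \<ge> 0" "\<And>j z. z \<in> K \<Longrightarrow> norm (\<D> \<theta> z (axis j 1)) \<le> B j"
  by metis
 have B_le: "B j \<le> (\<Sum>j\<in>UNIV. B j)" for j using B(1) by (intro member_le_sum) auto
 have B_pos: "0 \<le> (\<Sum>j\<in>UNIV. B j)" using B(1) by (intro sum_nonneg) auto
 show thesis
 proof (rule that[OF K(2,3)])
  show "0 \<le> B0 + (\<Sum>j\<in>UNIV. B j)" using B0(1) B_pos by simp
  show "norm (\<theta> z) \<le> B0 + (\<Sum>j\<in>UNIV. B j)" for z
   using B0 B_pos K(4) by (cases "z \<in> K") (auto intro: add_increasing2)
  show "\<bar>\<D> \<theta> z (axis j 1) $ i\<bar> \<le> B0 + (\<Sum>j\<in>UNIV. B j)" for z i j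
  proof (cases "z \<in> K")
   case True
   have "\<bar>\<D> \<theta> z (axis j 1) $ i\<bar> \<le> norm (\<D> \<theta> z (axis j 1))"
    by (rule component_le_norm_cart)
   then show ?thesis using B(2)[OF True, of j] B_le[of j] B0(1) by linarith
  next
   case False
   then show ?thesis using D0 B0(1) B_pos by simp
  qed
  show "\<theta> z = 0" if "z \<notin> K" for z using K(4) that .
  show "\<D> \<theta> z v = 0" if "z \<notin> K" for z v using D0 that by simp
 qed
qed

section \<open>The weight and the mean tangential projection of a varifold\<close>

locale varifold_setting =
 fixes m :: nat and U :: "(real^'n) set" and V :: "((real^'n) \<times> (real^'n) set) measure"
 assumes m_le: "m \<le> CARD('n)" and open_U: "open U" and varifold: "varifold m U V"
begin

abbreviation mu :: "(real^'n) measure" where "mu \<equiv> weight U V"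
abbreviation \<mu> :: "(real^'n) measure" where "\<mu> \<equiv> completion mu"
abbreviation \<M> :: "(real^'n \<Rightarrow> 'b::topological_space) set" where "\<M> \<equiv> borel_measurable (completion mu)"

lemma sets_V: "sets V = sets (borel_of (varifold_top m U))"
 and space_V: "space V = U \<times> grassmannian m"
 using varifold by (auto simp: varifold_def radon_measure_def varifold_top_def)

lemma fst_measurable: "fst \<in> measurable V (borel_of (top_of_set U))"
 unfolding borel_of_def
proof (rule measurable_measure_of)
 fix A assume "A \<in> {A. openin (top_of_set U) A}"
 then have A: "openin (top_of_set U) A" by simp
 have "continuous_map (varifold_top m U) (top_of_set U) fst"
  unfolding varifold_top_def by (rule continuous_map_fst)
 from openin_continuous_map_preimage[OF this A]
 have "openin (varifold_top m U) {p \<in> topspace (varifold_top m U). fst p \<in> A}" .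
 moreover have "{p \<in> topspace (varifold_top m U). fst p \<in> A} = fst -` A \<inter> space V"
  by (auto simp: space_V varifold_top_def)
 ultimately show "fst -` A \<inter> space V \<in> sets V"
  by (simp add: sets_V sets_borel_of sigma_sets.Basic)
qed (auto simp: space_V dest: openin_imp_subset)

lemma sets_mu: "sets mu = sets (borel_of (top_of_set U))" and space_mu [simp]: "space mu = U"
 by (auto simp: weight_def)

lemma fst_mu: "fst \<in> measurable V mu"
 using fst_measurable by (simp add: measurable_cong_sets[OF refl sets_mu])

lemma distr_mu: "distr V mu fst = mu"
 by (simp add: weight_def cong: distr_cong)

text \<open>Preimages of compact sets under the projection are compact because the Grassmannian is.\<close>

lemma radon_mu: "radon_measure (top_of_set U) mu"
 unfolding radon_measure_def
proof (intro conjI allI impI)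
 fix K assume "compactin (top_of_set U) K"
 then have K: "compact K" "K \<subseteq> U" by (auto simp: compactin_subtopology)
 have "K \<in> sets (restrict_space borel U)"
  using K by (auto simp: sets_restrict_space image_iff intro!: bexI[of _ K] borel_compact)
 then have Ks: "K \<in> sets (borel_of (top_of_set U))" using sets_borel_of_top_of_set[OF open_U] by simp
 have "emeasure mu K = emeasure V (fst -` K \<inter> space V)"
  unfolding weight_def by (rule emeasure_distr[OF fst_measurable Ks])
 also have "fst -` K \<inter> space V = K \<times> grassmannian m" using K by (auto simp: space_V)
 also have "compactin (varifold_top m U) (K \<times> grassmannian m)"
  unfolding varifold_top_def using K compact_grassmannian[OF m_le]
  by (auto simp: compactin_Times compactin_subtopology)
 then have "emeasure V (K \<times> grassmannian m) < \<infinity>"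
  using varifold unfolding varifold_def radon_measure_def by blast
 finally show "emeasure mu K < \<infinity>" .
qed (auto simp: sets_mu)

lemmas sigma_finite_mu = radon_sigma_finite[OF radon_mu open_U]

definition proj_entry :: "'n \<Rightarrow> 'n \<Rightarrow> (real^'n) set \<Rightarrow> real" where
 "proj_entry i j S = orth_proj S (axis j 1) $ i"

lemma proj_entry_bound:
 assumes "S \<in> grassmannian m" shows "\<bar>proj_entry i j S\<bar> \<le> 1"
proof -
 have "subspace S" using assms by (simp add: grassmannian_def)
 then have "norm (orth_proj S (axis j 1)) \<le> norm (axis j (1::real))" by (rule norm_orth_proj_le)
 then show ?thesis
  using component_le_norm_cart[of "orth_proj S (axis j 1)" i]
  by (simp add: proj_entry_def norm_axis_1)
qed

lemma proj_entry_measurable: "(\<lambda>p. proj_entry i j (snd p)) \<in> borel_measurable V"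
proof (rule borel_of_measurable[OF _ sets_V])
 have "continuous_map (grassmannian_top m) euclidean ((\<lambda>T. blinfun_apply T (axis j 1) $ i) \<circ> (\<lambda>S :: (real^'n) set. Blinfun (orth_proj S)))"
  unfolding grassmannian_top_def
  by (rule continuous_map_pullback) (auto intro!: continuous_intros)
 then have "continuous_map (grassmannian_top m) euclidean (proj_entry i j)"
 proof (rule continuous_map_eq)
  fix S :: "(real^'n) set" assume "S \<in> topspace (grassmannian_top m)"
  then have "bounded_linear (orth_proj S)"
   using linear_orth_proj linear_conv_bounded_linear by (auto simp: grassmannian_def)
  then show "((\<lambda>T. blinfun_apply T (axis j 1) $ i) \<circ> (\<lambda>S. Blinfun (orth_proj S))) S = proj_entry i j S"
   by (simp add: proj_entry_def bounded_linear_Blinfun_apply)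
 qed
 then have "continuous_map (varifold_top m U) euclidean (proj_entry i j \<circ> snd)"
  unfolding varifold_top_def by (rule continuous_map_compose[OF continuous_map_snd])
 then show "continuous_map (varifold_top m U) euclidean (\<lambda>p. proj_entry i j (snd p))"
  by (simp add: o_def)
qed (simp add: space_V varifold_top_def)

lemma fst_completion: "fst \<in> measurable (completion V) \<mu>"
proof (rule completion.measurable_completion2)
 show "fst \<in> measurable (completion V) mu" by (rule measurable_completion[OF fst_mu])
 show "null_sets mu \<subseteq> null_sets (distr (completion V) mu fst)"
  by (simp add: distr_completion[OF fst_mu] distr_mu)
qed

text \<open>Each entry is the conditional expectation, given the base point, of the corresponding entry of
 the matrix of \<^term>\<open>orth_proj S\<close>.\<close>

definition mean_proj :: "real^'n \<Rightarrow> real^'n^'n" where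
 "mean_proj = (SOME P. \<forall>i j. (\<lambda>z. P z $ i $ j) \<in> borel_measurable mu \<and> (\<forall>z. \<bar>P z $ i $ j\<bar> \<le> 1) \<and>
   (\<forall>a :: real^'n \<Rightarrow> real. integrable mu a \<longrightarrow>
    (\<integral>p. a (fst p) * proj_entry i j (snd p) \<partial>V) = (\<integral>z. a z * P z $ i $ j \<partial>mu)))"

lemma mean_proj_spec:
 "(\<lambda>z. mean_proj z $ i $ j) \<in> borel_measurable mu \<and> (\<forall>z. \<bar>mean_proj z $ i $ j\<bar> \<le> 1) \<and>
   (\<forall>a :: real^'n \<Rightarrow> real. integrable mu a \<longrightarrow>
    (\<integral>p. a (fst p) * proj_entry i j (snd p) \<partial>V) = (\<integral>z. a z * mean_proj z $ i $ j \<partial>mu))"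
proof -
 define Q where "Q i j r \<longleftrightarrow> r \<in> borel_measurable mu \<and> (\<forall>z. \<bar>r z\<bar> \<le> 1) \<and>
   (\<forall>a :: real^'n \<Rightarrow> real. integrable mu a \<longrightarrow>
    (\<integral>p. a (fst p) * proj_entry i j (snd p) \<partial>V) = (\<integral>z. a z * r z \<partial>mu))" for i j and r :: "real^'n \<Rightarrow> real"
 have "\<exists>r. Q i j r" for i j
 proof -
  have sf: "sigma_finite_measure (distr V mu fst)" unfolding distr_mu by (rule sigma_finite_mu)
  have bd: "\<bar>proj_entry i j (snd p)\<bar> \<le> 1" if "p \<in> space V" for p
   using that proj_entry_bound by (auto simp: space_V)
  show ?thesis
  proof (rule fibre_mean[OF fst_mu sf proj_entry_measurable bd, unfolded distr_mu])
   fix r :: "real^'n \<Rightarrow> real"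
   assume r: "r \<in> borel_measurable mu" "\<And>y. \<bar>r y\<bar> \<le> 1"
    "\<And>a :: real^'n \<Rightarrow> real. integrable mu a \<Longrightarrow>
     (\<integral>p. a (fst p) * proj_entry i j (snd p) \<partial>V) = (\<integral>z. a z * r z \<partial>mu)"
   show ?thesis unfolding Q_def by (intro exI[of _ r] conjI allI impI r) assumption
  qed
 qed
 then obtain r where r: "\<And>i j. Q i j (r i j)" by metis
 have "\<forall>i j. Q i j (\<lambda>z. (\<chi> i j. r i j z) $ i $ j)" using r by simp
 then have "\<forall>i j. Q i j (\<lambda>z. mean_proj z $ i $ j)"
  unfolding mean_proj_def Q_def[symmetric]
  by (rule someI[where P="\<lambda>P. \<forall>i j. Q i j (\<lambda>z. P z $ i $ j)"])
 then show ?thesis by (simp add: Q_def)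
qed

lemma mean_proj_measurable [measurable]: "(\<lambda>z. mean_proj z $ i $ j) \<in> borel_measurable mu"
 and mean_proj_bound: "\<bar>mean_proj z $ i $ j\<bar> \<le> 1"
 using mean_proj_spec by auto

lemma integral_proj_entry:
 fixes a :: "real^'n \<Rightarrow> real"
 assumes a: "integrable \<mu> a"
 shows "integrable (completion V) (\<lambda>p. a (fst p) * proj_entry i j (snd p))" (is ?A)
  and "(\<integral>p. a (fst p) * proj_entry i j (snd p) \<partial>completion V) = (\<integral>z. a z * mean_proj z $ i $ j \<partial>\<mu>)" (is ?B)
proof -
 obtain b where b[measurable]: "b \<in> borel_measurable mu" and ab: "AE z in mu. a z = b z"
  using completion_ex_borel_measurable_real[OF borel_measurable_integrable[OF a]] by blast
 have am[measurable]: "a \<in> \<M>" using a by simp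
 have bc[measurable]: "b \<in> \<M>" using b by (rule measurable_completion)
 have abc: "AE z in \<mu>. a z = b z" using ab by (rule AE_completion)
 have bi: "integrable mu b"
 proof -
  have "integrable \<mu> b"
   using a integrable_cong_AE[OF am bc abc] by simp
  then show ?thesis using integrable_completion[OF b] by simp
 qed
 note fst_mu[measurable] fst_completion[measurable] proj_entry_measurable[measurable]
 have pe[measurable]: "(\<lambda>p. proj_entry i j (snd p)) \<in> borel_measurable (completion V)"
  by (rule measurable_completion[OF proj_entry_measurable])
 have abV: "AE p in V. a (fst p) = b (fst p)"
  by (rule AE_distrD[OF fst_mu, unfolded distr_mu, OF ab])
 have abV': "AE p in completion V. a (fst p) * proj_entry i j (snd p) = b (fst p) * proj_entry i j (snd p)"
  using AE_completion[OF abV] by eventually_elim simp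
 have "integrable (distr V mu fst) b" unfolding distr_mu by (rule bi)
 then have bV: "integrable V (\<lambda>p. b (fst p))" by (simp add: integrable_distr_eq[OF fst_mu b])
 have bpV: "integrable V (\<lambda>p. b (fst p) * proj_entry i j (snd p))"
 proof (rule Bochner_Integration.integrable_bound[OF bV])
  show "AE p in V. norm (b (fst p) * proj_entry i j (snd p)) \<le> norm (b (fst p))"
  proof (rule AE_I2)
   fix p assume "p \<in> space V"
   then have "\<bar>proj_entry i j (snd p)\<bar> \<le> 1" using proj_entry_bound by (auto simp: space_V)
   then show "norm (b (fst p) * proj_entry i j (snd p)) \<le> norm (b (fst p))"
    by (simp add: abs_mult mult_left_le)
  qed
 qed measurable
 have m1: "(\<lambda>p. b (fst p) * proj_entry i j (snd p)) \<in> borel_measurable V" by measurable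
 have mc1: "(\<lambda>p. b (fst p) * proj_entry i j (snd p)) \<in> borel_measurable (completion V)"
  by (rule measurable_completion[OF m1])
 have mc2: "(\<lambda>p. a (fst p) * proj_entry i j (snd p)) \<in> borel_measurable (completion V)"
  by measurable
 show ?A
  using integrable_cong_AE[OF mc2 mc1 abV'] integrable_completion[OF m1] bpV by simp
 have "(\<integral>p. a (fst p) * proj_entry i j (snd p) \<partial>completion V) = (\<integral>p. b (fst p) * proj_entry i j (snd p) \<partial>V)"
  using integral_cong_AE[OF mc2 mc1 abV'] integral_completion[OF m1] by simp
 also have "\<dots> = (\<integral>z. b z * mean_proj z $ i $ j \<partial>mu)" using mean_proj_spec bi by blast
 also have "\<dots> = (\<integral>z. b z * mean_proj z $ i $ j \<partial>\<mu>)"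
  by (rule integral_completion[symmetric]) measurable
 also have "\<dots> = (\<integral>z. a z * mean_proj z $ i $ j \<partial>\<mu>)"
 proof (rule integral_cong_AE)
  have [measurable]: "(\<lambda>z. mean_proj z $ i $ j) \<in> \<M>"
   by (rule measurable_completion[OF mean_proj_measurable])
  show "(\<lambda>z. b z * mean_proj z $ i $ j) \<in> \<M>"
   "(\<lambda>z. a z * mean_proj z $ i $ j) \<in> \<M>" by measurable
  show "AE z in \<mu>. b z * mean_proj z $ i $ j = a z * mean_proj z $ i $ j"
   using abc by eventually_elim simp
 qed
 finally show ?B .
qed

text \<open>The mean over the fibre at \<open>z\<close> of the tangential divergence of \<open>\<theta>\<close>.\<close>

definition tdiv :: "(real^'n \<Rightarrow> real^'n) \<Rightarrow> real^'n \<Rightarrow> real" where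
 "tdiv \<theta> z = (\<Sum>j\<in>UNIV. \<Sum>i\<in>UNIV. \<D> \<theta> z (axis j 1) $ i * mean_proj z $ i $ j)"

lemma mean_proj_measurable' [measurable]: "(\<lambda>z. mean_proj z $ i $ j) \<in> \<M>"
 by (rule measurable_completion[OF mean_proj_measurable])

lemma continuous_measurable_mu: "continuous_on UNIV f \<Longrightarrow> f \<in> borel_measurable mu"
 by (rule radon_continuous_measurable[OF radon_mu open_U continuous_on_subset]) auto

text \<open>The inner product of matrices is the sum of the products of their entries, to each of which
 the conditional expectation applies.\<close>

lemma integral_tdiv:
 assumes \<theta>: "\<theta> \<in> test_fields U" and a[measurable]: "a \<in> \<M>"
  and A: "\<And>z. \<bar>a z\<bar> \<le> A"
 shows "(\<integral>(z, S). a z * hom_inner (orth_proj S) (\<D> \<theta> z) \<partial>completion V)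
   = (\<integral>z. a z * tdiv \<theta> z \<partial>\<mu>)"
  and "(\<integral>(z, S). a z * hom_inner (\<D> \<theta> z) (orth_proj S) \<partial>completion V)
   = (\<integral>z. a z * tdiv \<theta> z \<partial>\<mu>)"
  and "integrable \<mu> (\<lambda>z. a z * tdiv \<theta> z)"
proof -
 have sm: "smooth \<theta>" using \<theta> by (simp add: test_fields_def)
 let ?D = "\<lambda>i j z. \<D> \<theta> z (axis j 1) $ i"
 obtain K B where KB: "compact K" "K \<subseteq> U" "0 \<le> B" "\<And>z. norm (\<theta> z) \<le> B"
  "\<And>z. z \<notin> K \<Longrightarrow> \<theta> z = 0" "\<And>z i j. \<bar>?D i j z\<bar> \<le> B"
  "\<And>z v. z \<notin> K \<Longrightarrow> \<D> \<theta> z v = 0"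
  by (rule test_field_derivative_bound[OF \<theta>]) (rule that)
 have Dm: "?D i j \<in> borel_measurable mu" for i j
  by (rule continuous_measurable_mu) (intro continuous_intros smooth_continuous_D sm)
 have [measurable]: "?D i j \<in> \<M>" for i j
  by (rule measurable_completion[OF Dm])
 have aD: "integrable \<mu> (\<lambda>z. a z * ?D i j z)" for i j
 proof (rule radon_integrable_bounded[OF radon_mu open_U _ KB(1,2)])
  show "norm (a z * ?D i j z) \<le> A * B" for z
   using A KB(3,6) order_trans[OF abs_ge_zero A] by (simp add: abs_mult mult_mono)
 qed (auto simp: KB(7))
 have aDP: "integrable \<mu> (\<lambda>z. a z * ?D i j z * mean_proj z $ i $ j)" for i j
 proof (rule Bochner_Integration.integrable_bound[OF aD])
  show "AE z in \<mu>. norm (a z * ?D i j z * mean_proj z $ i $ j) \<le> norm (a z * ?D i j z)"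
   using mean_proj_bound by (intro AE_I2) (simp add: abs_mult mult_left_le)
 qed measurable
 have td: "a z * tdiv \<theta> z = (\<Sum>j\<in>UNIV. \<Sum>i\<in>UNIV. a z * ?D i j z * mean_proj z $ i $ j)" for z
  by (simp add: tdiv_def sum_distrib_left mult.assoc)
 show "integrable \<mu> (\<lambda>z. a z * tdiv \<theta> z)"
  unfolding td by (intro Bochner_Integration.integrable_sum aDP)
 have main: "(\<integral>p. (\<Sum>j\<in>UNIV. \<Sum>i\<in>UNIV. (a (fst p) * ?D i j (fst p)) * proj_entry i j (snd p)) \<partial>completion V)
   = (\<integral>z. a z * tdiv \<theta> z \<partial>\<mu>)"
  unfolding td
  by (simp add: Bochner_Integration.integral_sum integral_proj_entry[OF aD] Bochner_Integration.integrable_sum aDP)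
 have h1: "hom_inner (orth_proj S) (\<D> \<theta> z) = (\<Sum>j\<in>UNIV. \<Sum>i\<in>UNIV. ?D i j z * proj_entry i j S)"
  if "S \<in> grassmannian m" for z S
 proof -
  have "linear (orth_proj S)" using that linear_orth_proj by (auto simp: grassmannian_def)
  then show ?thesis
   by (simp add: hom_inner_eq inner_vec_def proj_entry_def mult.commute)
 qed
 have h2: "hom_inner (\<D> \<theta> z) (orth_proj S) = (\<Sum>j\<in>UNIV. \<Sum>i\<in>UNIV. ?D i j z * proj_entry i j S)"
  for z S
  by (simp add: hom_inner_eq[OF smooth_D(5)[OF sm]] inner_vec_def proj_entry_def)
 show "(\<integral>(z, S). a z * hom_inner (orth_proj S) (\<D> \<theta> z) \<partial>completion V)
   = (\<integral>z. a z * tdiv \<theta> z \<partial>\<mu>)"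
  unfolding main[symmetric]
  by (rule Bochner_Integration.integral_cong)
    (auto simp: space_V h1 sum_distrib_left mult.assoc)
 show "(\<integral>(z, S). a z * hom_inner (\<D> \<theta> z) (orth_proj S) \<partial>completion V)
   = (\<integral>z. a z * tdiv \<theta> z \<partial>\<mu>)"
  unfolding main[symmetric]
  by (rule Bochner_Integration.integral_cong)
    (auto simp: space_V h2 sum_distrib_left mult.assoc)
qed

lemma tdiv_integrable: "\<theta> \<in> test_fields U \<Longrightarrow> integrable \<mu> (tdiv \<theta>)"
 using integral_tdiv(3)[of \<theta> "\<lambda>z. 1" 1] by simp

lemma first_variation_eq:
 assumes \<theta>: "\<theta> \<in> test_fields U"
 shows "first_variation V \<theta> = (\<integral>z. tdiv \<theta> z \<partial>\<mu>)"
proof -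
 have sm: "smooth \<theta>" using \<theta> by (simp add: test_fields_def)
 have m: "(\<lambda>p. hom_inner (\<D> \<theta> (fst p)) (orth_proj (snd p))) \<in> borel_measurable V"
 proof -
  have [measurable]: "(\<lambda>p. \<D> \<theta> (fst p) (axis j 1) $ i) \<in> borel_measurable V" for i j
   by (rule measurable_compose[OF fst_mu continuous_measurable_mu])
     (intro continuous_intros smooth_continuous_D sm)
  note proj_entry_measurable[measurable]
  show ?thesis
   unfolding hom_inner_eq[OF smooth_D(5)[OF sm]] inner_vec_def proj_entry_def[symmetric] inner_real_def
   by measurable
 qed
 have "first_variation V \<theta> = (\<integral>p. hom_inner (\<D> \<theta> (fst p)) (orth_proj (snd p)) \<partial>completion V)"
  unfolding first_variation_def case_prod_beta by (rule integral_completion[symmetric, OF m])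
 also have "\<dots> = (\<integral>z. 1 * tdiv \<theta> z \<partial>\<mu>)"
  using integral_tdiv(2)[OF \<theta>, of "\<lambda>z. 1" 1] by (simp add: case_prod_unfold)
 finally show ?thesis by simp
qed

lemma first_variation_add:
 assumes "g \<in> test_fields U" "h \<in> test_fields U"
 shows "first_variation V (\<lambda>z. g z + h z) = first_variation V g + first_variation V h"
proof -
 have sm: "smooth g" "smooth h" using assms by (auto simp: test_fields_def)
 have "\<D> (\<lambda>z. g z + h z) z = (\<lambda>v. \<D> g z v + \<D> h z v)" for z
  by (rule frechet_derivative_at[symmetric]) (intro has_derivative_add smooth_D sm)
 then have "tdiv (\<lambda>z. g z + h z) z = tdiv g z + tdiv h z" for z
  by (simp add: tdiv_def sum.distrib distrib_right)
 then show ?thesis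
  using tdiv_integrable assms by (simp add: first_variation_eq test_fields_add)
qed

lemma first_variation_scaleR:
 assumes "g \<in> test_fields U"
 shows "first_variation V (\<lambda>z. c *\<^sub>R g z) = c * first_variation V g"
proof -
 have sm: "smooth g" using assms by (auto simp: test_fields_def)
 have "\<D> (\<lambda>z. c *\<^sub>R g z) z = (\<lambda>v. c *\<^sub>R \<D> g z v)" for z
  by (rule frechet_derivative_at[symmetric]) (intro has_derivative_scaleR_right smooth_D sm)
 then have "tdiv (\<lambda>z. c *\<^sub>R g z) z = c * tdiv g z" for z
  by (simp add: tdiv_def sum_distrib_left mult.assoc)
 then show ?thesis
  using assms by (simp add: first_variation_eq test_fields_scaleR)
qed

lemma first_variation_diff:
 assumes "g \<in> test_fields U" "h \<in> test_fields U"
 shows "first_variation V (\<lambda>z. g z - h z) = first_variation V g - first_variation V h"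
 using first_variation_add[OF assms(1) test_fields_scaleR[OF smooth_const[of "-1"] assms(2)]]
  first_variation_scaleR[OF assms(2), of "-1"] by simp

lemma first_variation_sum:
 assumes "\<And>i. i \<in> I \<Longrightarrow> g i \<in> test_fields U"
 shows "first_variation V (\<lambda>z. \<Sum>i\<in>I. g i z) = (\<Sum>i\<in>I. first_variation V (g i))"
 using assms
proof (induction I rule: infinite_finite_induct)
 case (insert i I)
 then show ?case by (simp add: first_variation_add test_fields_sum)
qed (use first_variation_scaleR[OF test_fields_0, of 0] in auto)

end


section \<open>The total variation measure\<close>

lemma ennreal_add_le: "ennreal (a + b) \<le> ennreal a + ennreal b"
proof (cases "a \<ge> 0")
 case True
 show ?thesis
 proof (cases "b \<ge> 0")
  case True then show ?thesis using \<open>a \<ge> 0\<close> by (simp add: ennreal_plus)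
 next
  case False
  then have "ennreal (a + b) \<le> ennreal a" by (intro ennreal_leI) simp
  then show ?thesis by (rule add_increasing2[OF zero_le])
 qed
next
 case False
 then have "ennreal (a + b) \<le> ennreal b" by (intro ennreal_leI) simp
 then show ?thesis by (rule add_increasing[OF zero_le])
qed

lemma ennreal_sum_le: "ennreal (\<Sum>i\<in>I. x i) \<le> (\<Sum>i\<in>I. ennreal (x i))"
proof (induction I rule: infinite_finite_induct)
 case (insert i I)
 have "ennreal (\<Sum>i\<in>insert i I. x i) \<le> ennreal (x i) + ennreal (\<Sum>i\<in>I. x i)"
  using insert.hyps ennreal_add_le by simp
 also have "\<dots> \<le> ennreal (x i) + (\<Sum>i\<in>I. ennreal (x i))" by (intro add_left_mono insert.IH)
 finally show ?case using insert.hyps by simp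
qed auto

text \<open>The sum is at most twice its largest term, which is less than \<open>t\<close>; it will bound the total of
 the dyadic pieces of a field at a point where its norm is comparable to \<open>t\<close>.\<close>

lemma truncated_geometric_sum:
 fixes t :: real
 assumes "0 \<le> t"
 shows "(\<Sum>k<N. if (1/2)^k < t then (1/2::real)^k else 0) \<le> 2 * t"
 using assms
proof (induction N arbitrary: t)
 case (Suc N)
 show ?case
 proof (cases "1 < t")
  case True
  have g: "(\<Sum>k<n. (1/2)^k) = 2 - 2 * (1/2::real)^n" for n by (induction n) auto
  have "(\<Sum>k<Suc N. if (1/2)^k < t then (1/2::real)^k else 0) \<le> (\<Sum>k<Suc N. (1/2::real)^k)"
   by (intro sum_mono) auto
  also have "\<dots> \<le> 2" unfolding g by simp
  finally show ?thesis using True by linarith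
 next
  case False
  have "(\<Sum>k<Suc N. if (1/2)^k < t then (1/2::real)^k else 0)
    = (\<Sum>k<N. if (1/2)^Suc k < t then (1/2::real)^Suc k else 0)"
   unfolding sum.lessThan_Suc_shift using False by simp
  also have "\<dots> = (\<Sum>k<N. (1/2) * (if (1/2)^k < 2 * t then (1/2::real)^k else 0))"
   by (intro sum.cong refl) auto
  also have "\<dots> = (1/2) * (\<Sum>k<N. if (1/2)^k < 2 * t then (1/2::real)^k else 0)"
   by (rule sum_distrib_left[symmetric])
  also have "\<dots> \<le> (1/2) * (2 * (2 * t))"
   using Suc.IH[of "2 * t"] Suc.prems by (intro mult_left_mono) auto
  finally show ?thesis by simp
 qed
qed simp

context varifold_setting
begin

abbreviation nu :: "(real^'n) measure" where "nu \<equiv> total_variation U V"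
abbreviation \<nu> :: "(real^'n) measure" where "\<nu> \<equiv> completion nu"
abbreviation \<N> :: "(real^'n \<Rightarrow> 'b::topological_space) set" where "\<N> \<equiv> borel_measurable (completion nu)"

definition unit_variation :: "(real^'n) set \<Rightarrow> ennreal" where
 "unit_variation G = (SUP g\<in>{g \<in> test_fields G. \<forall>z. norm (g z) \<le> 1}. ennreal (first_variation V g))"

lemma outer_eq: "total_variation_outer U V A = (INF G\<in>{G. open G \<and> A \<subseteq> G \<and> G \<subseteq> U}. unit_variation G)"
 by (simp add: total_variation_outer_def unit_variation_def)

lemma unit_variation_upper:
 "g \<in> test_fields G \<Longrightarrow> (\<And>z. norm (g z) \<le> 1) \<Longrightarrow> ennreal (first_variation V g) \<le> unit_variation G"
 unfolding unit_variation_def by (rule SUP_upper) auto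

lemma unit_variation_mono: "G \<subseteq> H \<Longrightarrow> unit_variation G \<le> unit_variation H"
 unfolding unit_variation_def by (rule SUP_subset_mono) (auto dest: test_fields_mono)

lemma outer_open: "open G \<Longrightarrow> G \<subseteq> U \<Longrightarrow> total_variation_outer U V G = unit_variation G"
 unfolding outer_eq
 by (intro antisym INF_lower INF_greatest) (auto intro: unit_variation_mono)

lemma outer_le: "open G \<Longrightarrow> A \<subseteq> G \<Longrightarrow> G \<subseteq> U \<Longrightarrow> total_variation_outer U V A \<le> unit_variation G"
 unfolding outer_eq by (rule INF_lower) auto

lemma outer_mono: "A \<subseteq> B \<Longrightarrow> total_variation_outer U V A \<le> total_variation_outer U V B"
 unfolding outer_eq by (rule INF_superset_mono) auto

text \<open>A partition of unity on the compact support splits a field into fields supported in the single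
 open sets, without increasing the norms.\<close>

lemma unit_variation_UN_le:
 assumes "\<And>i. open (G i)" "\<And>i. G i \<subseteq> U"
 shows "unit_variation (\<Union>i. G i) \<le> (\<Sum>i. unit_variation (G i))"
 unfolding unit_variation_def[of "\<Union>i. G i"]
proof (rule SUP_least)
 fix g assume "g \<in> {g \<in> test_fields (\<Union>i. G i). \<forall>z. norm (g z) \<le> 1}"
 then have g: "g \<in> test_fields (\<Union>i. G i)" and g1: "\<And>z. norm (g z) \<le> 1" by auto
 obtain K where K: "smooth g" "compact K" "K \<subseteq> (\<Union>i. G i)" "\<And>z. z \<notin> K \<Longrightarrow> g z = 0"
  by (rule test_fieldsE[OF g]) (rule that)
 show "ennreal (first_variation V g) \<le> (\<Sum>i. unit_variation (G i))"
 proof (rule smooth_partition[OF K(2) assms(1) K(3)])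
 fix \<psi> :: "nat \<Rightarrow> real^'n \<Rightarrow> real" and C N assume \<psi>:
  "\<And>i. smooth (\<psi> i)" "\<And>i x. 0 \<le> \<psi> i x" "\<And>i x. \<psi> i x \<le> 1"
  "\<And>i. compact (C i)" "\<And>i. C i \<subseteq> G i" "\<And>i x. x \<notin> C i \<Longrightarrow> \<psi> i x = 0"
  "\<And>x. x \<in> K \<Longrightarrow> (\<Sum>i<N. \<psi> i x) = 1"
 have gi: "(\<lambda>z. \<psi> i z *\<^sub>R g z) \<in> test_fields (G i)" for i
  by (rule test_fields_scaleR_left[OF \<psi>(1,4,5,6) K(1)])
 have giU: "(\<lambda>z. \<psi> i z *\<^sub>R g z) \<in> test_fields U" for i
  using gi test_fields_mono[OF assms(2)] by blast
 have n1: "norm (\<psi> i z *\<^sub>R g z) \<le> 1" for i z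
  using \<psi>(2,3)[of i z] g1[of z] by (simp add: mult_le_one)
 have "g = (\<lambda>z. \<Sum>i<N. \<psi> i z *\<^sub>R g z)"
 proof
  show "g z = (\<Sum>i<N. \<psi> i z *\<^sub>R g z)" for z
   using \<psi>(7)[of z] K(4)[of z] by (cases "z \<in> K") (auto simp: scaleR_sum_left[symmetric])
 qed
 then have "first_variation V g = first_variation V (\<lambda>z. \<Sum>i<N. \<psi> i z *\<^sub>R g z)" by simp
 also have "\<dots> = (\<Sum>i<N. first_variation V (\<lambda>z. \<psi> i z *\<^sub>R g z))"
  by (rule first_variation_sum[OF giU])
 finally have "ennreal (first_variation V g) \<le> (\<Sum>i<N. ennreal (first_variation V (\<lambda>z. \<psi> i z *\<^sub>R g z)))"
  using ennreal_sum_le by simp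
 also have "\<dots> \<le> (\<Sum>i<N. unit_variation (G i))"
  by (intro sum_mono unit_variation_upper gi n1)
 also have "\<dots> \<le> (\<Sum>i. unit_variation (G i))" by (rule sum_le_suminf) auto
 finally show "ennreal (first_variation V g) \<le> (\<Sum>i. unit_variation (G i))" .
 qed
qed

lemma outer_countably_subadditive:
 assumes "\<And>i. A i \<subseteq> U"
 shows "total_variation_outer U V (\<Union>i. A i) \<le> (\<Sum>i. total_variation_outer U V (A i))"
proof (rule ennreal_le_epsilon)
 fix e :: real assume fin: "(\<Sum>i. total_variation_outer U V (A i)) < top" and e: "0 < e"
 have "\<exists>G. open G \<and> A i \<subseteq> G \<and> G \<subseteq> U \<and>
   unit_variation G < total_variation_outer U V (A i) + ennreal (e * (1/2)^Suc i)" for i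
 proof -
  have "total_variation_outer U V (A i) < top" using fin by (rule ennreal_suminf_lessD)
  moreover have "0 < ennreal (e * (1/2)^Suc i)" using e by simp
  ultimately have "total_variation_outer U V (A i) + 0 < total_variation_outer U V (A i) + ennreal (e * (1/2)^Suc i)"
   unfolding ennreal_add_left_cancel_less by auto
  then have "(INF G\<in>{G. open G \<and> A i \<subseteq> G \<and> G \<subseteq> U}. unit_variation G) < total_variation_outer U V (A i) + ennreal (e * (1/2)^Suc i)"
   unfolding outer_eq[symmetric] by simp
  then show ?thesis unfolding INF_less_iff by blast
 qed
 then obtain G where G: "\<And>i. open (G i)" "\<And>i. A i \<subseteq> G i" "\<And>i. G i \<subseteq> U"
  "\<And>i. unit_variation (G i) < total_variation_outer U V (A i) + ennreal (e * (1/2)^Suc i)"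
  by metis
 have sums: "(\<lambda>i. e * (1/2)^Suc i) sums (e * 1)" by (intro sums_mult power_half_series)
 have "total_variation_outer U V (\<Union>i. A i) \<le> unit_variation (\<Union>i. G i)"
 proof (rule outer_le)
  show "open (\<Union>i. G i)" using G(1) by blast
  show "(\<Union>i. A i) \<subseteq> (\<Union>i. G i)" using G(2) by blast
  show "(\<Union>i. G i) \<subseteq> U" using G(3) by blast
 qed
 also have "\<dots> \<le> (\<Sum>i. unit_variation (G i))" by (rule unit_variation_UN_le[OF G(1,3)])
 also have "\<dots> \<le> (\<Sum>i. total_variation_outer U V (A i) + ennreal (e * (1/2)^Suc i))"
  by (intro suminf_le summableI less_imp_le[OF G(4)])
 also have "\<dots> = (\<Sum>i. total_variation_outer U V (A i)) + (\<Sum>i. ennreal (e * (1/2)^Suc i))"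
  by (intro suminf_add[symmetric] summableI)
 also have "(\<Sum>i. ennreal (e * (1/2)^Suc i)) = ennreal (e * 1)"
  using e by (intro suminf_ennreal_eq[OF _ sums]) simp
 finally show "total_variation_outer U V (\<Union>i. A i) \<le> (\<Sum>i. total_variation_outer U V (A i)) + ennreal e"
  by simp
qed

lemma outer_empty: "total_variation_outer U V {} = 0"
proof -
 have "first_variation V g = 0" if "g \<in> test_fields {}" for g
 proof -
  have "g = (\<lambda>z. 0)" using test_fieldsE[OF that] by auto
  then show ?thesis using first_variation_scaleR[OF test_fields_0, of 0] by simp
 qed
 then have "unit_variation {} = 0" unfolding unit_variation_def by (intro antisym SUP_least) auto
 then show ?thesis using outer_open[of "{}"] by simp
qed

lemma outer_Un: "A \<subseteq> U \<Longrightarrow> B \<subseteq> U \<Longrightarrow>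
 total_variation_outer U V (A \<union> B) \<le> total_variation_outer U V A + total_variation_outer U V B"
 using outer_countably_subadditive[of "binaryset A B"]
  suminf_binaryset_eq[of "total_variation_outer U V" A B, OF outer_empty]
 by (simp add: UN_binaryset_eq) (auto simp: binaryset_def)

text \<open>Open sets split the outer measure additively: a near optimal field in \<open>G \<inter> W\<close>
 has compact support there, hence may be added to any field supported in the complement of
 that support without increasing the supremum norm.\<close>

lemma outer_split:
 assumes G: "open G" "G \<subseteq> U" and X: "X \<subseteq> U"
 shows "total_variation_outer U V (G \<inter> X) + total_variation_outer U V ((U - G) \<inter> X) = total_variation_outer U V X"
proof (rule antisym)
 have "X = (G \<inter> X) \<union> ((U - G) \<inter> X)" using X by auto
 then show "total_variation_outer U V X \<le> total_variation_outer U V (G \<inter> X) + total_variation_outer U V ((U - G) \<inter> X)"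
  using outer_Un[of "G \<inter> X" "(U - G) \<inter> X"] X by auto
 show "total_variation_outer U V (G \<inter> X) + total_variation_outer U V ((U - G) \<inter> X) \<le> total_variation_outer U V X"
  unfolding outer_eq[of X]
 proof (rule INF_greatest)
  fix W assume "W \<in> {W. open W \<and> X \<subseteq> W \<and> W \<subseteq> U}"
  then have W: "open W" "X \<subseteq> W" "W \<subseteq> U" by auto
  have ne: "{g \<in> test_fields (G \<inter> W). \<forall>z. norm (g z) \<le> 1} \<noteq> {}"
   by (auto intro!: exI[of _ "\<lambda>z. 0"])
  have main: "ennreal (first_variation V g) + unit_variation (W - K) \<le> unit_variation W"
   if g: "g \<in> test_fields (G \<inter> W)" "\<And>z. norm (g z) \<le> 1" and K: "\<And>z. z \<notin> K \<Longrightarrow> g z = 0" for g K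
  proof -
   have gW: "g \<in> test_fields W" "g \<in> test_fields U" using g(1) test_fields_mono[of "G \<inter> W"] W by blast+
   have ne': "{h \<in> test_fields (W - K). \<forall>z. norm (h z) \<le> 1} \<noteq> {}"
    by (auto intro!: exI[of _ "\<lambda>z. 0"])
   have "ennreal (first_variation V g) + ennreal (first_variation V h) \<le> unit_variation W"
    if h: "h \<in> test_fields (W - K)" "\<And>z. norm (h z) \<le> 1" for h
   proof -
    have hW: "h \<in> test_fields W" "h \<in> test_fields U" using h(1) test_fields_mono[of "W - K"] W by blast+
    have hK: "h z = 0" if "z \<in> K" for z
    proof -
     obtain C where "C \<subseteq> W - K" "\<And>z. z \<notin> C \<Longrightarrow> h z = 0"
      by (rule test_fieldsE[OF h(1)]) (rule that)
     then show ?thesis using \<open>z \<in> K\<close> by blast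
    qed
    have n: "norm (g z + h z) \<le> 1" for z
     using K[of z] hK[of z] g(2)[of z] h(2)[of z] by (cases "z \<in> K") auto
    have gh: "ennreal (first_variation V (\<lambda>z. g z + h z)) \<le> unit_variation W"
     by (rule unit_variation_upper[OF test_fields_add[OF gW(1) hW(1)] n])
    have g0: "ennreal (first_variation V g) \<le> unit_variation W" by (rule unit_variation_upper[OF gW(1) g(2)])
    have h0: "ennreal (first_variation V h) \<le> unit_variation W" by (rule unit_variation_upper[OF hW(1) h(2)])
    show ?thesis
    \<comment> \<open>If one of the two values is negative, then \<open>ennreal\<close> cuts it off to zero and the other field alone is
     admissible in \<open>W\<close>.\<close>
    proof (cases "first_variation V g \<ge> 0 \<and> first_variation V h \<ge> 0")
     case True
     then show ?thesis using gh first_variation_add[OF gW(2) hW(2)] by (simp add: ennreal_plus)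
    next
     case False
     then show ?thesis using g0 h0 by (auto simp: ennreal_neg not_le)
    qed
   qed
   then show ?thesis
    unfolding unit_variation_def[of "W - K"] ennreal_SUP_add_right[OF ne']
    by (intro SUP_least) auto
  qed
  have "unit_variation (G \<inter> W) + total_variation_outer U V ((U - G) \<inter> X) \<le> unit_variation W"
   unfolding unit_variation_def[of "G \<inter> W"] ennreal_SUP_add_left[OF ne, symmetric]
  proof (rule SUP_least)
   fix g assume "g \<in> {g \<in> test_fields (G \<inter> W). \<forall>z. norm (g z) \<le> 1}"
   then have g: "g \<in> test_fields (G \<inter> W)" "\<And>z. norm (g z) \<le> 1" by auto
   obtain K where K: "smooth g" "compact K" "K \<subseteq> G \<inter> W" "\<And>z. z \<notin> K \<Longrightarrow> g z = 0"
    by (rule test_fieldsE[OF g(1)]) (rule that)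
   have "total_variation_outer U V ((U - G) \<inter> X) \<le> unit_variation (W - K)"
    by (rule outer_le) (use K W compact_imp_closed[OF K(2)] in auto)
   then have "ennreal (first_variation V g) + total_variation_outer U V ((U - G) \<inter> X)
     \<le> ennreal (first_variation V g) + unit_variation (W - K)" by (rule add_left_mono)
   also have "\<dots> \<le> unit_variation W" by (rule main[OF g K(4)])
   finally show "ennreal (first_variation V g) + total_variation_outer U V ((U - G) \<inter> X) \<le> unit_variation W" .
  qed
  moreover have "total_variation_outer U V (G \<inter> X) \<le> unit_variation (G \<inter> W)"
   by (rule outer_le) (use G W in auto)
  ultimately show "total_variation_outer U V (G \<inter> X) + total_variation_outer U V ((U - G) \<inter> X) \<le> unit_variation W"
   by (meson add_right_mono order_trans)
 qed
qed

lemma sets_nu: "sets nu = sets (borel_of (top_of_set U))" and space_nu [simp]: "space nu = U"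
proof -
 have "sets (borel_of (top_of_set U)) \<subseteq> Pow U"
  using sets.space_closed[of "borel_of (top_of_set U)"] by simp
 then show "sets nu = sets (borel_of (top_of_set U))" "space nu = U"
  using sets.sigma_sets_eq[of "borel_of (top_of_set U)"]
  by (auto simp: total_variation_def sets_measure_of space_measure_of)
qed

lemma emeasure_nu:
 assumes A: "A \<in> sets nu" shows "emeasure nu A = total_variation_outer U V A"
proof -
 interpret sigma_algebra U "Pow U" by (rule sigma_algebra_Pow)
 let ?L = "lambda_system U (Pow U) (total_variation_outer U V)"
 have "outer_measure_space (Pow U) (total_variation_outer U V)"
  unfolding outer_measure_space_def positive_def increasing_def countably_subadditive_def
  using outer_empty outer_mono outer_countably_subadditive by (auto simp: Pow_def subset_eq)
 from caratheodory_lemma[OF this] have ms: "measure_space U ?L (total_variation_outer U V)" .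
 have "{A. openin (top_of_set U) A} \<subseteq> ?L"
 proof
  fix B assume "B \<in> {A. openin (top_of_set U) A}"
  then have B: "open B" "B \<subseteq> U" using open_U by (auto simp: openin_open_eq)
  then show "B \<in> ?L" unfolding lambda_system_def using outer_split[OF B] by auto
 qed
 then have sub: "sets nu \<subseteq> ?L"
  unfolding sets_nu sets_borel_of using ms
  by (intro sigma_algebra.sigma_sets_subset) (auto simp: measure_space_def)
 show ?thesis
 proof (rule emeasure_measure_of[OF total_variation_def])
  show "sets (borel_of (top_of_set U)) \<subseteq> Pow U"
   using sets.space_closed[of "borel_of (top_of_set U)"] by simp
  show "positive (sets nu) (total_variation_outer U V)" by (simp add: positive_def outer_empty)
  show "countably_additive (sets nu) (total_variation_outer U V)"
   using ms sub unfolding measure_space_def countably_additive_def by blast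
 qed (rule A)
qed

lemma open_in_sets_nu: "open G \<Longrightarrow> G \<subseteq> U \<Longrightarrow> G \<in> sets nu"
 unfolding sets_nu sets_borel_of by (intro sigma_sets.Basic) (simp add: openin_open_eq[OF open_U])

lemma first_variation_le_measure:
 assumes "g \<in> test_fields G" "open G" "G \<subseteq> U" "0 < B" "\<And>z. norm (g z) \<le> B"
 shows "ennreal (first_variation V g) \<le> ennreal B * emeasure nu G"
proof -
 let ?h = "\<lambda>z. (1/B) *\<^sub>R g z"
 have gU: "g \<in> test_fields U" using assms(1) test_fields_mono[OF assms(3)] by blast
 have "?h \<in> test_fields G" by (rule test_fields_scaleR[OF smooth_const assms(1)])
 moreover have "norm (?h z) \<le> 1" for z using assms(4) assms(5)[of z] by (simp add: field_simps)
 ultimately have "ennreal (first_variation V ?h) \<le> unit_variation G" by (rule unit_variation_upper)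
 also have "\<dots> = emeasure nu G" using assms by (simp add: emeasure_nu open_in_sets_nu outer_open)
 finally have "ennreal B * ennreal (first_variation V ?h) \<le> ennreal B * emeasure nu G" by (rule mult_left_mono) simp
 moreover have "first_variation V g = B * first_variation V ?h"
  using first_variation_scaleR[OF gU, of "1/B"] assms(4) by simp
 ultimately show ?thesis using assms(4) by (simp add: ennreal_mult')
qed

end

locale bv_varifold = varifold_setting m U V
 for m and U :: "(real^'n) set" and V :: "((real^'n) \<times> (real^'n) set) measure" +
 assumes radon_nu: "radon_measure (top_of_set U) (total_variation U V)"
begin

lemma continuous_measurable_nu: "continuous_on UNIV f \<Longrightarrow> f \<in> borel_measurable nu"
 by (rule radon_continuous_measurable[OF radon_nu open_U continuous_on_subset]) auto

text \<open>The field is cut into pieces according to the dyadic size of its norm. The \<open>k\<close>-th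
 piece has norm of order \<open>2\<^sup>-\<^sup>k\<close> and lives where the field is at least of that order.\<close>

lemma first_variation_le_integral_unit:
 assumes \<theta>: "\<theta> \<in> test_fields U" and \<theta>1: "\<And>z. norm (\<theta> z) \<le> 1"
 shows "ennreal (first_variation V \<theta>) \<le> 16 * (\<integral>\<^sup>+ z. ennreal (norm (\<theta> z)) \<partial>nu)"
proof -
 obtain C where C: "smooth \<theta>" "compact C" "C \<subseteq> U" "\<And>z. z \<notin> C \<Longrightarrow> \<theta> z = 0"
  by (rule test_fieldsE[OF \<theta>]) (rule that)
 have cont: "continuous_on UNIV \<theta>" by (rule smooth_D(3)[OF C(1)])
 define c where "c k z = smooth_step ((1/3) * (4^Suc k * (\<theta> z \<bullet> \<theta> z) - 1))" for k z
 have sc: "smooth (c k)" for k unfolding c_def[abs_def]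
  by (intro smooth_compose[OF smooth_smooth_step] smooth_mult smooth_diff smooth_inner smooth_const C(1))
 have four: "(4::real)^Suc k * x\<^sup>2 = (2^Suc k * x)\<^sup>2" for k x
 proof -
  have "(4::real)^Suc k = (2\<^sup>2)^Suc k" by simp
  also have "\<dots> = (2^Suc k)\<^sup>2" by (simp only: power_mult[symmetric] mult.commute)
  finally show ?thesis by (simp only: power_mult_distrib)
 qed
 have c0: "c k z = 0" if "norm (\<theta> z) \<le> (1/2)^Suc k" for k z
 proof -
  have "2^Suc k * norm (\<theta> z) \<le> 1" using that by (simp add: field_simps power_one_over)
  then have "(2^Suc k * norm (\<theta> z))\<^sup>2 \<le> 1" by (simp add: power_le_one)
  then have "4^Suc k * (norm (\<theta> z))\<^sup>2 \<le> 1" unfolding four .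
  then show ?thesis unfolding c_def by (intro smooth_step_0) (simp add: power2_norm_eq_inner[symmetric])
 qed
 have c1: "c k z = 1" if "(1/2)^k \<le> norm (\<theta> z)" for k z
 proof -
  have "2 \<le> 2^Suc k * norm (\<theta> z)" using that by (simp add: field_simps power_one_over)
  then have "2\<^sup>2 \<le> (2^Suc k * norm (\<theta> z))\<^sup>2" by (intro power_mono) auto
  then have "4 \<le> 4^Suc k * (norm (\<theta> z))\<^sup>2" unfolding four by simp
  then show ?thesis unfolding c_def by (intro smooth_step_1) (simp add: power2_norm_eq_inner[symmetric])
 qed
 have cb: "0 \<le> c k z" "c k z \<le> 1" for k z by (auto simp: c_def smooth_step_ge_0 smooth_step_le_1)
 \<comment> \<open>The differences of consecutive cutoffs sum up to the last cutoff; \<open>d k\<close> is supported where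
  the norm of \<open>\<theta>\<close> lies between \<open>2\<^sup>-\<^sup>k\<^sup>-\<^sup>1\<close> and, if \<open>k > 0\<close>, \<open>2\<^sup>1\<^sup>-\<^sup>k\<close>.\<close>
 define d where "d k z = (if k = 0 then c 0 z else c k z - c (k - 1) z)" for k z
 define e where "e k z = d k z *\<^sub>R \<theta> z" for k z
 define G where "G k = {z. (1/2)^(k+2) < norm (\<theta> z)}" for k
 have sd: "smooth (d k)" for k
  unfolding d_def[abs_def] by (cases "k = 0") (auto intro: smooth_diff sc)
 have sumd: "(\<Sum>k<Suc N. d k z) = c N z" for N z
  by (induction N) (auto simp: d_def)
 have db: "\<bar>d k z\<bar> \<le> 1" for k z
  using cb[of k z] cb[of "k-1" z] cb[of 0 z] by (auto simp: d_def abs_le_iff)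
 have d0: "d k z = 0" if "norm (\<theta> z) \<le> (1/2)^Suc k" for k z
 proof (cases k)
  case 0 then show ?thesis using c0[of z 0] that by (simp add: d_def)
 next
  case (Suc j)
  have "(1/2::real)^Suc k \<le> (1/2)^Suc j" unfolding Suc by (intro power_decreasing) auto
  then have "norm (\<theta> z) \<le> (1/2)^Suc j" using that by (rule order_trans[rotated])
  then have "c j z = 0" "c k z = 0" using c0[of z k] c0[of z j] that by auto
  then show ?thesis using Suc by (simp add: d_def)
 qed
 have eb: "norm (e k z) \<le> 2 * (1/2)^k" for k z
 proof (cases k)
  case 0
  have "norm (e k z) \<le> 1 * 1" unfolding e_def norm_scaleR
   using db[of k z] \<theta>1[of z] by (intro mult_mono) auto
  then show ?thesis using 0 by simp
 next
  case (Suc j)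
  show ?thesis
  proof (cases "(1/2)^j \<le> norm (\<theta> z)")
   case True
   have "(1/2::real)^k \<le> (1/2)^j" unfolding Suc by (intro power_decreasing) auto
   then have "c k z = 1" using c1[of k z] True by (meson order_trans)
   then have "d k z = 0" using c1[OF True] Suc by (simp add: d_def)
   then show ?thesis by (simp add: e_def)
  next
   case False
   have "norm (e k z) \<le> 1 * (1/2)^j" unfolding e_def norm_scaleR
    using db[of k z] False by (intro mult_mono) auto
   then show ?thesis using Suc by simp
  qed
 qed
 have Go: "open (G k)" for k unfolding G_def
  by (intro open_Collect_less continuous_intros cont)
 have GU: "G k \<subseteq> U" for k
 proof
  fix z assume "z \<in> G k"
  then have "0 < norm (\<theta> z)" unfolding G_def mem_Collect_eq by (rule le_less_trans[rotated]) simp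
  then show "z \<in> U" using C(3,4) by auto
 qed
 have eG: "e k \<in> test_fields (G k)" for k
 proof (rule test_fieldsI[where C="C \<inter> {z. (1/2)^Suc k \<le> norm (\<theta> z)}"])
  show "smooth (e k)" unfolding e_def[abs_def] by (intro smooth_scaleR sd C(1))
  show "compact (C \<inter> {z. (1/2)^Suc k \<le> norm (\<theta> z)})"
   by (intro compact_Int_closed C(2) closed_Collect_le continuous_intros cont)
  have "(1/2::real)^(k+2) < (1/2)^Suc k" by simp
  then show "C \<inter> {z. (1/2)^Suc k \<le> norm (\<theta> z)} \<subseteq> G k"
   unfolding G_def by (blast intro: less_le_trans)
  show "e k z = 0" if "z \<notin> C \<inter> {z. (1/2)^Suc k \<le> norm (\<theta> z)}" for z
   using that C(4)[of z] d0[of z k] by (auto simp: e_def)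
 qed
 have eU: "e k \<in> test_fields U" for k using eG test_fields_mono[OF GU] by blast
 have e_le: "ennreal (first_variation V (e k)) \<le> ennreal (2 * (1/2)^k) * emeasure nu (G k)" for k
  by (rule first_variation_le_measure[OF eG Go GU _ eb]) simp
 obtain u C' where u: "smooth (u :: _ \<Rightarrow> real)" "\<And>x. 0 \<le> u x" "\<And>x. u x \<le> 1"
  "\<And>x. x \<in> C \<Longrightarrow> u x = 1" "compact C'" "C' \<subseteq> U" "\<And>x. x \<notin> C' \<Longrightarrow> u x = 0"
  by (rule smooth_cutoff[OF C(2) open_U C(3)]) (rule that)
 \<comment> \<open>A neighbourhood of the support of finite measure serves to estimate what remains of the field
  after subtracting the first pieces.\<close>
 define W where "W = {x. 0 < u x}"
 have W3: "W \<subseteq> C'"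
  unfolding W_def using u(7) less_irrefl[of "0::real"] by fastforce
 have W: "open W" "C \<subseteq> W"
  unfolding W_def using u(4) by (auto intro!: open_Collect_less continuous_intros smooth_D(3)[OF u(1)])
 have WU: "W \<subseteq> U" using W3 u(6) by blast
 have "emeasure nu W \<le> emeasure nu C'"
  using radon_compact(1)[OF radon_nu open_U u(5,6)] W3 by (rule emeasure_mono[rotated])
 then have Wfin: "emeasure nu W < top"
  using radon_compact(2)[OF radon_nu open_U u(5,6)] by (auto intro: le_less_trans)
 have pt: "(\<Sum>k<Suc N. ennreal (2 * (1/2)^k) * indicator (G k) z) \<le> 16 * ennreal (norm (\<theta> z))" for N z
 proof -
  have "(\<Sum>k<Suc N. ennreal (2 * (1/2)^k) * indicator (G k) z)
    = (\<Sum>k<Suc N. ennreal (2 * (if (1/2)^k < 4 * norm (\<theta> z) then (1/2)^k else 0)))"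
  proof (rule sum.cong)
   fix k
   have "z \<in> G k \<longleftrightarrow> (1/2)^k < 4 * norm (\<theta> z)" by (simp add: G_def field_simps)
   then show "ennreal (2 * (1/2)^k) * indicator (G k) z
    = ennreal (2 * (if (1/2)^k < 4 * norm (\<theta> z) then (1/2)^k else 0))" by (simp add: indicator_def)
  qed simp
  also have "\<dots> = ennreal (\<Sum>k<Suc N. 2 * (if (1/2)^k < 4 * norm (\<theta> z) then (1/2)^k else 0))"
   by (rule sum_ennreal) simp
  also have "\<dots> \<le> ennreal (2 * (2 * (4 * norm (\<theta> z))))"
   unfolding sum_distrib_left[symmetric]
   by (intro ennreal_leI mult_left_mono truncated_geometric_sum) auto
  also have "\<dots> = ennreal (16 * norm (\<theta> z))" by simp
  also have "\<dots> = 16 * ennreal (norm (\<theta> z))" by (subst ennreal_mult') auto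
  finally show ?thesis .
 qed
 have Gs[measurable]: "G k \<in> sets nu" for k by (rule open_in_sets_nu[OF Go GU])
 have [measurable]: "\<theta> \<in> borel_measurable nu" by (rule continuous_measurable_nu[OF cont])
 have main: "ennreal (first_variation V \<theta>) \<le> 16 * (\<integral>\<^sup>+ z. ennreal (norm (\<theta> z)) \<partial>nu) + ennreal ((1/2)^N) * emeasure nu W" for N
 proof -
  define r where "r z = (1 - c N z) *\<^sub>R \<theta> z" for z
  have rW: "r \<in> test_fields W" unfolding r_def[abs_def]
   by (rule test_fieldsI[where C=C])
     (use C W in \<open>auto intro!: smooth_scaleR smooth_diff sc smooth_const\<close>)
  have rU: "r \<in> test_fields U" using rW test_fields_mono[OF WU] by blast
  have rb: "norm (r z) \<le> (1/2)^N" for z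
  proof (cases "(1/2)^N \<le> norm (\<theta> z)")
   case True then show ?thesis using c1 by (simp add: r_def)
  next
   case False
   have "norm (r z) \<le> 1 * (1/2)^N" unfolding r_def norm_scaleR
    using cb[of N z] False by (intro mult_mono) auto
   then show ?thesis by simp
  qed
  have r_le: "ennreal (first_variation V r) \<le> ennreal ((1/2)^N) * emeasure nu W"
   by (rule first_variation_le_measure[OF rW W(1) WU _ rb]) simp
  have "\<theta> = (\<lambda>z. (\<Sum>k<Suc N. e k z) + r z)"
   unfolding e_def scaleR_sum_left[symmetric] sumd r_def by (auto simp: algebra_simps)
  then have "first_variation V \<theta> = first_variation V (\<lambda>z. (\<Sum>k<Suc N. e k z) + r z)" by simp
  also have "\<dots> = (\<Sum>k<Suc N. first_variation V (e k)) + first_variation V r"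
   using first_variation_add[OF test_fields_sum rU, of "{..<Suc N}" e] first_variation_sum[of "{..<Suc N}" e] eU by simp
  finally have "ennreal (first_variation V \<theta>) \<le> ennreal (\<Sum>k<Suc N. first_variation V (e k)) + ennreal (first_variation V r)"
   using ennreal_add_le by simp
  also have "\<dots> \<le> (\<Sum>k<Suc N. ennreal (first_variation V (e k))) + ennreal (first_variation V r)"
   by (intro add_right_mono ennreal_sum_le)
  also have "\<dots> \<le> (\<Sum>k<Suc N. ennreal (2 * (1/2)^k) * emeasure nu (G k)) + ennreal ((1/2)^N) * emeasure nu W"
   by (intro add_mono sum_mono e_le r_le)
  also have "(\<Sum>k<Suc N. ennreal (2 * (1/2)^k) * emeasure nu (G k))
    = (\<integral>\<^sup>+z. (\<Sum>k<Suc N. ennreal (2 * (1/2)^k) * indicator (G k) z) \<partial>nu)"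
   by (subst nn_integral_sum) (auto simp: nn_integral_cmult_indicator)
  also have "\<dots> \<le> (\<integral>\<^sup>+z. 16 * ennreal (norm (\<theta> z)) \<partial>nu)" by (intro nn_integral_mono pt)
  also have "\<dots> = 16 * (\<integral>\<^sup>+z. ennreal (norm (\<theta> z)) \<partial>nu)" by (rule nn_integral_cmult) measurable
  finally show ?thesis by (simp add: add_right_mono)
 qed
 show ?thesis
 proof (rule ennreal_le_epsilon)
  fix \<epsilon> :: real assume "0 < \<epsilon>"
  let ?w = "enn2real (emeasure nu W)"
  have w: "emeasure nu W = ennreal ?w" using Wfin by simp
  obtain N where N: "(1/2)^N < \<epsilon> / (?w + 1)"
   using real_arch_pow_inv[of "\<epsilon> / (?w + 1)" "1/2"] \<open>0 < \<epsilon>\<close> by (auto simp: add_nonneg_pos)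
  have pos: "0 < ?w + 1" by (simp add: add_nonneg_pos)
  have "(1/2)^N * ?w \<le> (1/2)^N * (?w + 1)" by simp
  also have "\<dots> \<le> \<epsilon>" using N pos by (simp add: pos_less_divide_eq)
  finally have "ennreal ((1/2)^N) * emeasure nu W \<le> ennreal \<epsilon>"
   by (subst w) (auto simp: ennreal_mult[symmetric] intro!: ennreal_leI)
  then show "ennreal (first_variation V \<theta>) \<le> 16 * (\<integral>\<^sup>+ z. ennreal (norm (\<theta> z)) \<partial>nu) + ennreal \<epsilon>"
   using main[of N] by (meson add_left_mono order_trans)
 qed
qed

text \<open>Any test field is bounded, hence a multiple of one of norm at most one.\<close>

lemma first_variation_le_integral:
 assumes \<theta>: "\<theta> \<in> test_fields U"
 shows "ennreal \<bar>first_variation V \<theta>\<bar> \<le> 16 * (\<integral>\<^sup>+ z. ennreal (norm (\<theta> z)) \<partial>nu)"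
proof -
 have main: "ennreal (first_variation V g) \<le> 16 * (\<integral>\<^sup>+ z. ennreal (norm (g z)) \<partial>nu)" if g: "g \<in> test_fields U" for g
 proof -
  obtain B where B: "0 \<le> B" "\<And>z. norm (g z) \<le> B"
   by (rule test_field_derivative_bound[OF g]) (rule that)
  define b where "b = B + 1"
  have b: "0 < b" using B(1) by (simp add: b_def)
  have bb: "norm (g z) \<le> b" for z using B(2)[of z] by (simp add: b_def)
  let ?h = "\<lambda>z. (1/b) *\<^sub>R g z"
  have gm[measurable]: "g \<in> borel_measurable nu"
   using g by (intro continuous_measurable_nu smooth_D(3)) (simp add: test_fields_def)
  have h: "?h \<in> test_fields U" by (rule test_fields_scaleR[OF smooth_const g])
  have "ennreal (first_variation V ?h) \<le> 16 * (\<integral>\<^sup>+ z. ennreal (norm (?h z)) \<partial>nu)"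
   using b bb by (intro first_variation_le_integral_unit[OF h]) (simp add: field_simps)
  then have "ennreal b * ennreal (first_variation V ?h) \<le> ennreal b * (16 * (\<integral>\<^sup>+ z. ennreal (norm (?h z)) \<partial>nu))"
   by (rule mult_left_mono) simp
  also have "\<dots> = 16 * (\<integral>\<^sup>+ z. ennreal b * ennreal (norm (?h z)) \<partial>nu)"
   by (subst nn_integral_cmult) (auto simp: mult.left_commute)
  also have "(\<lambda>z. ennreal b * ennreal (norm (?h z))) = (\<lambda>z. ennreal (norm (g z)))"
   using b by (auto simp: ennreal_mult[symmetric])
  finally have "ennreal b * ennreal (first_variation V ?h) \<le> 16 * (\<integral>\<^sup>+ z. ennreal (norm (g z)) \<partial>nu)" .
  moreover have "first_variation V g = b * first_variation V ?h"
   using first_variation_scaleR[OF g, of "1/b"] b by simp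
  ultimately show ?thesis using b by (simp add: ennreal_mult')
 qed
 have m: "(\<lambda>z. (-1) *\<^sub>R \<theta> z) \<in> test_fields U" by (rule test_fields_scaleR[OF smooth_const \<theta>])
 show ?thesis
 proof (cases "first_variation V \<theta> \<ge> 0")
  case True then show ?thesis using main[OF \<theta>] by simp
 next
  case False then show ?thesis using main[OF m] first_variation_scaleR[OF \<theta>, of "-1"] by simp
 qed
qed

end


section \<open>Density of test fields\<close>

text \<open>By inner regularity, \<open>A\<close> may be replaced by a compact subset \<open>K\<close>. Cutoff functions that are equal
 to one on \<open>K\<close> and supported in shrinking neighbourhoods of \<open>K\<close> converge to its indicator.\<close>

lemma radon_indicator_approx:
 fixes M :: "'a::euclidean_space measure"
 assumes M: "radon_measure (top_of_set U) M" and U: "open U"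
  and A: "A \<in> sets M" "emeasure M A < \<infinity>" and e: "0 < e"
 shows "\<exists>u C. smooth (u :: 'a \<Rightarrow> real) \<and> compact C \<and> C \<subseteq> U \<and> (\<forall>x. x \<notin> C \<longrightarrow> u x = 0) \<and>
  (\<integral>\<^sup>+x. ennreal \<bar>u x - indicator A x\<bar> \<partial>M) \<le> ennreal e"
proof -
 have sets: "sets M = sets (restrict_space borel U)" "space M = U" using radon_sets[OF M U] by auto
 have Ab: "A \<in> sets borel" "A \<subseteq> U"
  using A(1) U unfolding sets(1) by (auto simp: sets_restrict_space)
 have id: "(\<lambda>x. x) \<in> measurable (density M (indicator A)) borel"
  using measurable_restrict_space1[OF measurable_ident] sets
  by (simp add: measurable_cong_sets[OF sets(1) refl] id_def)
 define N where "N = distr (density M (indicator A)) borel (\<lambda>x. x)"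
 have emN: "emeasure N B = emeasure M (B \<inter> A)" if "B \<in> sets borel" for B
 proof -
  have BU: "B \<inter> U \<in> sets M" using that unfolding sets(1) by (auto simp: sets_restrict_space)
  have "emeasure N B = emeasure (density M (indicator A)) (B \<inter> U)"
   unfolding N_def by (subst emeasure_distr[OF id that]) (simp add: sets)
  also have "\<dots> = (\<integral>\<^sup>+x. indicator A x * indicator (B \<inter> U) x \<partial>M)"
   using A BU by (intro emeasure_density) auto
  also have "\<dots> = (\<integral>\<^sup>+x. indicator (A \<inter> (B \<inter> U)) x \<partial>M)"
   by (intro nn_integral_cong) (auto simp: indicator_def)
  also have "\<dots> = emeasure M (A \<inter> (B \<inter> U))" using A BU by (intro nn_integral_indicator) auto
  also have "A \<inter> (B \<inter> U) = B \<inter> A" using Ab by auto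
  finally show ?thesis .
 qed
 have NA: "emeasure N A = emeasure M A" using emN[OF Ab(1)] by simp
 have sup: "emeasure N A = (SUP K \<in> {K. K \<subseteq> A \<and> compact K}. emeasure N K)"
 proof (rule inner_regular)
  show "sets N = sets borel" by (simp add: N_def)
  have "emeasure N (space N) = emeasure M A" using emN[of UNIV] by (simp add: N_def)
  then show "emeasure N (space N) \<noteq> \<infinity>" using A(2) by simp
 qed (rule Ab(1))
 have "\<exists>K\<in>{K. K \<subseteq> A \<and> compact K}. emeasure N A < emeasure N K + ennreal (e/2)"
  by (rule SUP_approx_ennreal[OF _ _ sup]) (use A(2) e NA in auto)
 then obtain K where K: "K \<subseteq> A" "compact K" "emeasure N A < emeasure N K + ennreal (e/2)" by blast
 have KU: "K \<subseteq> U" using K(1) Ab(2) by blast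
 have Km[measurable]: "K \<in> sets M" by (rule radon_compact(1)[OF M U K(2) KU])
 have Am[measurable]: "A \<in> sets M" by (rule A(1))
 have NK: "emeasure N K = emeasure M K" using emN[OF borel_compact[OF K(2)]] K(1) by (simp add: Int_absorb2)
 have Kfin: "emeasure M K < \<infinity>" by (rule radon_compact(2)[OF M U K(2) KU])
 have AK: "emeasure M (A - K) \<le> ennreal (e/2)"
 proof -
  have "emeasure M (A - K) = emeasure M A - emeasure M K"
   using Kfin K(1) by (intro emeasure_Diff) auto
  also have "\<dots> \<le> ennreal (e/2)"
   using K(3) unfolding NA NK by (subst ennreal_minus_le_iff) (auto intro: less_imp_le)
  finally show ?thesis .
 qed
 have "\<exists>u C. smooth (u :: 'a \<Rightarrow> real) \<and> compact C \<and> C \<subseteq> U \<and> (\<forall>x. x \<notin> C \<longrightarrow> u x = 0) \<and>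
  (\<integral>\<^sup>+x. ennreal \<bar>u x - indicator K x\<bar> \<partial>M) \<le> ennreal (e/2)"
 proof (cases "K = {}")
  case True
  then show ?thesis by (intro exI[of _ "\<lambda>x. 0"] exI[of _ "{}"]) auto
 next
  case False
  obtain u0 :: "'a \<Rightarrow> real" and C0 where u0: "smooth u0" "\<And>x. 0 \<le> u0 x" "\<And>x. u0 x \<le> 1"
   "\<And>x. x \<in> K \<Longrightarrow> u0 x = 1" "compact C0" "C0 \<subseteq> U" "\<And>x. x \<notin> C0 \<Longrightarrow> u0 x = 0"
   by (rule smooth_cutoff[OF K(2) U KU]) (rule that)
  define G where "G n = {x. infdist x K < 1 / real (Suc n)} \<inter> {x. 0 < u0 x}" for n
  have Go: "open (G n)" for n unfolding G_def
   by (intro open_Int open_Collect_less continuous_intros smooth_D(3)[OF u0(1)])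
  have KG: "K \<subseteq> G n" for n using u0(4) by (auto simp: G_def)
  have GC: "G n \<subseteq> C0" for n
  proof
   fix x assume "x \<in> G n"
   then have "u0 x \<noteq> 0" by (auto simp: G_def)
   then show "x \<in> C0" using u0(7) by blast
  qed
  have "\<exists>u C. smooth (u :: 'a \<Rightarrow> real) \<and> (\<forall>x. 0 \<le> u x \<and> u x \<le> 1) \<and> (\<forall>x\<in>K. u x = 1) \<and>
    compact C \<and> C \<subseteq> G n \<and> (\<forall>x. x \<notin> C \<longrightarrow> u x = 0)" for n
   using smooth_cutoff[OF K(2) Go KG, of n] by metis
  then obtain u C where u: "\<And>n. smooth (u n :: 'a \<Rightarrow> real)" "\<And>n x. 0 \<le> u n x \<and> u n x \<le> 1"
   "\<And>n x. x \<in> K \<Longrightarrow> u n x = 1" "\<And>n. compact (C n)" "\<And>n. C n \<subseteq> G n" "\<And>n x. x \<notin> C n \<Longrightarrow> u n x = 0"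
   by metis
  have um[measurable]: "u n \<in> borel_measurable M" for n
   by (rule radon_continuous_measurable[OF M U smooth_D(3)[OF u(1)]])
  have C0m[measurable]: "C0 \<in> sets M" by (rule radon_compact(1)[OF M U u0(5,6)])
  have lim: "(\<lambda>n. ennreal \<bar>u n x - indicator K x\<bar>) \<longlonglongrightarrow> 0" for x
  proof (cases "x \<in> K")
   case True then show ?thesis using u(3) by simp
  next
   case False
   have "0 < infdist x K"
    using False K(2) \<open>K \<noteq> {}\<close> by (simp add: infdist_pos_not_in_closed compact_imp_closed)
   then obtain n0 where n0: "1 / real (Suc n0) < infdist x K" using nat_approx_posE by blast
   have "eventually (\<lambda>n. ennreal \<bar>u n x - indicator K x\<bar> = 0) sequentially"
    unfolding eventually_sequentially
   proof (intro exI allI impI)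
    fix n assume "n0 \<le> n"
    then have "1 / real (Suc n) \<le> 1 / real (Suc n0)" by (intro divide_left_mono) auto
    then have "x \<notin> G n" using n0 by (simp add: G_def)
    then have "x \<notin> C n" using u(5) by blast
    then show "ennreal \<bar>u n x - indicator K x\<bar> = 0" using u(6) False by simp
   qed
   then show ?thesis by (rule tendsto_eventually)
  qed
  have bd: "ennreal \<bar>u n x - indicator K x\<bar> \<le> indicator C0 x" for n x
  proof (cases "x \<in> C0")
   case True
   have "\<bar>u n x - indicator K x\<bar> \<le> 1" using u(2)[of n x] by (auto simp: indicator_def)
   then show ?thesis using True by simp
  next
   case False
   then have "x \<notin> C n" "x \<notin> K" using u(5)[of n] GC[of n] KG[of n] by auto
   then show ?thesis using u(6) by simp
  qed
  have "(\<lambda>n. \<integral>\<^sup>+x. ennreal \<bar>u n x - indicator K x\<bar> \<partial>M) \<longlonglongrightarrow> (\<integral>\<^sup>+x. 0 \<partial>M)"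
  proof (rule nn_integral_dominated_convergence[where w="indicator C0"])
   show "(\<integral>\<^sup>+x. indicator C0 x \<partial>M) < \<infinity>" using radon_compact(2)[OF M U u0(5,6)] by simp
   show "AE x in M. ennreal \<bar>u j x - indicator K x\<bar> \<le> indicator C0 x" for j using bd by simp
   show "AE x in M. (\<lambda>i. ennreal \<bar>u i x - indicator K x\<bar>) \<longlonglongrightarrow> 0" using lim by simp
  qed measurable
  then have "(\<lambda>n. \<integral>\<^sup>+x. ennreal \<bar>u n x - indicator K x\<bar> \<partial>M) \<longlonglongrightarrow> 0" by simp
  then have "eventually (\<lambda>n. (\<integral>\<^sup>+x. ennreal \<bar>u n x - indicator K x\<bar> \<partial>M) < ennreal (e/2)) sequentially"
   using e by (intro order_tendstoD(2)) auto
  then obtain n where "(\<integral>\<^sup>+x. ennreal \<bar>u n x - indicator K x\<bar> \<partial>M) < ennreal (e/2)"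
   unfolding eventually_sequentially by blast
  moreover have "C n \<subseteq> U" using u(5) GC u0(6) by blast
  ultimately show ?thesis
   using u(1,4,6) by (intro exI[of _ "u n"] exI[of _ "C n"]) (auto intro: less_imp_le)
 qed
 then obtain u C where u: "smooth (u :: 'a \<Rightarrow> real)" "compact C" "C \<subseteq> U" "\<And>x. x \<notin> C \<Longrightarrow> u x = 0"
  "(\<integral>\<^sup>+x. ennreal \<bar>u x - indicator K x\<bar> \<partial>M) \<le> ennreal (e/2)" by blast
 have um[measurable]: "u \<in> borel_measurable M"
  by (rule radon_continuous_measurable[OF M U smooth_D(3)[OF u(1)]])
 have "(\<integral>\<^sup>+x. ennreal \<bar>u x - indicator A x\<bar> \<partial>M)
   \<le> (\<integral>\<^sup>+x. ennreal \<bar>u x - indicator K x\<bar> + indicator (A - K) x \<partial>M)"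
 proof (rule nn_integral_mono)
  fix x
  show "ennreal \<bar>u x - indicator A x\<bar> \<le> ennreal \<bar>u x - indicator K x\<bar> + indicator (A - K) x"
  proof (cases "x \<in> A - K")
   case True
   have "\<bar>u x - indicator A x\<bar> \<le> \<bar>u x - indicator K x\<bar> + 1" using True by simp
   then have "ennreal \<bar>u x - indicator A x\<bar> \<le> ennreal (\<bar>u x - indicator K x\<bar> + 1)" by (rule ennreal_leI)
   then show ?thesis using True by (simp add: ennreal_plus)
  next
   case False
   then have "indicator A x = (indicator K x :: real)" using K(1) by (auto simp: indicator_def)
   then show ?thesis by simp
  qed
 qed
 also have "\<dots> = (\<integral>\<^sup>+x. ennreal \<bar>u x - indicator K x\<bar> \<partial>M) + emeasure M (A - K)"
  by (subst nn_integral_add) auto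
 also have "\<dots> \<le> ennreal (e/2) + ennreal (e/2)" by (intro add_mono u(5) AK)
 also have "\<dots> = ennreal e" using e by (simp add: ennreal_plus[symmetric] del: ennreal_plus)
 finally show ?thesis using u by blast
qed

text \<open>By the induction rule for integrable functions it suffices to approximate indicators of sets
 of finite measure, times a constant vector.\<close>

lemma radon_test_dense:
 fixes M :: "(real^'n) measure" and g :: "real^'n \<Rightarrow> real^'n"
 assumes M: "radon_measure (top_of_set U) M" and U: "open U" and g: "integrable M g" and e: "0 < e"
 shows "\<exists>\<theta>\<in>test_fields U. L1_dist M \<theta> g \<le> ennreal e"
 using g e
proof (induction arbitrary: e rule: integrable_induct)
 case (base A c)
 obtain u C where u: "smooth (u :: _ \<Rightarrow> real)" "compact C" "C \<subseteq> U" "\<forall>x. x \<notin> C \<longrightarrow> u x = 0"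
  "(\<integral>\<^sup>+x. ennreal \<bar>u x - indicator A x\<bar> \<partial>M) \<le> ennreal (e / (norm c + 1))"
  using radon_indicator_approx[OF M U base(1,2), of "e / (norm c + 1)"] base(3)
  by (auto simp: add_nonneg_pos)
 have [measurable]: "A \<in> sets M" "u \<in> borel_measurable M"
  using base radon_continuous_measurable[OF M U smooth_D(3)[OF u(1)]] by auto
 have pos: "0 < norm c + 1" by (simp add: add_nonneg_pos)
 have "(\<integral>\<^sup>+x. ennreal (norm (u x *\<^sub>R c - indicator A x *\<^sub>R c)) \<partial>M)
   = (\<integral>\<^sup>+x. ennreal (norm c) * ennreal \<bar>u x - indicator A x\<bar> \<partial>M)"
  by (intro nn_integral_cong)
    (simp add: scaleR_diff_left[symmetric] ennreal_mult[symmetric] mult.commute)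
 also have "\<dots> = ennreal (norm c) * (\<integral>\<^sup>+x. ennreal \<bar>u x - indicator A x\<bar> \<partial>M)"
  by (rule nn_integral_cmult) measurable
 also have "\<dots> \<le> ennreal (norm c) * ennreal (e / (norm c + 1))" by (rule mult_left_mono[OF u(5)]) simp
 also have "\<dots> = ennreal (norm c * (e / (norm c + 1)))" using pos base(3) by (simp add: ennreal_mult[symmetric])
 also have "\<dots> \<le> ennreal e"
  using pos base(3) by (intro ennreal_leI) (simp add: field_simps)
 finally have "(\<integral>\<^sup>+x. ennreal (norm (u x *\<^sub>R c - indicator A x *\<^sub>R c)) \<partial>M) \<le> ennreal e" .
 moreover have "(\<lambda>x. u x *\<^sub>R c) \<in> test_fields U"
  using u(4) by (intro test_fields_scaleR_left[OF u(1,2,3)]) auto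
 ultimately show ?case by (intro bexI[of _ "\<lambda>x. u x *\<^sub>R c"])
next
 case (add f g)
 obtain \<theta> where \<theta>: "\<theta> \<in> test_fields U" "L1_dist M \<theta> f \<le> ennreal (e/2)"
  using add.IH(1)[of "e/2"] add.prems by auto
 obtain \<xi> where \<xi>: "\<xi> \<in> test_fields U" "L1_dist M \<xi> g \<le> ennreal (e/2)"
  using add.IH(2)[of "e/2"] add.prems by auto
 have [measurable]: "f \<in> borel_measurable M" "g \<in> borel_measurable M" using add.hyps by auto
 have [measurable]: "\<theta> \<in> borel_measurable M" "\<xi> \<in> borel_measurable M"
  using \<theta> \<xi> by (auto intro!: radon_continuous_measurable[OF M U] smooth_D(3) simp: test_fields_def)
 have "(\<integral>\<^sup>+x. ennreal (norm ((\<theta> x + \<xi> x) - (f x + g x))) \<partial>M)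
   \<le> (\<integral>\<^sup>+x. ennreal (norm (\<theta> x - f x)) + ennreal (norm (\<xi> x - g x)) \<partial>M)"
 proof (rule nn_integral_mono)
  fix x
  have "norm ((\<theta> x + \<xi> x) - (f x + g x)) \<le> norm (\<theta> x - f x) + norm (\<xi> x - g x)"
   by (rule norm_diff_triangle_ineq)
  then show "ennreal (norm ((\<theta> x + \<xi> x) - (f x + g x))) \<le> ennreal (norm (\<theta> x - f x)) + ennreal (norm (\<xi> x - g x))"
   by (simp add: ennreal_plus[symmetric] ennreal_leI del: ennreal_plus)
 qed
 also have "\<dots> = L1_dist M \<theta> f + L1_dist M \<xi> g"
  by (rule nn_integral_add) measurable
 also have "\<dots> \<le> ennreal (e/2) + ennreal (e/2)" by (intro add_mono \<theta> \<xi>)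
 also have "\<dots> = ennreal e" using add.prems by (simp add: ennreal_plus[symmetric] del: ennreal_plus)
 finally show ?case
  using test_fields_add[OF \<theta>(1) \<xi>(1)] by (intro bexI[of _ "\<lambda>z. \<theta> z + \<xi> z"])
next
 case (lim f s)
 have [measurable]: "f \<in> borel_measurable M" "\<And>i. s i \<in> borel_measurable M" using lim.hyps by auto
 have "(\<lambda>i. L1_dist M (s i) f) \<longlonglongrightarrow> (\<integral>\<^sup>+x. 0 \<partial>M)"
 proof (rule nn_integral_dominated_convergence[where w="\<lambda>x. ennreal (3 * norm (f x))"])
  show "(\<integral>\<^sup>+x. ennreal (3 * norm (f x)) \<partial>M) < \<infinity>"
  proof -
   have "integrable M (\<lambda>x. 3 *\<^sub>R f x)" using lim.hyps(4) by simp
   then have "(\<integral>\<^sup>+x. ennreal (norm (3 *\<^sub>R f x)) \<partial>M) < \<infinity>" unfolding integrable_iff_bounded by blast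
   also have "(\<lambda>x. norm (3 *\<^sub>R f x)) = (\<lambda>x. 3 * norm (f x))" by simp
   finally show ?thesis .
  qed
  show "AE x in M. ennreal (norm (s j x - f x)) \<le> ennreal (3 * norm (f x))" for j
  proof (rule AE_I2)
   fix x assume "x \<in> space M"
   then have "norm (s j x - f x) \<le> 3 * norm (f x)"
    using lim.hyps(3)[of x j] norm_triangle_ineq4[of "s j x" "f x"] by linarith
   then show "ennreal (norm (s j x - f x)) \<le> ennreal (3 * norm (f x))" by (rule ennreal_leI)
  qed
  show "AE x in M. (\<lambda>i. ennreal (norm (s i x - f x))) \<longlonglongrightarrow> 0"
  proof (rule AE_I2)
   fix x assume "x \<in> space M"
   then have "(\<lambda>i. s i x - f x) \<longlonglongrightarrow> 0" using lim.hyps(2) by (simp add: LIM_zero)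
   then have "(\<lambda>i. ennreal (norm (s i x - f x))) \<longlonglongrightarrow> ennreal 0"
    by (intro tendsto_ennrealI tendsto_norm_zero)
   then show "(\<lambda>i. ennreal (norm (s i x - f x))) \<longlonglongrightarrow> 0" by simp
  qed
 qed measurable
 then have "eventually (\<lambda>i. L1_dist M (s i) f < ennreal (e/2)) sequentially"
  using lim.prems by (intro order_tendstoD(2)) auto
 then obtain i where i: "L1_dist M (s i) f < ennreal (e/2)"
  unfolding eventually_sequentially by blast
 obtain \<theta> where \<theta>: "\<theta> \<in> test_fields U" "L1_dist M \<theta> (s i) \<le> ennreal (e/2)"
  using lim.IH[of "e/2" i] lim.prems by auto
 have [measurable]: "\<theta> \<in> borel_measurable M"
  using \<theta> by (auto intro!: radon_continuous_measurable[OF M U] smooth_D(3) simp: test_fields_def)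
 have "L1_dist M \<theta> f
   \<le> (\<integral>\<^sup>+x. ennreal (norm (\<theta> x - s i x)) + ennreal (norm (s i x - f x)) \<partial>M)"
 proof (rule nn_integral_mono)
  fix x
  have "norm (\<theta> x - f x) \<le> norm (\<theta> x - s i x) + norm (s i x - f x)"
   using norm_triangle_ineq[of "\<theta> x - s i x" "s i x - f x"] by simp
  then show "ennreal (norm (\<theta> x - f x)) \<le> ennreal (norm (\<theta> x - s i x)) + ennreal (norm (s i x - f x))"
   by (simp add: ennreal_plus[symmetric] ennreal_leI del: ennreal_plus)
 qed
 also have "\<dots> = L1_dist M \<theta> (s i) + L1_dist M (s i) f"
  by (rule nn_integral_add) measurable
 also have "\<dots> \<le> ennreal (e/2) + ennreal (e/2)" using i by (intro add_mono \<theta>) simp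
 also have "\<dots> = ennreal e" using lim.prems by (simp add: ennreal_plus[symmetric] del: ennreal_plus)
 finally show ?case using \<theta>(1) by blast
qed

lemma completion_ex_borel_measurable_euclidean:
 fixes g :: "'a \<Rightarrow> 'b::euclidean_space"
 assumes g: "g \<in> borel_measurable (completion M)"
 obtains g' where "g' \<in> borel_measurable M" "AE x in M. g x = g' x"
proof -
 have "\<exists>h. h \<in> borel_measurable M \<and> (AE x in M. g x \<bullet> b = h x)" for b
 proof -
  have "(\<lambda>x. g x \<bullet> b) \<in> borel_measurable (completion M)" using g by measurable
  from completion_ex_borel_measurable_real[OF this] show ?thesis by blast
 qed
 then obtain h where h: "\<And>b. h b \<in> borel_measurable M" "\<And>b. AE x in M. g x \<bullet> b = h b x" by metis
 show thesis
 proof (rule that[of "\<lambda>x. \<Sum>b\<in>Basis. h b x *\<^sub>R b"])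
  show "(\<lambda>x. \<Sum>b\<in>Basis. h b x *\<^sub>R b) \<in> borel_measurable M" using h(1) by measurable
  have "AE x in M. \<forall>b\<in>Basis. g x \<bullet> b = h b x"
   by (rule AE_finite_allI) (auto intro: h(2))
  then show "AE x in M. g x = (\<Sum>b\<in>Basis. h b x *\<^sub>R b)"
  proof eventually_elim
   case (elim x)
   have "g x = (\<Sum>b\<in>Basis. (g x \<bullet> b) *\<^sub>R b)" by (rule euclidean_representation[symmetric])
   also have "\<dots> = (\<Sum>b\<in>Basis. h b x *\<^sub>R b)" using elim by (intro sum.cong) auto
   finally show ?case .
  qed
 qed
qed

lemma radon_test_dense_completion:
 fixes M :: "(real^'n) measure" and g :: "real^'n \<Rightarrow> real^'n"
 assumes M: "radon_measure (top_of_set U) M" and U: "open U" and g: "integrable (completion M) g"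
 obtains \<theta> where "\<And>i::nat. \<theta> i \<in> test_fields U"
  "(\<lambda>i. L1_dist (completion M) (\<theta> i) g) \<longlonglongrightarrow> 0"
proof -
 obtain g' where g': "g' \<in> borel_measurable M" and ae: "AE x in M. g x = g' x"
  by (rule completion_ex_borel_measurable_euclidean[OF borel_measurable_integrable[OF g]]) (rule that)
 have "integrable (completion M) g'"
  using g integrable_cong_AE[OF borel_measurable_integrable[OF g] measurable_completion[OF g'] AE_completion[OF ae]] by simp
 then have gi: "integrable M g'" using integrable_completion[OF g'] by simp
 have "\<exists>\<theta>\<in>test_fields U. L1_dist M \<theta> g' \<le> ennreal ((1/2)^i)" for i
  by (rule radon_test_dense[OF M U gi]) simp
 then obtain \<theta> where \<theta>: "\<And>i. \<theta> i \<in> test_fields U"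
  "\<And>i. L1_dist M (\<theta> i) g' \<le> ennreal ((1/2)^i)" by metis
 have eq: "L1_dist (completion M) (\<theta> i) g = L1_dist M (\<theta> i) g'" for i
  unfolding nn_integral_completion
  by (rule nn_integral_cong_AE) (use ae in eventually_elim, simp)
 have "(\<lambda>i. ennreal ((1/2)^i)) \<longlonglongrightarrow> ennreal 0"
  by (intro tendsto_ennrealI LIMSEQ_realpow_zero) auto
 then have up: "(\<lambda>i. ennreal ((1/2)^i)) \<longlonglongrightarrow> 0" unfolding ennreal_0 .
 have "(\<lambda>i. L1_dist (completion M) (\<theta> i) g) \<longlonglongrightarrow> 0"
 proof (rule tendsto_sandwich[OF _ _ tendsto_const up])
  show "eventually (\<lambda>i. L1_dist (completion M) (\<theta> i) g \<le> ennreal ((1/2)^i)) sequentially"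
   unfolding eq by (intro always_eventually allI \<theta>(2))
 qed simp
 then show thesis by (rule that[OF \<theta>(1)])
qed

text \<open>The fundamental lemma of the calculus of variations: test fields are dense in
 \<open>L\<^sub>1\<close> of the measure with density \<open>norm h\<close>, and the unit vector field in direction \<open>h\<close>
 belongs locally to that space.\<close>

lemma radon_test_zero:
 fixes M :: "(real^'n) measure" and h :: "real^'n \<Rightarrow> real^'n"
 assumes M: "radon_measure (top_of_set U) M" and U: "open U"
  and h: "h \<in> borel_measurable (completion M)"
  and loc: "\<And>K. compact K \<Longrightarrow> K \<subseteq> U \<Longrightarrow> (\<integral>\<^sup>+x. ennreal (norm (h x)) * indicator K x \<partial>M) < \<infinity>"
  and zero: "\<And>\<theta>. \<theta> \<in> test_fields U \<Longrightarrow> (\<integral>x. \<theta> x \<bullet> h x \<partial>completion M) = 0"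
 shows "AE x in M. h x = 0"
proof -
 obtain h' where h'[measurable]: "h' \<in> borel_measurable M" and ae: "AE x in M. h x = h' x"
  by (rule completion_ex_borel_measurable_euclidean[OF h]) (rule that)
 have loc': "(\<integral>\<^sup>+x. ennreal (norm (h' x)) * indicator K x \<partial>M) < \<infinity>" if "compact K" "K \<subseteq> U" for K
 proof -
  have "(\<integral>\<^sup>+x. ennreal (norm (h' x)) * indicator K x \<partial>M) = (\<integral>\<^sup>+x. ennreal (norm (h x)) * indicator K x \<partial>M)"
   by (rule nn_integral_cong_AE) (use ae in eventually_elim, simp)
  then show ?thesis using loc[OF that] by simp
 qed
 define M' where "M' = density M (\<lambda>x. ennreal (norm (h' x)))"
 have M': "radon_measure (top_of_set U) M'"
  unfolding radon_measure_def
 proof (intro conjI allI impI)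
  show "space M' = topspace (top_of_set U)" using radon_sets[OF M U] by (simp add: M'_def)
  show "sets M' = sets (borel_of (top_of_set U))" using M by (simp add: M'_def radon_measure_def)
  fix K assume "compactin (top_of_set U) K"
  then have K: "compact K" "K \<subseteq> U" by (auto simp: compactin_subtopology)
  have "emeasure M' K = (\<integral>\<^sup>+x. ennreal (norm (h' x)) * indicator K x \<partial>M)"
   unfolding M'_def by (rule emeasure_density[OF _ radon_compact(1)[OF M U K]]) measurable
  then show "emeasure M' K < \<infinity>" using loc'[OF K] by simp
 qed
 have zero': "(\<integral>x. \<theta> x \<bullet> h' x \<partial>M) = 0" if \<theta>: "\<theta> \<in> test_fields U" for \<theta>
 proof -
  have [measurable]: "\<theta> \<in> borel_measurable M"
   using \<theta> by (auto intro!: radon_continuous_measurable[OF M U] smooth_D(3) simp: test_fields_def)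
  have c: "\<theta> \<in> borel_measurable (completion M)" "h' \<in> borel_measurable (completion M)"
   by (auto intro: measurable_completion)
  have "(\<integral>x. \<theta> x \<bullet> h' x \<partial>M) = (\<integral>x. \<theta> x \<bullet> h' x \<partial>completion M)"
   by (rule integral_completion[symmetric]) measurable
  also have "\<dots> = (\<integral>x. \<theta> x \<bullet> h x \<partial>completion M)"
  proof (rule integral_cong_AE)
   show "(\<lambda>x. \<theta> x \<bullet> h' x) \<in> borel_measurable (completion M)" "(\<lambda>x. \<theta> x \<bullet> h x) \<in> borel_measurable (completion M)"
    using c h by measurable
   show "AE x in completion M. \<theta> x \<bullet> h' x = \<theta> x \<bullet> h x"
    using AE_completion[OF ae] by eventually_elim simp
  qed
  finally show ?thesis using zero[OF \<theta>] by simp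
 qed
 have K0: "AE x in M. x \<in> K \<longrightarrow> h' x = 0" if K: "compact K" "K \<subseteq> U" for K
 proof -
  have Km[measurable]: "K \<in> sets M" by (rule radon_compact(1)[OF M U K])
  \<comment> \<open>Approximating the field \<open>\<phi>\<close> by test fields tests \<open>h\<close> against its own direction on \<open>K\<close>.\<close>
  define \<phi> where "\<phi> x = indicator K x *\<^sub>R sgn (h' x)" for x
  have \<phi>m[measurable]: "\<phi> \<in> borel_measurable M" unfolding \<phi>_def[abs_def] sgn_div_norm by measurable
  have \<phi>m'[measurable]: "\<phi> \<in> borel_measurable M'" unfolding M'_def by simp
  have \<phi>i: "integrable (completion M') \<phi>"
   by (rule radon_integrable_bounded[OF M' U measurable_completion[OF \<phi>m'] K, of 1])
     (auto simp: \<phi>_def norm_sgn)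
  obtain \<theta> where \<theta>: "\<And>i::nat. \<theta> i \<in> test_fields U"
   "(\<lambda>i. \<integral>\<^sup>+x. ennreal (norm (\<theta> i x - \<phi> x)) \<partial>completion M') \<longlonglongrightarrow> 0"
   by (rule radon_test_dense_completion[OF M' U \<phi>i]) (rule that)
  have \<theta>m[measurable]: "\<theta> i \<in> borel_measurable M" for i
   using \<theta>(1)[of i] by (auto intro!: radon_continuous_measurable[OF M U] smooth_D(3) simp: test_fields_def)
  have lim: "(\<lambda>i. \<integral>\<^sup>+x. ennreal (norm (h' x)) * ennreal (norm (\<theta> i x - \<phi> x)) \<partial>M) \<longlonglongrightarrow> 0"
   using \<theta>(2) unfolding nn_integral_completion M'_def by (simp add: nn_integral_density)
  have int: "integrable M (\<lambda>x. \<theta> i x \<bullet> h' x)" for i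
  proof -
   obtain K' B where KB: "compact K'" "K' \<subseteq> U" "0 \<le> B" "\<And>z. norm (\<theta> i z) \<le> B" "\<And>z. z \<notin> K' \<Longrightarrow> \<theta> i z = 0"
    by (rule test_field_derivative_bound[OF \<theta>(1)[of i]]) (rule that)
   have [measurable]: "K' \<in> sets M" by (rule radon_compact(1)[OF M U KB(1,2)])
   show ?thesis
   proof (rule integrableI_bounded)
    have "(\<integral>\<^sup>+x. ennreal (norm (\<theta> i x \<bullet> h' x)) \<partial>M) \<le> (\<integral>\<^sup>+x. ennreal B * (ennreal (norm (h' x)) * indicator K' x) \<partial>M)"
    proof (rule nn_integral_mono)
     fix x
     show "ennreal (norm (\<theta> i x \<bullet> h' x)) \<le> ennreal B * (ennreal (norm (h' x)) * indicator K' x)"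
     proof (cases "x \<in> K'")
      case True
      have "norm (\<theta> i x \<bullet> h' x) \<le> norm (\<theta> i x) * norm (h' x)" by (simp add: Cauchy_Schwarz_ineq2)
      also have "\<dots> \<le> B * norm (h' x)" using KB(4) by (intro mult_right_mono) auto
      finally have "ennreal (norm (\<theta> i x \<bullet> h' x)) \<le> ennreal (B * norm (h' x))" by (rule ennreal_leI)
      then show ?thesis using True KB(3) by (simp add: ennreal_mult)
     next
      case False then show ?thesis using KB(5) by simp
     qed
    qed
    also have "\<dots> = ennreal B * (\<integral>\<^sup>+x. ennreal (norm (h' x)) * indicator K' x \<partial>M)"
     by (intro nn_integral_cmult) measurable
    also have "\<dots> < \<infinity>" using loc'[OF KB(1,2)] by (simp add: ennreal_mult_less_top)
    finally show "(\<integral>\<^sup>+x. ennreal (norm (\<theta> i x \<bullet> h' x)) \<partial>M) < \<infinity>" .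
   qed measurable
  qed
  have \<phi>h: "\<phi> x \<bullet> h' x = norm (h' x) * indicator K x" for x
   by (cases "h' x = 0") (auto simp: \<phi>_def sgn_div_norm power2_norm_eq_inner[symmetric] power2_eq_square)
  have \<phi>int: "integrable M (\<lambda>x. \<phi> x \<bullet> h' x)"
   unfolding \<phi>h
  proof (rule integrableI_bounded)
   have "(\<integral>\<^sup>+x. ennreal (norm (norm (h' x) * indicator K x)) \<partial>M) = (\<integral>\<^sup>+x. ennreal (norm (h' x)) * indicator K x \<partial>M)"
    by (intro nn_integral_cong) (auto simp: indicator_def)
   then show "(\<integral>\<^sup>+x. ennreal (norm (norm (h' x) * indicator K x)) \<partial>M) < \<infinity>" using loc'[OF K] by simp
  qed measurable
  have "(\<lambda>i. \<integral>x. \<theta> i x \<bullet> h' x \<partial>M) \<longlonglongrightarrow> (\<integral>x. \<phi> x \<bullet> h' x \<partial>M)"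
  proof (rule tendsto_L1_int[OF int \<phi>int])
   show "(\<lambda>i. \<integral>\<^sup>+x. ennreal (norm (\<theta> i x \<bullet> h' x - \<phi> x \<bullet> h' x)) \<partial>M) \<longlonglongrightarrow> 0"
   proof (rule tendsto_sandwich[OF _ _ tendsto_const lim])
    show "eventually (\<lambda>i. (\<integral>\<^sup>+x. ennreal (norm (\<theta> i x \<bullet> h' x - \<phi> x \<bullet> h' x)) \<partial>M)
      \<le> (\<integral>\<^sup>+x. ennreal (norm (h' x)) * ennreal (norm (\<theta> i x - \<phi> x)) \<partial>M)) sequentially"
    proof (intro always_eventually allI nn_integral_mono)
     fix i x
     have "norm (\<theta> i x \<bullet> h' x - \<phi> x \<bullet> h' x) \<le> norm (h' x) * norm (\<theta> i x - \<phi> x)"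
      using Cauchy_Schwarz_ineq2[of "\<theta> i x - \<phi> x" "h' x"] by (simp add: inner_diff_left mult.commute)
     then show "ennreal (norm (\<theta> i x \<bullet> h' x - \<phi> x \<bullet> h' x)) \<le> ennreal (norm (h' x)) * ennreal (norm (\<theta> i x - \<phi> x))"
      by (simp add: ennreal_mult[symmetric] ennreal_leI)
    qed
   qed simp
  qed
  then have "(\<integral>x. \<phi> x \<bullet> h' x \<partial>M) = 0" using zero'[OF \<theta>(1)] by (simp add: LIMSEQ_const_iff)
  then have "AE x in M. \<phi> x \<bullet> h' x = 0"
   using integral_nonneg_eq_0_iff_AE[OF \<phi>int] by (simp add: \<phi>h)
  then show ?thesis unfolding \<phi>h by eventually_elim auto
 qed
 obtain C :: "nat \<Rightarrow> (real^'n) set"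
  where C: "\<And>n. compact (C n)" "\<And>n. C n \<subseteq> U" "\<Union>(range C) = U"
  using open_Union_compact_subsets[OF U] by metis
 have "AE x in M. \<forall>n. x \<in> C n \<longrightarrow> h' x = 0"
  unfolding AE_all_countable using K0[OF C(1,2)] by blast
 moreover have "AE x in M. x \<in> U" using radon_sets(2)[OF M U] by (intro AE_I2) simp
 ultimately show ?thesis using ae
 proof eventually_elim
  case (elim x)
  then obtain n where "x \<in> C n" using C(3) by blast
  then show ?case using elim by auto
 qed
qed

section \<open>Extension of the first variation\<close>

context bv_varifold
begin

abbreviation \<delta> :: "(real^'n \<Rightarrow> real^'n) \<Rightarrow> real" where "\<delta> \<equiv> first_variation_ext U V"

lemma test_field_measurable_nu: "\<theta> \<in> test_fields U \<Longrightarrow> \<theta> \<in> \<N>"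
 by (intro measurable_completion continuous_measurable_nu smooth_D(3)) (simp add: test_fields_def)

lemma first_variation_diff_le:
 assumes h: "h \<in> test_fields U" "h' \<in> test_fields U"
  and [measurable]: "g \<in> \<N>" "g' \<in> \<N>"
 shows "ennreal \<bar>first_variation V h - first_variation V h'\<bar> \<le>
  16 * (L1_dist \<nu> h g + L1_dist \<nu> g g'
    + L1_dist \<nu> h' g')"
proof -
 note test_field_measurable_nu[OF h(1), measurable] test_field_measurable_nu[OF h(2), measurable]
 have "ennreal \<bar>first_variation V h - first_variation V h'\<bar> \<le> 16 * L1_dist \<nu> h h'"
  using first_variation_le_integral[OF test_fields_diff[OF h]] first_variation_diff[OF h]
  by (simp add: nn_integral_completion)
 also have "\<dots> \<le> 16 * (\<integral>\<^sup>+z. (ennreal (norm (h z - g z)) + ennreal (norm (g z - g' z))) + ennreal (norm (h' z - g' z)) \<partial>\<nu>)"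
 proof (intro mult_left_mono nn_integral_mono)
  fix z
  have "norm (h z - h' z) \<le> norm (h z - g z) + norm (g z - g' z) + norm (h' z - g' z)"
   using norm_triangle_ineq[of "h z - g z" "g z - h' z"] norm_triangle_ineq[of "g z - g' z" "g' z - h' z"]
   by (simp add: norm_minus_commute)
  then show "ennreal (norm (h z - h' z)) \<le> (ennreal (norm (h z - g z)) + ennreal (norm (g z - g' z))) + ennreal (norm (h' z - g' z))"
   by (simp add: ennreal_plus[symmetric] ennreal_leI del: ennreal_plus)
 qed simp
 also have "(\<integral>\<^sup>+z. (ennreal (norm (h z - g z)) + ennreal (norm (g z - g' z))) + ennreal (norm (h' z - g' z)) \<partial>\<nu>)
  = L1_dist \<nu> h g + L1_dist \<nu> g g'
    + L1_dist \<nu> h' g'"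
  by (subst nn_integral_add) (auto simp: nn_integral_add)
 finally show ?thesis .
qed

text \<open>Two sequences of test fields with the same limit in \<open>L\<^sub>1\<close> have the same limit of first variations,
 so that the definite description in the definition of the extension is justified.\<close>

lemma first_variation_ext_eqI:
 assumes g: "g \<in> \<N>" and h: "\<And>i. h i \<in> test_fields U"
  and lim: "(\<lambda>i. L1_dist \<nu> (h i) g) \<longlonglongrightarrow> 0"
  and L: "(\<lambda>i. first_variation V (h i)) \<longlonglongrightarrow> L"
 shows "\<delta> g = L"
 unfolding first_variation_ext_def
proof (rule the_equality)
 show "\<exists>h. (\<forall>i. h i \<in> test_fields U) \<and>
   (\<lambda>i. L1_dist \<nu> (h i) g) \<longlonglongrightarrow> 0 \<and> (\<lambda>i. first_variation V (h i)) \<longlonglongrightarrow> L"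
  using h lim L by blast
 fix L' assume "\<exists>h. (\<forall>i. h i \<in> test_fields U) \<and>
   (\<lambda>i. L1_dist \<nu> (h i) g) \<longlonglongrightarrow> 0 \<and> (\<lambda>i. first_variation V (h i)) \<longlonglongrightarrow> L'"
 then obtain h' where h': "\<And>i. h' i \<in> test_fields U"
  "(\<lambda>i. L1_dist \<nu> (h' i) g) \<longlonglongrightarrow> 0" "(\<lambda>i. first_variation V (h' i)) \<longlonglongrightarrow> L'"
  by blast
 have "(\<lambda>i. 16 * (L1_dist \<nu> (h i) g + L1_dist \<nu> g g
    + L1_dist \<nu> (h' i) g)) \<longlonglongrightarrow> 16 * (0 + 0 + 0)"
  by (intro ennreal_tendsto_cmult tendsto_add lim h'(2)) auto
 then have up: "(\<lambda>i. 16 * (L1_dist \<nu> (h i) g + L1_dist \<nu> g g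
    + L1_dist \<nu> (h' i) g)) \<longlonglongrightarrow> 0" by simp
 have "(\<lambda>i. ennreal \<bar>first_variation V (h i) - first_variation V (h' i)\<bar>) \<longlonglongrightarrow> 0"
 proof (rule tendsto_sandwich[OF _ _ tendsto_const up])
  show "eventually (\<lambda>i. ennreal \<bar>first_variation V (h i) - first_variation V (h' i)\<bar> \<le>
    16 * (L1_dist \<nu> (h i) g + L1_dist \<nu> g g
    + L1_dist \<nu> (h' i) g)) sequentially"
   by (intro always_eventually allI first_variation_diff_le[OF h h'(1) g g])
 qed simp
 moreover have "(\<lambda>i. ennreal \<bar>first_variation V (h i) - first_variation V (h' i)\<bar>) \<longlonglongrightarrow> ennreal \<bar>L - L'\<bar>"
  by (intro tendsto_ennrealI tendsto_rabs tendsto_diff L h'(3))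
 ultimately have "ennreal \<bar>L - L'\<bar> = 0" by (rule LIMSEQ_unique[rotated])
 then show "L' = L" by simp
qed

lemma first_variation_ext_test: "\<theta> \<in> test_fields U \<Longrightarrow> \<delta> \<theta> = first_variation V \<theta>"
 by (rule first_variation_ext_eqI[OF test_field_measurable_nu, of _ "\<lambda>i. \<theta>"]) auto

lemma first_variation_ext_approx:
 assumes g: "integrable \<nu> g"
 obtains h where "\<And>i::nat. h i \<in> test_fields U"
  "(\<lambda>i. L1_dist \<nu> (h i) g) \<longlonglongrightarrow> 0"
  "(\<lambda>i. first_variation V (h i)) \<longlonglongrightarrow> \<delta> g"
proof -
 have gm: "g \<in> \<N>" using g by simp
 obtain h where h: "\<And>i::nat. h i \<in> test_fields U"
  "(\<lambda>i. L1_dist \<nu> (h i) g) \<longlonglongrightarrow> 0"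
  by (rule radon_test_dense_completion[OF radon_nu open_U g]) (rule that)
 have "Cauchy (\<lambda>i. first_variation V (h i))"
 proof (rule CauchyI)
  fix e :: real assume "0 < e"
  then have "eventually (\<lambda>i. L1_dist \<nu> (h i) g < ennreal (e/64)) sequentially"
   by (intro order_tendstoD(2)[OF h(2)]) simp
  then obtain N where N: "\<And>i. i \<ge> N \<Longrightarrow> L1_dist \<nu> (h i) g < ennreal (e/64)"
   unfolding eventually_sequentially by blast
  show "\<exists>M. \<forall>m\<ge>M. \<forall>n\<ge>M. norm (first_variation V (h m) - first_variation V (h n)) < e"
  proof (intro exI allI impI)
   fix m n assume mn: "N \<le> m" "N \<le> n"
   have "ennreal \<bar>first_variation V (h m) - first_variation V (h n)\<bar> \<le>
    16 * (L1_dist \<nu> (h m) g + L1_dist \<nu> g g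
    + L1_dist \<nu> (h n) g)"
    by (rule first_variation_diff_le[OF h(1) h(1) gm gm])
   also have "\<dots> \<le> 16 * (ennreal (e/64) + 0 + ennreal (e/64))"
    using N[OF mn(1)] N[OF mn(2)] by (intro mult_left_mono add_mono) auto
   also have "\<dots> = ennreal 16 * ennreal (e/64 + e/64)"
    using \<open>0 < e\<close> by (simp add: ennreal_plus[symmetric] del: ennreal_plus)
   also have "\<dots> = ennreal (16 * (e/64 + e/64))"
    using \<open>0 < e\<close> by (intro ennreal_mult[symmetric]) auto
   also have "\<dots> = ennreal (e/2)" by simp
   finally have "\<bar>first_variation V (h m) - first_variation V (h n)\<bar> \<le> e/2"
    using \<open>0 < e\<close> by (simp add: ennreal_le_iff)
   then show "norm (first_variation V (h m) - first_variation V (h n)) < e" using \<open>0 < e\<close> by simp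
  qed
 qed
 then obtain L where L: "(\<lambda>i. first_variation V (h i)) \<longlonglongrightarrow> L"
  using real_Cauchy_convergent convergent_def by blast
 have "\<delta> g = L" by (rule first_variation_ext_eqI[OF gm h L])
 then show thesis using that[OF h] L by simp
qed

lemma first_variation_ext_diff_le:
 assumes "integrable \<nu> g" "integrable \<nu> g'"
 shows "ennreal \<bar>\<delta> g - \<delta> g'\<bar>
  \<le> 16 * L1_dist \<nu> g g'"
proof -
 obtain h where h: "\<And>i::nat. h i \<in> test_fields U"
  "(\<lambda>i. L1_dist \<nu> (h i) g) \<longlonglongrightarrow> 0"
  "(\<lambda>i. first_variation V (h i)) \<longlonglongrightarrow> \<delta> g"
  by (rule first_variation_ext_approx[OF assms(1)]) (rule that)
 obtain h' where h': "\<And>i::nat. h' i \<in> test_fields U"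
  "(\<lambda>i. L1_dist \<nu> (h' i) g') \<longlonglongrightarrow> 0"
  "(\<lambda>i. first_variation V (h' i)) \<longlonglongrightarrow> \<delta> g'"
  by (rule first_variation_ext_approx[OF assms(2)]) (rule that)
 have up: "(\<lambda>i. 16 * (L1_dist \<nu> (h i) g + L1_dist \<nu> g g'
    + L1_dist \<nu> (h' i) g'))
   \<longlonglongrightarrow> 16 * (0 + L1_dist \<nu> g g' + 0)"
  by (intro ennreal_tendsto_cmult tendsto_add h(2) h'(2) tendsto_const) auto
 have lo: "(\<lambda>i. ennreal \<bar>first_variation V (h i) - first_variation V (h' i)\<bar>)
   \<longlonglongrightarrow> ennreal \<bar>\<delta> g - \<delta> g'\<bar>"
  by (intro tendsto_ennrealI tendsto_rabs tendsto_diff h(3) h'(3))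
 have "ennreal \<bar>\<delta> g - \<delta> g'\<bar>
   \<le> 16 * (0 + L1_dist \<nu> g g' + 0)"
 proof (rule LIMSEQ_le[OF lo up], intro exI[of _ 0] allI impI)
  fix i
  show "ennreal \<bar>first_variation V (h i) - first_variation V (h' i)\<bar> \<le>
    16 * (L1_dist \<nu> (h i) g + L1_dist \<nu> g g'
    + L1_dist \<nu> (h' i) g')"
   by (rule first_variation_diff_le[OF h(1) h'(1)]) (use assms in auto)
 qed
 then show ?thesis by simp
qed

lemma first_variation_ext_add:
 assumes "integrable \<nu> g" "integrable \<nu> g'"
 shows "\<delta> (\<lambda>z. g z + g' z) = \<delta> g + \<delta> g'"
proof -
 obtain h where h: "\<And>i::nat. h i \<in> test_fields U"
  "(\<lambda>i. L1_dist \<nu> (h i) g) \<longlonglongrightarrow> 0"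
  "(\<lambda>i. first_variation V (h i)) \<longlonglongrightarrow> \<delta> g"
  by (rule first_variation_ext_approx[OF assms(1)]) (rule that)
 obtain h' where h': "\<And>i::nat. h' i \<in> test_fields U"
  "(\<lambda>i. L1_dist \<nu> (h' i) g') \<longlonglongrightarrow> 0"
  "(\<lambda>i. first_variation V (h' i)) \<longlonglongrightarrow> \<delta> g'"
  by (rule first_variation_ext_approx[OF assms(2)]) (rule that)
 have gm[measurable]: "g \<in> \<N>" "g' \<in> \<N>"
  using assms by auto
 note test_field_measurable_nu[OF h(1), measurable] test_field_measurable_nu[OF h'(1), measurable]
 show ?thesis
 proof (rule first_variation_ext_eqI)
  show "(\<lambda>z. g z + g' z) \<in> \<N>" by measurable
  show "(\<lambda>z. h i z + h' i z) \<in> test_fields U" for i by (rule test_fields_add[OF h(1) h'(1)])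
  have up: "(\<lambda>i. L1_dist \<nu> (h i) g + L1_dist \<nu> (h' i) g') \<longlonglongrightarrow> 0"
   using tendsto_add[OF h(2) h'(2)] by simp
  have le: "(\<integral>\<^sup>+ z. ennreal (norm ((h i z + h' i z) - (g z + g' z))) \<partial>\<nu>)
   \<le> L1_dist \<nu> (h i) g + L1_dist \<nu> (h' i) g'" for i
  proof -
   have "(\<integral>\<^sup>+ z. ennreal (norm ((h i z + h' i z) - (g z + g' z))) \<partial>\<nu>)
    \<le> (\<integral>\<^sup>+ z. ennreal (norm (h i z - g z)) + ennreal (norm (h' i z - g' z)) \<partial>\<nu>)"
   proof (rule nn_integral_mono)
    fix z
    have "norm ((h i z + h' i z) - (g z + g' z)) \<le> norm (h i z - g z) + norm (h' i z - g' z)"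
     by (rule norm_diff_triangle_ineq)
    then show "ennreal (norm ((h i z + h' i z) - (g z + g' z))) \<le> ennreal (norm (h i z - g z)) + ennreal (norm (h' i z - g' z))"
     by (simp add: ennreal_plus[symmetric] ennreal_leI del: ennreal_plus)
   qed
   then show ?thesis by (simp add: nn_integral_add)
  qed
  show "(\<lambda>i. \<integral>\<^sup>+ z. ennreal (norm ((h i z + h' i z) - (g z + g' z))) \<partial>\<nu>) \<longlonglongrightarrow> 0"
   by (rule tendsto_sandwich[OF _ _ tendsto_const up]) (use le in auto)
  show "(\<lambda>i. first_variation V (\<lambda>z. h i z + h' i z)) \<longlonglongrightarrow> \<delta> g + \<delta> g'"
   unfolding first_variation_add[OF h(1) h'(1)] by (rule tendsto_add[OF h(3) h'(3)])
 qed
qed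

lemma first_variation_ext_sum:
 assumes "finite I" "\<And>i. i \<in> I \<Longrightarrow> integrable \<nu> (g i)"
 shows "\<delta> (\<lambda>z. \<Sum>i\<in>I. g i z) = (\<Sum>i\<in>I. \<delta> (g i))"
 using assms
proof (induction I rule: finite_induct)
 case empty
 have "first_variation V (\<lambda>z. 0) = 0" using first_variation_scaleR[OF test_fields_0, of 0] by simp
 then show ?case using first_variation_ext_test[OF test_fields_0] by simp
next
 case (insert i I)
 then show ?case by (simp add: first_variation_ext_add)
qed

lemma integrable_scaled_test_field:
 assumes \<theta>: "\<theta> \<in> test_fields U" and \<phi>: "\<phi> \<in> \<N>"
  "\<And>z. \<theta> z \<noteq> 0 \<Longrightarrow> \<bar>\<phi> z\<bar> \<le> B"
 shows "integrable \<nu> (\<lambda>z. \<phi> z *\<^sub>R \<theta> z)"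
proof -
 obtain K A where K: "compact K" "K \<subseteq> U" "0 \<le> A" "\<And>z. norm (\<theta> z) \<le> A" "\<And>z. z \<notin> K \<Longrightarrow> \<theta> z = 0"
  by (rule test_field_derivative_bound[OF \<theta>]) (rule that)
 define B' where "B' = max B 0"
 have "0 \<le> B'" by (simp add: B'_def)
 show ?thesis
 proof (rule radon_integrable_bounded[OF radon_nu open_U _ K(1,2)])
  show "(\<lambda>z. \<phi> z *\<^sub>R \<theta> z) \<in> \<N>"
   using \<phi>(1) test_field_measurable_nu[OF \<theta>] by measurable
  show "norm (\<phi> z *\<^sub>R \<theta> z) \<le> B' * A" for z
  proof (cases "\<theta> z = 0")
   case True
   then show ?thesis using \<open>0 \<le> B'\<close> K(3) by simp
  next
   case False
   then show ?thesis using \<phi>(2)[OF False] K(3) K(4)[of z] \<open>0 \<le> B'\<close> by (auto simp: B'_def intro!: mult_mono)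
  qed
 qed (simp add: K(5))
qed

text \<open>The form in which the continuity of the extension enters below: the fields converge in \<open>L\<^sub>1\<close> by
 dominated convergence. Bounds and limits only matter where the test field is nonzero.\<close>

lemma first_variation_ext_dominated_convergence:
 assumes \<theta>: "\<theta> \<in> test_fields U"
  and \<phi>: "\<And>j. \<phi> j \<in> \<N>" "\<And>j z. \<theta> z \<noteq> 0 \<Longrightarrow> \<bar>\<phi> j z\<bar> \<le> B"
  and \<psi>: "\<psi> \<in> \<N>" "\<And>z. \<theta> z \<noteq> 0 \<Longrightarrow> \<bar>\<psi> z\<bar> \<le> B"
  and lim: "AE z in nu. \<theta> z \<noteq> 0 \<longrightarrow> (\<lambda>j. \<phi> j z) \<longlonglongrightarrow> \<psi> z"
 shows "(\<lambda>j. \<delta> (\<lambda>z. \<phi> j z *\<^sub>R \<theta> z)) \<longlonglongrightarrow> \<delta> (\<lambda>z. \<psi> z *\<^sub>R \<theta> z)"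
proof -
 note [measurable] = \<phi>(1) \<psi>(1) test_field_measurable_nu[OF \<theta>]
 have i\<theta>: "integrable \<nu> \<theta>"
  using integrable_scaled_test_field[OF \<theta>, of "\<lambda>z. 1" 1] by simp
 have "(\<lambda>j. \<integral>\<^sup>+z. ennreal (norm (\<phi> j z *\<^sub>R \<theta> z - \<psi> z *\<^sub>R \<theta> z)) \<partial>\<nu>) \<longlonglongrightarrow> (\<integral>\<^sup>+z. 0 \<partial>\<nu>)"
 proof (rule nn_integral_dominated_convergence[where w="\<lambda>z. ennreal (norm ((2 * B) *\<^sub>R \<theta> z))"])
  have "integrable \<nu> (\<lambda>z. (2 * B) *\<^sub>R \<theta> z)" using i\<theta> by simp
  then show "(\<integral>\<^sup>+z. ennreal (norm ((2 * B) *\<^sub>R \<theta> z)) \<partial>\<nu>) < \<infinity>"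
   unfolding integrable_iff_bounded by blast
  show "AE z in \<nu>. ennreal (norm (\<phi> j z *\<^sub>R \<theta> z - \<psi> z *\<^sub>R \<theta> z)) \<le> ennreal (norm ((2 * B) *\<^sub>R \<theta> z))" for j
  proof (intro AE_I2 ennreal_leI)
   fix z
   show "norm (\<phi> j z *\<^sub>R \<theta> z - \<psi> z *\<^sub>R \<theta> z) \<le> norm ((2 * B) *\<^sub>R \<theta> z)"
   proof (cases "\<theta> z = 0")
    case False
    then have "\<bar>\<phi> j z - \<psi> z\<bar> \<le> \<bar>2 * B\<bar>"
     using \<phi>(2)[of z j] \<psi>(2)[of z] by (simp add: abs_le_iff)
    then show ?thesis
     unfolding scaleR_diff_left[symmetric] norm_scaleR by (intro mult_right_mono) auto
   qed simp
  qed
  show "AE z in \<nu>. (\<lambda>j. ennreal (norm (\<phi> j z *\<^sub>R \<theta> z - \<psi> z *\<^sub>R \<theta> z))) \<longlonglongrightarrow> 0"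
   using AE_completion[OF lim]
  proof eventually_elim
   case (elim z)
   show ?case
   proof (cases "\<theta> z = 0")
    case True then show ?thesis by simp
   next
    case False
    then have "(\<lambda>j. \<phi> j z *\<^sub>R \<theta> z - \<psi> z *\<^sub>R \<theta> z) \<longlonglongrightarrow> 0"
     using elim by (intro LIM_zero tendsto_scaleR tendsto_const) auto
    then have "(\<lambda>j. ennreal (norm (\<phi> j z *\<^sub>R \<theta> z - \<psi> z *\<^sub>R \<theta> z))) \<longlonglongrightarrow> ennreal 0"
     by (intro tendsto_ennrealI tendsto_norm_zero)
    then show ?thesis by simp
   qed
  qed
 qed measurable
 then have z: "(\<lambda>j. \<integral>\<^sup>+z. ennreal (norm (\<phi> j z *\<^sub>R \<theta> z - \<psi> z *\<^sub>R \<theta> z)) \<partial>\<nu>) \<longlonglongrightarrow> 0" by simp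
 have "(\<lambda>j. 16 * (\<integral>\<^sup>+z. ennreal (norm (\<phi> j z *\<^sub>R \<theta> z - \<psi> z *\<^sub>R \<theta> z)) \<partial>\<nu>)) \<longlonglongrightarrow> 16 * 0"
  by (intro ennreal_tendsto_cmult z) simp
 then have up: "(\<lambda>j. 16 * (\<integral>\<^sup>+z. ennreal (norm (\<phi> j z *\<^sub>R \<theta> z - \<psi> z *\<^sub>R \<theta> z)) \<partial>\<nu>)) \<longlonglongrightarrow> 0" by simp
 have "(\<lambda>j. ennreal \<bar>\<delta> (\<lambda>z. \<phi> j z *\<^sub>R \<theta> z) - \<delta> (\<lambda>z. \<psi> z *\<^sub>R \<theta> z)\<bar>) \<longlonglongrightarrow> ennreal 0"
  unfolding ennreal_0
  by (rule tendsto_sandwich[OF _ _ tendsto_const up])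
    (auto intro!: always_eventually first_variation_ext_diff_le integrable_scaled_test_field[OF \<theta>, where B=B] \<phi> \<psi>)
 then have "(\<lambda>j. \<bar>\<delta> (\<lambda>z. \<phi> j z *\<^sub>R \<theta> z) - \<delta> (\<lambda>z. \<psi> z *\<^sub>R \<theta> z)\<bar>) \<longlonglongrightarrow> 0"
  by (rule tendsto_ennrealD) auto
 then show ?thesis by (simp add: tendsto_rabs_zero_iff LIM_zero_iff)
qed

end


section \<open>Smooth quasi-interpolation on lattices\<close>

lemma smooth_derivative_bounded:
 fixes f :: "'a::euclidean_space \<Rightarrow> 'b::real_normed_vector"
 assumes f: "smooth f" and C: "compact C"
 obtains A where "0 \<le> A" "\<And>x v. x \<in> C \<Longrightarrow> norm (\<D> f x v) \<le> A * norm v"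
proof -
 have "\<exists>B\<ge>0. \<forall>x\<in>C. norm (\<D> f x b) \<le> B" for b
 proof -
  have "bounded ((\<lambda>x. \<D> f x b) ` C)"
   by (intro compact_imp_bounded compact_continuous_image smooth_continuous_D f C)
  then obtain B where "\<forall>y\<in>(\<lambda>x. \<D> f x b) ` C. norm y \<le> B" unfolding bounded_iff by blast
  then show ?thesis by (intro exI[of _ "max B 0"]) auto
 qed
 then obtain B where B: "\<And>b. 0 \<le> B b" "\<And>b x. x \<in> C \<Longrightarrow> norm (\<D> f x b) \<le> B b"
  by metis
 show thesis
 proof (rule that[of "\<Sum>b\<in>Basis. B b"])
  show "0 \<le> (\<Sum>b\<in>Basis. B b)" using B(1) by (intro sum_nonneg)
  fix x v assume x: "x \<in> C"
  have "\<D> f x v = (\<Sum>b\<in>Basis. (v \<bullet> b) *\<^sub>R \<D> f x b)"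
   by (rule has_derivative_basis[OF smooth_D(1)[OF f]])
  also have "norm \<dots> \<le> (\<Sum>b\<in>Basis. norm v * B b)"
  proof (rule order_trans[OF norm_sum sum_mono])
   fix b :: 'a assume "b \<in> Basis"
   then have "\<bar>v \<bullet> b\<bar> \<le> norm v" by (rule Basis_le_norm)
   then show "norm ((v \<bullet> b) *\<^sub>R \<D> f x b) \<le> norm v * B b"
    using B(2)[OF x, of b] by (simp add: mult_mono)
  qed
  finally show "norm (\<D> f x v) \<le> (\<Sum>b\<in>Basis. B b) * norm v"
   by (simp add: sum_distrib_left mult.commute)
 qed
qed

lemma smooth_mean_value:
 fixes f :: "'a::euclidean_space \<Rightarrow> 'b::real_normed_vector"
 assumes "smooth f" "convex S" "\<And>x v. x \<in> S \<Longrightarrow> norm (\<D> f x v) \<le> B * norm v"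
  "x \<in> S" "y \<in> S"
 shows "norm (f x - f y) \<le> B * norm (x - y)"
 by (rule differentiable_bound[OF assms(2) has_derivative_at_withinI[OF smooth_D(1)[OF assms(1)]] _ assms(4,5)])
   (intro onorm_le assms(3))

text \<open>A smooth bump supported in \<open>[-1, 1]\<close>. Being a difference of consecutive translates of one
 function, its integer translates have telescoping sums, which are therefore equal to one.\<close>

definition hat :: "real \<Rightarrow> real" where
 "hat t = smooth_step (t + 1) - smooth_step t"

lemma smooth_hat: "smooth hat"
 unfolding hat_def[abs_def]
 by (intro smooth_diff smooth_compose[OF smooth_smooth_step] smooth_add smooth_const smooth_ident smooth_smooth_step)

lemma hat_0: "1 \<le> \<bar>t\<bar> \<Longrightarrow> hat t = 0"
 by (cases "t \<ge> 0") (auto simp: hat_def smooth_step_0 smooth_step_1)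

lemma hat_abs: "\<bar>hat t\<bar> \<le> 1"
 using smooth_step_ge_0[of t] smooth_step_ge_0[of "t+1"] smooth_step_le_1[of t] smooth_step_le_1[of "t+1"]
 by (simp add: hat_def abs_le_iff)

lemma sum_hat:
 assumes "\<bar>t\<bar> \<le> real N"
 shows "(\<Sum>k\<in>{- int N..int N}. hat (t - of_int k)) = 1"
proof -
 have "(\<Sum>k\<in>{- int n..int n}. hat (t - of_int k)) = smooth_step (t + real n + 1) - smooth_step (t - real n)" for n
 proof (induction n)
  case (Suc n)
  have "{- int (Suc n)..int (Suc n)} = insert (- int (Suc n)) (insert (int (Suc n)) {- int n..int n})" by auto
  then have "(\<Sum>k\<in>{- int (Suc n)..int (Suc n)}. hat (t - of_int k))
    = hat (t - of_int (- int (Suc n))) + (hat (t - of_int (int (Suc n))) + (\<Sum>k\<in>{- int n..int n}. hat (t - of_int k)))"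
   by simp
  moreover have "t - of_int (- int (Suc n)) = t + real n + 1" "t - of_int (int (Suc n)) = t - real n - 1"
   by simp_all
  ultimately show ?case unfolding Suc.IH by (simp add: hat_def algebra_simps)
 qed (simp add: hat_def)
 then show ?thesis using assms by (simp add: smooth_step_0 smooth_step_1 abs_le_iff)
qed

definition cell :: "('k \<Rightarrow> int) \<Rightarrow> real^'k \<Rightarrow> real" where
 "cell q x = (\<Prod>i\<in>UNIV. hat (x $ i - of_int (q i)))"

definition lattice_point :: "('k \<Rightarrow> int) \<Rightarrow> real^'k" where
 "lattice_point q = (\<chi> i. of_int (q i))"

definition near :: "('k \<Rightarrow> int) \<Rightarrow> real^'k \<Rightarrow> bool" where
 "near q x \<longleftrightarrow> (\<forall>i. \<bar>x $ i - of_int (q i)\<bar> \<le> 1)"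

definition lattice_box :: "nat \<Rightarrow> ('k \<Rightarrow> int) set" where
 "lattice_box N = PiE UNIV (\<lambda>_. {- int N..int N})"

lemma finite_lattice_box [simp]: "finite (lattice_box N :: ('k::finite \<Rightarrow> int) set)"
 by (simp add: lattice_box_def finite_PiE)

lemma smooth_cell: "smooth (cell q)"
proof -
 have "smooth (\<lambda>x :: real^'k. x $ i)" for i
  by (intro smooth_linear bounded_linear_vec_nth)
 then show ?thesis unfolding cell_def[abs_def]
  by (intro smooth_prod smooth_compose[OF smooth_hat] smooth_diff smooth_const)
qed

lemma cell_far: "\<not> near q x \<Longrightarrow> cell q x = 0"
proof -
 assume "\<not> near q x"
 then obtain i where "1 \<le> \<bar>x $ i - of_int (q i)\<bar>" by (auto simp: near_def not_le intro: less_imp_le)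
 then have "hat (x $ i - of_int (q i)) = 0" by (rule hat_0)
 then show ?thesis unfolding cell_def by (intro prod_zero) auto
qed

lemma cell_abs: "\<bar>cell q x\<bar> \<le> of_bool (near q x)"
proof (cases "near q x")
 case True
 have "\<bar>cell q x\<bar> \<le> (\<Prod>i\<in>(UNIV::'a set). 1)"
  unfolding cell_def abs_prod by (intro prod_mono) (auto simp: hat_abs)
 then show ?thesis using True by simp
qed (simp add: cell_far)

lemma sum_cell:
 fixes x :: "real^'k"
 assumes "\<And>i. \<bar>x $ i\<bar> \<le> real N"
 shows "(\<Sum>q\<in>lattice_box N. cell q x) = 1"
proof -
 have "(\<Prod>i\<in>UNIV. \<Sum>k\<in>{- int N..int N}. hat (x $ i - of_int k)) = (\<Sum>q\<in>lattice_box N. cell q x)"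
  unfolding lattice_box_def cell_def by (rule prod_sum_PiE) auto
 then show ?thesis using sum_hat[OF assms] by simp
qed

text \<open>At most three integers lie within distance one of a given coordinate. Thus the number of
 nonvanishing summands in lattice interpolation is bounded independently of the mesh size.\<close>

lemma sum_near:
 fixes x :: "real^'k"
 shows "(\<Sum>q\<in>lattice_box N. of_bool (near q x)) \<le> (3::real)^CARD('k)"
proof -
 have "of_bool (near q x) = (\<Prod>i\<in>UNIV. of_bool (\<bar>x $ i - of_int (q i)\<bar> \<le> 1) :: real)" for q
 proof (cases "near q x")
  case False
  then obtain i where "\<not> \<bar>x $ i - of_int (q i)\<bar> \<le> 1" by (auto simp: near_def)
  then have "(\<Prod>i\<in>UNIV. of_bool (\<bar>x $ i - of_int (q i)\<bar> \<le> 1) :: real) = 0"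
   by (intro prod_zero) auto
  then show ?thesis using False by simp
 qed (simp add: near_def)
 note eq = this
 have "(\<Sum>q\<in>lattice_box N. of_bool (near q x))
   = (\<Prod>i\<in>UNIV. \<Sum>k\<in>{- int N..int N}. of_bool (\<bar>x $ i - of_int k\<bar> \<le> 1) :: real)"
  unfolding lattice_box_def by (subst prod_sum_PiE) (simp_all only: eq finite_atLeastAtMost_int finite_UNIV finite)
 also have "\<dots> \<le> (\<Prod>i\<in>(UNIV::'k set). 3)"
 proof (rule prod_mono, intro conjI sum_nonneg)
  fix i
  have "(\<Sum>k\<in>{- int N..int N}. of_bool (\<bar>x $ i - of_int k\<bar> \<le> 1) :: real)
    = real (card {k\<in>{- int N..int N}. \<bar>x $ i - of_int k\<bar> \<le> 1})"
   by (simp add: of_bool_def sum.If_cases Int_def)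
  also have "\<dots> \<le> real (card {\<lceil>x $ i - 1\<rceil>..\<lceil>x $ i - 1\<rceil> + 2})"
  proof -
   have "{k\<in>{- int N..int N}. \<bar>x $ i - of_int k\<bar> \<le> 1} \<subseteq> {\<lceil>x $ i - 1\<rceil>..\<lceil>x $ i - 1\<rceil> + 2}"
   proof
    fix k assume "k \<in> {k\<in>{- int N..int N}. \<bar>x $ i - of_int k\<bar> \<le> 1}"
    then have k: "x $ i - 1 \<le> of_int k" "of_int k \<le> x $ i + 1" by (auto simp: abs_le_iff)
    have "\<lceil>x $ i - 1\<rceil> \<le> k" using k(1) by (subst ceiling_le_iff)
    moreover have "k \<le> \<lceil>x $ i - 1\<rceil> + 2" using k(2) by linarith
    ultimately show "k \<in> {\<lceil>x $ i - 1\<rceil>..\<lceil>x $ i - 1\<rceil> + 2}" by simp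
   qed
   then show ?thesis by (intro of_nat_mono card_mono) auto
  qed
  finally show "(\<Sum>k\<in>{- int N..int N}. of_bool (\<bar>x $ i - of_int k\<bar> \<le> 1)) \<le> (3::real)" by simp
 qed auto
 finally show ?thesis by simp
qed

text \<open>All cells are translates of one function with compact support.\<close>

lemma cell_derivative_bound:
 obtains A where "0 \<le> A"
  "\<And>q (x :: real^'k) v. \<bar>\<D> (cell q) x v\<bar> \<le> A * norm v * of_bool (near q x)"
proof -
 let ?c = "cell (\<lambda>_. 0) :: real^'k \<Rightarrow> real"
 define Q where "Q = {x :: real^'k. \<forall>i. \<bar>x $ i\<bar> \<le> 1}"
 have "closed Q" unfolding Q_def by (intro closed_Collect_all closed_Collect_le continuous_intros)
 moreover have "bounded Q"
 proof (rule boundedI)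
  fix x assume "x \<in> Q"
  then have "(\<Sum>i\<in>UNIV. \<bar>x $ i\<bar>) \<le> (\<Sum>i\<in>(UNIV :: 'k set). 1)" by (intro sum_mono) (auto simp: Q_def)
  then show "norm x \<le> real CARD('k)" using norm_le_l1_cart[of x] by simp
 qed
 ultimately have Q: "compact Q" by (simp add: compact_eq_bounded_closed)
 obtain A where A: "0 \<le> A" "\<And>x v. x \<in> Q \<Longrightarrow> norm (\<D> ?c x v) \<le> A * norm v"
  by (rule smooth_derivative_bounded[OF smooth_cell Q]) (rule that)
 show thesis
 proof (rule that[OF A(1)])
  fix q :: "'k \<Rightarrow> int" and x v :: "real^'k"
  have sh: "cell q = (\<lambda>x. ?c (x - lattice_point q))" by (auto simp: cell_def lattice_point_def)
  have "(cell q has_derivative (\<lambda>v. \<D> ?c (x - lattice_point q) v)) (at x)"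
   unfolding sh
   by (rule has_derivative_compose[OF _ smooth_D(1)[OF smooth_cell], where f="\<lambda>x. x - lattice_point q" and f'="\<lambda>v. v"])
     (auto intro!: derivative_eq_intros)
  then have D: "\<D> (cell q) x = \<D> ?c (x - lattice_point q)"
   by (rule frechet_derivative_at[symmetric])
  have nq: "near q x \<longleftrightarrow> x - lattice_point q \<in> Q" by (auto simp: near_def Q_def lattice_point_def)
  show "\<bar>\<D> (cell q) x v\<bar> \<le> A * norm v * of_bool (near q x)"
  proof (cases "near q x")
   case True then show ?thesis using A(2)[of "x - lattice_point q" v] nq D by simp
  next
   case False
   have "?c y = 0" if "y \<notin> Q" for y using cell_far[of "\<lambda>_. 0" y] that by (auto simp: near_def Q_def)
   then have "\<D> ?c (x - lattice_point q) = (\<lambda>v. 0)"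
    using \<open>closed Q\<close> False nq by (intro frechet_derivative_zero_outside[where C=Q and c=0]) auto
   then show ?thesis using D False by simp
  qed
 qed
qed

lemma near_dist:
 fixes x :: "real^'k"
 assumes "near q (real n *\<^sub>R x)" "0 < n"
 shows "norm (x - (1 / real n) *\<^sub>R lattice_point q) \<le> real CARD('k) / real n"
proof -
 have "norm (real n *\<^sub>R x - lattice_point q) \<le> (\<Sum>i\<in>UNIV. \<bar>(real n *\<^sub>R x - lattice_point q) $ i\<bar>)" by (rule norm_le_l1_cart)
 also have "\<dots> \<le> (\<Sum>i\<in>(UNIV::'k set). 1)" using assms(1) by (intro sum_mono) (auto simp: near_def lattice_point_def)
 finally have *: "norm (real n *\<^sub>R x - lattice_point q) \<le> real CARD('k)" by simp
 have "x - (1 / real n) *\<^sub>R lattice_point q = (1 / real n) *\<^sub>R (real n *\<^sub>R x - lattice_point q)"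
  using assms(2) by (simp add: scaleR_diff_right)
 then have "norm (x - (1 / real n) *\<^sub>R lattice_point q) = norm (real n *\<^sub>R x - lattice_point q) / real n" by simp
 then show ?thesis using * assms(2) by (simp add: divide_right_mono)
qed

lemma smooth_scaled_cell: "smooth (\<lambda>x. cell q (c *\<^sub>R x))"
 by (intro smooth_compose[OF smooth_cell] smooth_scaleR smooth_const smooth_ident)

lemma scaled_cell_derivative:
 "\<D> (\<lambda>x. cell q (c *\<^sub>R x)) x v = c * \<D> (cell q) (c *\<^sub>R x) v"
proof -
 have "((\<lambda>x. cell q (c *\<^sub>R x)) has_derivative (\<lambda>v. \<D> (cell q) (c *\<^sub>R x) (c *\<^sub>R v))) (at x)"
  by (rule has_derivative_compose[OF _ smooth_D(1)[OF smooth_cell]]) (auto intro!: derivative_eq_intros)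
 from frechet_derivative_at[OF this, symmetric] show ?thesis
  using linear_scale[OF smooth_D(5)[OF smooth_cell]] by simp
qed

lemma sum_scaled_cell:
 fixes x :: "real^'k"
 assumes "norm x < real n"
 shows "(\<Sum>q\<in>lattice_box (n\<^sup>2). cell q (real n *\<^sub>R x)) = 1"
  and "(\<Sum>q\<in>lattice_box (n\<^sup>2). \<D> (\<lambda>x. cell q (real n *\<^sub>R x)) x v) = 0"
proof -
 have one: "(\<Sum>q\<in>lattice_box (n\<^sup>2). cell q (real n *\<^sub>R x)) = 1" if "norm x < real n" for x :: "real^'k"
 proof (rule sum_cell)
  fix i
  have "\<bar>x $ i\<bar> \<le> real n" using component_le_norm_cart[of x i] that by linarith
  then have "real n * \<bar>x $ i\<bar> \<le> real n * real n" by (intro mult_left_mono) auto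
  then show "\<bar>(real n *\<^sub>R x) $ i\<bar> \<le> real (n\<^sup>2)" by (simp add: abs_mult power2_eq_square)
 qed
 then show "(\<Sum>q\<in>lattice_box (n\<^sup>2). cell q (real n *\<^sub>R x)) = 1" using assms .
 have "((\<lambda>x. \<Sum>q\<in>lattice_box (n\<^sup>2). cell q (real n *\<^sub>R x)) has_derivative
   (\<lambda>v. \<Sum>q\<in>lattice_box (n\<^sup>2). \<D> (\<lambda>x. cell q (real n *\<^sub>R x)) x v)) (at x)"
  by (intro has_derivative_sum smooth_D(1) smooth_scaled_cell)
 moreover have "((\<lambda>x. \<Sum>q\<in>lattice_box (n\<^sup>2). cell q (real n *\<^sub>R x)) has_derivative (\<lambda>v. 0)) (at x)"
  by (rule has_derivative_transform_within_open[where f="\<lambda>_. 1" and s="ball 0 (real n)"])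
    (use assms one in \<open>auto simp: dist_norm\<close>)
 ultimately show "(\<Sum>q\<in>lattice_box (n\<^sup>2). \<D> (\<lambda>x. cell q (real n *\<^sub>R x)) x v) = 0"
  using has_derivative_unique by (metis (no_types, lifting))
qed

lemma sum_near_le:
 fixes x :: "real^'k" and e :: "('k \<Rightarrow> int) \<Rightarrow> real"
 assumes "\<And>q. near q x \<Longrightarrow> \<bar>e q\<bar> \<le> E" "\<And>q. \<bar>a q\<bar> \<le> A * of_bool (near q x)" "0 \<le> A" "0 \<le> E"
 shows "\<bar>\<Sum>q\<in>lattice_box N. a q * e q\<bar> \<le> A * E * 3^CARD('k)"
proof -
 have "\<bar>\<Sum>q\<in>lattice_box N. a q * e q\<bar> \<le> (\<Sum>q\<in>lattice_box N. \<bar>a q * e q\<bar>)" by (rule sum_abs)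
 also have "\<dots> \<le> (\<Sum>q\<in>lattice_box N. A * E * of_bool (near q x))"
 proof (rule sum_mono)
  fix q
  show "\<bar>a q * e q\<bar> \<le> A * E * of_bool (near q x)"
  proof (cases "near q x")
   case True
   then show ?thesis using assms(1)[OF True] assms(2)[of q] assms(3,4) by (simp add: abs_mult mult_mono)
  next
   case False then show ?thesis using assms(2)[of q] by simp
  qed
 qed
 also have "\<dots> = A * E * (\<Sum>q\<in>lattice_box N. of_bool (near q x))" by (simp add: sum_distrib_left)
 also have "\<dots> \<le> A * E * 3^CARD('k)" using sum_near[of x N] assms(3,4) by (intro mult_left_mono) auto
 finally show ?thesis .
qed

lemma norm_sum_near_le:
 fixes x :: "real^'k" and e :: "('k \<Rightarrow> int) \<Rightarrow> 'b::real_normed_vector"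
 assumes "\<And>q. near q x \<Longrightarrow> norm (e q) \<le> E" "\<And>q. \<bar>a q\<bar> \<le> A * of_bool (near q x)" "0 \<le> A" "0 \<le> E"
 shows "norm (\<Sum>q\<in>lattice_box N. a q *\<^sub>R e q) \<le> A * E * 3^CARD('k)"
proof -
 have "norm (\<Sum>q\<in>lattice_box N. a q *\<^sub>R e q) \<le> (\<Sum>q\<in>lattice_box N. norm (a q *\<^sub>R e q))" by (rule norm_sum)
 also have "\<dots> \<le> \<bar>\<Sum>q\<in>lattice_box N. \<bar>a q\<bar> * norm (e q)\<bar>" by simp
 also have "\<dots> \<le> A * E * 3^CARD('k)"
  by (rule sum_near_le[of x]) (use assms in auto)
 finally show ?thesis .
qed

text \<open>Interpolating a map at the lattice points gives smooth maps that converge to it, with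
 derivatives controlled by a Lipschitz constant, near every ball on which it is Lipschitz.\<close>

lemma smooth_approximation:
 fixes g :: "real^'n \<Rightarrow> real^'k"
 obtains G C where "\<And>n. smooth (G n :: real^'n \<Rightarrow> real^'k)" "0 \<le> C"
  "\<And>z r L. 0 < r \<Longrightarrow> L-lipschitz_on (ball z r) g \<Longrightarrow>
    \<exists>n0. \<forall>n\<ge>n0. 0 < n \<and> (\<forall>x\<in>ball z (r/2). norm (G n x - g x) \<le> C * L / real n \<and>
     (\<forall>v. norm (\<D> (G n) x v) \<le> C * L * norm v))"
proof -
 obtain A where A: "0 \<le> A"
  "\<And>q (x :: real^'n) v. \<bar>\<D> (cell q) x v\<bar> \<le> A * norm v * of_bool (near q x)"
  by (rule cell_derivative_bound) (rule that)
 define d where "d = real CARD('n)"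
 have d: "0 \<le> d" by (simp add: d_def)
 define c where "c n q x = cell q (real n *\<^sub>R x)" for n q and x :: "real^'n"
 define p where "p n q = (1 / real n) *\<^sub>R (lattice_point q :: real^'n)" for n :: nat and q
 \<comment> \<open>The mesh size is \<open>1/n\<close>; the lattice points in a box of half-width \<open>n\<^sup>2\<close> cover every ball of
  radius at most \<open>n\<close> after rescaling.\<close>
 define G where "G n x = (\<Sum>q\<in>lattice_box (n\<^sup>2). c n q x *\<^sub>R g (p n q))" for n x
 have sc: "smooth (c n q)" for n q unfolding c_def[abs_def] by (rule smooth_scaled_cell)
 have DG: "\<D> (G n) x v = (\<Sum>q\<in>lattice_box (n\<^sup>2). \<D> (c n q) x v *\<^sub>R g (p n q))" for n x v
 proof -
  have "(G n has_derivative (\<lambda>v. \<Sum>q\<in>lattice_box (n\<^sup>2). \<D> (c n q) x v *\<^sub>R g (p n q))) (at x)"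
   unfolding G_def[abs_def] by (intro has_derivative_sum has_derivative_scaleR_left smooth_D(1) sc)
  from frechet_derivative_at[OF this, symmetric] show ?thesis by simp
 qed
 define C where "C = (1 + A) * d * 3^CARD('n)"
 show thesis
 proof (rule that[of G C])
  show "smooth (G n)" for n unfolding G_def[abs_def]
   by (intro smooth_sum smooth_scaleR sc smooth_const)
  show "0 \<le> C" using A d by (simp add: C_def)
  fix z :: "real^'n" and r L assume r: "0 < r" and L: "L-lipschitz_on (ball z r) g"
  have L0: "0 \<le> L" using L by (rule lipschitz_on_nonneg)
  obtain n1 :: nat where n1: "norm z + r < real n1" using reals_Archimedean2 by blast
  obtain n2 :: nat where n2: "2 * d / r < real n2" using reals_Archimedean2 by blast
  show "\<exists>n0. \<forall>n\<ge>n0. 0 < n \<and> (\<forall>x\<in>ball z (r/2). norm (G n x - g x) \<le> C * L / real n \<and>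
     (\<forall>v. norm (\<D> (G n) x v) \<le> C * L * norm v))"
  proof (intro exI allI impI)
   fix n assume n: "max (max n1 n2) 1 \<le> n"
   then have n0: "0 < n" by simp
   have "real n2 \<le> real n" using n by simp
   then have "2 * d / r < real n" using n2 by linarith
   then have dr: "d / real n \<le> r / 2" using r n0 by (simp add: field_simps)
   have "norm (G n x - g x) \<le> C * L / real n \<and>
     (\<forall>v. norm (\<D> (G n) x v) \<le> C * L * norm v)" if x: "x \<in> ball z (r/2)" for x
   proof -
    have "norm x \<le> norm z + norm (x - z)" using norm_triangle_sub[of x z] by simp
    moreover have "norm (x - z) < r / 2" using x by (simp add: dist_norm norm_minus_commute)
    moreover have "real n1 \<le> real n" using n by simp
    ultimately have xn: "norm x < real n" using n1 r by linarith
    have gp: "norm (g (p n q) - g x) \<le> L * (d / real n)" if "near q (real n *\<^sub>R x)" for q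
    proof -
     have dist: "norm (x - p n q) \<le> d / real n" unfolding p_def d_def by (rule near_dist[OF that n0])
     have "dist z (p n q) \<le> dist z x + dist x (p n q)" by (rule dist_triangle)
     moreover have "dist z x < r / 2" using x by simp
     moreover have "dist x (p n q) \<le> r / 2" using order_trans[OF dist dr] by (simp only: dist_norm)
     ultimately have "p n q \<in> ball z r" unfolding mem_ball by linarith
     moreover have "x \<in> ball z r" using x r by simp
     ultimately have "dist (g (p n q)) (g x) \<le> L * dist (p n q) x" by (rule lipschitz_onD[OF L])
     also have "\<dots> \<le> L * (d / real n)" using dist L0 by (intro mult_left_mono) (auto simp: dist_norm norm_minus_commute)
     finally show ?thesis by (simp add: dist_norm)
    qed
    have Ld: "0 \<le> L * (d / real n)" using L0 d by simp
    have s1: "(\<Sum>q\<in>lattice_box (n\<^sup>2). c n q x) = 1" unfolding c_def by (rule sum_scaled_cell(1)[OF xn])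
    have s0: "(\<Sum>q\<in>lattice_box (n\<^sup>2). \<D> (c n q) x v) = 0" for v
     unfolding c_def[abs_def] by (rule sum_scaled_cell(2)[OF xn])
    have "G n x - g x = (\<Sum>q\<in>lattice_box (n\<^sup>2). c n q x *\<^sub>R (g (p n q) - g x))"
     unfolding G_def scaleR_diff_right sum_subtractf scaleR_sum_left[symmetric] s1 by simp
    moreover have "norm (\<Sum>q\<in>lattice_box (n\<^sup>2). c n q x *\<^sub>R (g (p n q) - g x)) \<le> 1 * (L * (d / real n)) * 3^CARD('n)"
     by (rule norm_sum_near_le[where x="real n *\<^sub>R x", OF gp]) (simp_all add: c_def cell_abs L0 d)
    ultimately have "norm (G n x - g x) \<le> 1 * (L * (d / real n)) * 3^CARD('n)" by simp
    also have "\<dots> = d * 3^CARD('n) * L / real n" by simp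
    also have "\<dots> \<le> C * L / real n"
    proof (intro divide_right_mono mult_right_mono L0)
     have "1 * (d * 3^CARD('n)) \<le> (1 + A) * (d * 3^CARD('n))"
      using A(1) d by (intro mult_right_mono) auto
     then show "d * 3^CARD('n) \<le> C" by (simp add: C_def mult.assoc)
    qed simp
    finally have 1: "norm (G n x - g x) \<le> C * L / real n" .
    have "norm (\<D> (G n) x v) \<le> C * L * norm v" for v
    proof -
     have "\<D> (G n) x v
       = (\<Sum>q\<in>lattice_box (n\<^sup>2). \<D> (c n q) x v *\<^sub>R (g (p n q) - g x))"
      unfolding DG scaleR_diff_right sum_subtractf scaleR_sum_left[symmetric] s0 by simp
     moreover have "\<bar>\<D> (c n q) x v\<bar> \<le> (real n * (A * norm v)) * of_bool (near q (real n *\<^sub>R x))" for q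
      using A(2)[of q "real n *\<^sub>R x" v] n0
      unfolding c_def[abs_def] scaled_cell_derivative by (simp add: abs_mult mult.assoc)
     ultimately have "norm (\<D> (G n) x v) \<le> (real n * (A * norm v)) * (L * (d / real n)) * 3^CARD('n)"
      using norm_sum_near_le[of "real n *\<^sub>R x" "\<lambda>q. g (p n q) - g x" "L * (d / real n)" _ "real n * (A * norm v)" "n\<^sup>2"]
       gp Ld A(1) by simp
     also have "\<dots> = (A * d * 3^CARD('n)) * L * norm v" using n0 by (simp add: field_simps)
     also have "\<dots> \<le> C * L * norm v"
     proof (intro mult_right_mono L0)
      have "A * (d * 3^CARD('n)) \<le> (1 + A) * (d * 3^CARD('n))"
       using d by (intro mult_right_mono) auto
      then show "A * d * 3^CARD('n) \<le> C" by (simp add: C_def mult.assoc)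
     qed simp
     finally show ?thesis .
    qed
    with 1 show ?thesis by blast
   qed
   then show "0 < n \<and> (\<forall>x\<in>ball z (r/2). norm (G n x - g x) \<le> C * L / real n \<and>
     (\<forall>v. norm (\<D> (G n) x v) \<le> C * L * norm v))" using n0 by blast
  qed
 qed
qed


section \<open>Approximation by sums of products\<close>

lemma smooth_partial:
 fixes \<Psi> :: "'a::euclidean_space \<times> 'b::euclidean_space \<Rightarrow> 'c::real_normed_vector"
 assumes "smooth \<Psi>"
 shows "((\<lambda>y. \<Psi> (y, p)) has_derivative (\<lambda>u. \<D> \<Psi> (y, p) (u, 0))) (at y)"
  and "((\<lambda>w. \<Psi> (y, w)) has_derivative (\<lambda>v. \<D> \<Psi> (y, p) (0, v))) (at p)"
  and "smooth (\<lambda>y. \<Psi> (y, p))" and "smooth (\<lambda>w. \<Psi> (y, w))"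
proof -
 show "((\<lambda>y. \<Psi> (y, p)) has_derivative (\<lambda>u. \<D> \<Psi> (y, p) (u, 0))) (at y)"
  by (rule has_derivative_compose[OF _ smooth_D(1)[OF assms], where f="\<lambda>y. (y, p)" and f'="\<lambda>u. (u, 0)"])
    (auto intro!: derivative_eq_intros)
 show "((\<lambda>w. \<Psi> (y, w)) has_derivative (\<lambda>v. \<D> \<Psi> (y, p) (0, v))) (at p)"
  by (rule has_derivative_compose[OF _ smooth_D(1)[OF assms], where f="\<lambda>w. (y, w)" and f'="\<lambda>v. (0, v)"])
    (auto intro!: derivative_eq_intros)
 show "smooth (\<lambda>y. \<Psi> (y, p))" "smooth (\<lambda>w. \<Psi> (y, w))"
  by (intro smooth_compose[OF assms] smooth_Pair smooth_const smooth_ident)+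
qed

text \<open>The ray stays in the region where the derivative vanishes. This argument covers dimension one,
 where the complement of a ball is disconnected.\<close>

lemma constant_along_rays:
 fixes f :: "'a::euclidean_space \<Rightarrow> real"
 assumes f: "\<And>y. R' < norm y \<Longrightarrow> (f has_derivative (\<lambda>v. 0)) (at y)" and R': "0 \<le> R'" and y: "R' + 1 \<le> norm y"
 shows "f y = f (((R' + 1) / norm y) *\<^sub>R y)"
proof -
 define s where "s = (R' + 1) / norm y"
 have ny: "0 < norm y" using R' y by linarith
 have s: "0 \<le> s" "s \<le> 1" "s * norm y = R' + 1" using ny y R' by (auto simp: s_def)
 have "(f has_derivative (\<lambda>v. 0)) (at x within closed_segment (s *\<^sub>R y) y)" if x: "x \<in> closed_segment (s *\<^sub>R y) y" for x
 proof -
  obtain t where t: "0 \<le> t" "t \<le> 1" "x = (1 - t) *\<^sub>R (s *\<^sub>R y) + t *\<^sub>R y" using x by (auto simp: closed_segment_def)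
  have "x = ((1 - t) * s + t) *\<^sub>R y" unfolding t(3) by (simp add: algebra_simps)
  moreover have "s \<le> (1 - t) * s + t" using t(1) s(2) mult_left_mono[OF s(2) t(1)] by (simp add: algebra_simps)
  ultimately have "s * norm y \<le> norm x" using s(1) by (simp add: mult_right_mono)
  then have "R' < norm x" using s(3) by simp
  then show ?thesis by (rule has_derivative_at_withinI[OF f])
 qed
 then obtain c where "\<And>x. x \<in> closed_segment (s *\<^sub>R y) y \<Longrightarrow> f x = c"
  using has_derivative_zero_constant[OF convex_closed_segment] by blast
 then show ?thesis unfolding s_def[symmetric] by simp
qed

text \<open>The values outside a ball are attained on a sphere, by constancy along rays.\<close>

lemma bounded_of_compact_derivative:
 fixes \<Psi> :: "'a::euclidean_space \<times> 'b::euclidean_space \<Rightarrow> real"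
 assumes \<Psi>: "smooth \<Psi>" and R': "0 \<le> R'"
  and 0: "\<And>y w. norm w \<le> R \<Longrightarrow> R' < norm y \<Longrightarrow> \<D> \<Psi> (y, w) = (\<lambda>v. 0)"
 obtains C where "0 \<le> C" "\<And>y w. norm w \<le> R \<Longrightarrow> \<bar>\<Psi> (y, w)\<bar> \<le> C"
proof -
 have "bounded (\<Psi> ` (cball 0 (R' + 1) \<times> cball 0 R))"
  by (intro compact_imp_bounded compact_continuous_image smooth_D(3)[OF \<Psi>] compact_Times compact_cball)
 then obtain C where "\<forall>x\<in>\<Psi> ` (cball 0 (R' + 1) \<times> cball 0 R). norm x \<le> C"
  unfolding bounded_iff by blast
 then have C: "\<bar>\<Psi> (y, w)\<bar> \<le> C" if "norm y \<le> R' + 1" "norm w \<le> R" for y w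
  using that by auto
 show thesis
 proof (rule that[of "max C 0"])
  fix y w assume w: "norm (w::'b) \<le> R"
  show "\<bar>\<Psi> (y, w)\<bar> \<le> max C 0"
  proof (cases "norm y \<le> R' + 1")
   case True then show ?thesis using C[OF True w] by simp
  next
   case False
   then have y: "R' + 1 \<le> norm y" "0 < norm y" using R' by linarith+
   have "((\<lambda>y. \<Psi> (y, w)) has_derivative (\<lambda>v. 0)) (at y)" if "R' < norm y" for y
    using smooth_partial(1)[OF \<Psi>, of w y] 0[OF w that] by simp
   from constant_along_rays[OF this R' y(1)]
   have "\<Psi> (y, w) = \<Psi> (((R' + 1) / norm y) *\<^sub>R y, w)" .
   moreover have "norm (((R' + 1) / norm y) *\<^sub>R y) \<le> R' + 1" using y R' by simp
   ultimately show ?thesis using C[OF _ w] by (metis max.coboundedI1)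
  qed
 qed simp
qed

text \<open>Bounds on second derivatives, in the form in which they enter Taylor's formula with
 respect to the second variable.\<close>

lemma second_order_bounds:
 fixes \<Psi> :: "'a::euclidean_space \<times> 'b::euclidean_space \<Rightarrow> real"
 assumes \<Psi>: "smooth \<Psi>" and R: "0 \<le> R" and R': "0 \<le> R'"
  and 0: "\<And>y w. norm w < R + 2 \<Longrightarrow> R' < norm y \<Longrightarrow> \<D> \<Psi> (y, w) = (\<lambda>v. 0)"
 obtains B where "0 \<le> B"
  "\<And>y w e v. norm w \<le> R + 1 \<Longrightarrow>
    \<bar>\<D> (\<lambda>x. \<D> \<Psi> x e) (y, w) v\<bar> \<le> B * norm e * norm v"
  "\<And>y w p e. norm w \<le> R + 1 \<Longrightarrow> norm p \<le> R + 1 \<Longrightarrow>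
    \<bar>\<D> \<Psi> (y, p) e - \<D> \<Psi> (y, w) e\<bar> \<le> B * norm e * norm (w - p)"
  "\<And>y w p. norm w \<le> R + 1 \<Longrightarrow> norm p \<le> R + 1 \<Longrightarrow>
    \<bar>\<Psi> (y, p) + \<D> \<Psi> (y, p) (0, w - p) - \<Psi> (y, w)\<bar> \<le> B * norm (w - p) * norm (w - p)"
proof -
 let ?D = "\<lambda>x. \<D> \<Psi> x"
 let ?D2 = "\<lambda>e x. \<D> (\<lambda>x. ?D x e) x"
 let ?K = "cball (0::'a) R' \<times> cball (0::'b) (R + 1)"
 note sD = smooth_D(2)[OF \<Psi>]
 have K: "compact ?K" by (intro compact_Times compact_cball)
 have "\<exists>A\<ge>0. \<forall>x\<in>?K. \<forall>v. norm (?D2 b x v) \<le> A * norm v" for b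
 proof -
  obtain A where "0 \<le> A" "\<And>x v. x \<in> ?K \<Longrightarrow> norm (?D2 b x v) \<le> A * norm v"
   by (rule smooth_derivative_bounded[OF sD[of b] K]) (rule that)
  then show ?thesis by blast
 qed
 then obtain A where A: "\<And>b. 0 \<le> A b" "\<And>b x v. x \<in> ?K \<Longrightarrow> norm (?D2 b x v) \<le> A b * norm v"
  by metis
 define B where "B = (\<Sum>b\<in>(Basis :: ('a \<times> 'b) set). A b)"
 have B0: "0 \<le> B" unfolding B_def using A(1) by (intro sum_nonneg)
 have D2b: "\<bar>?D2 b (y, w) v\<bar> \<le> A b * norm v" if w: "norm w \<le> R + 1" for b y w v
 proof (cases "norm y \<le> R'")
  case True
  then show ?thesis using A(2)[of "(y, w)" b v] w by simp
 next
  case False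
  have "((\<lambda>x. ?D x b) has_derivative (\<lambda>v. 0)) (at (y, w))"
  proof (rule has_derivative_transform_within_open[where f="\<lambda>_. 0" and s="(- cball 0 R') \<times> ball 0 (R + 2)"])
   show "open ((- cball (0::'a) R') \<times> ball (0::'b) (R + 2))" by (intro open_Times open_Compl closed_cball open_ball)
   show "(y, w) \<in> (- cball 0 R') \<times> ball 0 (R + 2)" using False w by simp
   show "0 = ?D x b" if "x \<in> (- cball 0 R') \<times> ball 0 (R + 2)" for x
    using that 0[of "snd x" "fst x"] by (auto simp: not_le)
  qed simp
  then have "?D2 b (y, w) = (\<lambda>v. 0)" by (rule frechet_derivative_at[symmetric])
  then show ?thesis using A(1)[of b] by simp
 qed
 have D2: "\<bar>?D2 e (y, w) v\<bar> \<le> B * norm e * norm v" if w: "norm w \<le> R + 1" for e y w v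
 proof -
  have eq: "(\<lambda>x. ?D x e) = (\<lambda>x. \<Sum>b\<in>Basis. (e \<bullet> b) *\<^sub>R ?D x b)"
   using has_derivative_basis[OF smooth_D(1)[OF \<Psi>]] by blast
  have "((\<lambda>x. ?D x e) has_derivative (\<lambda>v. \<Sum>b\<in>Basis. (e \<bullet> b) *\<^sub>R ?D2 b (y, w) v)) (at (y, w))"
   unfolding eq by (intro has_derivative_sum has_derivative_scaleR_right smooth_D(1) sD)
  from frechet_derivative_at[OF this, symmetric]
  have "?D2 e (y, w) v = (\<Sum>b\<in>Basis. (e \<bullet> b) *\<^sub>R ?D2 b (y, w) v)" by simp
  also have "\<bar>\<dots>\<bar> \<le> (\<Sum>b\<in>Basis. A b * norm e * norm v)"
  proof (rule order_trans[OF sum_abs sum_mono])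
   fix b :: "'a \<times> 'b" assume "b \<in> Basis"
   then have "\<bar>e \<bullet> b\<bar> \<le> norm e" by (rule Basis_le_norm)
   then have "\<bar>e \<bullet> b\<bar> * \<bar>?D2 b (y, w) v\<bar> \<le> norm e * (A b * norm v)"
    using D2b[OF w] by (intro mult_mono) auto
   then show "\<bar>(e \<bullet> b) *\<^sub>R ?D2 b (y, w) v\<bar> \<le> A b * norm e * norm v" by (simp add: abs_mult mult.commute mult.left_commute)
  qed
  also have "\<dots> = B * norm e * norm v" by (simp add: B_def sum_distrib_right)
  finally show ?thesis .
 qed
 have Lip: "\<bar>?D (y, p) e - ?D (y, w) e\<bar> \<le> B * norm e * norm (w - p)"
  if w: "norm w \<le> R + 1" "norm p \<le> R + 1" for y w p e
 proof -
  have "norm (?D (y, p) e - ?D (y, w) e) \<le> (B * norm e) * norm (p - w)"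
  proof (rule smooth_mean_value[where f="\<lambda>t. ?D (y, t) e"])
   show "smooth (\<lambda>t. ?D (y, t) e)" by (rule smooth_partial(4)[OF sD])
   show "convex (cball (0::'b) (R + 1))" by simp
   fix t v assume t: "t \<in> cball (0::'b) (R + 1)"
   have "\<D> (\<lambda>t. ?D (y, t) e) t v = ?D2 e (y, t) (0, v)"
    using frechet_derivative_at[OF smooth_partial(2)[OF sD[of e]], of y t, symmetric] by simp
   then show "norm (\<D> (\<lambda>t. ?D (y, t) e) t v) \<le> B * norm e * norm v"
    using D2[of t e y "(0, v)"] t by simp
  qed (use w in auto)
  then show ?thesis by (simp add: norm_minus_commute)
 qed
 show thesis
 proof (rule that[OF B0 D2 Lip])
  fix y :: 'a and w p :: 'b assume w: "norm w \<le> R + 1" "norm p \<le> R + 1"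
  define F where "F t = \<Psi> (y, t) - ?D (y, p) (0, t)" for t
  have bl: "bounded_linear (\<lambda>t. ?D (y, p) (0, t))"
   by (intro bounded_linear_compose[OF smooth_D(6)[OF \<Psi>]] bounded_linear_Pair bounded_linear_zero bounded_linear_ident)
  have sF: "smooth F" unfolding F_def[abs_def]
   by (intro smooth_diff smooth_partial(4)[OF \<Psi>] smooth_linear bl)
  have DF: "\<D> F t v = ?D (y, t) (0, v) - ?D (y, p) (0, v)" for t v
  proof -
   have "(F has_derivative (\<lambda>v. ?D (y, t) (0, v) - ?D (y, p) (0, v))) (at t)"
    unfolding F_def[abs_def]
    by (intro has_derivative_diff smooth_partial(2)[OF \<Psi>] bounded_linear_imp_has_derivative bl)
   from frechet_derivative_at[OF this, symmetric] show ?thesis by simp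
  qed
  have "norm (F p - F w) \<le> (B * norm (w - p)) * norm (p - w)"
  proof (rule smooth_mean_value[OF sF])
   show "convex (cball (0::'b) (R + 1) \<inter> cball p (norm (w - p)))" by (intro convex_Int convex_cball)
   fix t v assume t: "t \<in> cball (0::'b) (R + 1) \<inter> cball p (norm (w - p))"
   have "\<bar>?D (y, t) (0, v) - ?D (y, p) (0, v)\<bar> \<le> B * norm (0::'a, v) * norm (p - t)"
    using t w by (intro Lip) auto
   also have "\<dots> \<le> B * norm v * norm (w - p)"
    using t B0 by (intro mult_mono) (auto simp: dist_norm)
   finally show "norm (\<D> F t v) \<le> B * norm (w - p) * norm v"
    unfolding DF by (simp add: mult.commute mult.left_commute)
  qed (use w in \<open>auto simp: dist_norm norm_minus_commute\<close>)
  moreover have "F p - F w = \<Psi> (y, p) + ?D (y, p) (0, w - p) - \<Psi> (y, w)"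
   unfolding F_def using linear_diff[OF bounded_linear.linear[OF bl], of w p] by simp
  ultimately show "\<bar>\<Psi> (y, p) + ?D (y, p) (0, w - p) - \<Psi> (y, w)\<bar> \<le> B * norm (w - p) * norm (w - p)"
   by (simp add: norm_minus_commute)
 qed
qed

text \<open>Interpolating with the first order Taylor polynomials in the second variable, instead of
 the values only, yields convergence of the first derivatives as well. Each summand is
 a product of a function of the first variable and one of the second.\<close>

lemma tensor_approximation:
 fixes \<Psi> :: "'a::euclidean_space \<times> (real^'k) \<Rightarrow> real"
 assumes \<Psi>: "smooth \<Psi>" and R: "0 \<le> R" and R': "0 \<le> R'"
  and 0: "\<And>y w. norm w < R + 2 \<Longrightarrow> R' < norm y \<Longrightarrow> \<D> \<Psi> (y, w) = (\<lambda>v. 0)"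
 obtains I :: "nat \<Rightarrow> (('k \<Rightarrow> int) \<times> 'k option) set" and \<alpha> :: "nat \<Rightarrow> (('k \<Rightarrow> int) \<times> 'k option) \<Rightarrow> 'a \<Rightarrow> real"
  and \<beta> :: "nat \<Rightarrow> (('k \<Rightarrow> int) \<times> 'k option) \<Rightarrow> real^'k \<Rightarrow> real" and C :: real and n0 :: nat
 where "\<And>n. finite (I n)" "\<And>n i. smooth (\<alpha> n i)" "\<And>n i. smooth (\<beta> n i)" "0 \<le> C" "0 < n0"
  "\<And>n i y. i \<in> I n \<Longrightarrow> R' < norm y \<Longrightarrow> \<D> (\<alpha> n i) y = (\<lambda>v. 0)"
  "\<And>n y w. n0 \<le> n \<Longrightarrow> norm w \<le> R \<Longrightarrow> \<bar>(\<Sum>i\<in>I n. \<alpha> n i y * \<beta> n i w) - \<Psi> (y, w)\<bar> \<le> C / real n"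
  "\<And>n y w u v. n0 \<le> n \<Longrightarrow> norm w \<le> R \<Longrightarrow>
    \<bar>(\<Sum>i\<in>I n. \<D> (\<alpha> n i) y u * \<beta> n i w + \<alpha> n i y * \<D> (\<beta> n i) w v)
     - \<D> \<Psi> (y, w) (u, v)\<bar> \<le> C * (norm u + norm v) / real n"
proof -
 let ?D = "\<lambda>x. \<D> \<Psi> x"
 let ?D2 = "\<lambda>e x. \<D> (\<lambda>x. ?D x e) x"
 note sD = smooth_D(2)[OF \<Psi>]
 obtain B where B: "0 \<le> B"
  "\<And>y w e v. norm w \<le> R + 1 \<Longrightarrow> \<bar>?D2 e (y, w) v\<bar> \<le> B * norm e * norm v"
  "\<And>y w p e. norm w \<le> R + 1 \<Longrightarrow> norm p \<le> R + 1 \<Longrightarrow>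
    \<bar>?D (y, p) e - ?D (y, w) e\<bar> \<le> B * norm e * norm (w - p)"
  "\<And>y w p. norm w \<le> R + 1 \<Longrightarrow> norm p \<le> R + 1 \<Longrightarrow>
    \<bar>\<Psi> (y, p) + ?D (y, p) (0, w - p) - \<Psi> (y, w)\<bar> \<le> B * norm (w - p) * norm (w - p)"
  by (rule second_order_bounds[OF \<Psi> R R' 0]) (assumption, assumption, rule that)
 obtain A where A: "0 \<le> A"
  "\<And>q (x :: real^'k) v. \<bar>\<D> (cell q) x v\<bar> \<le> A * norm v * of_bool (near q x)"
  by (rule cell_derivative_bound) (rule that)
 define d where "d = real CARD('k)"
 have d: "0 \<le> d" by (simp add: d_def)
 define c where "c n q w = cell q (real n *\<^sub>R w)" for n q and w :: "real^'k"
 let ?Dc = "\<lambda>n q w. \<D> (c n q) w"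
 define p where "p n q = (1 / real n) *\<^sub>R (lattice_point q :: real^'k)" for n :: nat and q
 \<comment> \<open>Only lattice points with \<open>norm (p n q) \<le> R + 1\<close> are used, where the derivative of \<open>\<Psi>\<close> is controlled;
  for large \<open>n\<close> they include all those whose cells meet the ball of radius \<open>R\<close>.\<close>
 define J where "J n = {q \<in> lattice_box (n\<^sup>2). norm (p n q) \<le> R + 1}" for n
 \<comment> \<open>The index \<open>None\<close> stands for the value of the Taylor polynomial at the lattice point, \<open>Some j\<close> for the
  \<open>j\<close>-th summand of its linear part.\<close>
 define I where "I n = J n \<times> (UNIV :: 'k option set)" for n
 define \<alpha> where "\<alpha> n i y = (case snd i of None \<Rightarrow> \<Psi> (y, p n (fst i)) | Some j \<Rightarrow> ?D (y, p n (fst i)) (0, axis j 1))" for n i y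
 define \<beta> where "\<beta> n i w = (case snd i of None \<Rightarrow> c n (fst i) w | Some j \<Rightarrow> c n (fst i) w * (w - p n (fst i)) $ j)" for n i w
 have sc: "smooth (c n q)" for n q unfolding c_def[abs_def] by (rule smooth_scaled_cell)
 have J: "finite (J n)" for n unfolding J_def by simp
 have \<alpha>N: "\<alpha> n (q, None) = (\<lambda>y. \<Psi> (y, p n q))" and \<alpha>S: "\<alpha> n (q, Some j) = (\<lambda>y. ?D (y, p n q) (0, axis j 1))"
  and \<beta>N: "\<beta> n (q, None) = c n q" and \<beta>S: "\<beta> n (q, Some j) = (\<lambda>w. c n q w * (w - p n q) $ j)" for n q j
  by (auto simp: \<alpha>_def \<beta>_def)
 have D\<alpha>N: "\<D> (\<alpha> n (q, None)) y = (\<lambda>u. ?D (y, p n q) (u, 0))" for n q y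
  unfolding \<alpha>N by (rule frechet_derivative_at[OF smooth_partial(1)[OF \<Psi>], symmetric])
 have D\<alpha>S: "\<D> (\<alpha> n (q, Some j)) y = (\<lambda>u. ?D2 (0, axis j 1) (y, p n q) (u, 0))" for n q y j
  unfolding \<alpha>S by (rule frechet_derivative_at[OF smooth_partial(1)[OF sD], symmetric])
 have D\<beta>S: "\<D> (\<beta> n (q, Some j)) w = (\<lambda>v. c n q w * v $ j + ?Dc n q w v * (w - p n q) $ j)" for n q w j
 proof -
  have "((\<lambda>w. (w - p n q) $ j) has_derivative (\<lambda>v. v $ j)) (at w)"
   by (auto intro!: derivative_eq_intros bounded_linear.has_derivative[OF bounded_linear_vec_nth])
  then show ?thesis unfolding \<beta>S
   by (intro frechet_derivative_at[OF has_derivative_mult[OF smooth_D(1)[OF sc]], symmetric])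
 qed
 have sumI: "(\<Sum>i\<in>I n. t i) = (\<Sum>q\<in>J n. t (q, None) + (\<Sum>j\<in>UNIV. t (q, Some j)))" for n and t :: "_ \<Rightarrow> real"
 proof -
  have o: "(\<Sum>s\<in>UNIV. t (q, s)) = t (q, None) + (\<Sum>j\<in>UNIV. t (q, Some j))" for q
   unfolding UNIV_option_conv by (subst sum.insert) (auto simp: sum.reindex)
  have "(\<Sum>i\<in>I n. t i) = (\<Sum>q\<in>J n. \<Sum>s\<in>UNIV. t (q, s))" unfolding I_def by (simp add: sum.cartesian_product)
  then show ?thesis unfolding o .
 qed
 have lin: "(\<Sum>j\<in>UNIV. ?D x (0, axis j 1) * v $ j) = ?D x (0, v)" for x and v :: "real^'k"
 proof -
  have l: "linear (\<lambda>v. ?D x (0, v))"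
   by (intro bounded_linear.linear bounded_linear_compose[OF smooth_D(6)[OF \<Psi>]] bounded_linear_Pair bounded_linear_zero bounded_linear_ident)
  have "?D x (0, v) = ?D x (0, \<Sum>j\<in>UNIV. v $ j *\<^sub>R axis j 1)"
   using basis_expansion[of v] by (simp add: scalar_mult_eq_scaleR)
  also have "\<dots> = (\<Sum>j\<in>UNIV. v $ j *\<^sub>R ?D x (0, axis j 1))"
   using linear_sum[OF l, of "\<lambda>j. v $ j *\<^sub>R axis j 1" UNIV] linear_scale[OF l] by simp
  finally show ?thesis by (simp add: mult.commute)
 qed
 define E where "E n q y w = \<Psi> (y, p n q) + ?D (y, p n q) (0, w - p n q)" for n q y w
 have lin2: "(\<Sum>j\<in>UNIV. ?D x (0, axis j 1) * (a * v $ j)) = a * ?D x (0, v)" for x a and v :: "real^'k"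
 proof -
  have "(\<Sum>j\<in>UNIV. ?D x (0, axis j 1) * (a * v $ j)) = (\<Sum>j\<in>UNIV. a * (?D x (0, axis j 1) * v $ j))"
   by (simp only: mult.left_commute)
  also have "\<dots> = a * (\<Sum>j\<in>UNIV. ?D x (0, axis j 1) * v $ j)" by (rule sum_distrib_left[symmetric])
  finally show ?thesis by (simp only: lin)
 qed
 have sum1: "(\<Sum>i\<in>I n. \<alpha> n i y * \<beta> n i w) = (\<Sum>q\<in>J n. c n q w * E n q y w)" for n y w
  unfolding sumI \<alpha>N \<alpha>S \<beta>N \<beta>S E_def lin2
  by (intro sum.cong refl) (simp only: distrib_left mult.commute)
 define e1 where "e1 n q y w u v = ?D (y, p n q) (u, v)
   + (\<Sum>j\<in>UNIV. (w - p n q) $ j * ?D2 (0, axis j 1) (y, p n q) (u, 0))" for n q y w u v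
 have split: "?D x (u, v) = ?D x (u, 0) + ?D x (0, v)" for x u v
  using linear_add[OF smooth_D(5)[OF \<Psi>], of x "(u, 0)" "(0, v)"] by simp
 have sum2: "(\<Sum>i\<in>I n. \<D> (\<alpha> n i) y u * \<beta> n i w + \<alpha> n i y * \<D> (\<beta> n i) w v)
   = (\<Sum>q\<in>J n. c n q w * e1 n q y w u v + ?Dc n q w v * E n q y w)" for n y w u v
  unfolding sumI
 proof (rule sum.cong[OF refl])
  fix q
  let ?a = "c n q w" and ?b = "?Dc n q w v" and ?p = "(y, p n q)"
  have "(\<Sum>j\<in>UNIV. \<D> (\<alpha> n (q, Some j)) y u * \<beta> n (q, Some j) w
     + \<alpha> n (q, Some j) y * \<D> (\<beta> n (q, Some j)) w v)
   = (\<Sum>j\<in>UNIV. ?a * ((w - p n q) $ j * ?D2 (0, axis j 1) ?p (u, 0)))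
    + (\<Sum>j\<in>UNIV. ?D ?p (0, axis j 1) * (?a * v $ j)) + (\<Sum>j\<in>UNIV. ?D ?p (0, axis j 1) * (?b * (w - p n q) $ j))"
   unfolding D\<alpha>S D\<beta>S unfolding \<alpha>S \<beta>S sum.distrib[symmetric]
   by (intro sum.cong refl) (simp only: distrib_left mult.commute mult.left_commute add.assoc)
  also have "\<dots> = ?a * (\<Sum>j\<in>UNIV. (w - p n q) $ j * ?D2 (0, axis j 1) ?p (u, 0))
    + ?a * ?D ?p (0, v) + ?b * ?D ?p (0, w - p n q)"
   unfolding lin2 sum_distrib_left[symmetric] ..
  finally show "\<D> (\<alpha> n (q, None)) y u * \<beta> n (q, None) w
     + \<alpha> n (q, None) y * \<D> (\<beta> n (q, None)) w v
    + (\<Sum>j\<in>UNIV. \<D> (\<alpha> n (q, Some j)) y u * \<beta> n (q, Some j) w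
     + \<alpha> n (q, Some j) y * \<D> (\<beta> n (q, Some j)) w v)
   = ?a * e1 n q y w u v + ?b * E n q y w"
   unfolding D\<alpha>N \<beta>N unfolding \<alpha>N E_def e1_def split[of _ u v] by (simp only: algebra_simps)
 qed
 obtain n1 :: nat where n1: "max d (R + 1) < real n1" using reals_Archimedean2 by blast
 define C where "C = 3^CARD('k) * (B * d * d + B * d + d * d * B + A * B * d * d)"
 have key: "\<bar>(\<Sum>i\<in>I n. \<alpha> n i y * \<beta> n i w) - \<Psi> (y, w)\<bar> \<le> C / real n \<and>
    \<bar>(\<Sum>i\<in>I n. \<D> (\<alpha> n i) y u * \<beta> n i w + \<alpha> n i y * \<D> (\<beta> n i) w v)
     - ?D (y, w) (u, v)\<bar> \<le> C * (norm u + norm v) / real n"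
  if n: "max n1 1 \<le> n" and w: "norm w \<le> R" for n y w u v
 proof -
  define h where "h = d / real n"
  have n': "0 < real n" "0 < n" "1 \<le> real n" "real n1 \<le> real n" using n by auto
  have h: "0 \<le> h" "h \<le> 1" using d n' n1 by (auto simp: h_def)
  have wn: "norm w < real n" using w n1 n' by linarith
  have w1: "norm w \<le> R + 1" using w by simp
  have near_p: "norm (w - p n q) \<le> h" if "near q (real n *\<^sub>R w)" for q
   unfolding p_def h_def d_def by (rule near_dist[OF that n'(2)])
  have near_R: "norm (p n q) \<le> R + 1" if "near q (real n *\<^sub>R w)" for q
   using near_p[OF that] norm_triangle_ineq4[of w "w - p n q"] w h by simp
  have ca: "\<bar>c n q w\<bar> \<le> 1 * of_bool (near q (real n *\<^sub>R w))" for q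
   using cell_abs[of q "real n *\<^sub>R w"] by (simp add: c_def)
  have Dca: "\<bar>?Dc n q w v\<bar> \<le> (real n * (A * norm v)) * of_bool (near q (real n *\<^sub>R w))" for q
   using A(2)[of q "real n *\<^sub>R w" v] n'
   unfolding c_def[abs_def] scaled_cell_derivative by (simp add: abs_mult mult.assoc)
  have off: "c n q w = 0 \<and> ?Dc n q w v = 0" if "q \<in> lattice_box (n\<^sup>2) - J n" for q
  proof -
   have "\<not> near q (real n *\<^sub>R w)" using that near_R[of q] by (auto simp: J_def)
   then show ?thesis using ca[of q] Dca[of q] by simp
  qed
  have sub: "J n \<subseteq> lattice_box (n\<^sup>2)" by (auto simp: J_def)
  have s1: "(\<Sum>q\<in>lattice_box (n\<^sup>2). c n q w) = 1" unfolding c_def by (rule sum_scaled_cell(1)[OF wn])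
  have s0: "(\<Sum>q\<in>lattice_box (n\<^sup>2). ?Dc n q w v) = 0"
   unfolding c_def[abs_def] by (rule sum_scaled_cell(2)[OF wn])
  have Eb: "\<bar>E n q y w - \<Psi> (y, w)\<bar> \<le> B * h * h" if "near q (real n *\<^sub>R w)" for q
  proof -
   have "\<bar>E n q y w - \<Psi> (y, w)\<bar> \<le> B * norm (w - p n q) * norm (w - p n q)"
    unfolding E_def by (rule B(4)[OF w1 near_R[OF that]])
   also have "\<dots> \<le> B * h * h" using near_p[OF that] B(1) h by (intro mult_mono) auto
   finally show ?thesis .
  qed
  have Bhh: "0 \<le> B * h * h" using B(1) h by simp
  have J1: "(\<Sum>q\<in>J n. c n q w * E n q y w) = (\<Sum>q\<in>lattice_box (n\<^sup>2). c n q w * E n q y w)"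
   by (rule sum.mono_neutral_left[OF finite_lattice_box sub]) (use off in auto)
  have "(\<Sum>i\<in>I n. \<alpha> n i y * \<beta> n i w) - \<Psi> (y, w) = (\<Sum>q\<in>lattice_box (n\<^sup>2). c n q w * (E n q y w - \<Psi> (y, w)))"
   unfolding sum1 J1 right_diff_distrib sum_subtractf sum_distrib_right[symmetric] s1 by simp
  also have "\<bar>\<dots>\<bar> \<le> 1 * (B * h * h) * 3^CARD('k)"
   by (rule sum_near_le[where x="real n *\<^sub>R w", OF Eb ca _ Bhh]) auto
  also have "\<dots> = 3^CARD('k) * (B * h * h)" by simp
  also have "\<dots> \<le> C / real n"
  proof -
   have "h * h \<le> d * d / real n"
   proof -
    have "h * h = d * d / (real n * real n)" by (simp add: h_def)
    also have "\<dots> \<le> d * d / real n"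
     using d n' mult_left_mono[OF n'(3), of "real n"] by (intro divide_left_mono) auto
    finally show ?thesis .
   qed
   then have "3^CARD('k) * (B * (h * h)) \<le> 3^CARD('k) * (B * (d * d / real n))"
    using B(1) by (intro mult_left_mono) auto
   also have "\<dots> = 3^CARD('k) * (B * d * d) / real n" by simp
   also have "\<dots> \<le> C / real n"
    unfolding C_def using A(1) B(1) d n' by (intro divide_right_mono mult_left_mono) auto
   finally show ?thesis by (simp add: mult.assoc)
  qed
  finally have first: "\<bar>(\<Sum>i\<in>I n. \<alpha> n i y * \<beta> n i w) - \<Psi> (y, w)\<bar> \<le> C / real n" .
  have e1b: "\<bar>e1 n q y w u v - ?D (y, w) (u, v)\<bar> \<le> B * (norm u + norm v) * h + d * h * (B * norm u)"
   if q: "near q (real n *\<^sub>R w)" for q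
  proof -
   have "\<bar>?D (y, p n q) (u, v) - ?D (y, w) (u, v)\<bar> \<le> B * norm (u, v) * norm (w - p n q)"
    by (rule B(3)[OF w1 near_R[OF q]])
   also have "\<dots> \<le> B * (norm u + norm v) * h"
    using near_p[OF q] norm_Pair_le[of u v] B(1) h by (intro mult_mono) auto
   finally have 1: "\<bar>?D (y, p n q) (u, v) - ?D (y, w) (u, v)\<bar> \<le> B * (norm u + norm v) * h" .
   have "\<bar>\<Sum>j\<in>UNIV. (w - p n q) $ j * ?D2 (0, axis j 1) (y, p n q) (u, 0)\<bar> \<le> (\<Sum>j\<in>(UNIV::'k set). h * (B * norm u))"
   proof (rule order_trans[OF sum_abs sum_mono])
    fix j
    have "\<bar>(w - p n q) $ j\<bar> \<le> h" using component_le_norm_cart[of "w - p n q" j] near_p[OF q] by linarith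
    moreover have "\<bar>?D2 (0, axis j 1) (y, p n q) (u, 0)\<bar> \<le> B * norm u"
     using B(2)[OF near_R[OF q], of "(0, axis j 1)" y "(u, 0)"] by (simp add: norm_axis_1)
    ultimately show "\<bar>(w - p n q) $ j * ?D2 (0, axis j 1) (y, p n q) (u, 0)\<bar> \<le> h * (B * norm u)"
     unfolding abs_mult using h by (intro mult_mono) auto
   qed
   also have "\<dots> = d * h * (B * norm u)" by (simp add: d_def)
   finally show ?thesis using 1 unfolding e1_def by linarith
  qed
  have e10: "0 \<le> B * (norm u + norm v) * h + d * h * (B * norm u)" using B(1) h d by simp
  have J2: "(\<Sum>q\<in>J n. c n q w * e1 n q y w u v + ?Dc n q w v * E n q y w)
    = (\<Sum>q\<in>lattice_box (n\<^sup>2). c n q w * e1 n q y w u v + ?Dc n q w v * E n q y w)"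
   by (rule sum.mono_neutral_left[OF finite_lattice_box sub]) (use off in auto)
  have "(\<Sum>i\<in>I n. \<D> (\<alpha> n i) y u * \<beta> n i w + \<alpha> n i y * \<D> (\<beta> n i) w v)
     - ?D (y, w) (u, v)
    = (\<Sum>q\<in>lattice_box (n\<^sup>2). c n q w * (e1 n q y w u v - ?D (y, w) (u, v)))
     + (\<Sum>q\<in>lattice_box (n\<^sup>2). ?Dc n q w v * (E n q y w - \<Psi> (y, w)))"
   unfolding sum2 J2 unfolding right_diff_distrib sum_subtractf sum.distrib sum_distrib_right[symmetric] s1 s0 by simp
  also have "\<bar>\<dots>\<bar> \<le> 1 * (B * (norm u + norm v) * h + d * h * (B * norm u)) * 3^CARD('k)
     + (real n * (A * norm v)) * (B * h * h) * 3^CARD('k)"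
  proof (rule order_trans[OF abs_triangle_ineq add_mono])
   show "\<bar>\<Sum>q\<in>lattice_box (n\<^sup>2). c n q w * (e1 n q y w u v - ?D (y, w) (u, v))\<bar>
     \<le> 1 * (B * (norm u + norm v) * h + d * h * (B * norm u)) * 3^CARD('k)"
    by (rule sum_near_le[where x="real n *\<^sub>R w", OF e1b ca _ e10]) auto
   show "\<bar>\<Sum>q\<in>lattice_box (n\<^sup>2). ?Dc n q w v * (E n q y w - \<Psi> (y, w))\<bar>
     \<le> (real n * (A * norm v)) * (B * h * h) * 3^CARD('k)"
    by (rule sum_near_le[where x="real n *\<^sub>R w", OF Eb Dca _ Bhh]) (use A(1) in auto)
  qed
  also have "\<dots> = 3^CARD('k) * ((norm u + norm v) * (B * d) + norm u * (d * d * B) + norm v * (A * B * d * d)) / real n"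
   using n' by (simp add: h_def field_simps)
  also have "\<dots> \<le> 3^CARD('k) * ((norm u + norm v) * (B * d) + (norm u + norm v) * (d * d * B) + (norm u + norm v) * (A * B * d * d)) / real n"
   using A(1) B(1) d n' by (intro divide_right_mono mult_left_mono add_mono mult_right_mono) auto
  also have "\<dots> = (3^CARD('k) * (B * d + d * d * B + A * B * d * d)) * (norm u + norm v) / real n"
   by (simp add: algebra_simps)
  also have "\<dots> \<le> C * (norm u + norm v) / real n"
   unfolding C_def using A(1) B(1) d n' by (intro divide_right_mono mult_right_mono mult_left_mono) auto
  finally show ?thesis using first by blast
 qed
 show thesis
 proof (rule that[of I \<alpha> \<beta> C "max n1 1"])
  show "finite (I n)" for n using J by (simp add: I_def)
  show "smooth (\<alpha> n i)" for n i
  proof (cases i)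
   case (Pair q s)
   show ?thesis unfolding Pair by (cases s) (auto simp: \<alpha>N \<alpha>S intro: smooth_partial(3) \<Psi> sD)
  qed
  show "smooth (\<beta> n i)" for n i
  proof (cases i)
   case (Pair q s)
   have "smooth (\<lambda>w. (w - p n q) $ j)" for j
    by (intro smooth_compose[OF smooth_linear[OF bounded_linear_vec_nth]] smooth_diff smooth_ident smooth_const)
   then show ?thesis unfolding Pair by (cases s) (auto simp: \<beta>N \<beta>S intro: smooth_mult sc)
  qed
  show "0 \<le> C" unfolding C_def using A(1) B(1) d by simp
  show "0 < max n1 1" by simp
  show "\<D> (\<alpha> n i) y = (\<lambda>v. 0)" if "i \<in> I n" "R' < norm y" for n i y
  proof (cases i)
   case (Pair q s)
   then have pR: "norm (p n q) < R + 2" using that(1) by (auto simp: I_def J_def)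
   show ?thesis
   proof (cases s)
    case None
    then show ?thesis unfolding Pair None D\<alpha>N using 0[OF pR that(2)] by simp
   next
    case (Some j)
    have "((\<lambda>y. ?D (y, p n q) (0, axis j 1)) has_derivative (\<lambda>v. 0)) (at y)"
     by (rule has_derivative_transform_within_open[where f="\<lambda>_. 0" and s="- cball 0 R'"])
       (use that(2) 0[OF pR] in auto)
    then show ?thesis unfolding Pair Some \<alpha>S by (rule frechet_derivative_at[symmetric])
   qed
  qed
  show "\<bar>(\<Sum>i\<in>I n. \<alpha> n i y * \<beta> n i w) - \<Psi> (y, w)\<bar> \<le> C / real n" if "max n1 1 \<le> n" "norm w \<le> R" for n y w
   using key[OF that] by blast
  show "\<bar>(\<Sum>i\<in>I n. \<D> (\<alpha> n i) y u * \<beta> n i w + \<alpha> n i y * \<D> (\<beta> n i) w v)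
     - ?D (y, w) (u, v)\<bar> \<le> C * (norm u + norm v) / real n" if "max n1 1 \<le> n" "norm w \<le> R" for n y w u v
   using key[OF that] by blast
 qed
qed


section \<open>Almost everywhere convergent selections\<close>

text \<open>In a decreasing sequence of midpoint convex classes, elements that nearly minimise
 a quadratic form are close to each other by the parallelogram law.\<close>

lemma nearly_minimising_sequence:
 fixes \<G> :: "nat \<Rightarrow> 'v set" and Q :: "'v \<Rightarrow> real" and D :: "'v \<Rightarrow> 'v \<Rightarrow> real" and mid :: "'v \<Rightarrow> 'v \<Rightarrow> 'v"
 assumes ne: "\<And>k. \<G> k \<noteq> {}" and dec: "\<And>k. \<G> (Suc k) \<subseteq> \<G> k"
  and mid: "\<And>k x y. x \<in> \<G> k \<Longrightarrow> y \<in> \<G> k \<Longrightarrow> mid x y \<in> \<G> k"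
  and Q0: "\<And>x. 0 \<le> Q x" and QB: "\<And>x. x \<in> \<G> 0 \<Longrightarrow> Q x \<le> B"
  and para: "\<And>x y. x \<in> \<G> 0 \<Longrightarrow> y \<in> \<G> 0 \<Longrightarrow> Q (mid x y) + D x y = (Q x + Q y) / 2"
 obtains x where "\<And>k. x k \<in> \<G> k" "\<And>k. D (x k) (x (Suc k)) \<le> (1/4)^k"
proof -
 have dec': "\<G> k \<subseteq> \<G> j" if "j \<le> k" for j k using that lift_Suc_antimono_le[of \<G>, OF dec] by blast
 define I where "I k = Inf (Q ` \<G> k)" for k
 have bb: "bdd_below (Q ` \<G> k)" for k using Q0 by (intro bdd_belowI[of _ 0]) auto
 have I_le: "I k \<le> Q x" if "x \<in> \<G> k" for k x
  unfolding I_def using that bb by (intro cINF_lower) auto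
 have "incseq I"
 proof (rule incseq_SucI)
  show "I k \<le> I (Suc k)" for k unfolding I_def
   using ne dec bb by (intro cInf_superset_mono) auto
 qed
 moreover have IB: "I k \<le> B" for k
 proof -
  obtain x where "x \<in> \<G> k" using ne by blast
  moreover then have "x \<in> \<G> 0" using dec'[of 0 k] by auto
  ultimately show ?thesis using I_le QB by (meson order_trans)
 qed
 ultimately obtain L where L: "I \<longlonglongrightarrow> L" "\<And>k. I k \<le> L"
  using incseq_convergent[of I B] by blast
 have "\<exists>N. \<forall>k\<ge>N. L - (1/4)^i / 2 < I k" for i
  using order_tendstoD(1)[OF L(1), of "L - (1/4)^i / 2"] by (auto simp: eventually_sequentially)
 then obtain N where N: "\<And>i k. N i \<le> k \<Longrightarrow> L - (1/4)^i / 2 < I k" by metis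
 \<comment> \<open>Any increasing choice with values at least \<open>i\<close> and \<open>N i\<close> will do; there, the infima differ from their limit by
  less than \<open>4\<^sup>-\<^sup>i / 2\<close>.\<close>
 define \<kappa> where "\<kappa> i = i + (\<Sum>j\<le>i. N j)" for i
 have \<kappa>: "i \<le> \<kappa> i" "N i \<le> \<kappa> i" "\<kappa> i \<le> \<kappa> (Suc i)" for i
  using member_le_sum[of i "{..i}" N] by (auto simp: \<kappa>_def)
 have "\<exists>x\<in>\<G> (\<kappa> i). Q x < I (\<kappa> i) + (1/4)^i / 2" for i
 proof -
  have "Inf (Q ` \<G> (\<kappa> i)) < I (\<kappa> i) + (1/4)^i / 2" by (simp add: I_def)
  then show ?thesis using cInf_lessD[of "Q ` \<G> (\<kappa> i)"] ne by blast
 qed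
 then obtain x where x: "\<And>i. x i \<in> \<G> (\<kappa> i)" "\<And>i. Q (x i) < I (\<kappa> i) + (1/4)^i / 2" by metis
 show thesis
 proof (rule that)
  show "x k \<in> \<G> k" for k using x(1)[of k] dec'[OF \<kappa>(1)[of k]] by blast
  show "D (x k) (x (Suc k)) \<le> (1/4)^k" for k
  proof -
   have a: "x k \<in> \<G> (\<kappa> k)" "x (Suc k) \<in> \<G> (\<kappa> k)"
    using x(1)[of k] x(1)[of "Suc k"] dec'[OF \<kappa>(3)[of k]] by auto
   have b: "x k \<in> \<G> 0" "x (Suc k) \<in> \<G> 0" using a dec'[of 0 "\<kappa> k"] by auto
   have "I (\<kappa> k) \<le> Q (mid (x k) (x (Suc k)))" by (rule I_le[OF mid[OF a]])
   moreover have "L - (1/4)^k / 2 < I (\<kappa> k)" by (rule N[OF \<kappa>(2)])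
   moreover have "Q (x k) < L + (1/4)^k / 2" using x(2)[of k] L(2)[of "\<kappa> k"] by linarith
   moreover have "Q (x (Suc k)) < L + (1/4)^Suc k / 2" using x(2)[of "Suc k"] L(2)[of "\<kappa> (Suc k)"] by linarith
   moreover have "(1/4::real)^Suc k \<le> (1/4)^k" by simp
   moreover have "d \<le> e" if "i \<le> q" "l - e / 2 < i" "q1 < l + e / 2" "q2 < l + e' / 2" "e' \<le> e"
    "q + d = (q1 + q2) / 2" for d e e' i q q1 q2 l :: real
    using that by (simp add: field_simps)
   ultimately show ?thesis using para[OF b] by blast
  qed
 qed
qed

text \<open>Thus weak compactness is replaced by almost everywhere convergence: the classes may be
 taken so small that all their elements approximate a given map.\<close>

lemma AE_convergent_selection:
 fixes \<G> :: "nat \<Rightarrow> 'v set" and \<phi> :: "'v \<Rightarrow> 'a \<Rightarrow> 'b::euclidean_space"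
 assumes M: "finite_measure M"
  and ne: "\<And>k. \<G> k \<noteq> {}" and dec: "\<And>k. \<G> (Suc k) \<subseteq> \<G> k"
  and mid: "\<And>k x y. x \<in> \<G> k \<Longrightarrow> y \<in> \<G> k \<Longrightarrow> mid x y \<in> \<G> k"
  and meas: "\<And>x. x \<in> \<G> 0 \<Longrightarrow> \<phi> x \<in> borel_measurable M"
  and bound: "\<And>x z. x \<in> \<G> 0 \<Longrightarrow> z \<in> space M \<Longrightarrow> norm (\<phi> x z) \<le> 1"
  and lin: "\<And>x y z. x \<in> \<G> 0 \<Longrightarrow> y \<in> \<G> 0 \<Longrightarrow> \<phi> (mid x y) z = (1/2) *\<^sub>R (\<phi> x z + \<phi> y z)"
 obtains x where "\<And>k. x k \<in> \<G> k" "AE z in M. convergent (\<lambda>k. \<phi> (x k) z)"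
proof -
 interpret finite_measure M by (rule M)
 define Q where "Q x = (\<integral>z. (norm (\<phi> x z))\<^sup>2 \<partial>M)" for x
 \<comment> \<open>The quantities \<open>Q\<close> and \<open>D\<close> satisfy the parallelogram identity \<open>para\<close> required for near minimisers.\<close>
 define D where "D x y = (\<integral>z. (norm ((1/2) *\<^sub>R (\<phi> x z - \<phi> y z)))\<^sup>2 \<partial>M)" for x y
 have Qint: "integrable M (\<lambda>z. (norm (\<phi> x z))\<^sup>2)" if "x \<in> \<G> 0" for x
 proof (rule integrable_const_bound[where B=1])
  show "AE z in M. norm ((norm (\<phi> x z))\<^sup>2) \<le> 1"
   using bound[OF that] by (intro AE_I2) (simp add: power_le_one)
  show "(\<lambda>z. (norm (\<phi> x z))\<^sup>2) \<in> borel_measurable M" using meas[OF that] by measurable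
 qed
 have Dint: "integrable M (\<lambda>z. (norm ((1/2) *\<^sub>R (\<phi> x z - \<phi> y z)))\<^sup>2)" if xy: "x \<in> \<G> 0" "y \<in> \<G> 0" for x y
 proof (rule integrable_const_bound[where B=1])
  show "AE z in M. norm ((norm ((1/2) *\<^sub>R (\<phi> x z - \<phi> y z)))\<^sup>2) \<le> 1"
  proof (rule AE_I2)
   fix z assume z: "z \<in> space M"
   have "norm (\<phi> x z - \<phi> y z) \<le> 2"
    using norm_triangle_ineq4[of "\<phi> x z" "\<phi> y z"] bound[OF xy(1) z] bound[OF xy(2) z] by linarith
   then show "norm ((norm ((1/2) *\<^sub>R (\<phi> x z - \<phi> y z)))\<^sup>2) \<le> 1" by (simp add: power_le_one)
  qed
  show "(\<lambda>z. (norm ((1/2) *\<^sub>R (\<phi> x z - \<phi> y z)))\<^sup>2) \<in> borel_measurable M"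
   using meas[OF xy(1)] meas[OF xy(2)] by measurable
 qed
 have Q0: "0 \<le> Q x" for x unfolding Q_def by (intro integral_nonneg_AE AE_I2) simp
 have QB: "Q x \<le> measure M (space M)" if "x \<in> \<G> 0" for x
 proof -
  have "Q x \<le> (\<integral>z. 1 \<partial>M)" unfolding Q_def
   using bound[OF that] by (intro integral_mono Qint that) (auto simp: power_le_one)
  then show ?thesis by simp
 qed
 have para: "Q (mid x y) + D x y = (Q x + Q y) / 2" if xy: "x \<in> \<G> 0" "y \<in> \<G> 0" for x y
 proof -
  have pt: "(norm (\<phi> (mid x y) z))\<^sup>2 + (norm ((1/2) *\<^sub>R (\<phi> x z - \<phi> y z)))\<^sup>2
    = (1/2) * (norm (\<phi> x z))\<^sup>2 + (1/2) * (norm (\<phi> y z))\<^sup>2" for z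
   unfolding lin[OF xy] power2_norm_eq_inner
   by (simp add: inner_add_left inner_add_right inner_diff_left inner_diff_right inner_commute field_simps)
  have "Q (mid x y) + D x y = (\<integral>z. (1/2) * (norm (\<phi> x z))\<^sup>2 + (1/2) * (norm (\<phi> y z))\<^sup>2 \<partial>M)"
   unfolding Q_def D_def pt[symmetric]
   by (rule Bochner_Integration.integral_add[symmetric, OF Qint[OF mid[OF xy]] Dint[OF xy]])
  also have "\<dots> = (Q x + Q y) / 2"
   unfolding Q_def using Qint[OF xy(1)] Qint[OF xy(2)] by (simp add: add_divide_distrib)
  finally show ?thesis .
 qed
 obtain x where x: "\<And>k. x k \<in> \<G> k" "\<And>k. D (x k) (x (Suc k)) \<le> (1/4)^k"
 proof (rule nearly_minimising_sequence[where \<G>=\<G> and Q=Q and D=D and mid=mid and B="measure M (space M)"])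
  show "\<G> k \<noteq> {}" for k by (rule ne)
  show "\<G> (Suc k) \<subseteq> \<G> k" for k by (rule dec)
  show "mid x y \<in> \<G> k" if "x \<in> \<G> k" "y \<in> \<G> k" for k x y by (rule mid[OF that])
  show "0 \<le> Q x" for x by (rule Q0)
  show "Q x \<le> measure M (space M)" if "x \<in> \<G> 0" for x by (rule QB[OF that])
  show "Q (mid x y) + D x y = (Q x + Q y) / 2" if "x \<in> \<G> 0" "y \<in> \<G> 0" for x y by (rule para[OF that])
 qed (rule that)
 have x0: "x k \<in> \<G> 0" for k
  using x(1)[of k] lift_Suc_antimono_le[of \<G>, OF dec, of 0 k] by auto
 note meas[OF x0, measurable]
 define d where "d k z = \<phi> (x (Suc k)) z - \<phi> (x k) z" for k z
 have [measurable]: "d k \<in> borel_measurable M" for k unfolding d_def[abs_def] by measurable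
 let ?m = "measure M (space M)"
 \<comment> \<open>The elementary inequality \<open>2 t \<le> 2\<^sup>k t\<^sup>2 + 2\<^sup>-\<^sup>k\<close> turns the summable \<open>L\<^sub>2\<close> bounds into summable
  \<open>L\<^sub>1\<close> bounds, as the measure is finite.\<close>
 have dk: "(\<integral>\<^sup>+z. ennreal (norm (d k z)) \<partial>M) \<le> ennreal ((1/2)^k * (2 + ?m))" for k
 proof -
  have int: "integrable M (\<lambda>z. 2 * 2^k * (norm ((1/2) *\<^sub>R (\<phi> (x k) z - \<phi> (x (Suc k)) z)))\<^sup>2 + (1/2)^k)"
   using Dint[OF x0 x0] by (intro Bochner_Integration.integrable_add integrable_mult_right) auto
  have "(\<integral>\<^sup>+z. ennreal (norm (d k z)) \<partial>M)
    \<le> (\<integral>\<^sup>+z. ennreal (2 * 2^k * (norm ((1/2) *\<^sub>R (\<phi> (x k) z - \<phi> (x (Suc k)) z)))\<^sup>2 + (1/2)^k) \<partial>M)"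
  proof (intro nn_integral_mono ennreal_leI)
   fix z
   define t where "t = norm (d k z)"
   have nt: "norm ((1/2) *\<^sub>R (\<phi> (x k) z - \<phi> (x (Suc k)) z)) = t / 2"
    unfolding t_def d_def by (simp add: norm_minus_commute)
   have e: "(1/2::real)^k = 1 / 2^k" by (simp add: power_one_over)
   have "0 \<le> (2^k * t - 1)\<^sup>2" by simp
   then have "2 * (2^k * t) \<le> (2^k * t)\<^sup>2 + 1" by (simp add: power2_eq_square algebra_simps)
   then have "2 * (2^k * t) / 2^k \<le> ((2^k * t)\<^sup>2 + 1) / 2^k" by (intro divide_right_mono) auto
   then have "2 * t \<le> 2^k * t\<^sup>2 + 1 / 2^k" by (simp add: power2_eq_square add_divide_distrib mult_ac)
   moreover have "2 * 2^k * (t / 2)\<^sup>2 = 2^k * t\<^sup>2 / 2" by (simp add: power_divide)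
   moreover have "0 \<le> 1 / (2::real)^k" by simp
   ultimately have "t \<le> 2 * 2^k * (t / 2)\<^sup>2 + 1 / 2^k" by linarith
   then show "norm (d k z) \<le> 2 * 2^k * (norm ((1/2) *\<^sub>R (\<phi> (x k) z - \<phi> (x (Suc k)) z)))\<^sup>2 + (1/2)^k"
    unfolding nt t_def[symmetric] e .
  qed
  also have "\<dots> = ennreal (\<integral>z. 2 * 2^k * (norm ((1/2) *\<^sub>R (\<phi> (x k) z - \<phi> (x (Suc k)) z)))\<^sup>2 + (1/2)^k \<partial>M)"
   by (intro nn_integral_eq_integral int AE_I2) simp
  also have "(\<integral>z. 2 * 2^k * (norm ((1/2) *\<^sub>R (\<phi> (x k) z - \<phi> (x (Suc k)) z)))\<^sup>2 + (1/2)^k \<partial>M)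
    = 2 * 2^k * D (x k) (x (Suc k)) + (1/2)^k * ?m"
   unfolding D_def using Dint[OF x0 x0]
   by (subst Bochner_Integration.integral_add) auto
  also have "\<dots> \<le> 2 * 2^k * (1/4)^k + (1/2)^k * ?m" using x(2)[of k] by simp
  also have "2 * 2^k * (1/4)^k + (1/2)^k * ?m = (1/2)^k * (2 + ?m)"
  proof -
   have "(2::real)^k * (1/4)^k = (1/2)^k" by (simp add: power_mult_distrib[symmetric])
   then show ?thesis by (simp add: algebra_simps)
  qed
  finally show ?thesis by (simp add: ennreal_leI)
 qed
 have "(\<integral>\<^sup>+z. (\<Sum>k. ennreal (norm (d k z))) \<partial>M) = (\<Sum>k. \<integral>\<^sup>+z. ennreal (norm (d k z)) \<partial>M)"
  by (rule nn_integral_suminf) measurable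
 also have "\<dots> \<le> (\<Sum>k. ennreal ((1/2)^k * (2 + ?m)))" by (intro suminf_le dk summableI)
 also have "\<dots> = ennreal (\<Sum>k. (1/2)^k * (2 + ?m))"
  by (intro suminf_ennreal2 summable_mult2 summable_geometric) auto
 also have "\<dots> < \<infinity>" by simp
 finally have "(\<integral>\<^sup>+z. (\<Sum>k. ennreal (norm (d k z))) \<partial>M) \<noteq> \<infinity>" by simp
 then have "AE z in M. (\<Sum>k. ennreal (norm (d k z))) \<noteq> \<infinity>"
  by (intro nn_integral_PInf_AE) measurable
 then have "AE z in M. convergent (\<lambda>k. \<phi> (x k) z)"
 proof eventually_elim
  case (elim z)
  then have "summable (\<lambda>k. norm (d k z))" by (intro summable_suminf_not_top) (auto simp: top_ennreal_def)
  then have "summable (\<lambda>k. d k z)" by (rule summable_norm_cancel)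
  then have "(\<lambda>n. \<Sum>k<n. d k z) \<longlonglongrightarrow> (\<Sum>k. d k z)" by (rule summable_LIMSEQ)
  moreover have "(\<Sum>k<n. d k z) = \<phi> (x n) z - \<phi> (x 0) z" for n
   unfolding d_def by (rule sum_lessThan_telescope)
  ultimately have "(\<lambda>n. \<phi> (x n) z - \<phi> (x 0) z) \<longlonglongrightarrow> (\<Sum>k. d k z)" by simp
  from tendsto_add[OF this tendsto_const[of "\<phi> (x 0) z"]] show ?case
   by (auto simp: convergent_def)
 qed
 with x(1) show thesis by (rule that)
qed

section \<open>Weak differentiability of locally Lipschitzian maps: smooth approximation\<close>

lemma borel_measurable_vec:
 fixes X :: "'a \<Rightarrow> 'b::euclidean_space ^ 'n"
 assumes "\<And>i. (\<lambda>z. X z $ i) \<in> borel_measurable M"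
 shows "X \<in> borel_measurable M"
proof (rule borel_measurable_euclidean_space[THEN iffD2], rule ballI)
 fix b :: "'b^'n" assume "b \<in> Basis"
 then obtain i u where b: "b = axis i u" unfolding Basis_vec_def by blast
 have "(\<lambda>z. X z $ i \<bullet> u) \<in> borel_measurable M"
  by (rule borel_measurable_inner[OF assms borel_measurable_const])
 then show "(\<lambda>z. X z \<bullet> b) \<in> borel_measurable M" unfolding b inner_axis .
qed

lemma blinfun_measurableI:
 fixes L :: "'a \<Rightarrow> 'n::finite \<Rightarrow> 'b::euclidean_space"
 assumes "\<And>i. (\<lambda>z. L z i) \<in> borel_measurable M"
 shows "(\<lambda>z. Blinfun (\<lambda>v::real^'n. \<Sum>i\<in>UNIV. v $ i *\<^sub>R L z i)) \<in> borel_measurable M"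
proof -
 define T where "T = (\<lambda>X :: 'b^'n. Blinfun (\<lambda>v::real^'n. \<Sum>i\<in>UNIV. v $ i *\<^sub>R X $ i))"
 have bl: "bounded_linear (\<lambda>v::real^'n. \<Sum>i\<in>UNIV. v $ i *\<^sub>R X $ i)" for X :: "'b^'n"
  by (intro bounded_linear_sum bounded_linear_scaleR_const bounded_linear_vec_nth)
 have "continuous_on UNIV T"
 proof (rule continuous_on_blinfun_componentwise)
  fix v :: "real^'n"
  show "continuous_on UNIV (\<lambda>X. blinfun_apply (T X) v)"
   unfolding T_def bounded_linear_Blinfun_apply[OF bl] by (intro continuous_intros)
 qed
 then have T: "T \<in> borel_measurable borel" by (rule borel_measurable_continuous_onI)
 have "(\<lambda>z. (\<chi> i. L z i) :: 'b^'n) \<in> borel_measurable M"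
  by (rule borel_measurable_vec) (use assms in simp)
 from measurable_compose[OF this T] show ?thesis by (simp add: T_def)
qed

lemma blinfun_apply_measurable:
 fixes F :: "'a \<Rightarrow> (real^'n) \<Rightarrow>\<^sub>L 'b::euclidean_space"
 assumes "F \<in> borel_measurable M" "\<theta> \<in> borel_measurable M"
 shows "(\<lambda>z. F z (\<theta> z)) \<in> borel_measurable M"
proof -
 have Fb: "(\<lambda>z. F z b) \<in> borel_measurable M" for b
 proof -
  have "(\<lambda>T :: (real^'n) \<Rightarrow>\<^sub>L 'b. blinfun_apply T b) \<in> borel_measurable borel"
   by (rule borel_measurable_continuous_onI) (intro continuous_intros)
  from measurable_compose[OF assms(1) this] show ?thesis .
 qed
 have "blinfun_apply (F z) (\<theta> z) = (\<Sum>b\<in>Basis. (\<theta> z \<bullet> b) *\<^sub>R blinfun_apply (F z) b)" for z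
  by (rule has_derivative_basis[OF bounded_linear_imp_has_derivative[OF blinfun.bounded_linear_right[of "F z"]]])
 then have eq: "(\<lambda>z. F z (\<theta> z)) = (\<lambda>z. \<Sum>b\<in>Basis. (\<theta> z \<bullet> b) *\<^sub>R F z b)" by (rule ext)
 show ?thesis unfolding eq
  by (intro borel_measurable_sum borel_measurable_scaleR borel_measurable_inner assms(2) borel_measurable_const Fb)
qed

text \<open>A compact set is covered by finitely many of the balls to which the local approximation
 applies; a single sequence serves for all of them.\<close>

lemma smooth_uniform_on_compact:
 fixes g :: "real^'n \<Rightarrow> real^'k"
 assumes g: "locally_lipschitz_on U g" and U: "open U"
 obtains G where "\<And>n. smooth (G n :: real^'n \<Rightarrow> real^'k)"
  "\<And>K. compact K \<Longrightarrow> K \<subseteq> U \<Longrightarrow> \<exists>n0 E. 0 < n0 \<and> 0 \<le> E \<and> (\<forall>n\<ge>n0. \<forall>x\<in>K. norm (G n x - g x) \<le> E / real n \<and>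
     (\<forall>v. norm (\<D> (G n) x v) \<le> E * norm v))"
proof -
 obtain G C where G: "\<And>n. smooth (G n :: real^'n \<Rightarrow> real^'k)" "0 \<le> C"
  "\<And>z r L. 0 < r \<Longrightarrow> L-lipschitz_on (ball z r) g \<Longrightarrow>
    \<exists>n0. \<forall>n\<ge>n0. 0 < n \<and> (\<forall>x\<in>ball z (r/2). norm (G n x - g x) \<le> C * L / real n \<and>
     (\<forall>v. norm (\<D> (G n) x v) \<le> C * L * norm v))"
  by (rule smooth_approximation[of g]) (rule that)
 define P where "P z r E n \<longleftrightarrow> 0 < n \<and> (\<forall>x\<in>ball z r. norm (G n x - g x) \<le> E / real n \<and>
     (\<forall>v. norm (\<D> (G n) x v) \<le> E * norm v))" for z r E n
 have "\<exists>r>0. \<exists>E\<ge>0. \<exists>n0. \<forall>n\<ge>n0. P z r E n" if z: "z \<in> U" for z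
 proof -
  obtain r1 L where r1: "r1 > 0" "L-lipschitz_on (ball z r1 \<inter> U) g"
   using g z unfolding locally_lipschitz_on_def by blast
  obtain r2 where r2: "r2 > 0" "ball z r2 \<subseteq> U" using U z open_contains_ball by blast
  define r where "r = min r1 r2"
  have r: "0 < r" using r1 r2 by (simp add: r_def)
  have "ball z r \<subseteq> ball z r1 \<inter> U" using r2 by (auto simp: r_def)
  then have L: "L-lipschitz_on (ball z r) g" using r1(2) lipschitz_on_subset by blast
  have "0 \<le> C * L" using G(2) lipschitz_on_nonneg[OF L] by simp
  moreover obtain n0 where "\<forall>n\<ge>n0. P z (r/2) (C * L) n" using G(3)[OF r L] unfolding P_def by blast
  ultimately show ?thesis using r by (intro exI[of _ "r/2"] conjI exI[of _ "C * L"] exI[of _ n0]) auto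
 qed
 then obtain r E N where r: "\<And>z. z \<in> U \<Longrightarrow> 0 < r z" "\<And>z. z \<in> U \<Longrightarrow> 0 \<le> E z"
  "\<And>z n. z \<in> U \<Longrightarrow> N z \<le> n \<Longrightarrow> P z (r z) (E z) n" by metis
 show thesis
 proof (rule that[OF G(1)])
  fix K assume K: "compact K" "K \<subseteq> U"
  have "K \<subseteq> (\<Union>z\<in>K. ball z (r z))"
   using r(1) K(2) by (intro subsetI UN_I) auto
  then obtain D where D: "D \<subseteq> K" "finite D" "K \<subseteq> (\<Union>z\<in>D. ball z (r z))"
   using compactE_image[OF K(1), of K "\<lambda>z. ball z (r z)"] by auto
  define E' where "E' = (\<Sum>z\<in>D. E z)"
  define N' where "N' = Suc (\<Sum>z\<in>D. N z)"
  have E'0: "0 \<le> E'" unfolding E'_def using r(2) D K by (intro sum_nonneg) auto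
  show "\<exists>n0 E. 0 < n0 \<and> 0 \<le> E \<and> (\<forall>n\<ge>n0. \<forall>x\<in>K. norm (G n x - g x) \<le> E / real n \<and>
     (\<forall>v. norm (\<D> (G n) x v) \<le> E * norm v))"
  proof (intro exI[of _ N'] exI[of _ E'] conjI E'0 allI impI ballI)
   show "0 < N'" by (simp add: N'_def)
   fix n x assume n: "N' \<le> n" and x: "x \<in> K"
   then obtain z where z: "z \<in> D" "x \<in> ball z (r z)" using subsetD[OF D(3) x] unfolding UN_iff by blast
   have zU: "z \<in> U" using z D K by blast
   have "N z \<le> (\<Sum>z\<in>D. N z)" using z D by (intro member_le_sum) auto
   then have "P z (r z) (E z) n" using n by (intro r(3)[OF zU]) (simp add: N'_def)
   then have p: "norm (G n x - g x) \<le> E z / real n" "\<And>v. norm (\<D> (G n) x v) \<le> E z * norm v" "0 < n"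
    using z(2) unfolding P_def by blast+
   have EE: "E z \<le> E'" unfolding E'_def using z D K r(2) by (intro member_le_sum) auto
   show "norm (G n x - g x) \<le> E' / real n" using p(1) EE p(3) by (meson divide_right_mono of_nat_0_le_iff order_trans)
   show "norm (\<D> (G n) x v) \<le> E' * norm v" for v
    using p(2)[of v] EE by (meson mult_right_mono norm_ge_zero order_trans)
  qed
 qed
qed

context varifold_setting
begin

text \<open>The transpose of \<open>mean_proj z\<close> applied to \<open>v\<close>: for almost all \<open>z\<close>, the mean of the
 projections of \<open>v\<close> over the fibre. It arises in the product rule for \<open>tdiv\<close>.\<close>

definition pproj :: "real^'n \<Rightarrow> real^'n \<Rightarrow> real^'n" where
 "pproj z v = (\<Sum>j\<in>UNIV. (\<Sum>i\<in>UNIV. v $ i * mean_proj z $ i $ j) *\<^sub>R axis j 1)"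

lemma linear_pproj: "linear (pproj z)"
 unfolding pproj_def[abs_def]
 by (intro linearI) (simp_all add: distrib_right sum.distrib scaleR_add_left sum_distrib_left scaleR_sum_right mult.assoc)

lemma norm_pproj_le: "norm (pproj z v) \<le> real CARD('n) * real CARD('n) * norm v"
proof -
 have "norm (pproj z v) \<le> (\<Sum>j\<in>(UNIV::'n set). real CARD('n) * norm v)"
  unfolding pproj_def
 proof (rule order_trans[OF norm_sum sum_mono])
  fix j :: 'n
  have "\<bar>\<Sum>i\<in>UNIV. v $ i * mean_proj z $ i $ j\<bar> \<le> (\<Sum>i\<in>(UNIV::'n set). norm v * 1)"
  proof (rule order_trans[OF sum_abs sum_mono])
   fix i
   show "\<bar>v $ i * mean_proj z $ i $ j\<bar> \<le> norm v * 1"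
    unfolding abs_mult using component_le_norm_cart[of v i] mean_proj_bound[of z i j] by (intro mult_mono) auto
  qed
  then show "norm ((\<Sum>i\<in>UNIV. v $ i * mean_proj z $ i $ j) *\<^sub>R axis j (1::real)) \<le> real CARD('n) * norm v"
   by (simp add: norm_axis_1)
 qed
 then show ?thesis by simp
qed

lemma pproj_axis: "pproj z (axis i 1) = (\<Sum>j\<in>UNIV. mean_proj z $ i $ j *\<^sub>R axis j 1)"
proof -
 have "(\<Sum>k\<in>UNIV. axis i 1 $ k * mean_proj z $ k $ j) = mean_proj z $ i $ j" for j
 proof -
  have "(\<Sum>k\<in>UNIV. axis i 1 $ k * mean_proj z $ k $ j) = (\<Sum>k\<in>UNIV. if k = i then mean_proj z $ i $ j else 0)"
   by (intro sum.cong) (auto simp: axis_def)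
  then show ?thesis by simp
 qed
 then show ?thesis by (simp add: pproj_def)
qed

definition smooth_approximants :: "(nat \<Rightarrow> real^'n \<Rightarrow> real^'k) \<Rightarrow> (real^'n \<Rightarrow> real^'k) \<Rightarrow> (real^'n \<Rightarrow> (real^'n) \<Rightarrow>\<^sub>L (real^'k)) \<Rightarrow> bool" where
 "smooth_approximants \<gamma> g G \<longleftrightarrow>
   (\<forall>j. smooth (\<gamma> j)) \<and> (\<forall>z\<in>U. (\<lambda>j. \<gamma> j z) \<longlonglongrightarrow> g z) \<and>
   (\<forall>K. compact K \<longrightarrow> K \<subseteq> U \<longrightarrow> (\<exists>B\<ge>0. \<forall>j. \<forall>z\<in>K. norm (\<gamma> j z) \<le> B \<and> norm (g z) \<le> B \<and>
    (\<forall>v. norm (\<D> (\<gamma> j) z (pproj z v)) \<le> B * norm v))) \<and>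
   G \<in> \<M> \<and> (AE z in mu. \<forall>v. (\<lambda>j. \<D> (\<gamma> j) z (pproj z v)) \<longlonglongrightarrow> G z v)"

lemma smooth_approximantsD:
 assumes "smooth_approximants \<gamma> g G"
 shows "smooth (\<gamma> j)" "z \<in> U \<Longrightarrow> (\<lambda>j. \<gamma> j z) \<longlonglongrightarrow> g z"
  "compact K \<Longrightarrow> K \<subseteq> U \<Longrightarrow> \<exists>B\<ge>0. \<forall>j. \<forall>z\<in>K. norm (\<gamma> j z) \<le> B \<and> norm (g z) \<le> B \<and>
    (\<forall>v. norm (\<D> (\<gamma> j) z (pproj z v)) \<le> B * norm v)"
  "G \<in> \<M>" "AE z in mu. \<forall>v. (\<lambda>j. \<D> (\<gamma> j) z (pproj z v)) \<longlonglongrightarrow> G z v"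
 using assms unfolding smooth_approximants_def by simp_all

text \<open>Smooth maps \<open>\<gamma>\<close> near \<open>g\<close> with uniformly bounded derivatives form midpoint convex
 classes; the selection lemma applies to their mean tangential derivatives.\<close>

lemma lipschitz_smooth_approximation:
 fixes g :: "real^'n \<Rightarrow> real^'k"
 assumes g: "locally_lipschitz_on U g"
 obtains \<gamma> G where "smooth_approximants \<gamma> g G"
proof -
 obtain S where S: "\<And>n. smooth (S n :: real^'n \<Rightarrow> real^'k)"
  "\<And>K. compact K \<Longrightarrow> K \<subseteq> U \<Longrightarrow> \<exists>n0 E. 0 < n0 \<and> 0 \<le> E \<and> (\<forall>n\<ge>n0. \<forall>x\<in>K. norm (S n x - g x) \<le> E / real n \<and>
     (\<forall>v. norm (\<D> (S n) x v) \<le> E * norm v))"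
  by (rule smooth_uniform_on_compact[OF g open_U]) (rule that)
 obtain C :: "nat \<Rightarrow> (real^'n) set"
  where C: "\<And>n. compact (C n)" "\<And>n. C n \<subseteq> U" "\<And>n. C n \<subseteq> interior (C (Suc n))" "\<Union>(range C) = U"
   "\<And>K. compact K \<Longrightarrow> K \<subseteq> U \<Longrightarrow> \<exists>N. \<forall>n\<ge>N. K \<subseteq> C n"
  using open_Union_compact_subsets[OF open_U] by metis
 have Cmono: "C n \<subseteq> C (Suc n)" for n using C(3)[of n] interior_subset by blast
 have "\<exists>B\<ge>0. \<forall>n. \<forall>x\<in>C i. \<forall>v. norm (\<D> (S n) x v) \<le> B * norm v" for i
 proof -
  obtain n0 E where E: "0 \<le> E" "\<And>n x v. n0 \<le> n \<Longrightarrow> x \<in> C i \<Longrightarrow> norm (\<D> (S n) x v) \<le> E * norm v"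
   using S(2)[OF C(1,2), of i] by blast
  have "\<exists>A\<ge>0. \<forall>x\<in>C i. \<forall>v. norm (\<D> (S n) x v) \<le> A * norm v" for n
  proof -
   obtain A where "0 \<le> A" "\<And>x v. x \<in> C i \<Longrightarrow> norm (\<D> (S n) x v) \<le> A * norm v"
    by (rule smooth_derivative_bounded[OF S(1)[of n] C(1)[of i]]) (rule that)
   then show ?thesis by blast
  qed
  then obtain A where A: "\<And>n. 0 \<le> A n" "\<And>n x v. x \<in> C i \<Longrightarrow> norm (\<D> (S n) x v) \<le> A n * norm v"
   by metis
  show ?thesis
  proof (intro exI[of _ "E + (\<Sum>n<n0. A n)"] conjI allI ballI)
   have s: "0 \<le> (\<Sum>n<n0. A n)" using A(1) by (intro sum_nonneg)
   then show "0 \<le> E + (\<Sum>n<n0. A n)" using E(1) by simp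
   fix n x v assume x: "x \<in> C i"
   have "\<exists>B. norm (\<D> (S n) x v) \<le> B * norm v \<and> B \<le> E + (\<Sum>n<n0. A n)"
   proof (cases "n0 \<le> n")
    case True then show ?thesis using E(2)[OF True x] s by (intro exI[of _ E]) auto
   next
    case False
    then have "A n \<le> (\<Sum>n<n0. A n)" using A(1) by (intro member_le_sum) auto
    then show ?thesis using A(2)[OF x] E(1) by (intro exI[of _ "A n"]) auto
   qed
   then show "norm (\<D> (S n) x v) \<le> (E + (\<Sum>n<n0. A n)) * norm v"
    by (meson mult_right_mono norm_ge_zero order_trans)
  qed
 qed
 then obtain B where B: "\<And>i. 0 \<le> B i"
  "\<And>i n x v. x \<in> C i \<Longrightarrow> norm (\<D> (S n) x v) \<le> B i * norm v" by metis
 \<comment> \<open>The bounds \<open>B\<close> do not depend on \<open>k\<close>, so that the classes decrease; they are nonempty because the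
  initial smooth maps, from some index on, approximate \<open>g\<close> on \<open>C k\<close> as closely as required.\<close>
 define \<G> where "\<G> k = {\<gamma> :: real^'n \<Rightarrow> real^'k. smooth \<gamma> \<and> (\<forall>x\<in>C k. norm (\<gamma> x - g x) \<le> 1 / real (Suc k)) \<and>
   (\<forall>i. \<forall>x\<in>C i. \<forall>v. norm (\<D> \<gamma> x v) \<le> B i * norm v)}" for k
 define mid :: "(real^'n \<Rightarrow> real^'k) \<Rightarrow> (real^'n \<Rightarrow> real^'k) \<Rightarrow> (real^'n \<Rightarrow> real^'k)"
  where "mid \<gamma> \<gamma>' = (\<lambda>x. (1/2) *\<^sub>R (\<gamma> x + \<gamma>' x))" for \<gamma> \<gamma>'
 have ne: "\<G> k \<noteq> {}" for k
 proof -
  obtain n0 E where E: "0 < n0" "0 \<le> E" "\<And>n x. n0 \<le> n \<Longrightarrow> x \<in> C k \<Longrightarrow> norm (S n x - g x) \<le> E / real n"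
   using S(2)[OF C(1,2), of k] by blast
  obtain n1 :: nat where n1: "E * real (Suc k) < real n1" using reals_Archimedean2 by blast
  define n where "n = max n0 n1"
  have n: "n0 \<le> n" "0 < real n" "E * real (Suc k) < real n" using E(1) n1 by (auto simp: n_def)
  have "E / real n \<le> 1 / real (Suc k)" using n by (simp add: field_simps)
  then have "S n \<in> \<G> k" unfolding \<G>_def using S(1) E(3)[OF n(1)] B(2) by (auto intro: order_trans)
  then show ?thesis by blast
 qed
 have dec: "\<G> (Suc k) \<subseteq> \<G> k" for k
 proof -
  have "1 / real (Suc (Suc k)) \<le> 1 / real (Suc k)" by (intro divide_left_mono) auto
  then show ?thesis unfolding \<G>_def using Cmono[of k] by (blast intro: order_trans)
 qed
 have Dmid: "\<D> (mid \<gamma> \<gamma>') x v = (1/2) *\<^sub>R (\<D> \<gamma> x v + \<D> \<gamma>' x v)"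
  if "smooth \<gamma>" "smooth \<gamma>'" for \<gamma> \<gamma>' x v
 proof -
  have "(mid \<gamma> \<gamma>' has_derivative (\<lambda>v. (1/2) *\<^sub>R (\<D> \<gamma> x v + \<D> \<gamma>' x v))) (at x)"
   unfolding mid_def by (intro has_derivative_scaleR_right has_derivative_add smooth_D(1) that)
  from frechet_derivative_at[OF this, symmetric] show ?thesis by simp
 qed
 have half: "norm ((1/2) *\<^sub>R (a + b)) \<le> c" if "norm a \<le> c" "norm b \<le> c" for a b :: "real^'k" and c
  using norm_triangle_ineq[of a b] that by simp
 have midG: "mid \<gamma> \<gamma>' \<in> \<G> k" if "\<gamma> \<in> \<G> k" "\<gamma>' \<in> \<G> k" for \<gamma> \<gamma>' k
 proof -
  have sm: "smooth \<gamma>" "smooth \<gamma>'" using that by (auto simp: \<G>_def)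
  have "smooth (mid \<gamma> \<gamma>')" unfolding mid_def by (intro smooth_scaleR smooth_add sm smooth_const)
  moreover have "norm (mid \<gamma> \<gamma>' x - g x) \<le> 1 / real (Suc k)" if x: "x \<in> C k" for x
  proof -
   have "mid \<gamma> \<gamma>' x - g x = (1/2) *\<^sub>R ((\<gamma> x - g x) + (\<gamma>' x - g x))"
    unfolding mid_def add_diff_add[symmetric] scaleR_diff_right scaleR_half_double ..
   then show ?thesis
    by (simp only:) (rule half, use \<open>\<gamma> \<in> \<G> k\<close> \<open>\<gamma>' \<in> \<G> k\<close> x in \<open>auto simp: \<G>_def simp del: of_nat_Suc\<close>)
  qed
  moreover have "norm (\<D> (mid \<gamma> \<gamma>') x v) \<le> B i * norm v" if x: "x \<in> C i" for i x v
   unfolding Dmid[OF sm] by (rule half) (use \<open>\<gamma> \<in> \<G> k\<close> \<open>\<gamma>' \<in> \<G> k\<close> x in \<open>auto simp: \<G>_def\<close>)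
  ultimately show ?thesis by (auto simp: \<G>_def)
 qed
 define cP where "cP = real CARD('n) * real CARD('n)"
 have cP: "0 \<le> cP" by (simp add: cP_def)
 define T where "T \<gamma> z v = \<D> \<gamma> z (pproj z v)" for \<gamma> :: "real^'n \<Rightarrow> real^'k" and z v
 have TB: "norm (T \<gamma> z v) \<le> (B i * cP) * norm v" if "\<gamma> \<in> \<G> 0" "z \<in> C i" for \<gamma> z v i
 proof -
  have "norm (T \<gamma> z v) \<le> B i * norm (pproj z v)" using that by (auto simp: \<G>_def T_def)
  also have "\<dots> \<le> B i * (cP * norm v)" unfolding cP_def by (intro mult_left_mono norm_pproj_le B(1))
  finally show ?thesis by (simp add: mult.assoc)
 qed
 have Tlin: "T \<gamma> z v = (\<Sum>i\<in>UNIV. v $ i *\<^sub>R T \<gamma> z (axis i 1))" if "smooth \<gamma>" for \<gamma> z v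
 proof -
  have l: "linear (T \<gamma> z)" unfolding T_def[abs_def]
   using linear_compose[OF linear_pproj smooth_D(5)[OF that]] by (simp add: o_def)
  have "T \<gamma> z v = T \<gamma> z (\<Sum>i\<in>UNIV. v $ i *\<^sub>R axis i 1)"
   using basis_expansion[of v] by (simp add: scalar_mult_eq_scaleR)
  also have "\<dots> = (\<Sum>i\<in>UNIV. v $ i *\<^sub>R T \<gamma> z (axis i 1))"
   using linear_sum[OF l, of "\<lambda>i. v $ i *\<^sub>R axis i 1" UNIV] linear_scale[OF l] by simp
  finally show ?thesis .
 qed
 have Tm: "(\<lambda>z. T \<gamma> z (axis i 1)) \<in> borel_measurable mu" if sm: "smooth \<gamma>" for \<gamma> i
 proof -
  have l: "linear (\<D> \<gamma> z)" for z by (rule smooth_D(5)[OF sm])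
  have "T \<gamma> z (axis i 1) = (\<Sum>j\<in>UNIV. mean_proj z $ i $ j *\<^sub>R \<D> \<gamma> z (axis j 1))" for z
   unfolding T_def pproj_axis
   using linear_sum[OF l[of z], of "\<lambda>j. mean_proj z $ i $ j *\<^sub>R axis j 1" UNIV] linear_scale[OF l[of z]] by simp
  moreover have "(\<lambda>z. \<D> \<gamma> z (axis j 1)) \<in> borel_measurable mu" for j
   by (intro continuous_measurable_mu smooth_continuous_D sm)
  ultimately show ?thesis by simp
 qed
 have lvl: "(\<lambda>z. LEAST i. z \<in> C i) \<in> measurable mu (count_space UNIV)"
 proof (rule measurable_Least)
  fix i
  have "C i \<in> sets mu" by (rule radon_compact(1)[OF radon_mu open_U C(1,2)])
  then show "Measurable.pred mu (\<lambda>z. z \<in> C i)" by measurable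
 qed
 \<comment> \<open>The weight makes the mean tangential derivatives of all members of the classes bounded by one;
  it is constant on the layers of the exhaustion.\<close>
 define w where "w z = 1 / (1 + real CARD('n) * (B (LEAST i. z \<in> C i) * cP))" for z
 have w0: "0 < 1 + real CARD('n) * (B i * cP)" for i using B(1)[of i] cP by (intro add_pos_nonneg) auto
 have wpos: "0 < w z" for z using w0 by (simp add: w_def)
 have wm[measurable]: "w \<in> borel_measurable mu"
 proof -
  have "(\<lambda>i. 1 / (1 + real CARD('n) * (B i * cP))) \<in> measurable (count_space UNIV) borel" by simp
  from measurable_compose[OF lvl this] show ?thesis unfolding w_def[abs_def] .
 qed
 define \<phi> where "\<phi> \<gamma> z = w z *\<^sub>R (\<chi> i. T \<gamma> z (axis i 1))" for \<gamma> z
 have Xm: "(\<lambda>z. (\<chi> i. T \<gamma> z (axis i 1)) :: (real^'k)^'n) \<in> borel_measurable mu" if "smooth \<gamma>" for \<gamma>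
  by (rule borel_measurable_vec) (use Tm[OF that] in simp)
 interpret sf: sigma_finite_measure mu by (rule sigma_finite_mu)
 obtain f :: "real^'n \<Rightarrow> real" where f: "f \<in> borel_measurable mu" "\<And>x. 0 < f x" "\<And>x. f x \<le> 1" "integrable mu f"
  by (rule sf.obtain_positive_integrable_function) (rule that)
 \<comment> \<open>A finite measure with the same null sets as the weight.\<close>
 define M where "M = density mu (\<lambda>z. ennreal (f z))"
 have fin: "finite_measure M"
 proof (rule finite_measureI)
  have "emeasure M (space mu) = (\<integral>\<^sup>+z. ennreal (f z) * indicator (space mu) z \<partial>mu)"
   unfolding M_def by (rule emeasure_density[OF _ sets.top]) (use f(1) in measurable)
  also have "\<dots> = (\<integral>\<^sup>+z. ennreal (f z) \<partial>mu)" by (intro nn_integral_cong) simp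
  finally have "emeasure M (space M) = (\<integral>\<^sup>+z. ennreal (f z) \<partial>mu)" by (simp add: M_def)
  also have "\<dots> = ennreal (\<integral>z. f z \<partial>mu)" using f by (intro nn_integral_eq_integral) (auto intro: less_imp_le)
  finally show "emeasure M (space M) \<noteq> \<infinity>" by simp
 qed
 have memC: "z \<in> C (LEAST i. z \<in> C i)" if zU: "z \<in> U" for z
 proof -
  obtain i where "z \<in> C i" using zU C(4) by blast
  then show ?thesis by (rule LeastI)
 qed
 obtain \<gamma> where \<gamma>: "\<And>k. \<gamma> k \<in> \<G> k" "AE z in M. convergent (\<lambda>k. \<phi> (\<gamma> k) z)"
 proof (rule AE_convergent_selection[OF fin, of \<G> mid \<phi>])
  show "\<G> k \<noteq> {}" for k by (rule ne)
  show "\<G> (Suc k) \<subseteq> \<G> k" for k by (rule dec)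
  show "mid x y \<in> \<G> k" if "x \<in> \<G> k" "y \<in> \<G> k" for k x y by (rule midG[OF that])
  show "\<phi> x \<in> borel_measurable M" if "x \<in> \<G> 0" for x
  proof -
   have [measurable]: "(\<lambda>z. (\<chi> i. T x z (axis i 1)) :: (real^'k)^'n) \<in> borel_measurable mu"
    using that by (intro Xm) (simp add: \<G>_def)
   show ?thesis unfolding \<phi>_def[abs_def] M_def by measurable
  qed
  show "\<phi> (mid x y) z = (1/2) *\<^sub>R (\<phi> x z + \<phi> y z)" if "x \<in> \<G> 0" "y \<in> \<G> 0" for x y z
  proof -
   have sm: "smooth x" "smooth y" using that by (auto simp: \<G>_def)
   have "(\<chi> i. T (mid x y) z (axis i 1)) = (1/2) *\<^sub>R ((\<chi> i. T x z (axis i 1)) + (\<chi> i. T y z (axis i 1)))"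
    unfolding T_def Dmid[OF sm] by (simp add: vec_eq_iff)
   then show ?thesis by (simp add: \<phi>_def scaleR_add_right mult.commute)
  qed
  show "norm (\<phi> x z) \<le> 1" if x: "x \<in> \<G> 0" "z \<in> space M" for x z
  proof -
   let ?i = "LEAST i. z \<in> C i"
   have z: "z \<in> C ?i" using x(2) by (intro memC) (simp add: M_def)
   have "norm ((\<chi> i. T x z (axis i 1)) :: (real^'k)^'n) \<le> (\<Sum>i\<in>UNIV. norm (T x z (axis i 1)))"
    unfolding norm_vec_def by (rule order_trans[OF L2_set_le_sum]) auto
   also have "\<dots> \<le> (\<Sum>i\<in>(UNIV::'n set). B ?i * cP)"
    using TB[OF x(1) z] by (intro sum_mono) (metis mult.right_neutral norm_axis_1)
   also have "\<dots> \<le> 1 + real CARD('n) * (B ?i * cP)" by simp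
   finally have "norm ((\<chi> i. T x z (axis i 1)) :: (real^'k)^'n) \<le> 1 + real CARD('n) * (B ?i * cP)" .
   then show ?thesis using w0[of ?i] by (simp add: \<phi>_def w_def)
  qed
 qed (rule that)
 have \<gamma>0: "\<gamma> k \<in> \<G> 0" for k using \<gamma>(1)[of k] lift_Suc_antimono_le[of \<G>, OF dec, of 0 k] by auto
 have sm: "smooth (\<gamma> k)" for k using \<gamma>0 by (simp add: \<G>_def)
 define L where "L z i = lim (\<lambda>k. T (\<gamma> k) z (axis i 1))" for z i
 define G where "G z = Blinfun (\<lambda>v. \<Sum>i\<in>UNIV. v $ i *\<^sub>R L z i)" for z
 have bl: "bounded_linear (\<lambda>v::real^'n. \<Sum>i\<in>UNIV. v $ i *\<^sub>R L z i)" for z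
  by (intro bounded_linear_sum bounded_linear_scaleR_const bounded_linear_vec_nth)
 have Gapp: "G z v = (\<Sum>i\<in>UNIV. v $ i *\<^sub>R L z i)" for z v
  unfolding G_def bounded_linear_Blinfun_apply[OF bl] ..
 have "AE z in mu. convergent (\<lambda>k. \<phi> (\<gamma> k) z)"
  using \<gamma>(2) f unfolding M_def by (simp add: AE_density)
 then have conv: "AE z in mu. \<forall>v. (\<lambda>j. T (\<gamma> j) z v) \<longlonglongrightarrow> G z v"
 proof eventually_elim
  case (elim z)
  then obtain X where X: "(\<lambda>k. \<phi> (\<gamma> k) z) \<longlonglongrightarrow> X" by (auto simp: convergent_def)
  have ax: "(\<lambda>k. T (\<gamma> k) z (axis i 1)) \<longlonglongrightarrow> L z i" for i
  proof -
   have "(\<lambda>k. (1 / w z) *\<^sub>R (\<phi> (\<gamma> k) z $ i)) \<longlonglongrightarrow> (1 / w z) *\<^sub>R (X $ i)"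
    by (intro tendsto_scaleR tendsto_const tendsto_vec_nth X)
   moreover have "(1 / w z) *\<^sub>R (\<phi> (\<gamma> k) z $ i) = T (\<gamma> k) z (axis i 1)" for k
    using wpos[of z] by (simp add: \<phi>_def)
   ultimately have "(\<lambda>k. T (\<gamma> k) z (axis i 1)) \<longlonglongrightarrow> (1 / w z) *\<^sub>R (X $ i)" by simp
   then show ?thesis unfolding L_def by (simp add: limI)
  qed
  show ?case
  proof
   fix v
   show "(\<lambda>j. T (\<gamma> j) z v) \<longlonglongrightarrow> G z v"
    unfolding Tlin[OF sm, of _ z v] Gapp by (intro tendsto_sum tendsto_scaleR tendsto_const ax)
  qed
 qed
 show thesis
 proof (rule that[of \<gamma> G], unfold smooth_approximants_def, intro conjI allI ballI impI)
  show "smooth (\<gamma> j)" for j by (rule sm)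
  show "(\<lambda>j. \<gamma> j z) \<longlonglongrightarrow> g z" if zU: "z \<in> U" for z
  proof -
   obtain N where "\<forall>n\<ge>N. {z} \<subseteq> C n" using C(5)[of "{z}"] zU by auto
   then have N: "z \<in> C n" if "N \<le> n" for n using that by blast
   have ev: "eventually (\<lambda>j. norm (\<gamma> j z - g z) \<le> 1 / real (Suc j)) sequentially"
    unfolding eventually_sequentially
   proof (intro exI allI impI)
    fix n assume "N \<le> n"
    then show "norm (\<gamma> n z - g z) \<le> 1 / real (Suc n)" using N \<gamma>(1)[of n] by (auto simp: \<G>_def)
   qed
   have up: "(\<lambda>j. 1 / real (Suc j)) \<longlonglongrightarrow> 0" using LIMSEQ_inverse_real_of_nat by (simp add: inverse_eq_divide)
   have "(\<lambda>j. norm (\<gamma> j z - g z)) \<longlonglongrightarrow> 0"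
    by (rule tendsto_sandwich[OF _ ev tendsto_const up]) simp
   then show ?thesis by (simp add: tendsto_norm_zero_iff LIM_zero_iff)
  qed
  show "\<exists>B\<ge>0. \<forall>j. \<forall>z\<in>K. norm (\<gamma> j z) \<le> B \<and> norm (g z) \<le> B \<and>
    (\<forall>v. norm (\<D> (\<gamma> j) z (pproj z v)) \<le> B * norm v)" if K: "compact K" "K \<subseteq> U" for K
  proof -
   obtain N where N: "\<And>n. N \<le> n \<Longrightarrow> K \<subseteq> C n" using C(5)[OF K] by blast
   have bd: "\<exists>b\<ge>0. \<forall>x\<in>K. norm (\<gamma> j x) \<le> b" for j
   proof -
    have "bounded (\<gamma> j ` K)" by (intro compact_imp_bounded compact_continuous_image smooth_D(3) sm K)
    then obtain b where "\<forall>y\<in>\<gamma> j ` K. norm y \<le> b" unfolding bounded_iff by blast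
    then show ?thesis by (intro exI[of _ "max b 0"]) auto
   qed
   then obtain b where b: "\<And>j. 0 \<le> b j" "\<And>j x. x \<in> K \<Longrightarrow> norm (\<gamma> j x) \<le> b j" by metis
   have near: "norm (\<gamma> n x - g x) \<le> 1" if "N \<le> n" "x \<in> K" for n x
   proof -
    have "norm (\<gamma> n x - g x) \<le> 1 / real (Suc n)" using N[OF that(1)] that(2) \<gamma>(1)[of n] by (auto simp: \<G>_def)
    also have "\<dots> \<le> 1" by simp
    finally show ?thesis .
   qed
   have gb: "norm (g x) \<le> b N + 1" if "x \<in> K" for x
    using near[OF order_refl that] b(2)[OF that, of N] norm_triangle_ineq4[of "\<gamma> N x" "\<gamma> N x - g x"] by simp
   define B1 where "B1 = (\<Sum>j<N. b j) + (b N + 2)"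
   have s: "0 \<le> (\<Sum>j<N. b j)" using b(1) by (intro sum_nonneg)
   have \<gamma>b: "norm (\<gamma> j x) \<le> B1" if "x \<in> K" for j x
   proof (cases "N \<le> j")
    case True
    then have "norm (\<gamma> j x) \<le> norm (g x) + 1"
     using near[OF True that] norm_triangle_sub[of "\<gamma> j x" "g x"] by simp
    then show ?thesis using gb[OF that] s by (simp add: B1_def)
   next
    case False
    then have "b j \<le> (\<Sum>j<N. b j)" using b(1) by (intro member_le_sum) auto
    then show ?thesis using b(2)[OF that, of j] b(1)[of N] by (simp add: B1_def)
   qed
   have gb': "norm (g x) \<le> B1" if "x \<in> K" for x using gb[OF that] s by (simp add: B1_def)
   show ?thesis
   proof (intro exI[of _ "B1 + B N * cP"] conjI allI ballI)
    have p: "0 \<le> B N * cP" using B(1) cP by simp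
    have p1: "0 \<le> B1" using s b(1)[of N] by (simp add: B1_def)
    show "0 \<le> B1 + B N * cP" using p p1 by simp
    fix j z assume z: "z \<in> K"
    show "norm (\<gamma> j z) \<le> B1 + B N * cP" using \<gamma>b[OF z, of j] p by linarith
    show "norm (g z) \<le> B1 + B N * cP" using gb'[OF z] p by linarith
    fix v
    have "norm (T (\<gamma> j) z v) \<le> (B N * cP) * norm v" using N[OF order_refl] z by (intro TB[OF \<gamma>0]) auto
    also have "\<dots> \<le> (B1 + B N * cP) * norm v" using p1 by (intro mult_right_mono) auto
    finally show "norm (\<D> (\<gamma> j) z (pproj z v)) \<le> (B1 + B N * cP) * norm v"
     by (simp add: T_def)
   qed
  qed
  have "(\<lambda>z. L z i) \<in> borel_measurable mu" for i
   unfolding L_def by (intro borel_measurable_lim_metric Tm sm)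
  then show "G \<in> \<M>"
   unfolding G_def[abs_def] by (intro measurable_completion blinfun_measurableI)
  show "AE z in mu. \<forall>v. (\<lambda>j. \<D> (\<gamma> j) z (pproj z v)) \<longlonglongrightarrow> G z v"
   using conv by (simp add: T_def)
 qed
qed

end


section \<open>The chain rule\<close>

lemma smooth_D_zero_bound:
 fixes \<eta> :: "'b::euclidean_space \<Rightarrow> real"
 assumes \<eta>: "smooth \<eta>" and 0: "\<And>y. R' < norm y \<Longrightarrow> \<D> \<eta> y = (\<lambda>v. 0)"
 obtains A where "0 \<le> A" "\<And>y v. \<bar>\<D> \<eta> y v\<bar> \<le> A * norm v"
proof -
 obtain A where A: "0 \<le> A" "\<And>x v. x \<in> cball 0 R' \<Longrightarrow> norm (\<D> \<eta> x v) \<le> A * norm v"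
  by (rule smooth_derivative_bounded[OF \<eta> compact_cball]) (rule that)
 have "\<bar>\<D> \<eta> y v\<bar> \<le> A * norm v" for y v
  using A(1) A(2)[of y v] 0[of y] by (cases "norm y \<le> R'") auto
 then show thesis by (rule that[OF A(1)])
qed

lemma blinfun_measurableI2:
 fixes F :: "'a \<Rightarrow> (real^'n) \<Rightarrow>\<^sub>L 'b::euclidean_space"
 assumes "\<And>i. (\<lambda>z. F z (axis i 1)) \<in> borel_measurable M"
 shows "F \<in> borel_measurable M"
proof -
 have "F z = Blinfun (\<lambda>v::real^'n. \<Sum>i\<in>UNIV. v $ i *\<^sub>R F z (axis i 1))" for z
 proof (rule blinfun_eqI)
  fix v :: "real^'n"
  have bl: "bounded_linear (\<lambda>v::real^'n. \<Sum>i\<in>UNIV. v $ i *\<^sub>R F z (axis i 1))"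
   by (intro bounded_linear_sum bounded_linear_scaleR_const bounded_linear_vec_nth)
  have "F z v = F z (\<Sum>i\<in>UNIV. v $ i *\<^sub>R axis i 1)"
   using basis_expansion[of v] by (simp add: scalar_mult_eq_scaleR)
  also have "\<dots> = (\<Sum>i\<in>UNIV. v $ i *\<^sub>R F z (axis i 1))"
   by (simp add: blinfun.sum_right blinfun.scaleR_right)
  finally show "F z v = blinfun_apply (Blinfun (\<lambda>v::real^'n. \<Sum>i\<in>UNIV. v $ i *\<^sub>R F z (axis i 1))) v"
   unfolding bounded_linear_Blinfun_apply[OF bl] .
 qed
 then have eq: "F = (\<lambda>z. Blinfun (\<lambda>v::real^'n. \<Sum>i\<in>UNIV. v $ i *\<^sub>R F z (axis i 1)))" by (rule ext)
 show ?thesis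
  by (rule ssubst[OF eq, of "\<lambda>G. G \<in> borel_measurable M"]) (rule blinfun_measurableI[OF assms])
qed

lemma derivative_measurable:
 fixes \<eta> :: "'b::euclidean_space \<Rightarrow> 'c::euclidean_space" and f X :: "'a \<Rightarrow> 'b"
 assumes \<eta>: "smooth \<eta>" and f: "f \<in> borel_measurable M" and X: "X \<in> borel_measurable M"
 shows "(\<lambda>z. \<D> \<eta> (f z) (X z)) \<in> borel_measurable M"
proof -
 have "(\<lambda>z. \<D> \<eta> (f z) b) \<in> borel_measurable M" for b
  by (rule measurable_compose[OF f borel_measurable_continuous_onI[OF smooth_continuous_D[OF \<eta>]]])
 moreover have "\<D> \<eta> (f z) (X z) = (\<Sum>b\<in>Basis. (X z \<bullet> b) *\<^sub>R \<D> \<eta> (f z) b)" for z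
  by (rule has_derivative_basis[OF smooth_D(1)[OF \<eta>]])
 then have "(\<lambda>z. \<D> \<eta> (f z) (X z)) = (\<lambda>z. \<Sum>b\<in>Basis. (X z \<bullet> b) *\<^sub>R \<D> \<eta> (f z) b)"
  by (rule ext)
 ultimately show ?thesis
  by (simp only:) (intro borel_measurable_sum borel_measurable_scaleR borel_measurable_inner X borel_measurable_const)
qed

lemma smooth_compose_measurable:
 fixes \<eta> :: "'b::euclidean_space \<Rightarrow> 'c::real_normed_vector"
 assumes "smooth \<eta>" "f \<in> borel_measurable M"
 shows "(\<lambda>z. \<eta> (f z)) \<in> borel_measurable M"
 by (rule measurable_compose[OF assms(2) borel_measurable_continuous_onI[OF smooth_D(3)[OF assms(1)]]])

lemma bounded_of_compact_derivative1:
 fixes \<eta> :: "'a::euclidean_space \<Rightarrow> real"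
 assumes \<eta>: "smooth \<eta>" and R': "0 \<le> R'" and 0: "\<And>y. R' < norm y \<Longrightarrow> \<D> \<eta> y = (\<lambda>v. 0)"
 obtains C where "0 \<le> C" "\<And>y. \<bar>\<eta> y\<bar> \<le> C"
proof -
 let ?\<Psi> = "\<lambda>x :: 'a \<times> real. \<eta> (fst x)"
 have sm: "smooth ?\<Psi>" by (intro smooth_compose[OF \<eta>] smooth_linear bounded_linear_fst)
 have D: "\<D> ?\<Psi> (y, w) = (\<lambda>v. 0)" if "norm w \<le> 0" "R' < norm y" for y w
 proof -
  have "(?\<Psi> has_derivative (\<lambda>v. \<D> \<eta> (fst (y, w)) (fst v))) (at (y, w))"
   by (rule has_derivative_compose[OF has_derivative_fst[OF has_derivative_ident] smooth_D(1)[OF \<eta>]])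
  then have "(?\<Psi> has_derivative (\<lambda>v. 0)) (at (y, w))" using 0[OF that(2)] by simp
  then show ?thesis by (rule frechet_derivative_at[symmetric])
 qed
 obtain C where C: "0 \<le> C" "\<And>y w. norm w \<le> 0 \<Longrightarrow> \<bar>?\<Psi> (y, w)\<bar> \<le> C"
  by (rule bounded_of_compact_derivative[OF sm R', of 0]) (use D in blast, rule that)
 show thesis using C(2)[of 0] by (intro that[OF C(1)]) auto
qed

context bv_varifold
begin

text \<open>The defining identity of weak derivatives for everywhere defined functions, with the fibre integral
 carried out. Compactness of the support of the derivative of \<open>\<eta>\<close> is expressed by a radius, as
 this is the form that is passed to \<open>\<eta> \<circ> p\<close> under composition; and the operator norm replaces
 the equivalent Euclidean norm.\<close>

definition weak_diff :: "(real^'n \<Rightarrow> 'b::euclidean_space) \<Rightarrow> (real^'n \<Rightarrow> (real^'n) \<Rightarrow>\<^sub>L 'b) \<Rightarrow> bool" where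
 "weak_diff f F \<longleftrightarrow> f \<in> \<M> \<and> f \<in> \<N> \<and>
   F \<in> \<M> \<and>
   (\<forall>K s. compact K \<longrightarrow> K \<subseteq> U \<longrightarrow>
    (\<integral>\<^sup>+z. ennreal (norm (F z) * indicator {z\<in>K. norm (f z) \<le> s} z) \<partial>\<mu>) < \<infinity>) \<and>
   (\<forall>\<theta> \<eta> R'. \<theta> \<in> test_fields U \<longrightarrow> smooth \<eta> \<longrightarrow> 0 \<le> R' \<longrightarrow>
    (\<forall>y. R' < norm y \<longrightarrow> \<D> \<eta> y = (\<lambda>v. 0)) \<longrightarrow>
    \<delta> (\<lambda>z. \<eta> (f z) *\<^sub>R \<theta> z) =
     (\<integral>z. \<eta> (f z) * tdiv \<theta> z \<partial>\<mu>)
     + (\<integral>z. \<D> \<eta> (f z) (F z (\<theta> z)) \<partial>\<mu>))"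

lemma weak_diffD:
 assumes "weak_diff f F"
 shows "f \<in> \<M>" "f \<in> \<N>"
  "F \<in> \<M>"
  "compact K \<Longrightarrow> K \<subseteq> U \<Longrightarrow>
    (\<integral>\<^sup>+z. ennreal (norm (F z) * indicator {z\<in>K. norm (f z) \<le> s} z) \<partial>\<mu>) < \<infinity>"
  "\<theta> \<in> test_fields U \<Longrightarrow> smooth \<eta> \<Longrightarrow> 0 \<le> R' \<Longrightarrow>
    (\<And>y. R' < norm y \<Longrightarrow> \<D> \<eta> y = (\<lambda>v. 0)) \<Longrightarrow>
    \<delta> (\<lambda>z. \<eta> (f z) *\<^sub>R \<theta> z) =
     (\<integral>z. \<eta> (f z) * tdiv \<theta> z \<partial>\<mu>)
     + (\<integral>z. \<D> \<eta> (f z) (F z (\<theta> z)) \<partial>\<mu>)"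
 using assms unfolding weak_diff_def by blast+

lemma tdiv_zero_outside:
 assumes "compact K" "\<And>z. z \<notin> K \<Longrightarrow> \<theta> z = 0" "z \<notin> K"
 shows "tdiv \<theta> z = 0"
proof -
 have "\<D> \<theta> z = (\<lambda>v. 0)"
  by (rule frechet_derivative_zero_outside[where C=K and c=0]) (use assms in \<open>auto simp: compact_imp_closed\<close>)
 then show ?thesis by (simp add: tdiv_def)
qed

text \<open>Multiplying a test field by a function of the base point produces the derivative of that
 function along the mean projection: the source of weak derivatives of smooth functions.\<close>

lemma tdiv_scaleR:
 assumes u: "smooth (u :: real^'n \<Rightarrow> real)" and \<theta>: "smooth \<theta>"
 shows "tdiv (\<lambda>z. u z *\<^sub>R \<theta> z) z = u z * tdiv \<theta> z + \<D> u z (pproj z (\<theta> z))"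
proof -
 have D: "\<D> (\<lambda>z. u z *\<^sub>R \<theta> z) z v = u z *\<^sub>R \<D> \<theta> z v + \<D> u z v *\<^sub>R \<theta> z" for v
  by (rule fun_cong[OF frechet_derivative_at[OF has_derivative_scaleR[OF smooth_D(1)[OF u] smooth_D(1)[OF \<theta>]], symmetric]])
 let ?Du = "\<lambda>j. \<D> u z (axis j 1)"
 have l: "linear (\<D> u z)" by (rule smooth_D(5)[OF u])
 have "\<D> u z (pproj z (\<theta> z)) = (\<Sum>j\<in>UNIV. (\<Sum>i\<in>UNIV. \<theta> z $ i * mean_proj z $ i $ j) * ?Du j)"
  unfolding pproj_def
  using linear_sum[OF l, of "\<lambda>j. (\<Sum>i\<in>UNIV. \<theta> z $ i * mean_proj z $ i $ j) *\<^sub>R axis j 1" UNIV] linear_scale[OF l] by simp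
 also have "\<dots> = (\<Sum>j\<in>UNIV. \<Sum>i\<in>UNIV. ?Du j * \<theta> z $ i * mean_proj z $ i $ j)"
  by (intro sum.cong refl) (subst sum_distrib_right, intro sum.cong refl, simp add: mult_ac)
 finally show ?thesis
  unfolding tdiv_def D by (simp add: sum.distrib distrib_right sum_distrib_left mult.assoc)
qed

text \<open>The identities in question are stable under bounded pointwise convergence of the function and
 dominated almost everywhere convergence of the derivative term.\<close>

lemma variation_formula_limit:
 assumes \<theta>: "\<theta> \<in> test_fields U" and K: "compact K" and \<theta>0: "\<And>z. z \<notin> K \<Longrightarrow> \<theta> z = 0"
  and \<phi>m: "\<And>j. \<phi> j \<in> \<M>" "\<And>j. \<phi> j \<in> \<N>" and \<psi>m: "\<psi> \<in> \<M>" "\<psi> \<in> \<N>"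
  and b: "\<And>j z. z \<in> K \<Longrightarrow> \<bar>\<phi> j z\<bar> \<le> C" and lim: "\<And>z. z \<in> K \<Longrightarrow> (\<lambda>j. \<phi> j z) \<longlonglongrightarrow> \<psi> z"
  and wm: "\<And>j. w j \<in> \<M>" "v \<in> \<M>" and wlim: "AE z in mu. (\<lambda>j. w j z) \<longlonglongrightarrow> v z"
  and W: "integrable \<mu> W" "\<And>j. AE z in mu. \<bar>w j z\<bar> \<le> W z"
  and eq: "\<And>j. \<delta> (\<lambda>z. \<phi> j z *\<^sub>R \<theta> z)
   = (\<integral>z. \<phi> j z * tdiv \<theta> z \<partial>\<mu>) + (\<integral>z. w j z \<partial>\<mu>)"
 shows "\<delta> (\<lambda>z. \<psi> z *\<^sub>R \<theta> z)
   = (\<integral>z. \<psi> z * tdiv \<theta> z \<partial>\<mu>) + (\<integral>z. v z \<partial>\<mu>)"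
proof -
 have b': "\<bar>\<psi> z\<bar> \<le> C" if "z \<in> K" for z
  by (rule LIMSEQ_le_const2[OF tendsto_rabs[OF lim[OF that]]]) (use b[OF that] in blast)
 have inK: "z \<in> K" if "\<theta> z \<noteq> 0" for z using \<theta>0 that by blast
 have t0: "tdiv \<theta> z = 0" if "z \<notin> K" for z by (rule tdiv_zero_outside[OF K _ that]) (rule \<theta>0)
 have L1: "(\<lambda>j. \<delta> (\<lambda>z. \<phi> j z *\<^sub>R \<theta> z)) \<longlonglongrightarrow> \<delta> (\<lambda>z. \<psi> z *\<^sub>R \<theta> z)"
  by (rule first_variation_ext_dominated_convergence[OF \<theta> \<phi>m(2) b[OF inK] \<psi>m(2) b'[OF inK] AE_I2]) (use lim inK in auto)
 have L2: "(\<lambda>j. \<integral>z. \<phi> j z * tdiv \<theta> z \<partial>\<mu>) \<longlonglongrightarrow> (\<integral>z. \<psi> z * tdiv \<theta> z \<partial>\<mu>)"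
 proof (rule integral_dominated_convergence[where w="\<lambda>z. C * \<bar>tdiv \<theta> z\<bar>"])
  have t: "tdiv \<theta> \<in> \<M>" using tdiv_integrable[OF \<theta>] by simp
  show "(\<lambda>z. \<psi> z * tdiv \<theta> z) \<in> \<M>" by (rule borel_measurable_times[OF \<psi>m(1) t])
  show "(\<lambda>z. \<phi> j z * tdiv \<theta> z) \<in> \<M>" for j by (rule borel_measurable_times[OF \<phi>m(1) t])
  show "integrable \<mu> (\<lambda>z. C * \<bar>tdiv \<theta> z\<bar>)" using tdiv_integrable[OF \<theta>] by simp
  have "(\<lambda>j. \<phi> j z * tdiv \<theta> z) \<longlonglongrightarrow> \<psi> z * tdiv \<theta> z" for z
   using lim[of z] t0[of z] by (cases "z \<in> K") (auto intro: tendsto_mult)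
  then show "AE z in \<mu>. (\<lambda>j. \<phi> j z * tdiv \<theta> z) \<longlonglongrightarrow> \<psi> z * tdiv \<theta> z" by (intro AE_I2)
  have "norm (\<phi> j z * tdiv \<theta> z) \<le> C * \<bar>tdiv \<theta> z\<bar>" for j z
   using b[of z j] t0[of z] by (cases "z \<in> K") (auto simp: abs_mult intro: mult_right_mono)
  then show "AE z in \<mu>. norm (\<phi> j z * tdiv \<theta> z) \<le> C * \<bar>tdiv \<theta> z\<bar>" for j by (intro AE_I2)
 qed
 have L3: "(\<lambda>j. \<integral>z. w j z \<partial>\<mu>) \<longlonglongrightarrow> (\<integral>z. v z \<partial>\<mu>)"
  by (rule integral_dominated_convergence[OF wm(2,1) W(1)]) (use wlim W(2) in \<open>simp_all add: AE_completion_iff\<close>)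
 show ?thesis by (rule LIMSEQ_unique[OF L1]) (unfold eq, rule tendsto_add[OF L2 L3])
qed

text \<open>The typical dominating function: test functions with compactly supported derivative only see
 \<open>F\<close> on sets where \<open>f\<close> is bounded.\<close>

lemma dominating_integrable:
 fixes f :: "real^'n \<Rightarrow> 'b::euclidean_space"
 assumes f: "f \<in> \<M>" and F: "F \<in> \<M>"
  and K: "compact K" "K \<subseteq> U"
  and fin: "(\<integral>\<^sup>+z. ennreal (norm (F z :: (real^'n) \<Rightarrow>\<^sub>L 'b) * indicator {z\<in>K. norm (f z) \<le> s} z) \<partial>\<mu>) < \<infinity>"
 shows "integrable \<mu> (\<lambda>z. c * (norm (F z) * indicator {z\<in>K. norm (f z) \<le> s} z) + c' * indicator K z)"
proof -
 have [measurable]: "K \<in> sets \<mu>" using radon_compact(1)[OF radon_mu open_U K] by simp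
 have nF[measurable]: "(\<lambda>z. norm (F z)) \<in> \<M>"
  by (rule measurable_compose[OF F borel_measurable_continuous_onI]) (intro continuous_intros)
 note f[measurable]
 have eq: "indicator {z\<in>K. norm (f z) \<le> s} z = (indicator K z * indicator {..s} (norm (f z)) :: real)" for z
  by (auto simp: indicator_def)
 have m: "(\<lambda>z. norm (F z) * indicator {z\<in>K. norm (f z) \<le> s} z) \<in> \<M>"
  unfolding eq by measurable
 have i1: "integrable \<mu> (\<lambda>z. norm (F z) * indicator {z\<in>K. norm (f z) \<le> s} z)"
  by (rule integrableI_bounded[OF m]) (use fin in simp)
 have i2: "integrable \<mu> (indicator K :: _ \<Rightarrow> real)"
  by (rule radon_integrable_bounded[OF radon_mu open_U _ K, of _ 1]) auto
 show ?thesis using i1 i2 by (intro Bochner_Integration.integrable_add integrable_mult_right) auto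
qed

lemma pproj_measurable:
 assumes "\<theta> \<in> \<M>"
 shows "(\<lambda>z. pproj z (\<theta> z)) \<in> \<M>"
proof -
 have "(\<lambda>z. \<theta> z $ i) \<in> \<M>" for i
  by (rule measurable_compose[OF assms borel_measurable_continuous_onI]) (intro continuous_intros)
 then show ?thesis unfolding pproj_def by measurable
qed

lemma smooth_derivative_pproj_measurable:
 assumes \<gamma>: "smooth (\<gamma> :: real^'n \<Rightarrow> 'b::euclidean_space)" and \<theta>: "\<theta> \<in> \<M>"
 shows "(\<lambda>z. \<D> \<gamma> z (pproj z (\<theta> z))) \<in> \<M>"
proof -
 have "(\<lambda>z. \<D> \<gamma> z b) \<in> \<M>" for b
  by (intro measurable_completion continuous_measurable_mu smooth_continuous_D \<gamma>)
 moreover have "(\<lambda>z. \<D> \<gamma> z (pproj z (\<theta> z)))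
   = (\<lambda>z. \<Sum>b\<in>Basis. (pproj z (\<theta> z) \<bullet> b) *\<^sub>R \<D> \<gamma> z b)"
  by (rule ext) (rule has_derivative_basis[OF smooth_D(1)[OF \<gamma>]])
 ultimately show ?thesis
  by (simp only:) (intro borel_measurable_sum borel_measurable_scaleR borel_measurable_inner pproj_measurable \<theta> borel_measurable_const)
qed

lemma test_field_measurable_mu: "\<theta> \<in> test_fields U \<Longrightarrow> \<theta> \<in> \<M>"
 by (intro measurable_completion continuous_measurable_mu smooth_D(3)) (simp add: test_fields_def)

lemma integrable_times_tdiv:
 assumes \<theta>: "\<theta> \<in> test_fields U" and K: "compact K" "K \<subseteq> U" "\<And>z. z \<notin> K \<Longrightarrow> \<theta> z = 0"
  and a: "a \<in> \<M>" "\<And>z. z \<in> K \<Longrightarrow> \<bar>a z\<bar> \<le> A"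
 shows "integrable \<mu> (\<lambda>z. a z * tdiv \<theta> z)"
proof -
 have Km[measurable]: "K \<in> sets \<mu>" using radon_compact(1)[OF radon_mu open_U K(1,2)] by simp
 note a(1)[measurable]
 have "integrable \<mu> (\<lambda>z. (a z * indicator K z) * tdiv \<theta> z)"
 proof (rule integral_tdiv(3)[OF \<theta>])
  show "\<bar>a z * indicator K z\<bar> \<le> max A 0" for z
   using a(2)[of z] by (auto simp: indicator_def)
 qed measurable
 moreover have "(a z * indicator K z) * tdiv \<theta> z = a z * tdiv \<theta> z" for z
  using tdiv_zero_outside[OF K(1), of \<theta> z] K(3) by (cases "z \<in> K") auto
 ultimately show ?thesis by simp
qed

lemma weak_diff_integrable:
 fixes f :: "real^'n \<Rightarrow> 'b::euclidean_space"
 assumes W: "weak_diff f F" and \<theta>: "\<theta> \<in> test_fields U" and \<eta>: "smooth \<eta>"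
  and 0: "\<And>y. R' < norm y \<Longrightarrow> \<D> \<eta> y = (\<lambda>v. (0::real))"
 shows "integrable \<mu> (\<lambda>z. \<D> \<eta> (f z) (F z (\<theta> z)))"
proof -
 note fm = weak_diffD(1)[OF W] and Fm = weak_diffD(3)[OF W]
 obtain K T where K: "compact K" "K \<subseteq> U" "0 \<le> T" "\<And>z. norm (\<theta> z) \<le> T" "\<And>z. z \<notin> K \<Longrightarrow> \<theta> z = 0"
  by (rule test_field_derivative_bound[OF \<theta>]) (rule that)
 obtain A where A: "0 \<le> A" "\<And>y v. \<bar>\<D> \<eta> y v\<bar> \<le> A * norm v"
  by (rule smooth_D_zero_bound[OF \<eta> 0]) (assumption, rule that)
 show ?thesis
 proof (rule Bochner_Integration.integrable_bound[OF dominating_integrable[OF fm Fm K(1,2) weak_diffD(4)[OF W K(1,2)], of "A * T" R' 0]])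
  show "(\<lambda>z. \<D> \<eta> (f z) (F z (\<theta> z))) \<in> \<M>"
   by (rule derivative_measurable[OF \<eta> fm blinfun_apply_measurable[OF Fm test_field_measurable_mu[OF \<theta>]]])
  show "AE z in \<mu>. norm (\<D> \<eta> (f z) (F z (\<theta> z)))
    \<le> norm ((A * T) * (norm (F z) * indicator {z\<in>K. norm (f z) \<le> R'} z) + 0 * indicator K z)"
  proof (rule AE_I2)
   fix z
   show "norm (\<D> \<eta> (f z) (F z (\<theta> z)))
    \<le> norm ((A * T) * (norm (F z) * indicator {z\<in>K. norm (f z) \<le> R'} z) + 0 * indicator K z)"
   proof (cases "z \<in> K \<and> norm (f z) \<le> R'")
    case True
    have "norm (F z (\<theta> z)) \<le> norm (F z) * T" by (rule order_trans[OF norm_blinfun mult_left_mono[OF K(4)]]) simp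
    then have "\<bar>\<D> \<eta> (f z) (F z (\<theta> z))\<bar> \<le> A * (norm (F z) * T)"
     by (intro order_trans[OF A(2)] mult_left_mono A(1))
    then show ?thesis using True A(1) K(3) by (simp add: mult_ac)
   next
    case False
    then have "\<D> \<eta> (f z) (F z (\<theta> z)) = 0"
     using 0[of "f z"] K(5)[of z] linear_0[OF smooth_D(5)[OF \<eta>]] by (cases "z \<in> K") (auto simp: blinfun.zero_right)
    then show ?thesis by simp
   qed
  qed
 qed
qed

text \<open>For a sum of products \<open>\<alpha>\<^sub>i(y) \<beta>\<^sub>i(w)\<close> this is a sum of instances of the definition of weak
 derivatives, with test fields \<open>\<beta>\<^sub>i(\<gamma>) \<theta>\<close>. Such sums approximate \<open>\<Psi>\<close> and its derivative uniformly on
 the range of \<open>w\<close> occurring on the support of \<open>\<theta>\<close>, with error terms that are linear in \<open>F \<theta>\<close> where \<open>f\<close> is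
 bounded by \<open>R'\<close>, and free of \<open>F\<close> elsewhere.\<close>

lemma chain_smooth:
 fixes f :: "real^'n \<Rightarrow> 'b::euclidean_space" and \<gamma> :: "real^'n \<Rightarrow> real^'k" and \<Psi> :: "'b \<times> (real^'k) \<Rightarrow> real"
 assumes W: "weak_diff f F" and \<gamma>: "smooth \<gamma>" and \<theta>: "\<theta> \<in> test_fields U"
  and K: "compact K" "K \<subseteq> U" "\<And>z. z \<notin> K \<Longrightarrow> \<theta> z = 0"
  and R: "0 \<le> R" "\<And>z. z \<in> K \<Longrightarrow> norm (\<gamma> z) \<le> R"
  and \<Psi>: "smooth \<Psi>" and R': "0 \<le> R'"
  and 0: "\<And>y w. norm w < R + 2 \<Longrightarrow> R' < norm y \<Longrightarrow> \<D> \<Psi> (y, w) = (\<lambda>v. 0)"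
 shows "\<delta> (\<lambda>z. \<Psi> (f z, \<gamma> z) *\<^sub>R \<theta> z) =
   (\<integral>z. \<Psi> (f z, \<gamma> z) * tdiv \<theta> z \<partial>\<mu>)
   + (\<integral>z. \<D> \<Psi> (f z, \<gamma> z) (F z (\<theta> z), \<D> \<gamma> z (pproj z (\<theta> z))) \<partial>\<mu>)"
proof -
 note fm = weak_diffD(1)[OF W] and fn = weak_diffD(2)[OF W] and Fm = weak_diffD(3)[OF W]
 note \<theta>m = test_field_measurable_mu[OF \<theta>]
 have s\<theta>: "smooth \<theta>" using \<theta> by (simp add: test_fields_def)
 define u where "u z = F z (\<theta> z)" for z
 define v where "v z = \<D> \<gamma> z (pproj z (\<theta> z))" for z
 have um: "u \<in> \<M>" unfolding u_def by (rule blinfun_apply_measurable[OF Fm \<theta>m])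
 have vm: "v \<in> \<M>" unfolding v_def by (rule smooth_derivative_pproj_measurable[OF \<gamma> \<theta>m])
 have \<gamma>m: "\<gamma> \<in> \<M>" "\<gamma> \<in> \<N>"
  by (intro measurable_completion continuous_measurable_mu continuous_measurable_nu smooth_D(3) \<gamma>)+
 obtain T where T: "0 \<le> T" "\<And>z. norm (\<theta> z) \<le> T"
  by (rule test_field_derivative_bound[OF \<theta>]) (rule that)
 obtain A\<gamma> where A\<gamma>: "0 \<le> A\<gamma>" "\<And>x v. x \<in> K \<Longrightarrow> norm (\<D> \<gamma> x v) \<le> A\<gamma> * norm v"
  by (rule smooth_derivative_bounded[OF \<gamma> K(1)]) (rule that)
 define cP where "cP = real CARD('n) * real CARD('n)"
 have cP: "0 \<le> cP" by (simp add: cP_def)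
 have u0: "u z = 0" and v0: "v z = 0" if "z \<notin> K" for z
  using K(3)[OF that] linear_0[OF linear_pproj] linear_0[OF smooth_D(5)[OF \<gamma>]] by (simp_all add: u_def v_def)
 have ub: "norm (u z) \<le> norm (F z) * T" for z
  unfolding u_def by (rule order_trans[OF norm_blinfun mult_left_mono[OF T(2)]]) simp
 define Bv where "Bv = A\<gamma> * (cP * T)"
 have Bv0: "0 \<le> Bv" using A\<gamma>(1) cP T(1) by (simp add: Bv_def)
 have vb: "norm (v z) \<le> Bv" if "z \<in> K" for z
 proof -
  have "norm (v z) \<le> A\<gamma> * norm (pproj z (\<theta> z))" unfolding v_def by (rule A\<gamma>(2)[OF that])
  also have "\<dots> \<le> A\<gamma> * (cP * norm (\<theta> z))" unfolding cP_def by (intro mult_left_mono norm_pproj_le A\<gamma>(1))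
  also have "\<dots> \<le> Bv" unfolding Bv_def using T cP A\<gamma>(1) by (intro mult_left_mono) auto
  finally show ?thesis .
 qed
 show ?thesis
 proof (rule tensor_approximation[OF \<Psi> R(1) R' 0])
  fix I :: "nat \<Rightarrow> (('k \<Rightarrow> int) \<times> 'k option) set" and \<alpha> :: "nat \<Rightarrow> (('k \<Rightarrow> int) \<times> 'k option) \<Rightarrow> 'b \<Rightarrow> real"
   and \<beta> :: "nat \<Rightarrow> (('k \<Rightarrow> int) \<times> 'k option) \<Rightarrow> real^'k \<Rightarrow> real" and C :: real and n0 :: nat
  assume I: "\<And>n. finite (I n)" and s\<alpha>: "\<And>n i. smooth (\<alpha> n i)" and s\<beta>: "\<And>n i. smooth (\<beta> n i)"
   and C: "0 \<le> C" and n0: "0 < n0"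
   and \<alpha>0: "\<And>n i y. i \<in> I n \<Longrightarrow> R' < norm y \<Longrightarrow> \<D> (\<alpha> n i) y = (\<lambda>v. 0)"
   and app0: "\<And>n y w. n0 \<le> n \<Longrightarrow> norm w \<le> R \<Longrightarrow> \<bar>(\<Sum>i\<in>I n. \<alpha> n i y * \<beta> n i w) - \<Psi> (y, w)\<bar> \<le> C / real n"
   and app1: "\<And>n y w u v. n0 \<le> n \<Longrightarrow> norm w \<le> R \<Longrightarrow>
    \<bar>(\<Sum>i\<in>I n. \<D> (\<alpha> n i) y u * \<beta> n i w + \<alpha> n i y * \<D> (\<beta> n i) w v)
     - \<D> \<Psi> (y, w) (u, v)\<bar> \<le> C * (norm u + norm v) / real n"
  define P where "P n z = (\<Sum>i\<in>I n. \<alpha> n i (f z) * \<beta> n i (\<gamma> z))" for n z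
  define S where "S n z = (\<Sum>i\<in>I n. \<D> (\<alpha> n i) (f z) (u z) * \<beta> n i (\<gamma> z)
    + \<alpha> n i (f z) * \<D> (\<beta> n i) (\<gamma> z) (v z))" for n z
  have \<alpha>m: "(\<lambda>z. \<alpha> n i (f z)) \<in> \<M>" "(\<lambda>z. \<alpha> n i (f z)) \<in> \<N>" for n i
   by (rule smooth_compose_measurable[OF s\<alpha> fm], rule smooth_compose_measurable[OF s\<alpha> fn])
  have \<beta>m: "(\<lambda>z. \<beta> n i (\<gamma> z)) \<in> \<M>" "(\<lambda>z. \<beta> n i (\<gamma> z)) \<in> \<N>" for n i
   by (rule smooth_compose_measurable[OF s\<beta> \<gamma>m(1)], rule smooth_compose_measurable[OF s\<beta> \<gamma>m(2)])
  have D\<alpha>m: "(\<lambda>z. \<D> (\<alpha> n i) (f z) (u z)) \<in> \<M>" for n i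
   by (rule derivative_measurable[OF s\<alpha> fm um])
  have D\<beta>m: "(\<lambda>z. \<D> (\<beta> n i) (\<gamma> z) (v z)) \<in> \<M>" for n i
   by (rule derivative_measurable[OF s\<beta> \<gamma>m(1) vm])
  have Pm: "P n \<in> \<M>" "P n \<in> \<N>" for n
   unfolding P_def[abs_def]
   by (intro borel_measurable_sum borel_measurable_times \<alpha>m \<beta>m)+
  have Sm: "S n \<in> \<M>" for n
   unfolding S_def[abs_def]
   by (intro borel_measurable_sum borel_measurable_times borel_measurable_add \<alpha>m \<beta>m D\<alpha>m D\<beta>m)
  have step: "\<delta> (\<lambda>z. P n z *\<^sub>R \<theta> z) = (\<integral>z. P n z * tdiv \<theta> z \<partial>\<mu>) + (\<integral>z. S n z \<partial>\<mu>)" for n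
  proof -
   define \<xi> where "\<xi> i z = \<beta> n i (\<gamma> z) *\<^sub>R \<theta> z" for i z
   have s\<beta>\<gamma>: "smooth (\<lambda>z. \<beta> n i (\<gamma> z))" for i by (rule smooth_compose[OF s\<beta> \<gamma>])
   have \<xi>: "\<xi> i \<in> test_fields U" for i unfolding \<xi>_def[abs_def] by (rule test_fields_scaleR[OF s\<beta>\<gamma> \<theta>])
   have \<xi>0: "\<xi> i z = 0" if "z \<notin> K" for i z using K(3)[OF that] by (simp add: \<xi>_def)
   have D\<beta>\<gamma>: "\<D> (\<lambda>z. \<beta> n i (\<gamma> z)) z = (\<lambda>w. \<D> (\<beta> n i) (\<gamma> z) (\<D> \<gamma> z w))" for i z
    by (rule frechet_derivative_at[OF has_derivative_compose[OF smooth_D(1)[OF \<gamma>] smooth_D(1)[OF s\<beta>]], symmetric])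
   have td: "tdiv (\<xi> i) z = \<beta> n i (\<gamma> z) * tdiv \<theta> z + \<D> (\<beta> n i) (\<gamma> z) (v z)" for i z
    unfolding \<xi>_def[abs_def] tdiv_scaleR[OF s\<beta>\<gamma> s\<theta>] D\<beta>\<gamma> v_def ..
   have Fx: "F z (\<xi> i z) = \<beta> n i (\<gamma> z) *\<^sub>R u z" for i z by (simp add: \<xi>_def u_def blinfun.scaleR_right)
   have Dx: "\<D> (\<alpha> n i) (f z) (F z (\<xi> i z)) = \<D> (\<alpha> n i) (f z) (u z) * \<beta> n i (\<gamma> z)" for i z
    unfolding Fx using linear_scale[OF smooth_D(5)[OF s\<alpha>]] by simp
   have eq: "\<delta> (\<lambda>z. \<alpha> n i (f z) *\<^sub>R \<xi> i z) =
     (\<integral>z. \<alpha> n i (f z) * tdiv (\<xi> i) z \<partial>\<mu>)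
     + (\<integral>z. \<D> (\<alpha> n i) (f z) (F z (\<xi> i z)) \<partial>\<mu>)" if "i \<in> I n" for i
    by (rule weak_diffD(5)[OF W \<xi> s\<alpha> R' \<alpha>0[OF that]])
   have i\<nu>: "integrable \<nu> (\<lambda>z. \<alpha> n i (f z) *\<^sub>R \<xi> i z)" if i: "i \<in> I n" for i
   proof -
    obtain A where "0 \<le> A" "\<And>y. \<bar>\<alpha> n i y\<bar> \<le> A"
     by (rule bounded_of_compact_derivative1[OF s\<alpha> R' \<alpha>0[OF i]]) (assumption, rule that)
    then show ?thesis by (intro integrable_scaled_test_field[OF \<xi> \<alpha>m(2)])
   qed
   have ia: "integrable \<mu> (\<lambda>z. \<alpha> n i (f z) * tdiv (\<xi> i) z)" if i: "i \<in> I n" for i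
   proof -
    obtain A where A: "0 \<le> A" "\<And>y. \<bar>\<alpha> n i y\<bar> \<le> A"
     by (rule bounded_of_compact_derivative1[OF s\<alpha> R' \<alpha>0[OF i]]) (assumption, rule that)
    show ?thesis by (rule integrable_times_tdiv[OF \<xi> K(1,2) \<xi>0 \<alpha>m(1) A(2)])
   qed
   have ib: "integrable \<mu> (\<lambda>z. \<D> (\<alpha> n i) (f z) (F z (\<xi> i z)))" if i: "i \<in> I n" for i
    by (rule weak_diff_integrable[OF W \<xi> s\<alpha> \<alpha>0[OF i]])
   have "\<delta> (\<lambda>z. P n z *\<^sub>R \<theta> z) = \<delta> (\<lambda>z. \<Sum>i\<in>I n. \<alpha> n i (f z) *\<^sub>R \<xi> i z)"
    unfolding P_def \<xi>_def scaleR_sum_left by simp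
   also have "\<dots> = (\<Sum>i\<in>I n. \<delta> (\<lambda>z. \<alpha> n i (f z) *\<^sub>R \<xi> i z))"
    by (rule first_variation_ext_sum[OF I i\<nu>])
   also have "\<dots> = (\<Sum>i\<in>I n. \<integral>z. \<alpha> n i (f z) * tdiv (\<xi> i) z + \<D> (\<alpha> n i) (f z) (F z (\<xi> i z)) \<partial>\<mu>)"
    using eq ia ib by (intro sum.cong refl) simp
   also have "\<dots> = (\<integral>z. (\<Sum>i\<in>I n. \<alpha> n i (f z) * tdiv (\<xi> i) z + \<D> (\<alpha> n i) (f z) (F z (\<xi> i z))) \<partial>\<mu>)"
    using ia ib by (intro Bochner_Integration.integral_sum[symmetric] Bochner_Integration.integrable_add)
   finally have e1: "\<delta> (\<lambda>z. P n z *\<^sub>R \<theta> z) =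
     (\<integral>z. (\<Sum>i\<in>I n. \<alpha> n i (f z) * tdiv (\<xi> i) z + \<D> (\<alpha> n i) (f z) (F z (\<xi> i z))) \<partial>\<mu>)" .
   have pt: "(\<Sum>i\<in>I n. \<alpha> n i (f z) * tdiv (\<xi> i) z + \<D> (\<alpha> n i) (f z) (F z (\<xi> i z)))
     = P n z * tdiv \<theta> z + S n z" for z
    unfolding td Dx P_def S_def sum_distrib_right sum.distrib[symmetric]
    by (intro sum.cong refl) (simp add: algebra_simps)
   have iS0: "integrable \<mu> (\<lambda>z. P n z * tdiv \<theta> z + S n z)"
    unfolding pt[symmetric] using ia ib by (intro Bochner_Integration.integrable_sum Bochner_Integration.integrable_add)
   have iP: "integrable \<mu> (\<lambda>z. P n z * tdiv \<theta> z)"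
   proof -
    have "\<exists>B. \<forall>z\<in>K. \<bar>\<alpha> n i (f z) * \<beta> n i (\<gamma> z)\<bar> \<le> B" if i: "i \<in> I n" for i
    proof -
     obtain A where A: "0 \<le> A" "\<And>y. \<bar>\<alpha> n i y\<bar> \<le> A"
      by (rule bounded_of_compact_derivative1[OF s\<alpha> R' \<alpha>0[OF i]]) (assumption, rule that)
     have "bounded ((\<lambda>z. \<beta> n i (\<gamma> z)) ` K)"
      by (intro compact_imp_bounded compact_continuous_image smooth_D(3) s\<beta>\<gamma> K(1))
     then obtain B where B: "\<forall>y\<in>(\<lambda>z. \<beta> n i (\<gamma> z)) ` K. norm y \<le> B" unfolding bounded_iff by blast
     have "\<bar>\<alpha> n i (f z) * \<beta> n i (\<gamma> z)\<bar> \<le> A * B" if "z \<in> K" for z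
      unfolding abs_mult using A B that by (intro mult_mono) auto
     then show ?thesis by blast
    qed
    then obtain B where B: "\<And>i z. i \<in> I n \<Longrightarrow> z \<in> K \<Longrightarrow> \<bar>\<alpha> n i (f z) * \<beta> n i (\<gamma> z)\<bar> \<le> B i" by metis
    show ?thesis
    proof (rule integrable_times_tdiv[OF \<theta> K(1,2) _ Pm(1)])
     show "\<theta> z = 0" if "z \<notin> K" for z by (rule K(3)[OF that])
     show "\<bar>P n z\<bar> \<le> (\<Sum>i\<in>I n. B i)" if "z \<in> K" for z
      unfolding P_def by (rule order_trans[OF sum_abs sum_mono[OF B[OF _ that]]])
    qed
   qed
   have iS: "integrable \<mu> (S n)"
    using Bochner_Integration.integrable_diff[OF iS0 iP] by simp
   show ?thesis unfolding e1 pt using iP iS by simp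
  qed
  have zero': "\<D> \<Psi> (y, w) = (\<lambda>v. 0)" if "norm w \<le> R" "R' < norm y" for y w
   using that by (intro 0) auto
  obtain C\<Psi> where C\<Psi>: "0 \<le> C\<Psi>" "\<And>y w. norm w \<le> R \<Longrightarrow> \<bar>\<Psi> (y, w)\<bar> \<le> C\<Psi>"
   by (rule bounded_of_compact_derivative[OF \<Psi> R' zero']) (assumption, assumption, rule that)
  obtain A where A: "0 \<le> A" "\<And>x w. x \<in> cball (0::'b) R' \<times> cball (0::real^'k) R \<Longrightarrow> norm (\<D> \<Psi> x w) \<le> A * norm w"
   by (rule smooth_derivative_bounded[OF \<Psi> compact_Times[OF compact_cball compact_cball]]) (rule that)
  have \<Psi>m: "(\<lambda>z. \<Psi> (f z, \<gamma> z)) \<in> \<M>" "(\<lambda>z. \<Psi> (f z, \<gamma> z)) \<in> \<N>"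
   by (intro smooth_compose_measurable[OF \<Psi>] borel_measurable_Pair fm fn \<gamma>m)+
  have D\<Psi>m: "(\<lambda>z. \<D> \<Psi> (f z, \<gamma> z) (u z, v z)) \<in> \<M>"
   by (intro derivative_measurable[OF \<Psi>] borel_measurable_Pair fm \<gamma>m um vm)
  have Cn: "C / real n \<le> C" if "n0 \<le> n" for n
  proof -
   have "1 \<le> real n" using that n0 by simp
   then show ?thesis using C mult_left_mono[of 1 "real n" C] by (simp add: field_simps)
  qed
  have zero_lim: "(\<lambda>j. c / real (j + n0)) \<longlonglongrightarrow> 0" for c :: real
   using LIMSEQ_ignore_initial_segment[OF lim_const_over_n[of c], of n0] .
  have Plim: "(\<lambda>j. P (j + n0) z) \<longlonglongrightarrow> \<Psi> (f z, \<gamma> z)" if "z \<in> K" for z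
  proof (rule LIM_zero_cancel, rule Lim_null_comparison[OF _ zero_lim])
   show "eventually (\<lambda>j. norm (P (j + n0) z - \<Psi> (f z, \<gamma> z)) \<le> C / real (j + n0)) sequentially"
    unfolding P_def real_norm_def by (intro always_eventually allI app0 R(2)[OF that]) simp
  qed
  have Pb: "\<bar>P (j + n0) z\<bar> \<le> C\<Psi> + C" if "z \<in> K" for j z
   using app0[OF _ R(2)[OF that], of "j + n0" "f z"] Cn[of "j + n0"] C\<Psi>(2)[OF R(2)[OF that], of "f z"]
   unfolding P_def by linarith
  let ?W = "\<lambda>z. ((A + C) * T) * (norm (F z) * indicator {z\<in>K. norm (f z) \<le> R'} z) + ((A + C) * Bv) * indicator K z"
  have "\<delta> (\<lambda>z. \<Psi> (f z, \<gamma> z) *\<^sub>R \<theta> z) = (\<integral>z. \<Psi> (f z, \<gamma> z) * tdiv \<theta> z \<partial>\<mu>)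
    + (\<integral>z. \<D> \<Psi> (f z, \<gamma> z) (u z, v z) \<partial>\<mu>)"
  proof (rule variation_formula_limit[where \<phi>="\<lambda>j. P (j + n0)" and w="\<lambda>j. S (j + n0)" and W="?W", OF \<theta> K(1) _ Pm \<Psi>m Pb Plim Sm D\<Psi>m _ _ _ step])
   show "\<theta> z = 0" if "z \<notin> K" for z by (rule K(3)[OF that])
   show "integrable \<mu> ?W"
    by (rule dominating_integrable[OF fm Fm K(1,2) weak_diffD(4)[OF W K(1,2)]])
   have S0: "S n z = 0" if "z \<notin> K" for n z
    unfolding S_def u0[OF that] v0[OF that] using linear_0[OF smooth_D(5)[OF s\<alpha>]] linear_0[OF smooth_D(5)[OF s\<beta>]] by simp
   have D0: "\<D> \<Psi> (f z, \<gamma> z) (u z, v z) = 0" if "z \<notin> K" for z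
    unfolding u0[OF that] v0[OF that] using linear_0[OF smooth_D(5)[OF \<Psi>]] by (simp add: zero_prod_def)
   show "AE z in mu. (\<lambda>j. S (j + n0) z) \<longlonglongrightarrow> \<D> \<Psi> (f z, \<gamma> z) (u z, v z)"
   proof (rule AE_I2)
    fix z
    show "(\<lambda>j. S (j + n0) z) \<longlonglongrightarrow> \<D> \<Psi> (f z, \<gamma> z) (u z, v z)"
    proof (cases "z \<in> K")
     case True
     show ?thesis
     proof (rule LIM_zero_cancel, rule Lim_null_comparison[OF _ zero_lim])
      show "eventually (\<lambda>j. norm (S (j + n0) z - \<D> \<Psi> (f z, \<gamma> z) (u z, v z))
        \<le> C * (norm (u z) + norm (v z)) / real (j + n0)) sequentially"
       unfolding S_def real_norm_def by (intro always_eventually allI app1 R(2)[OF True]) simp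
     qed
    next
     case False
     then show ?thesis using S0 D0 by simp
    qed
   qed
   show "AE z in mu. \<bar>S (j + n0) z\<bar> \<le> ?W z" for j
   proof (rule AE_I2)
    fix z
    let ?n = "j + n0"
    have Cn': "C * c / real ?n \<le> C * c" if "0 \<le> c" for c
     using mult_right_mono[OF Cn[of ?n] that] by simp
    show "\<bar>S (j + n0) z\<bar> \<le> ?W z"
    proof (cases "z \<in> K")
     case zK: True
     show ?thesis
     proof (cases "norm (f z) \<le> R'")
      case True
      have "\<bar>\<D> \<Psi> (f z, \<gamma> z) (u z, v z)\<bar> \<le> A * norm (u z, v z)"
       using A(2)[of "(f z, \<gamma> z)" "(u z, v z)"] True R(2)[OF zK] by simp
      also have "\<dots> \<le> A * (norm (u z) + norm (v z))" by (intro mult_left_mono norm_Pair_le A(1))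
      finally have "\<bar>S ?n z\<bar> \<le> A * (norm (u z) + norm (v z)) + C * (norm (u z) + norm (v z))"
       using app1[OF _ R(2)[OF zK], of ?n "f z" "u z" "v z"] Cn'[of "norm (u z) + norm (v z)"]
       unfolding S_def by force
      also have "\<dots> = (A + C) * (norm (u z) + norm (v z))" by (simp add: distrib_right)
      also have "\<dots> \<le> (A + C) * (norm (F z) * T + Bv)"
       using ub[of z] vb[OF zK] A(1) C by (intro mult_left_mono add_mono) auto
      finally show ?thesis using True zK by (simp add: algebra_simps)
     next
      case False
      \<comment> \<open>Where \<open>norm (f z) > R'\<close>, the derivatives of \<open>\<alpha> i\<close> vanish, so that \<open>u z\<close> may be replaced by zero.\<close>
      have "S ?n z = (\<Sum>i\<in>I ?n. \<D> (\<alpha> ?n i) (f z) 0 * \<beta> ?n i (\<gamma> z)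
        + \<alpha> ?n i (f z) * \<D> (\<beta> ?n i) (\<gamma> z) (v z))"
       unfolding S_def using \<alpha>0[of _ ?n "f z"] False by (intro sum.cong refl) auto
      moreover have "\<D> \<Psi> (f z, \<gamma> z) (0, v z) = 0" using zero'[OF R(2)[OF zK], of "f z"] False by simp
      ultimately have "\<bar>S ?n z\<bar> \<le> C * norm (v z)"
       using app1[OF _ R(2)[OF zK], of ?n "f z" 0 "v z"] Cn'[of "norm (v z)"] by force
      also have "\<dots> \<le> (A + C) * Bv" using vb[OF zK] A(1) C by (intro mult_mono) auto
      finally show ?thesis using False zK by simp
     qed
    qed (simp add: S0)
   qed
  qed
  then show ?thesis unfolding u_def v_def .
 qed
qed

end


section \<open>Composition with Lipschitz maps\<close>

lemma smooth_derivative_tendsto: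
 fixes f :: "'a::euclidean_space \<Rightarrow> 'b::real_normed_vector"
 assumes f: "smooth f" and x: "(x \<longlongrightarrow> a) F" and v: "(v \<longlongrightarrow> w) F"
 shows "((\<lambda>j. \<D> f (x j) (v j)) \<longlongrightarrow> \<D> f a w) F"
proof -
 have e: "\<D> f y u = (\<Sum>b\<in>Basis. (u \<bullet> b) *\<^sub>R \<D> f y b)" for y u
  by (rule has_derivative_basis[OF smooth_D(1)[OF f]])
 have "((\<lambda>j. \<D> f (x j) b) \<longlongrightarrow> \<D> f a b) F" for b
  by (rule continuous_on_tendsto_compose[OF smooth_continuous_D[OF f, of UNIV] x]) auto
 then have t: "((\<lambda>j. \<Sum>b\<in>Basis. (v j \<bullet> b) *\<^sub>R \<D> f (x j) b)
   \<longlongrightarrow> (\<Sum>b\<in>Basis. (w \<bullet> b) *\<^sub>R \<D> f a b)) F"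
  by (intro tendsto_sum tendsto_scaleR tendsto_inner v tendsto_const)
 have eq: "(\<lambda>j. \<D> f (x j) (v j)) = (\<lambda>j. \<Sum>b\<in>Basis. (v j \<bullet> b) *\<^sub>R \<D> f (x j) b)"
  by (rule ext) (rule e)
 show ?thesis unfolding eq e[of a w] by (rule t)
qed

lemma frechet_derivative_compose:
 assumes "smooth \<eta>" "smooth p"
 shows "\<D> (\<lambda>x. \<eta> (p x)) x = (\<lambda>v. \<D> \<eta> (p x) (\<D> p x v))"
 by (rule frechet_derivative_at[OF has_derivative_compose[OF smooth_D(1)[OF assms(2)] smooth_D(1)[OF assms(1)]], symmetric])

context bv_varifold
begin

text \<open>The relation determines \<open>G\<close> up to null sets of the weight, being the weak derivative of \<open>g\<close>.\<close>

definition lipschitz_derivative :: "(real^'n \<Rightarrow> real^'k) \<Rightarrow> (real^'n \<Rightarrow> (real^'n) \<Rightarrow>\<^sub>L (real^'k)) \<Rightarrow> bool" where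
 "lipschitz_derivative g G \<longleftrightarrow> (\<exists>\<gamma>. smooth_approximants \<gamma> g G)"

lemma lipschitz_derivative_exists:
 fixes g :: "real^'n \<Rightarrow> real^'k"
 assumes "locally_lipschitz_on U g"
 obtains G where "lipschitz_derivative g G"
 by (rule lipschitz_smooth_approximation[OF assms]) (auto simp: lipschitz_derivative_def)

lemma lipschitz_derivative_measurable:
 fixes g :: "real^'n \<Rightarrow> real^'k"
 assumes "lipschitz_derivative g G"
 shows "g \<in> \<M>" "g \<in> \<N>"
  "G \<in> \<M>"
proof -
 obtain \<gamma> where "smooth_approximants \<gamma> g G" using assms unfolding lipschitz_derivative_def by blast
 note \<gamma> = smooth_approximantsD[OF this]
 show "G \<in> \<M>" by (rule \<gamma>(4))
 show "g \<in> \<M>"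
 proof (rule borel_measurable_LIMSEQ_metric)
  show "\<gamma> i \<in> \<M>" for i
   by (intro measurable_completion continuous_measurable_mu smooth_D(3) \<gamma>(1))
  show "(\<lambda>i. \<gamma> i z) \<longlonglongrightarrow> g z" if "z \<in> space \<mu>" for z using \<gamma>(2) that by simp
 qed
 show "g \<in> \<N>"
 proof (rule borel_measurable_LIMSEQ_metric)
  show "\<gamma> i \<in> \<N>" for i
   by (intro measurable_completion continuous_measurable_nu smooth_D(3) \<gamma>(1))
  show "(\<lambda>i. \<gamma> i z) \<longlonglongrightarrow> g z" if "z \<in> space \<nu>" for z using \<gamma>(2) that by simp
 qed
qed

lemma lipschitz_derivative_bound:
 fixes g :: "real^'n \<Rightarrow> real^'k"
 assumes L: "lipschitz_derivative g G" and K: "compact K" "K \<subseteq> U"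
 obtains B where "0 \<le> B" "\<And>z. z \<in> K \<Longrightarrow> norm (g z) \<le> B" "AE z in mu. z \<in> K \<longrightarrow> norm (G z) \<le> B"
proof -
 obtain \<gamma> where "smooth_approximants \<gamma> g G" using L unfolding lipschitz_derivative_def by blast
 note \<gamma> = smooth_approximantsD[OF this]
 obtain B where B: "0 \<le> B" "\<forall>j. \<forall>z\<in>K. norm (\<gamma> j z) \<le> B \<and> norm (g z) \<le> B \<and>
    (\<forall>v. norm (\<D> (\<gamma> j) z (pproj z v)) \<le> B * norm v)"
  using \<gamma>(3)[OF K] by blast
 show thesis
 proof (rule that[OF B(1)])
  show "norm (g z) \<le> B" if "z \<in> K" for z using B(2) that by blast
  show "AE z in mu. z \<in> K \<longrightarrow> norm (G z) \<le> B"
   using \<gamma>(5)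
  proof eventually_elim
   case (elim z)
   show ?case
   proof
    assume z: "z \<in> K"
    show "norm (G z) \<le> B"
    proof (rule norm_blinfun_bound[OF B(1)])
     fix v
     have "norm (\<D> (\<gamma> j) z (pproj z v)) \<le> B * norm v" for j using B(2) z by blast
     then show "norm (G z v) \<le> B * norm v"
      by (intro Lim_norm_ubound[OF _ elim[THEN spec, of v]] always_eventually allI) auto
    qed
   qed
  qed
 qed
qed

text \<open>Pass to the limit in the smooth approximants of \<open>g\<close>; they share bounds on the support of
 \<open>\<theta>\<close>, so that a single radius \<open>R'\<close> serves for all of them.\<close>

lemma chain_lipschitz:
 fixes f :: "real^'n \<Rightarrow> 'b::euclidean_space" and g :: "real^'n \<Rightarrow> real^'k" and \<Psi> :: "'b \<times> (real^'k) \<Rightarrow> real"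
 assumes W: "weak_diff f F" and L: "lipschitz_derivative g G" and \<theta>: "\<theta> \<in> test_fields U" and \<Psi>: "smooth \<Psi>"
  and 0: "\<And>R. \<exists>R'\<ge>0. \<forall>y w. norm w < R \<longrightarrow> R' < norm y \<longrightarrow> \<D> \<Psi> (y, w) = (\<lambda>v. 0)"
 shows "\<delta> (\<lambda>z. \<Psi> (f z, g z) *\<^sub>R \<theta> z) =
   (\<integral>z. \<Psi> (f z, g z) * tdiv \<theta> z \<partial>\<mu>)
   + (\<integral>z. \<D> \<Psi> (f z, g z) (F z (\<theta> z), G z (\<theta> z)) \<partial>\<mu>)"
proof -
 note fm = weak_diffD(1)[OF W] and fn = weak_diffD(2)[OF W] and Fm = weak_diffD(3)[OF W]
 note gm = lipschitz_derivative_measurable[OF L]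
 note \<theta>m = test_field_measurable_mu[OF \<theta>]
 obtain \<gamma> where "smooth_approximants \<gamma> g G" using L unfolding lipschitz_derivative_def by blast
 note \<gamma> = smooth_approximantsD[OF this]
 obtain K T where K: "compact K" "K \<subseteq> U" "0 \<le> T" "\<And>z. norm (\<theta> z) \<le> T" "\<And>z. z \<notin> K \<Longrightarrow> \<theta> z = 0"
  by (rule test_field_derivative_bound[OF \<theta>]) (rule that)
 obtain B where B: "0 \<le> B" "\<forall>j. \<forall>z\<in>K. norm (\<gamma> j z) \<le> B \<and> norm (g z) \<le> B \<and>
    (\<forall>v. norm (\<D> (\<gamma> j) z (pproj z v)) \<le> B * norm v)"
  using \<gamma>(3)[OF K(1,2)] by blast
 have \<gamma>B: "norm (\<gamma> j z) \<le> B" and gB: "norm (g z) \<le> B"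
  and D\<gamma>B: "norm (\<D> (\<gamma> j) z (pproj z v)) \<le> B * norm v" if "z \<in> K" for j z v
  using B(2) that by blast+
 obtain R' where R': "0 \<le> R'" "\<forall>y w. norm w < B + 2 \<longrightarrow> R' < norm y \<longrightarrow> \<D> \<Psi> (y, w) = (\<lambda>v. 0)"
  using 0[of "B + 2"] by blast
 have zero': "\<D> \<Psi> (y, w) = (\<lambda>v. 0)" if "norm w \<le> B" "R' < norm y" for y w
  using R'(2) that B(1) by simp
 define u where "u z = F z (\<theta> z)" for z
 define v where "v j z = \<D> (\<gamma> j) z (pproj z (\<theta> z))" for j z
 have um: "u \<in> \<M>" unfolding u_def by (rule blinfun_apply_measurable[OF Fm \<theta>m])
 have vm: "v j \<in> \<M>" for j
  unfolding v_def[abs_def] by (rule smooth_derivative_pproj_measurable[OF \<gamma>(1) \<theta>m])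
 have Gm: "(\<lambda>z. G z (\<theta> z)) \<in> \<M>" by (rule blinfun_apply_measurable[OF gm(3) \<theta>m])
 have \<gamma>m: "\<gamma> j \<in> \<M>" "\<gamma> j \<in> \<N>" for j
  by (intro measurable_completion continuous_measurable_mu continuous_measurable_nu smooth_D(3) \<gamma>(1))+
 have u0: "u z = 0" and v0: "v j z = 0" if "z \<notin> K" for j z
  using K(5)[OF that] linear_0[OF linear_pproj] linear_0[OF smooth_D(5)[OF \<gamma>(1)]] by (simp_all add: u_def v_def)
 have ub: "norm (u z) \<le> norm (F z) * T" for z
  unfolding u_def by (rule order_trans[OF norm_blinfun mult_left_mono[OF K(4)]]) simp
 have vb: "norm (v j z) \<le> B * T" if "z \<in> K" for j z
  unfolding v_def by (rule order_trans[OF D\<gamma>B[OF that] mult_left_mono[OF K(4) B(1)]])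
 have step: "\<delta> (\<lambda>z. \<Psi> (f z, \<gamma> j z) *\<^sub>R \<theta> z) =
   (\<integral>z. \<Psi> (f z, \<gamma> j z) * tdiv \<theta> z \<partial>\<mu>)
   + (\<integral>z. \<D> \<Psi> (f z, \<gamma> j z) (u z, v j z) \<partial>\<mu>)" for j
  unfolding u_def v_def
 proof (rule chain_smooth[OF W \<gamma>(1) \<theta> K(1,2) _ B(1) _ \<Psi> R'(1)])
  show "\<theta> z = 0" if "z \<notin> K" for z by (rule K(5)[OF that])
  show "norm (\<gamma> j z) \<le> B" if "z \<in> K" for z by (rule \<gamma>B[OF that])
  show "\<D> \<Psi> (y, w) = (\<lambda>v. 0)" if "norm w < B + 2" "R' < norm y" for y w
   using R'(2) that by simp
 qed
 obtain C where C: "0 \<le> C" "\<And>y w. norm w \<le> B \<Longrightarrow> \<bar>\<Psi> (y, w)\<bar> \<le> C"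
  by (rule bounded_of_compact_derivative[OF \<Psi> R'(1) zero']) (assumption, assumption, rule that)
 obtain A where A: "0 \<le> A" "\<And>x w. x \<in> cball (0::'b) R' \<times> cball (0::real^'k) B \<Longrightarrow> norm (\<D> \<Psi> x w) \<le> A * norm w"
  by (rule smooth_derivative_bounded[OF \<Psi> compact_Times[OF compact_cball compact_cball]]) (rule that)
 have \<Psi>m: "(\<lambda>z. \<Psi> (f z, \<gamma> j z)) \<in> \<M>" "(\<lambda>z. \<Psi> (f z, \<gamma> j z)) \<in> \<N>"
  "(\<lambda>z. \<Psi> (f z, g z)) \<in> \<M>" "(\<lambda>z. \<Psi> (f z, g z)) \<in> \<N>" for j
  by (intro smooth_compose_measurable[OF \<Psi>] borel_measurable_Pair fm fn \<gamma>m gm)+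
 have D\<Psi>m: "(\<lambda>z. \<D> \<Psi> (f z, \<gamma> j z) (u z, v j z)) \<in> \<M>"
  "(\<lambda>z. \<D> \<Psi> (f z, g z) (u z, G z (\<theta> z))) \<in> \<M>" for j
  by (intro derivative_measurable[OF \<Psi>] borel_measurable_Pair fm \<gamma>m um vm gm Gm)+
 have \<gamma>lim: "(\<lambda>j. \<gamma> j z) \<longlonglongrightarrow> g z" if "z \<in> K" for z using \<gamma>(2) that K(2) by blast
 have \<Psi>lim: "(\<lambda>j. \<Psi> (f z, \<gamma> j z)) \<longlonglongrightarrow> \<Psi> (f z, g z)" if "z \<in> K" for z
  by (rule continuous_on_tendsto_compose[OF smooth_D(3)[OF \<Psi>, of UNIV] tendsto_Pair[OF tendsto_const \<gamma>lim[OF that]]]) auto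
 have \<Psi>b: "\<bar>\<Psi> (f z, \<gamma> j z)\<bar> \<le> C" "\<bar>\<Psi> (f z, g z)\<bar> \<le> C" if "z \<in> K" for j z
  by (intro C(2) \<gamma>B[OF that] gB[OF that])+
 let ?W = "\<lambda>z. (A * T) * (norm (F z) * indicator {z\<in>K. norm (f z) \<le> R'} z) + (A * (B * T)) * indicator K z"
 have "\<delta> (\<lambda>z. \<Psi> (f z, g z) *\<^sub>R \<theta> z) = (\<integral>z. \<Psi> (f z, g z) * tdiv \<theta> z \<partial>\<mu>)
   + (\<integral>z. \<D> \<Psi> (f z, g z) (u z, G z (\<theta> z)) \<partial>\<mu>)"
 proof (rule variation_formula_limit[where W="?W", OF \<theta> K(1) _ \<Psi>m \<Psi>b(1) \<Psi>lim D\<Psi>m _ _ _ step])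
  show "\<theta> z = 0" if "z \<notin> K" for z by (rule K(5)[OF that])
  show "integrable \<mu> ?W"
   by (rule dominating_integrable[OF fm Fm K(1,2) weak_diffD(4)[OF W K(1,2)]])
  show "AE z in mu. (\<lambda>j. \<D> \<Psi> (f z, \<gamma> j z) (u z, v j z))
    \<longlonglongrightarrow> \<D> \<Psi> (f z, g z) (u z, G z (\<theta> z))"
   using \<gamma>(5)
  proof eventually_elim
   case (elim z)
   show ?case
   proof (cases "z \<in> K")
    case True
    have "(\<lambda>j. v j z) \<longlonglongrightarrow> G z (\<theta> z)" unfolding v_def by (rule elim[THEN spec])
    then show ?thesis
     by (intro smooth_derivative_tendsto[OF \<Psi>] tendsto_Pair tendsto_const \<gamma>lim[OF True])
   next
    case False
    then have "G z (\<theta> z) = 0" using K(5) by (simp add: blinfun.zero_right)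
    then show ?thesis unfolding u0[OF False] v0[OF False]
     using linear_0[OF smooth_D(5)[OF \<Psi>]] by (simp add: zero_prod_def)
   qed
  qed
  show "AE z in mu. \<bar>\<D> \<Psi> (f z, \<gamma> j z) (u z, v j z)\<bar>
    \<le> ?W z" for j
  proof (rule AE_I2)
   fix z
   show "\<bar>\<D> \<Psi> (f z, \<gamma> j z) (u z, v j z)\<bar>
    \<le> ?W z"
   proof (cases "z \<in> K")
    case zK: True
    show ?thesis
    proof (cases "norm (f z) \<le> R'")
     case True
     have "\<bar>\<D> \<Psi> (f z, \<gamma> j z) (u z, v j z)\<bar> \<le> A * norm (u z, v j z)"
      using A(2)[of "(f z, \<gamma> j z)" "(u z, v j z)"] True \<gamma>B[OF zK] by simp
     also have "\<dots> \<le> A * (norm (u z) + norm (v j z))" by (intro mult_left_mono norm_Pair_le A(1))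
     also have "\<dots> \<le> A * (norm (F z) * T + B * T)" by (intro mult_left_mono add_mono ub vb[OF zK] A(1))
     finally show ?thesis using True zK by (simp add: algebra_simps)
    next
     case False
     then have "\<D> \<Psi> (f z, \<gamma> j z) = (\<lambda>v. 0)" by (intro zero' \<gamma>B[OF zK]) simp
     then show ?thesis using A(1) B(1) K(3) by simp
    qed
   next
    case False
    show ?thesis unfolding u0[OF False] v0[OF False]
     using False linear_0[OF smooth_D(5)[OF \<Psi>]] by (simp add: zero_prod_def)
   qed
  qed
 qed
 then show ?thesis unfolding u_def .
qed

end


section \<open>Weak derivatives of composites\<close>

lemma measurable_norm_blinfun:
 fixes F :: "'a \<Rightarrow> (real^'n) \<Rightarrow>\<^sub>L 'b::euclidean_space"
 assumes "F \<in> borel_measurable M" shows "(\<lambda>z. norm (F z)) \<in> borel_measurable M"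
 by (rule measurable_compose[OF assms borel_measurable_continuous_onI]) (intro continuous_intros)

lemma nn_integral_finite_dominated:
 fixes f g :: "'a \<Rightarrow> real"
 assumes "AE x in M. f x \<le> g x" "integrable M g"
 shows "(\<integral>\<^sup>+x. ennreal (f x) \<partial>M) < \<infinity>"
proof -
 have "(\<integral>\<^sup>+x. ennreal (f x) \<partial>M) \<le> (\<integral>\<^sup>+x. ennreal (norm (g x)) \<partial>M)"
  by (rule nn_integral_mono_AE) (use assms(1) in eventually_elim, auto intro!: ennreal_leI)
 also have "\<dots> < \<infinity>" using assms(2) unfolding integrable_iff_bounded by blast
 finally show ?thesis .
qed

context bv_varifold
begin

lemma weak_diff_zero: "weak_diff (\<lambda>z. 0 :: 'b::euclidean_space) (\<lambda>z. 0)"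
proof -
 have "\<delta> (\<lambda>z. \<eta> 0 *\<^sub>R \<theta> z) = (\<integral>z. \<eta> 0 * tdiv \<theta> z \<partial>\<mu>)
   + (\<integral>z. \<D> \<eta> 0 0 \<partial>\<mu>)"
  if \<theta>: "\<theta> \<in> test_fields U" and \<eta>: "smooth \<eta>" for \<theta> and \<eta> :: "'b \<Rightarrow> real"
 proof -
  have "(\<lambda>z. \<eta> 0 *\<^sub>R \<theta> z) \<in> test_fields U" by (rule test_fields_scaleR[OF smooth_const \<theta>])
  then have "\<delta> (\<lambda>z. \<eta> 0 *\<^sub>R \<theta> z) = first_variation V (\<lambda>z. \<eta> 0 *\<^sub>R \<theta> z)"
   by (rule first_variation_ext_test)
  also have "\<dots> = \<eta> 0 * first_variation V \<theta>" by (rule first_variation_scaleR[OF \<theta>])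
  also have "\<dots> = (\<integral>z. \<eta> 0 * tdiv \<theta> z \<partial>\<mu>)"
   using first_variation_eq[OF \<theta>] tdiv_integrable[OF \<theta>] by simp
  finally show ?thesis using linear_0[OF smooth_D(5)[OF \<eta>]] by simp
 qed
 then show ?thesis unfolding weak_diff_def by simp
qed

text \<open>The properness of \<open>p\<close> in its first variable turns test functions \<open>\<eta>\<close> into test functions
 \<open>\<eta> \<circ> p\<close> to which the chain rule applies, and keeps \<open>f\<close> bounded where \<open>p (f, g)\<close> is.\<close>

lemma weak_diff_compose:
 fixes f :: "real^'n \<Rightarrow> 'b::euclidean_space" and g :: "real^'n \<Rightarrow> real^'k" and p :: "'b \<times> (real^'k) \<Rightarrow> 'c::euclidean_space"
  and H :: "real^'n \<Rightarrow> (real^'n) \<Rightarrow>\<^sub>L 'c"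
 assumes W: "weak_diff f F" and L: "lipschitz_derivative g G" and p: "smooth p"
  and proper: "\<And>R \<rho>. \<exists>R'\<ge>0. \<forall>y w. norm w < R \<longrightarrow> R' < norm y \<longrightarrow> \<rho> < norm (p (y, w))"
  and H: "\<And>z v. H z v = \<D> p (f z, g z) (F z v, G z v)"
 shows "weak_diff (\<lambda>z. p (f z, g z)) H"
proof -
 note fm = weak_diffD(1)[OF W] and fn = weak_diffD(2)[OF W] and Fm = weak_diffD(3)[OF W]
 note gm = lipschitz_derivative_measurable[OF L]
 have hm: "(\<lambda>z. p (f z, g z)) \<in> \<M>" "(\<lambda>z. p (f z, g z)) \<in> \<N>"
  by (intro smooth_compose_measurable[OF p] borel_measurable_Pair fm fn gm)+
 have Fb: "(\<lambda>z. F z b) \<in> \<M>" for b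
  by (rule blinfun_apply_measurable[OF Fm borel_measurable_const])
 have Gb: "(\<lambda>z. G z b) \<in> \<M>" for b
  by (rule blinfun_apply_measurable[OF gm(3) borel_measurable_const])
 have Hm: "H \<in> \<M>"
  by (rule blinfun_measurableI2, unfold H, rule derivative_measurable[OF p])
    (intro borel_measurable_Pair fm gm Fb Gb)+
 show ?thesis
  unfolding weak_diff_def
 proof (intro conjI hm Hm allI impI)
  fix K s assume K: "compact K" "K \<subseteq> U"
  obtain B where B: "0 \<le> B" "\<And>z. z \<in> K \<Longrightarrow> norm (g z) \<le> B" "AE z in mu. z \<in> K \<longrightarrow> norm (G z) \<le> B"
   by (rule lipschitz_derivative_bound[OF L K]) (rule that)
  obtain R' where R': "0 \<le> R'" "\<forall>y w. norm w < B + 1 \<longrightarrow> R' < norm y \<longrightarrow> s < norm (p (y, w))"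
   using proper[of "B + 1" s] by blast
  obtain A where A: "0 \<le> A" "\<And>x w. x \<in> cball (0::'b) R' \<times> cball (0::real^'k) B \<Longrightarrow> norm (\<D> p x w) \<le> A * norm w"
   by (rule smooth_derivative_bounded[OF p compact_Times[OF compact_cball compact_cball]]) (rule that)
  let ?D = "\<lambda>z. A * (norm (F z) * indicator {z\<in>K. norm (f z) \<le> R'} z) + (A * B) * indicator K z"
  have i: "integrable \<mu> ?D"
   by (rule dominating_integrable[OF fm Fm K weak_diffD(4)[OF W K]])
  have dom: "AE z in \<mu>. norm (H z) * indicator {z\<in>K. norm (p (f z, g z)) \<le> s} z \<le> ?D z"
   unfolding AE_completion_iff using B(3)
  proof eventually_elim
   case (elim z)
   show ?case
   proof (cases "z \<in> K \<and> norm (p (f z, g z)) \<le> s")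
    case True
    have g: "norm (g z) \<le> B" using True B(2) by simp
    have f: "norm (f z) \<le> R'" using R'(2)[rule_format, of "g z" "f z"] g True by force
    have "norm (H z) \<le> A * (norm (F z) + norm (G z))"
    proof (rule norm_blinfun_bound)
     show "0 \<le> A * (norm (F z) + norm (G z))" using A(1) by simp
     fix v
     have "norm (H z v) \<le> A * norm (F z v, G z v)" unfolding H using f g by (intro A(2)) simp
     also have "\<dots> \<le> A * (norm (F z) * norm v + norm (G z) * norm v)"
      by (intro mult_left_mono order_trans[OF norm_Pair_le] add_mono norm_blinfun A(1))
     finally show "norm (H z v) \<le> A * (norm (F z) + norm (G z)) * norm v" by (simp add: algebra_simps)
    qed
    also have "\<dots> \<le> A * (norm (F z) + B)" using elim True by (intro mult_left_mono add_left_mono A(1)) simp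
    finally show ?thesis using True f by (simp add: algebra_simps)
   next
    case False
    then have "indicator {z\<in>K. norm (p (f z, g z)) \<le> s} z = (0::real)" by simp
    then show ?thesis using A(1) B(1) by simp
   qed
  qed
  show "(\<integral>\<^sup>+z. ennreal (norm (H z) * indicator {z\<in>K. norm (p (f z, g z)) \<le> s} z) \<partial>\<mu>) < \<infinity>"
   by (rule nn_integral_finite_dominated[OF dom i])
 next
  fix \<theta> and \<eta> :: "'c \<Rightarrow> real" and R1
  assume \<theta>: "\<theta> \<in> test_fields U" and \<eta>: "smooth \<eta>" and R1: "0 \<le> R1"
   and 0: "\<forall>y. R1 < norm y \<longrightarrow> \<D> \<eta> y = (\<lambda>v. 0)"
  have D: "\<D> (\<lambda>x. \<eta> (p x)) x = (\<lambda>v. \<D> \<eta> (p x) (\<D> p x v))" for x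
   by (rule frechet_derivative_compose[OF \<eta> p])
  have "\<delta> (\<lambda>z. \<eta> (p (f z, g z)) *\<^sub>R \<theta> z) =
   (\<integral>z. \<eta> (p (f z, g z)) * tdiv \<theta> z \<partial>\<mu>)
   + (\<integral>z. \<D> (\<lambda>x. \<eta> (p x)) (f z, g z) (F z (\<theta> z), G z (\<theta> z)) \<partial>\<mu>)"
  proof (rule chain_lipschitz[OF W L \<theta> smooth_compose[OF \<eta> p]])
   fix R
   obtain R' where R': "0 \<le> R'" "\<forall>y w. norm w < R \<longrightarrow> R' < norm y \<longrightarrow> R1 < norm (p (y, w))"
    using proper[of R R1] by blast
   show "\<exists>R'\<ge>0. \<forall>y w. norm w < R \<longrightarrow> R' < norm y \<longrightarrow> \<D> (\<lambda>x. \<eta> (p x)) (y, w) = (\<lambda>v. 0)"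
    using R' 0 unfolding D by (intro exI[of _ R']) simp
  qed
  then show "\<delta> (\<lambda>z. \<eta> (p (f z, g z)) *\<^sub>R \<theta> z) =
   (\<integral>z. \<eta> (p (f z, g z)) * tdiv \<theta> z \<partial>\<mu>)
   + (\<integral>z. \<D> \<eta> (p (f z, g z)) (H z (\<theta> z)) \<partial>\<mu>)"
   unfolding D H .
 qed
qed

lemma blinfun_of_linear:
 fixes L :: "real^'n \<Rightarrow> 'b::euclidean_space"
 assumes "linear L" shows "blinfun_apply (Blinfun L) = L"
 by (rule bounded_linear_Blinfun_apply) (rule linear_conv_bounded_linear[THEN iffD1, OF assms])

lemma weak_diff_pair:
 fixes f :: "real^'n \<Rightarrow> 'b::euclidean_space" and g :: "real^'n \<Rightarrow> real^'k"
 assumes W: "weak_diff f F" and L: "lipschitz_derivative g G"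
 obtains H where "weak_diff (\<lambda>z. (f z, g z)) H" "\<And>z v. blinfun_apply (H z) v = (F z v, G z v)"
proof -
 define H where "H z = Blinfun (\<lambda>v. (F z v, G z v))" for z
 have H: "blinfun_apply (H z) v = (F z v, G z v)" for z v
 proof -
  have "linear (\<lambda>v. (F z v, G z v))"
   by (intro linearI) (simp_all add: blinfun.add_right blinfun.scaleR_right)
  then show ?thesis unfolding H_def by (simp add: blinfun_of_linear)
 qed
 have D: "\<D> (\<lambda>x :: 'b \<times> (real^'k). x) x = (\<lambda>v. v)" for x
  by (rule frechet_derivative_at[OF has_derivative_ident, symmetric])
 have "weak_diff (\<lambda>z. (\<lambda>x. x) (f z, g z)) H"
 proof (rule weak_diff_compose[OF W L smooth_ident])
  show "\<exists>R'\<ge>0. \<forall>(y::'b) (w::real^'k). norm w < R \<longrightarrow> R' < norm y \<longrightarrow> \<rho> < norm (y, w)" for R \<rho>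
  proof (intro exI[of _ "max \<rho> 0"] conjI allI impI)
   fix y :: 'b and w :: "real^'k" assume "max \<rho> 0 < norm y"
   then show "\<rho> < norm (y, w)" using norm_fst_le[of y w] by simp
  qed simp
 qed (simp add: D H)
 then show thesis by (intro that[of H] H) simp
qed

lemma weak_diff_add:
 fixes f g :: "real^'n \<Rightarrow> real^'k"
 assumes W: "weak_diff f F" and L: "lipschitz_derivative g G"
 shows "weak_diff (\<lambda>z. f z + g z) (\<lambda>z. F z + G z)"
proof -
 have b: "bounded_linear (\<lambda>x :: (real^'k) \<times> (real^'k). fst x + snd x)"
  by (intro bounded_linear_add bounded_linear_fst bounded_linear_snd)
 have D: "\<D> (\<lambda>x :: (real^'k) \<times> (real^'k). fst x + snd x) x = (\<lambda>v. fst v + snd v)" for x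
  by (rule frechet_derivative_at[OF bounded_linear_imp_has_derivative[OF b], symmetric])
 have "weak_diff (\<lambda>z. (\<lambda>x. fst x + snd x) (f z, g z)) (\<lambda>z. F z + G z)"
 proof (rule weak_diff_compose[OF W L smooth_linear[OF b]])
  show "\<exists>R'\<ge>0. \<forall>(y::real^'k) (w::real^'k). norm w < R \<longrightarrow> R' < norm y \<longrightarrow> \<rho> < norm (fst (y, w) + snd (y, w))" for R \<rho>
  proof (intro exI[of _ "max (\<rho> + R) 0"] conjI allI impI)
   fix y w :: "real^'k" assume "norm w < R" "max (\<rho> + R) 0 < norm y"
   then show "\<rho> < norm (fst (y, w) + snd (y, w))" using norm_diff_ineq[of y w] by simp
  qed simp
 qed (simp add: D blinfun.add_left)
 then show ?thesis by simp
qed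

lemma weak_diff_lipschitz:
 fixes g :: "real^'n \<Rightarrow> real^'k"
 assumes "lipschitz_derivative g G" shows "weak_diff g G"
 using weak_diff_add[OF weak_diff_zero assms] by simp

text \<open>Real valued locally Lipschitzian functions are treated as maps to the one dimensional space
 \<open>real^1\<close>; this recovers the statement for the real valued function.\<close>

lemma weak_diff_component:
 fixes g :: "real^'n \<Rightarrow> real^1"
 assumes L: "lipschitz_derivative g G"
 obtains H where "weak_diff (\<lambda>z. g z $ 1) H" "\<And>z v. blinfun_apply (H z) v = G z v $ 1"
proof -
 define H where "H z = Blinfun (\<lambda>v. G z v $ 1)" for z
 have H: "blinfun_apply (H z) v = G z v $ 1" for z v
 proof -
  have "linear (\<lambda>v. G z v $ 1)"
   by (intro linearI) (simp_all add: blinfun.add_right blinfun.scaleR_right)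
  then show ?thesis unfolding H_def by (simp add: blinfun_of_linear)
 qed
 have b: "bounded_linear (\<lambda>x :: real \<times> (real^1). fst x + snd x $ 1)"
  by (intro bounded_linear_add bounded_linear_fst bounded_linear_compose[OF bounded_linear_vec_nth bounded_linear_snd])
 have D: "\<D> (\<lambda>x :: real \<times> (real^1). fst x + snd x $ 1) x = (\<lambda>v. fst v + snd v $ 1)" for x
  by (rule frechet_derivative_at[OF bounded_linear_imp_has_derivative[OF b], symmetric])
 have "weak_diff (\<lambda>z. (\<lambda>x. fst x + snd x $ 1) (0, g z)) H"
 proof (rule weak_diff_compose[OF weak_diff_zero L smooth_linear[OF b]])
  show "\<exists>R'\<ge>0. \<forall>(y::real) (w::real^1). norm w < R \<longrightarrow> R' < norm y \<longrightarrow> \<rho> < norm (fst (y, w) + snd (y, w) $ 1)" for R \<rho>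
  proof (intro exI[of _ "max (\<rho> + R) 0"] conjI allI impI)
   fix y :: real and w :: "real^1" assume "norm w < R" "max (\<rho> + R) 0 < norm y"
   then show "\<rho> < norm (fst (y, w) + snd (y, w) $ 1)"
    using norm_diff_ineq[of y "w $ 1"] component_le_norm_cart[of w 1] by simp
  qed simp
 qed (simp add: D H)
 then show thesis by (intro that[of H] H) simp
qed

subsection \<open>Products\<close>

text \<open>Rescaling \<open>\<tau>\<close> to \<open>s *\<^sub>R \<tau> (y /\<^sub>R s)\<close> preserves the bound on the derivative, and yields
 the identity on larger and larger balls.\<close>

lemma smooth_truncation:
 obtains \<tau> :: "'b::euclidean_space \<Rightarrow> 'b" and c where "smooth \<tau>" "\<And>y. norm y \<le> 1 \<Longrightarrow> \<tau> y = y"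
  "\<And>y. 2 \<le> norm y \<Longrightarrow> \<tau> y = 0" "\<And>y. norm (\<tau> y) \<le> norm y"
  "0 \<le> c" "\<And>y u. norm (\<D> \<tau> y u) \<le> c * norm u"
proof -
 define \<tau> :: "'b \<Rightarrow> 'b" where "\<tau> y = ball_bump 0 2 y *\<^sub>R y" for y
 have s: "smooth \<tau>" unfolding \<tau>_def[abs_def] by (intro smooth_scaleR smooth_ball_bump smooth_ident)
 have 0: "\<tau> y = 0" if "2 \<le> norm y" for y using ball_bump_0[of 2 y 0] that by (simp add: \<tau>_def)
 obtain c where c: "0 \<le> c" "\<And>x v. x \<in> cball 0 2 \<Longrightarrow> norm (\<D> \<tau> x v) \<le> c * norm v"
  by (rule smooth_derivative_bounded[OF s compact_cball]) (rule that)
 show thesis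
 proof (rule that[OF s _ 0 _ c(1)])
  show "\<tau> y = y" if "norm y \<le> 1" for y using ball_bump_1[of 2 y 0] that by (simp add: \<tau>_def)
  show "norm (\<tau> y) \<le> norm y" for y
   using ball_bump_bounds[of 0 2 y] by (simp add: \<tau>_def mult_left_le_one_le)
  show "norm (\<D> \<tau> y u) \<le> c * norm u" for y u
  proof (cases "norm y \<le> 2")
   case False
   have "\<D> \<tau> y = (\<lambda>v. 0)"
    by (rule frechet_derivative_zero_outside[where C="cball 0 2" and c=0]) (use False 0 in auto)
   then show ?thesis using c(1) by simp
  qed (simp add: c(2))
 qed
qed

text \<open>The product \<open>w y\<close> is not proper in \<open>y\<close>, as \<open>w\<close> may vanish. Hence \<open>f\<close> is truncated first, and
 the truncation removed by dominated convergence with the locally integrable functions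
 \<open>norm f\<close> and \<open>norm F\<close>.\<close>

lemma weak_diff_product:
 fixes f :: "real^'n \<Rightarrow> 'b::euclidean_space" and g :: "real^'n \<Rightarrow> real^1"
 assumes W: "weak_diff f F" and L: "lipschitz_derivative g G"
  and f1: "L1_loc U mu f" and F1: "L1_loc U mu F"
 obtains H where "weak_diff (\<lambda>z. g z $ 1 *\<^sub>R f z) H"
  "\<And>z v. blinfun_apply (H z) v = (G z v $ 1) *\<^sub>R f z + g z $ 1 *\<^sub>R F z v"
proof -
 note fm = weak_diffD(1)[OF W] and fn = weak_diffD(2)[OF W] and Fm = weak_diffD(3)[OF W]
 note gm = lipschitz_derivative_measurable[OF L]
 define H where "H z = Blinfun (\<lambda>v. (G z v $ 1) *\<^sub>R f z + g z $ 1 *\<^sub>R F z v)" for z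
 have H: "blinfun_apply (H z) v = (G z v $ 1) *\<^sub>R f z + g z $ 1 *\<^sub>R F z v" for z v
 proof -
  have "linear (\<lambda>v. (G z v $ 1) *\<^sub>R f z + g z $ 1 *\<^sub>R F z v)"
   by (intro linearI) (simp_all add: blinfun.add_right blinfun.scaleR_right algebra_simps)
  then show ?thesis unfolding H_def by (simp add: blinfun_of_linear)
 qed
 have Fb: "(\<lambda>z. F z b) \<in> \<M>" for b
  by (rule blinfun_apply_measurable[OF Fm borel_measurable_const])
 have comp: "(\<lambda>z. h z $ 1) \<in> borel_measurable M" if "h \<in> borel_measurable M" for h :: "real^'n \<Rightarrow> real^1" and M
  by (rule measurable_compose[OF that borel_measurable_continuous_onI]) (intro continuous_intros)
 have Gb: "(\<lambda>z. G z b $ 1) \<in> \<M>" for b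
  by (rule comp[OF blinfun_apply_measurable[OF gm(3) borel_measurable_const]])
 have hm: "(\<lambda>z. g z $ 1 *\<^sub>R f z) \<in> \<M>" "(\<lambda>z. g z $ 1 *\<^sub>R f z) \<in> \<N>"
  by (intro borel_measurable_scaleR comp fm fn gm)+
 have Hm: "H \<in> \<M>"
  by (rule blinfun_measurableI2, unfold H) (intro borel_measurable_add borel_measurable_scaleR comp gm fm Fb Gb)
 have dom: "integrable \<mu> (\<lambda>z. (a * norm (f z) + b * norm (F z)) * indicator K z)"
  if K: "compact K" "K \<subseteq> U" for a b K
 proof -
  have [measurable]: "K \<in> sets \<mu>" using radon_compact(1)[OF radon_mu open_U K] by simp
  note fm[measurable] measurable_norm_blinfun[OF Fm, measurable]
  have nf: "(\<integral>\<^sup>+z. ennreal (norm (norm (f z) * indicator K z)) \<partial>\<mu>) = (\<integral>\<^sup>+z\<in>K. ennreal (norm (f z)) \<partial>\<mu>)"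
   "(\<integral>\<^sup>+z. ennreal (norm (norm (F z) * indicator K z)) \<partial>\<mu>) = (\<integral>\<^sup>+z\<in>K. ennreal (norm (F z)) \<partial>\<mu>)"
   by (auto intro!: nn_integral_cong simp: indicator_def)
  have "integrable \<mu> (\<lambda>z. norm (f z) * indicator K z)"
  proof (rule integrableI_bounded)
   show "(\<integral>\<^sup>+z. ennreal (norm (norm (f z) * indicator K z)) \<partial>\<mu>) < \<infinity>"
    unfolding nf(1) using f1 K unfolding L1_loc_def by blast
  qed measurable
  moreover have "integrable \<mu> (\<lambda>z. norm (F z) * indicator K z)"
  proof (rule integrableI_bounded)
   show "(\<integral>\<^sup>+z. ennreal (norm (norm (F z) * indicator K z)) \<partial>\<mu>) < \<infinity>"
    unfolding nf(2) using F1 K unfolding L1_loc_def by blast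
  qed measurable
  ultimately have "integrable \<mu> (\<lambda>z. a * (norm (f z) * indicator K z) + b * (norm (F z) * indicator K z))"
   by (intro Bochner_Integration.integrable_add integrable_mult_right)
  then show ?thesis by (simp add: algebra_simps)
 qed
 have "weak_diff (\<lambda>z. g z $ 1 *\<^sub>R f z) H"
  unfolding weak_diff_def
 proof (intro conjI hm Hm allI impI)
  fix K s assume K: "compact K" "K \<subseteq> U"
  obtain B where B: "0 \<le> B" "\<And>z. z \<in> K \<Longrightarrow> norm (g z) \<le> B" "AE z in mu. z \<in> K \<longrightarrow> norm (G z) \<le> B"
   by (rule lipschitz_derivative_bound[OF L K]) (rule that)
  have le: "AE z in \<mu>. norm (H z) * indicator {z\<in>K. norm (g z $ 1 *\<^sub>R f z) \<le> s} z
    \<le> (B * norm (f z) + B * norm (F z)) * indicator K z"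
   unfolding AE_completion_iff using B(3)
  proof eventually_elim
   case (elim z)
   show ?case
   proof (cases "z \<in> K")
    case True
    have "norm (H z) \<le> B * norm (f z) + B * norm (F z)"
    proof (rule norm_blinfun_bound)
     show "0 \<le> B * norm (f z) + B * norm (F z)" using B(1) by simp
     fix v
     have "\<bar>G z v $ 1\<bar> \<le> norm (G z) * norm v" by (rule order_trans[OF component_le_norm_cart norm_blinfun])
     also have "\<dots> \<le> B * norm v" using elim True by (intro mult_right_mono) auto
     finally have 1: "\<bar>G z v $ 1\<bar> \<le> B * norm v" .
     have 2: "\<bar>g z $ 1\<bar> \<le> B" by (rule order_trans[OF component_le_norm_cart B(2)[OF True]])
     have "norm (H z v) \<le> \<bar>G z v $ 1\<bar> * norm (f z) + \<bar>g z $ 1\<bar> * norm (F z v)"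
      unfolding H by (rule order_trans[OF norm_triangle_ineq]) simp
     also have "\<dots> \<le> (B * norm v) * norm (f z) + B * (norm (F z) * norm v)"
      by (intro add_mono mult_mono 1 2 norm_blinfun) (use B(1) in auto)
     finally show "norm (H z v) \<le> (B * norm (f z) + B * norm (F z)) * norm v" by (simp add: algebra_simps)
    qed
    then show ?thesis using True B(1) by (auto simp: indicator_def)
   qed simp
  qed
  show "(\<integral>\<^sup>+z. ennreal (norm (H z) * indicator {z\<in>K. norm (g z $ 1 *\<^sub>R f z) \<le> s} z) \<partial>\<mu>) < \<infinity>"
   by (rule nn_integral_finite_dominated[OF le dom[OF K]])
 next
  fix \<theta> and \<eta> :: "'b \<Rightarrow> real" and R1
  assume \<theta>: "\<theta> \<in> test_fields U" and \<eta>: "smooth \<eta>" and R1: "0 \<le> R1"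
   and 0: "\<forall>y. R1 < norm y \<longrightarrow> \<D> \<eta> y = (\<lambda>v. 0)"
  have zero: "\<D> \<eta> y = (\<lambda>v. 0)" if "R1 < norm y" for y using 0 that by blast
  obtain A where A: "0 \<le> A" "\<And>y v. \<bar>\<D> \<eta> y v\<bar> \<le> A * norm v"
   by (rule smooth_D_zero_bound[OF \<eta> zero]) (assumption, rule that)
  obtain C where C: "0 \<le> C" "\<And>y. \<bar>\<eta> y\<bar> \<le> C"
   by (rule bounded_of_compact_derivative1[OF \<eta> R1 zero]) (assumption, rule that)
  obtain \<tau> :: "'b \<Rightarrow> 'b" and c where \<tau>: "smooth \<tau>" "\<And>y. norm y \<le> 1 \<Longrightarrow> \<tau> y = y"
   "\<And>y. 2 \<le> norm y \<Longrightarrow> \<tau> y = 0" "\<And>y. norm (\<tau> y) \<le> norm y"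
   "0 \<le> c" "\<And>y u. norm (\<D> \<tau> y u) \<le> c * norm u"
   by (rule smooth_truncation) (rule that)
  obtain K T where K: "compact K" "K \<subseteq> U" "0 \<le> T" "\<And>z. norm (\<theta> z) \<le> T" "\<And>z. z \<notin> K \<Longrightarrow> \<theta> z = 0"
   by (rule test_field_derivative_bound[OF \<theta>]) (rule that)
  obtain B where B: "0 \<le> B" "\<And>z. z \<in> K \<Longrightarrow> norm (g z) \<le> B" "AE z in mu. z \<in> K \<longrightarrow> norm (G z) \<le> B"
   by (rule lipschitz_derivative_bound[OF L K(1,2)]) (rule that)
  \<comment> \<open>The scale is \<open>Suc s\<close> rather than \<open>s\<close>, to avoid division by zero.\<close>
  define t where "t s y = real (Suc s) *\<^sub>R \<tau> (y /\<^sub>R real (Suc s))" for s and y :: 'b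
  have ts: "smooth (t s)" for s
   unfolding t_def[abs_def] by (intro smooth_scaleR smooth_const smooth_compose[OF \<tau>(1)] smooth_ident)
  have t_id: "t s y = y" if "norm y \<le> real (Suc s)" for s y
  proof -
   have "norm (y /\<^sub>R real (Suc s)) \<le> 1" using that by (simp add: field_simps)
   from \<tau>(2)[OF this] show ?thesis by (simp add: t_def)
  qed
  have t_0: "t s y = 0" if "2 * real (Suc s) \<le> norm y" for s y
  proof -
   have "2 \<le> norm (y /\<^sub>R real (Suc s))" using that by (simp add: field_simps)
   from \<tau>(3)[OF this] show ?thesis by (simp add: t_def)
  qed
  have t_le: "norm (t s y) \<le> norm y" for s y
  proof -
   have "norm (t s y) = real (Suc s) * norm (\<tau> (y /\<^sub>R real (Suc s)))" by (simp add: t_def)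
   also have "\<dots> \<le> real (Suc s) * norm (y /\<^sub>R real (Suc s))" by (intro mult_left_mono \<tau>(4)) simp
   also have "\<dots> = norm y" by (simp del: of_nat_Suc)
   finally show ?thesis .
  qed
  have Dt: "\<D> (t s) y u = \<D> \<tau> (y /\<^sub>R real (Suc s)) u" for s y u
  proof -
   have "(t s has_derivative (\<lambda>u. real (Suc s) *\<^sub>R \<D> \<tau> (y /\<^sub>R real (Suc s)) (u /\<^sub>R real (Suc s)))) (at y)"
    unfolding t_def[abs_def]
    by (intro has_derivative_scaleR_right has_derivative_compose[OF _ smooth_D(1)[OF \<tau>(1)]] has_derivative_ident)
   then show ?thesis
    using linear_scale[OF smooth_D(5)[OF \<tau>(1)]] by (subst frechet_derivative_at[symmetric]) auto
  qed
  have Dt_le: "norm (\<D> (t s) y u) \<le> c * norm u" for s y u unfolding Dt by (rule \<tau>(6))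
  have Dt_id: "\<D> (t s) y u = u" if "norm y < real (Suc s)" for s y u
  proof -
   have "((\<lambda>x. x) has_derivative (\<lambda>u. u)) (at y)" by (rule has_derivative_ident)
   then have "(t s has_derivative (\<lambda>u. u)) (at y)"
    by (rule has_derivative_transform_within_open[where s="ball 0 (real (Suc s))"])
      (use that t_id in \<open>auto simp: dist_norm\<close>)
   then show ?thesis by (subst frechet_derivative_at[symmetric]) auto
  qed
  define q where "q s x = snd x $ 1 *\<^sub>R t s (fst x)" for s and x :: "'b \<times> (real^1)"
  have qs: "smooth (q s)" for s
   unfolding q_def[abs_def]
   by (intro smooth_scaleR smooth_compose[OF ts] smooth_linear bounded_linear_fst
      bounded_linear_compose[OF bounded_linear_vec_nth bounded_linear_snd])
  have Dq: "\<D> (q s) (y, w) (u, v) = w $ 1 *\<^sub>R \<D> (t s) y u + v $ 1 *\<^sub>R t s y" for s y w u v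
  proof -
   have "((\<lambda>x. snd x $ 1 *\<^sub>R t s (fst x)) has_derivative
     (\<lambda>x. snd (y, w) $ 1 *\<^sub>R \<D> (t s) (fst (y, w)) (fst x) + snd x $ 1 *\<^sub>R t s (fst (y, w)))) (at (y, w))"
    by (intro has_derivative_scaleR has_derivative_compose[OF _ smooth_D(1)[OF ts]] bounded_linear_imp_has_derivative
      bounded_linear_fst bounded_linear_compose[OF bounded_linear_vec_nth bounded_linear_snd])
   from fun_cong[OF frechet_derivative_at[OF this], of "(u, v)"] show ?thesis by (simp add: q_def[abs_def])
  qed
  have D: "\<D> (\<lambda>x. \<eta> (q s x)) x = (\<lambda>v. \<D> \<eta> (q s x) (\<D> (q s) x v))" for s x
   by (rule frechet_derivative_compose[OF \<eta> qs])
  define X where "X s z = g z $ 1 *\<^sub>R \<D> (t s) (f z) (F z (\<theta> z)) + G z (\<theta> z) $ 1 *\<^sub>R t s (f z)" for s z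
  have step: "\<delta> (\<lambda>z. \<eta> (q s (f z, g z)) *\<^sub>R \<theta> z) =
   (\<integral>z. \<eta> (q s (f z, g z)) * tdiv \<theta> z \<partial>\<mu>)
   + (\<integral>z. \<D> \<eta> (q s (f z, g z)) (X s z) \<partial>\<mu>)" for s
  proof -
   have "\<delta> (\<lambda>z. \<eta> (q s (f z, g z)) *\<^sub>R \<theta> z) =
    (\<integral>z. \<eta> (q s (f z, g z)) * tdiv \<theta> z \<partial>\<mu>)
    + (\<integral>z. \<D> (\<lambda>x. \<eta> (q s x)) (f z, g z) (F z (\<theta> z), G z (\<theta> z)) \<partial>\<mu>)"
   proof (rule chain_lipschitz[OF W L \<theta> smooth_compose[OF \<eta> qs]])
    fix R
    have "\<D> (q s) (y, w) v = 0" if y: "2 * real (Suc s) < norm y" for y w v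
    proof -
     have "\<D> (t s) y = (\<lambda>v. 0)"
      by (rule frechet_derivative_zero_outside[where C="cball 0 (2 * real (Suc s))" and c=0]) (use y t_0 in auto)
     then show ?thesis using Dq[of s y w "fst v" "snd v"] t_0[of s y] y by simp
    qed
    then show "\<exists>R'\<ge>0. \<forall>y w. norm w < R \<longrightarrow> R' < norm y \<longrightarrow> \<D> (\<lambda>x. \<eta> (q s x)) (y, w) = (\<lambda>v. 0)"
     unfolding D using linear_0[OF smooth_D(5)[OF \<eta>]] by (intro exI[of _ "2 * real (Suc s)"]) simp
   qed
   then show ?thesis unfolding D Dq X_def .
  qed
  have q_ev: "eventually (\<lambda>s. q s (f z, g z) = g z $ 1 *\<^sub>R f z \<and> X s z = H z (\<theta> z)) sequentially" for z
  proof -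
   have "eventually (\<lambda>s. norm (f z) < real (Suc s)) sequentially"
    using eventually_gt_at_top[of "nat \<lceil>norm (f z)\<rceil>"] by eventually_elim linarith
   then show ?thesis
   proof eventually_elim
    case (elim s)
    then show ?case using t_id[of "f z" s] Dt_id[OF elim] unfolding q_def X_def H by simp
   qed
  qed
  have qm: "(\<lambda>z. q s (f z, g z)) \<in> \<M>" "(\<lambda>z. q s (f z, g z)) \<in> \<N>" for s
   by (intro smooth_compose_measurable[OF qs] borel_measurable_Pair fm fn gm)+
  note \<theta>m = test_field_measurable_mu[OF \<theta>]
  have Xm: "X s \<in> \<M>" for s
   unfolding X_def[abs_def]
   by (intro borel_measurable_add borel_measurable_scaleR comp gm derivative_measurable[OF ts fm] smooth_compose_measurable[OF ts fm]
     blinfun_apply_measurable[OF Fm \<theta>m] blinfun_apply_measurable[OF gm(3) \<theta>m])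
  have \<eta>m: "(\<lambda>z. \<eta> (q s (f z, g z))) \<in> \<M>" "(\<lambda>z. \<eta> (q s (f z, g z))) \<in> \<N>"
   "(\<lambda>z. \<eta> (g z $ 1 *\<^sub>R f z)) \<in> \<M>" "(\<lambda>z. \<eta> (g z $ 1 *\<^sub>R f z)) \<in> \<N>" for s
   by (rule smooth_compose_measurable[OF \<eta>], intro qm hm)+
  have \<eta>lim: "(\<lambda>s. \<eta> (q s (f z, g z))) \<longlonglongrightarrow> \<eta> (g z $ 1 *\<^sub>R f z)" for z
   by (rule tendsto_eventually) (use q_ev[of z] in eventually_elim, simp)
  show "\<delta> (\<lambda>z. \<eta> (g z $ 1 *\<^sub>R f z) *\<^sub>R \<theta> z) =
    (\<integral>z. \<eta> (g z $ 1 *\<^sub>R f z) * tdiv \<theta> z \<partial>\<mu>)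
    + (\<integral>z. \<D> \<eta> (g z $ 1 *\<^sub>R f z) (H z (\<theta> z)) \<partial>\<mu>)"
  proof (rule variation_formula_limit[where W="\<lambda>z. (A * B * T * norm (f z) + A * B * c * T * norm (F z)) * indicator K z",
     OF \<theta> K(1) _ \<eta>m C(2) \<eta>lim _ _ _ _ _ step])
   show "\<theta> z = 0" if "z \<notin> K" for z by (rule K(5)[OF that])
   show "integrable \<mu> (\<lambda>z. (A * B * T * norm (f z) + A * B * c * T * norm (F z)) * indicator K z)"
    by (rule dom[OF K(1,2)])
   show "(\<lambda>z. \<D> \<eta> (g z $ 1 *\<^sub>R f z) (H z (\<theta> z))) \<in> \<M>"
    by (rule derivative_measurable[OF \<eta> hm(1) blinfun_apply_measurable[OF Hm \<theta>m]])
   show "(\<lambda>z. \<D> \<eta> (q s (f z, g z)) (X s z)) \<in> \<M>" for s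
    by (rule derivative_measurable[OF \<eta> qm(1) Xm])
   show "AE z in mu. (\<lambda>s. \<D> \<eta> (q s (f z, g z)) (X s z))
     \<longlonglongrightarrow> \<D> \<eta> (g z $ 1 *\<^sub>R f z) (H z (\<theta> z))"
   proof (rule AE_I2)
    show "(\<lambda>s. \<D> \<eta> (q s (f z, g z)) (X s z)) \<longlonglongrightarrow> \<D> \<eta> (g z $ 1 *\<^sub>R f z) (H z (\<theta> z))" for z
     by (rule tendsto_eventually) (use q_ev[of z] in eventually_elim, simp)
   qed
   show "AE z in mu. \<bar>\<D> \<eta> (q s (f z, g z)) (X s z)\<bar>
     \<le> (A * B * T * norm (f z) + A * B * c * T * norm (F z)) * indicator K z" for s
    using B(3)
   proof eventually_elim
    case (elim z)
    show ?case
    proof (cases "z \<in> K")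
     case True
     have "\<bar>G z (\<theta> z) $ 1\<bar> \<le> norm (G z) * norm (\<theta> z)" by (rule order_trans[OF component_le_norm_cart norm_blinfun])
     also have "\<dots> \<le> B * T" using elim True K(4) B(1) by (intro mult_mono) auto
     finally have 1: "\<bar>G z (\<theta> z) $ 1\<bar> \<le> B * T" .
     have 2: "\<bar>g z $ 1\<bar> \<le> B" by (rule order_trans[OF component_le_norm_cart B(2)[OF True]])
     have "norm (F z (\<theta> z)) \<le> norm (F z) * T" by (rule order_trans[OF norm_blinfun mult_left_mono[OF K(4)]]) simp
     then have 3: "norm (\<D> (t s) (f z) (F z (\<theta> z))) \<le> c * (norm (F z) * T)"
      by (intro order_trans[OF Dt_le] mult_left_mono \<tau>(5))
     have "norm (X s z) \<le> \<bar>g z $ 1\<bar> * norm (\<D> (t s) (f z) (F z (\<theta> z))) + \<bar>G z (\<theta> z) $ 1\<bar> * norm (t s (f z))"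
      unfolding X_def by (rule order_trans[OF norm_triangle_ineq]) simp
     also have "\<dots> \<le> B * (c * (norm (F z) * T)) + (B * T) * norm (f z)"
      by (intro add_mono mult_mono 1 2 3 t_le) (use B(1) K(3) in auto)
     finally have "A * norm (X s z) \<le> A * (B * (c * (norm (F z) * T)) + (B * T) * norm (f z))"
      by (intro mult_left_mono A(1))
     then have "\<bar>\<D> \<eta> (q s (f z, g z)) (X s z)\<bar> \<le> A * (B * (c * (norm (F z) * T)) + (B * T) * norm (f z))"
      by (rule order_trans[OF A(2)])
     then show ?thesis using True by (simp add: algebra_simps)
    next
     case False
     then have "X s z = 0" using K(5)[OF False] linear_0[OF smooth_D(5)[OF ts]] by (simp add: X_def blinfun.zero_right)
     then show ?thesis using False linear_0[OF smooth_D(5)[OF \<eta>]] by simp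
    qed
   qed
  qed
 qed
 then show thesis by (rule that[OF _ H])
qed

subsection \<open>Uniqueness and vanishing on level sets\<close>

text \<open>Represent the functionals by vectors and apply the fundamental lemma.\<close>

lemma test_zero_functional:
 fixes L :: "real^'n \<Rightarrow> real^'n \<Rightarrow> real"
 assumes lin: "\<And>z. linear (L z)" and m: "\<And>b. (\<lambda>z. L z b) \<in> \<M>"
  and loc: "\<And>K. compact K \<Longrightarrow> K \<subseteq> U \<Longrightarrow>
   \<exists>w. integrable \<mu> w \<and> (\<forall>z\<in>K. \<forall>v. norm v \<le> 1 \<longrightarrow> \<bar>L z v\<bar> \<le> w z)"
  and zero: "\<And>\<theta>. \<theta> \<in> test_fields U \<Longrightarrow> (\<integral>z. L z (\<theta> z) \<partial>\<mu>) = 0"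
 shows "AE z in mu. \<forall>v. L z v = 0"
proof -
 define h :: "real^'n \<Rightarrow> real^'n" where "h z = (\<Sum>b\<in>Basis. L z b *\<^sub>R b)" for z
 have L: "L z v = v \<bullet> h z" for z v
 proof -
  have "L z v = L z (\<Sum>b\<in>Basis. (v \<bullet> b) *\<^sub>R b)" by (simp add: euclidean_representation)
  also have "\<dots> = (\<Sum>b\<in>Basis. (v \<bullet> b) * L z b)" by (simp only: linear_sum[OF lin] linear_scale[OF lin] real_scaleR_def)
  finally show ?thesis unfolding h_def by (simp add: inner_sum_right mult.commute)
 qed
 have "AE z in mu. h z = 0"
 proof (rule radon_test_zero[OF radon_mu open_U])
  show "h \<in> \<M>" unfolding h_def[abs_def]
   by (intro borel_measurable_sum borel_measurable_scaleR m borel_measurable_const)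
  show "(\<integral>z. \<theta> z \<bullet> h z \<partial>\<mu>) = 0" if "\<theta> \<in> test_fields U" for \<theta>
   using zero[OF that] by (simp add: L)
  fix K assume K: "compact K" "K \<subseteq> U"
  obtain w where w: "integrable \<mu> w" "\<forall>z\<in>K. \<forall>v. norm v \<le> 1 \<longrightarrow> \<bar>L z v\<bar> \<le> w z"
   using loc[OF K] by blast
  have "norm (h z) \<le> real DIM(real^'n) * w z" if "z \<in> K" for z
  proof -
   have "norm (h z) \<le> (\<Sum>b\<in>(Basis::(real^'n) set). w z)"
    unfolding h_def by (rule order_trans[OF norm_sum sum_mono]) (use w(2) that in auto)
   then show ?thesis by simp
  qed
  then have "(\<integral>\<^sup>+z. ennreal (norm (h z)) * indicator K z \<partial>mu) \<le> (\<integral>\<^sup>+z. ennreal (norm (real DIM(real^'n) * w z)) \<partial>mu)"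
   by (intro nn_integral_mono) (auto simp: indicator_def intro!: ennreal_leI order_trans[OF _ abs_ge_self])
  also have "\<dots> = (\<integral>\<^sup>+z. ennreal (norm (real DIM(real^'n) * w z)) \<partial>\<mu>)"
   by (rule nn_integral_completion[symmetric])
  also have "\<dots> < \<infinity>"
   using integrable_mult_right[OF w(1), of "real DIM(real^'n)"] unfolding integrable_iff_bounded by blast
  finally show "(\<integral>\<^sup>+z. ennreal (norm (h z)) * indicator K z \<partial>mu) < \<infinity>" .
 qed
 then show ?thesis by eventually_elim (simp add: L)
qed

text \<open>Insert functions \<open>\<eta>\<close> that agree with a linear functional on a ball, and let its radius tend to
 infinity.\<close>

lemma weak_diff_unique:
 fixes f :: "real^'n \<Rightarrow> 'b::euclidean_space"
 assumes W: "weak_diff f F" and W': "weak_diff f F'"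
 shows "AE z in mu. F z = F' z"
proof -
 note fm = weak_diffD(1)[OF W] and Fm = weak_diffD(3)[OF W] and Fm' = weak_diffD(3)[OF W']
 have main: "AE z in mu. \<forall>v. norm (f z) < real s \<longrightarrow> F z v \<bullet> e = F' z v \<bullet> e" for s :: nat and e :: 'b
 proof (cases "s = 0")
  case False
  define R where "R = 2 * real s"
  have R: "0 < R" using False by (simp add: R_def)
  define \<eta> where "\<eta> y = ball_bump 0 R y * (y \<bullet> e)" for y :: 'b
  have \<eta>: "smooth \<eta>" unfolding \<eta>_def[abs_def] by (intro smooth_mult smooth_ball_bump smooth_inner smooth_ident smooth_const)
  have "\<eta> y = 0" if "y \<notin> cball 0 R" for y using ball_bump_0[OF R, of y 0] that by (simp add: \<eta>_def)
  then have 0: "\<D> \<eta> y = (\<lambda>v. 0)" if "R < norm y" for y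
   by (intro frechet_derivative_zero_outside[where C="cball 0 R" and c=0]) (use that in auto)
  have D: "\<D> \<eta> y v = v \<bullet> e" if "norm y < real s" for y v
  proof -
   have "((\<lambda>y. y \<bullet> e) has_derivative (\<lambda>v. v \<bullet> e)) (at y)" by (intro has_derivative_inner_left has_derivative_ident)
   then have "(\<eta> has_derivative (\<lambda>v. v \<bullet> e)) (at y)"
   proof (rule has_derivative_transform_within_open[where s="ball 0 (real s)"])
    show "x \<bullet> e = \<eta> x" if "x \<in> ball 0 (real s)" for x
     using ball_bump_1[OF R, of x 0] that by (simp add: \<eta>_def R_def)
   qed (use that in auto)
   then show ?thesis by (subst frechet_derivative_at[symmetric]) auto
  qed
  obtain A where A: "0 \<le> A" "\<And>y v. \<bar>\<D> \<eta> y v\<bar> \<le> A * norm v"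
   by (rule smooth_D_zero_bound[OF \<eta> 0]) (assumption, rule that)
  define L where "L z v = \<D> \<eta> (f z) (F z v) - \<D> \<eta> (f z) (F' z v)" for z v
  have lD: "linear (\<D> \<eta> y)" for y by (rule smooth_D(5)[OF \<eta>])
  have "AE z in mu. \<forall>v. L z v = 0"
  proof (rule test_zero_functional)
   show "linear (L z)" for z unfolding L_def[abs_def]
    by (intro linearI) (simp_all add: blinfun.add_right blinfun.scaleR_right linear_add[OF lD] linear_scale[OF lD] algebra_simps)
   show "(\<lambda>z. L z b) \<in> \<M>" for b unfolding L_def
    by (intro borel_measurable_diff derivative_measurable[OF \<eta> fm] blinfun_apply_measurable[OF Fm borel_measurable_const]
      blinfun_apply_measurable[OF Fm' borel_measurable_const])
   show "(\<integral>z. L z (\<theta> z) \<partial>\<mu>) = 0" if \<theta>: "\<theta> \<in> test_fields U" for \<theta>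
    unfolding L_def
    using weak_diffD(5)[OF W \<theta> \<eta> less_imp_le[OF R] 0] weak_diffD(5)[OF W' \<theta> \<eta> less_imp_le[OF R] 0]
     weak_diff_integrable[OF W \<theta> \<eta> 0] weak_diff_integrable[OF W' \<theta> \<eta> 0] by simp
   fix K assume K: "compact K" "K \<subseteq> U"
   let ?I = "indicator {z\<in>K. norm (f z) \<le> R} :: _ \<Rightarrow> real"
   let ?w = "\<lambda>z. (A * (norm (F z) * ?I z) + 0 * indicator K z) + (A * (norm (F' z) * ?I z) + 0 * indicator K z)"
   have "integrable \<mu> ?w"
    by (intro Bochner_Integration.integrable_add[OF dominating_integrable dominating_integrable] fm Fm Fm' K weak_diffD(4)[OF W K] weak_diffD(4)[OF W' K])
   moreover have "\<bar>L z v\<bar> \<le> ?w z" if z: "z \<in> K" and v: "norm v \<le> 1" for z v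
   proof (cases "norm (f z) \<le> R")
    case True
    have "\<bar>\<D> \<eta> (f z) (X v)\<bar> \<le> A * norm X" for X :: "(real^'n) \<Rightarrow>\<^sub>L 'b"
    proof -
     have "norm (X v) \<le> norm X" using order_trans[OF norm_blinfun mult_left_mono[OF v]] by simp
     then show ?thesis by (intro order_trans[OF A(2)] mult_left_mono A(1))
    qed
    from this[of "F z"] this[of "F' z"] show ?thesis using True z unfolding L_def by simp
   next
    case False
    then show ?thesis using 0[of "f z"] A(1) by (simp add: L_def)
   qed
   ultimately show "\<exists>w. integrable \<mu> w \<and> (\<forall>z\<in>K. \<forall>v. norm v \<le> 1 \<longrightarrow> \<bar>L z v\<bar> \<le> w z)"
    by (intro exI[of _ ?w]) blast
  qed
  then show ?thesis
  proof eventually_elim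
   case (elim z)
   show ?case
   proof (intro allI impI)
    fix v assume n: "norm (f z) < real s"
    have "\<D> \<eta> (f z) (F z v) = \<D> \<eta> (f z) (F' z v)"
     using elim[THEN spec, of v] unfolding L_def by simp
    then show "F z v \<bullet> e = F' z v \<bullet> e" unfolding D[OF n] .
   qed
  qed
 qed simp
 have "AE z in mu. \<forall>s. \<forall>e\<in>Basis. \<forall>v. norm (f z) < real s \<longrightarrow> F z v \<bullet> e = F' z v \<bullet> e"
  unfolding AE_all_countable by (intro allI AE_finite_allI finite_Basis main)
 then show ?thesis
 proof eventually_elim
  case (elim z)
  obtain s :: nat where s: "norm (f z) < real s" using reals_Archimedean2 by blast
  show ?case
  proof (rule blinfun_eqI, rule euclidean_eqI)
   show "F z v \<bullet> e = F' z v \<bullet> e" if "e \<in> Basis" for v e using elim s that by blast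
  qed
 qed
qed

text \<open>For \<open>\<beta>\<^sub>j(y) = \<eta>((j + 1) y) / (j + 1)\<close>, the functions \<open>\<beta>\<^sub>j(f)\<close> tend to zero uniformly, whereas
 \<open>D\<beta>\<^sub>j(f) = D\<eta>((j + 1) f)\<close> tends to \<open>D\<eta>(0)\<close> on the zero set of \<open>f\<close> and to zero elsewhere.\<close>

lemma weak_diff_zero_set:
 fixes f :: "real^'n \<Rightarrow> 'b::euclidean_space"
 assumes W: "weak_diff f F"
 shows "AE z in mu. f z = 0 \<longrightarrow> F z = 0"
proof -
 note fm = weak_diffD(1)[OF W] and fn = weak_diffD(2)[OF W] and Fm = weak_diffD(3)[OF W]
 have main: "AE z in mu. \<forall>v. f z = 0 \<longrightarrow> F z v \<bullet> e = 0" for e :: 'b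
 proof -
  define \<eta> where "\<eta> y = ball_bump 0 2 y * (y \<bullet> e)" for y :: 'b
  have \<eta>: "smooth \<eta>" unfolding \<eta>_def[abs_def] by (intro smooth_mult smooth_ball_bump smooth_inner smooth_ident smooth_const)
  have "\<eta> y = 0" if "y \<notin> cball 0 2" for y using ball_bump_0[of 2 y 0] that by (simp add: \<eta>_def)
  then have 0: "\<D> \<eta> y = (\<lambda>v. 0)" if "2 < norm y" for y
   by (intro frechet_derivative_zero_outside[where C="cball 0 2" and c=0]) (use that in auto)
  have D0: "\<D> \<eta> 0 v = v \<bullet> e" for v
  proof -
   have "((\<lambda>y. y \<bullet> e) has_derivative (\<lambda>v. v \<bullet> e)) (at 0)" by (intro has_derivative_inner_left has_derivative_ident)
   then have "(\<eta> has_derivative (\<lambda>v. v \<bullet> e)) (at 0)"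
   proof (rule has_derivative_transform_within_open[where s="ball 0 1"])
    show "x \<bullet> e = \<eta> x" if "x \<in> ball 0 1" for x
     using ball_bump_1[of 2 x 0] that by (simp add: \<eta>_def)
   qed auto
   then show ?thesis by (subst frechet_derivative_at[symmetric]) auto
  qed
  obtain A where A: "0 \<le> A" "\<And>y v. \<bar>\<D> \<eta> y v\<bar> \<le> A * norm v"
   by (rule smooth_D_zero_bound[OF \<eta> 0]) (assumption, rule that)
  obtain C where C: "0 \<le> C" "\<And>y. \<bar>\<eta> y\<bar> \<le> C"
   by (rule bounded_of_compact_derivative1[OF \<eta> zero_le_numeral 0]) (assumption, rule that)
  define \<beta> where "\<beta> j y = \<eta> (real (Suc j) *\<^sub>R y) / real (Suc j)" for j y
  have \<beta>: "smooth (\<beta> j)" for j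
   unfolding \<beta>_def[abs_def] divide_inverse by (intro smooth_mult smooth_const smooth_compose[OF \<eta>] smooth_scaleR smooth_ident)
  have D\<beta>: "\<D> (\<beta> j) y v = \<D> \<eta> (real (Suc j) *\<^sub>R y) v" for j y v
  proof -
   have "(\<beta> j has_derivative (\<lambda>v. \<D> \<eta> (real (Suc j) *\<^sub>R y) (real (Suc j) *\<^sub>R v) / real (Suc j))) (at y)"
    unfolding \<beta>_def[abs_def] divide_inverse
    by (intro has_derivative_mult_left has_derivative_compose[OF _ smooth_D(1)[OF \<eta>]] has_derivative_scaleR_right has_derivative_ident)
   then show ?thesis
    using linear_scale[OF smooth_D(5)[OF \<eta>]] by (subst frechet_derivative_at[symmetric]) auto
  qed
  have \<beta>0: "\<D> (\<beta> j) y = (\<lambda>v. 0)" if "2 < norm y" for j y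
  proof -
   have "norm y \<le> real (Suc j) * norm y" using mult_right_mono[of 1 "real (Suc j)" "norm y"] by simp
   then have "2 < norm (real (Suc j) *\<^sub>R y)" using that by simp
   from 0[OF this] show ?thesis by (intro ext) (simp add: D\<beta>)
  qed
  have \<beta>C: "\<bar>\<beta> j y\<bar> \<le> C / real (Suc j)" "\<bar>\<beta> j y\<bar> \<le> C" for j y
  proof -
   show "\<bar>\<beta> j y\<bar> \<le> C / real (Suc j)" unfolding \<beta>_def abs_divide using C(2) by (simp add: divide_right_mono)
   also have "\<dots> \<le> C" using C(1) by (simp add: field_simps)
   finally show "\<bar>\<beta> j y\<bar> \<le> C" .
  qed
  have \<beta>lim: "(\<lambda>j. \<beta> j y) \<longlonglongrightarrow> 0" for y
   by (rule Lim_null_comparison[OF _ LIMSEQ_Suc[OF lim_const_over_n[of C]]]) (use \<beta>C(1) in simp)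
  define L where "L z v = (if f z = 0 then F z v \<bullet> e else 0)" for z v
  have D\<beta>lim: "(\<lambda>j. \<D> (\<beta> j) (f z) (F z v)) \<longlonglongrightarrow> L z v" for z v
  proof (cases "f z = 0")
   case True
   then show ?thesis by (simp add: D\<beta> D0 L_def)
  next
   case False
   obtain N :: nat where N: "2 / norm (f z) < real N" using reals_Archimedean2 by blast
   have "eventually (\<lambda>j. \<D> (\<beta> j) (f z) (F z v) = 0) sequentially"
    using eventually_ge_at_top[of N]
   proof eventually_elim
    case (elim j)
    have "2 < real N * norm (f z)" using N False by (simp add: field_simps)
    also have "\<dots> \<le> real (Suc j) * norm (f z)" using elim by (intro mult_right_mono) auto
    finally have "2 < norm (real (Suc j) *\<^sub>R f z)" by simp
    from 0[OF this] show ?case by (simp add: D\<beta>)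
   qed
   then show ?thesis using False by (simp add: L_def tendsto_eventually)
  qed
  have Lm: "(\<lambda>z. L z b) \<in> \<M>" for b
  proof (rule borel_measurable_LIMSEQ_metric)
   show "(\<lambda>z. \<D> (\<beta> j) (f z) (F z b)) \<in> \<M>" for j
    by (rule derivative_measurable[OF \<beta> fm blinfun_apply_measurable[OF Fm borel_measurable_const]])
  qed (rule D\<beta>lim)
  have "AE z in mu. \<forall>v. L z v = 0"
  proof (rule test_zero_functional[OF _ Lm])
   show "linear (L z)" for z unfolding L_def[abs_def]
    by (intro linearI) (auto simp: blinfun.add_right blinfun.scaleR_right inner_add_left)
   show "\<exists>w. integrable \<mu> w \<and> (\<forall>z\<in>K. \<forall>v. norm v \<le> 1 \<longrightarrow> \<bar>L z v\<bar> \<le> w z)" if K: "compact K" "K \<subseteq> U" for K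
   proof (intro exI[of _ "\<lambda>z. norm e * (norm (F z) * indicator {z\<in>K. norm (f z) \<le> 0} z) + 0 * indicator K z"] conjI ballI allI impI)
    show "integrable \<mu> (\<lambda>z. norm e * (norm (F z) * indicator {z\<in>K. norm (f z) \<le> 0} z) + 0 * indicator K z)"
     by (rule dominating_integrable[OF fm Fm K weak_diffD(4)[OF W K]])
    fix z v assume z: "z \<in> K" and v: "norm (v::real^'n) \<le> 1"
    have "\<bar>F z v \<bullet> e\<bar> \<le> norm (F z v) * norm e" by (rule Cauchy_Schwarz_ineq2)
    also have "\<dots> \<le> (norm (F z) * 1) * norm e"
     by (intro mult_right_mono order_trans[OF norm_blinfun mult_left_mono[OF v]]) auto
    finally show "\<bar>L z v\<bar> \<le> norm e * (norm (F z) * indicator {z\<in>K. norm (f z) \<le> 0} z) + 0 * indicator K z"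
     using z by (auto simp: L_def mult.commute)
   qed
   fix \<theta> assume \<theta>: "\<theta> \<in> test_fields U"
   note \<theta>m = test_field_measurable_mu[OF \<theta>]
   obtain K T where K: "compact K" "K \<subseteq> U" "0 \<le> T" "\<And>z. norm (\<theta> z) \<le> T" "\<And>z. z \<notin> K \<Longrightarrow> \<theta> z = 0"
    by (rule test_field_derivative_bound[OF \<theta>]) (rule that)
   have tm: "tdiv \<theta> \<in> \<M>" using tdiv_integrable[OF \<theta>] by simp
   have eq: "\<delta> (\<lambda>z. \<beta> j (f z) *\<^sub>R \<theta> z) = (\<integral>z. \<beta> j (f z) * tdiv \<theta> z \<partial>\<mu>)
     + (\<integral>z. \<D> (\<beta> j) (f z) (F z (\<theta> z)) \<partial>\<mu>)" for j
    by (rule weak_diffD(5)[OF W \<theta> \<beta> _ \<beta>0]) auto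
   have m: "(\<lambda>z. \<D> (\<beta> j) (f z) (F z (\<theta> z))) \<in> \<M>" for j
    by (rule derivative_measurable[OF \<beta> fm blinfun_apply_measurable[OF Fm \<theta>m]])
   let ?W = "\<lambda>z. (A * T) * (norm (F z) * indicator {z\<in>K. norm (f z) \<le> 2} z) + 0 * indicator K z"
   have "\<delta> (\<lambda>z. 0 *\<^sub>R \<theta> z) = (\<integral>z. 0 * tdiv \<theta> z \<partial>\<mu>) + (\<integral>z. L z (\<theta> z) \<partial>\<mu>)"
   proof (rule variation_formula_limit[where W="?W", OF \<theta> K(1) _ smooth_compose_measurable[OF \<beta> fm] smooth_compose_measurable[OF \<beta> fn]
      borel_measurable_const borel_measurable_const \<beta>C(2) \<beta>lim m borel_measurable_LIMSEQ_metric[OF m D\<beta>lim] _ _ _ eq])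
    show "\<theta> z = 0" if "z \<notin> K" for z by (rule K(5)[OF that])
    show "AE z in mu. (\<lambda>j. \<D> (\<beta> j) (f z) (F z (\<theta> z))) \<longlonglongrightarrow> L z (\<theta> z)"
     by (rule AE_I2) (rule D\<beta>lim)
    show "integrable \<mu> ?W"
     by (rule dominating_integrable[OF fm Fm K(1,2) weak_diffD(4)[OF W K(1,2)]])
    show "AE z in mu. \<bar>\<D> (\<beta> j) (f z) (F z (\<theta> z))\<bar>
      \<le> ?W z" for j
    proof (rule AE_I2)
     fix z
     show "\<bar>\<D> (\<beta> j) (f z) (F z (\<theta> z))\<bar>
      \<le> ?W z"
     proof (cases "z \<in> K \<and> norm (f z) \<le> 2")
      case True
      have "norm (F z (\<theta> z)) \<le> norm (F z) * T" by (rule order_trans[OF norm_blinfun mult_left_mono[OF K(4)]]) simp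
      then have "\<bar>\<D> (\<beta> j) (f z) (F z (\<theta> z))\<bar> \<le> A * (norm (F z) * T)"
       unfolding D\<beta> by (intro order_trans[OF A(2)] mult_left_mono A(1))
      then show ?thesis using True by (simp add: mult_ac)
     next
      case False
      then have "\<D> (\<beta> j) (f z) (F z (\<theta> z)) = 0"
       using \<beta>0[of "f z"] K(5)[of z] linear_0[OF smooth_D(5)[OF \<beta>]] by (cases "z \<in> K") (auto simp: blinfun.zero_right)
      then show ?thesis using A(1) K(3) by simp
     qed
    qed
   qed
   then show "(\<integral>z. L z (\<theta> z) \<partial>\<mu>) = 0"
    using first_variation_ext_test[OF test_fields_scaleR[OF smooth_const \<theta>], of 0] first_variation_scaleR[OF \<theta>, of 0] by simp
  qed
  then show ?thesis by eventually_elim (auto simp: L_def split: if_splits)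
 qed
 have "AE z in mu. \<forall>e\<in>Basis. \<forall>v. f z = 0 \<longrightarrow> F z v \<bullet> e = 0"
  by (intro AE_finite_allI finite_Basis main)
 then show ?thesis
 proof eventually_elim
  case (elim z)
  show ?case
  proof (rule impI, rule blinfun_eqI, rule euclidean_eqI)
   show "F z v \<bullet> e = (0 :: (real^'n) \<Rightarrow>\<^sub>L 'b) v \<bullet> e" if "f z = 0" "e \<in> Basis" for v e using elim that by simp
  qed
 qed
qed

end


section \<open>Almost everywhere defined functions\<close>

text \<open>The domain has a null complement, hence is measurable with respect to the completion.\<close>

lemma partial_measurable_iff:
 fixes f :: "'a \<rightharpoonup> 'b::topological_space"
 shows "partial_measurable M f \<longleftrightarrow> dom f \<subseteq> space M \<and> (AE z in M. z \<in> dom f) \<and> (\<lambda>z. the (f z)) \<in> borel_measurable (completion M)"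
proof -
 have dom: "dom f \<in> sets (completion M)" if "dom f \<subseteq> space M" "AE z in M. z \<in> dom f"
 proof -
  have "{z \<in> space M. z \<notin> dom f} \<in> sets (completion M)"
   using sets_completion_AE[where M=M and P="\<lambda>z. z \<notin> dom f"] that(2) by (simp add: pred_def)
  then have "space (completion M) - {z \<in> space M. z \<notin> dom f} \<in> sets (completion M)" by (rule sets.compl_sets)
  moreover have "space (completion M) - {z \<in> space M. z \<notin> dom f} = dom f" using that(1) by auto
  ultimately show ?thesis by simp
 qed
 show ?thesis
 proof (intro iffI)
  assume f: "partial_measurable M f"
  then have *: "dom f \<subseteq> space M" "AE z in M. z \<in> dom f" by (simp_all add: partial_measurable_def)
  have "(\<lambda>z. the (f z)) \<in> borel_measurable (completion M)"
  proof (rule borel_measurableI)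
   fix E :: "'b set" assume E: "open E"
   have "(\<lambda>z. the (f z)) -` E \<inter> space (completion M) =
     {z \<in> dom f. the (f z) \<in> E} \<union> (if the None \<in> E then space (completion M) - dom f else {})"
    using *(1) by (auto simp: domIff) (metis not_Some_eq)
   also have "\<dots> \<in> sets (completion M)"
    using f E dom[OF *] by (auto simp: partial_measurable_def)
   finally show "(\<lambda>z. the (f z)) -` E \<inter> space (completion M) \<in> sets (completion M)" .
  qed
  then show "dom f \<subseteq> space M \<and> (AE z in M. z \<in> dom f) \<and> (\<lambda>z. the (f z)) \<in> borel_measurable (completion M)"
   using * by simp
 next
  assume f: "dom f \<subseteq> space M \<and> (AE z in M. z \<in> dom f) \<and> (\<lambda>z. the (f z)) \<in> borel_measurable (completion M)"
  have "{z \<in> dom f. the (f z) \<in> E} \<in> sets (completion M)" if "open E" for E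
  proof -
   have "dom f \<inter> ((\<lambda>z. the (f z)) -` E \<inter> space (completion M)) \<in> sets (completion M)"
    using f dom that by (intro sets.Int measurable_sets) auto
   moreover have "dom f \<inter> ((\<lambda>z. the (f z)) -` E \<inter> space (completion M)) = {z \<in> dom f. the (f z) \<in> E}"
    using f by auto
   ultimately show ?thesis by simp
  qed
  then show "partial_measurable M f" using f by (simp add: partial_measurable_def)
 qed
qed

text \<open>The Hilbert-Schmidt norm is computed from the images of the standard basis.\<close>

lemma norm_le_hom_norm: "norm F \<le> hom_norm (blinfun_apply F)"
 and hom_norm_le: "hom_norm (blinfun_apply F) \<le> real CARD('n) * norm F"
 for F :: "(real^'n) \<Rightarrow>\<^sub>L 'b::euclidean_space"
proof -
 have lin: "linear (blinfun_apply F)" by (rule linear_conv_bounded_linear[THEN iffD2, OF blinfun.bounded_linear_right])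
 have eq: "hom_norm (blinfun_apply F) = L2_set (\<lambda>i. norm (F (axis i 1))) UNIV"
  unfolding hom_norm_def hom_inner_eq[OF lin] L2_set_def by (simp add: power2_norm_eq_inner)
 show "norm F \<le> hom_norm (blinfun_apply F)"
 proof (rule norm_blinfun_bound)
  show "0 \<le> hom_norm (blinfun_apply F)" unfolding eq by (rule L2_set_nonneg)
  fix v :: "real^'n"
  have "norm (F v) = norm (\<Sum>i\<in>UNIV. v $ i *\<^sub>R F (axis i 1))"
   using basis_expansion[of v] by (simp add: scalar_mult_eq_scaleR blinfun.sum_right[symmetric] blinfun.scaleR_right[symmetric])
  also have "\<dots> \<le> (\<Sum>i\<in>UNIV. norm (v $ i) * norm (F (axis i 1)))"
   by (rule order_trans[OF norm_sum]) simp
  also have "\<dots> \<le> L2_set (\<lambda>i. norm (v $ i)) UNIV * L2_set (\<lambda>i. norm (F (axis i 1))) UNIV"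
   using L2_set_mult_ineq[of "\<lambda>i. norm (v $ i)" "\<lambda>i. norm (F (axis i 1))" UNIV] by simp
  finally show "norm (F v) \<le> hom_norm (blinfun_apply F) * norm v" by (simp add: eq norm_vec_def mult.commute)
 qed
 have "hom_norm (blinfun_apply F) \<le> (\<Sum>i\<in>UNIV. norm (F (axis i 1)))"
  unfolding eq by (rule L2_set_le_sum) simp
 also have "\<dots> \<le> (\<Sum>i\<in>(UNIV::'n set). norm F)"
 proof (rule sum_mono)
  show "norm (F (axis i 1)) \<le> norm F" for i
   using norm_blinfun[of F "axis i 1"] by (simp add: norm_axis_1)
 qed
 finally show "hom_norm (blinfun_apply F) \<le> real CARD('n) * norm F" by simp
qed

lemma compact_support_iff_bounded:
 fixes P :: "'b::euclidean_space \<Rightarrow> bool"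
 shows "compact (closure {y. P y}) \<longleftrightarrow> (\<exists>R\<ge>0. \<forall>y. R < norm y \<longrightarrow> \<not> P y)"
proof
 assume "compact (closure {y. P y})"
 then have "bounded {y. P y}" using bounded_subset closure_subset compact_imp_bounded by metis
 then obtain R where "\<forall>y\<in>{y. P y}. norm y \<le> R" unfolding bounded_iff by blast
 then show "\<exists>R\<ge>0. \<forall>y. R < norm y \<longrightarrow> \<not> P y" by (intro exI[of _ "max R 0"]) force
next
 assume "\<exists>R\<ge>0. \<forall>y. R < norm y \<longrightarrow> \<not> P y"
 then obtain R where "\<forall>y. R < norm y \<longrightarrow> \<not> P y" by blast
 then have "bounded {y. P y}" unfolding bounded_iff by (intro exI[of _ R]) force
 then show "compact (closure {y. P y})" by (simp add: compact_closure)
qed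

lemma AE_completion_subset:
 assumes s: "sets M = sets N" and null: "\<And>A. A \<in> null_sets N \<Longrightarrow> A \<in> null_sets M"
 shows "(AE z in N. P z) \<Longrightarrow> (AE z in M. P z)" and "f \<in> borel_measurable (completion N) \<Longrightarrow> f \<in> borel_measurable (completion M)"
proof -
 have sp: "space M = space N" by (rule sets_eq_imp_space_eq[OF s])
 show "AE z in M. P z" if "AE z in N. P z"
  using that null unfolding eventually_ae_filter sp by blast
 have "sets (completion N) \<subseteq> sets (completion M)"
  unfolding sets_completion s using null by blast
 then show "f \<in> borel_measurable (completion M)" if "f \<in> borel_measurable (completion N)"
  using that sp unfolding measurable_def by auto
qed

context bv_varifold
begin

lemma emeasure_weight_plus:
 assumes A: "A \<in> sets mu"
 shows "emeasure (weight_plus_variation U V) A = emeasure mu A + emeasure nu A"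
proof -
 let ?S = "sets (borel_of (top_of_set U))"
 have sub: "?S \<subseteq> Pow U" using sets.space_closed[of "borel_of (top_of_set U)"] by simp
 have sp: "space (borel_of (top_of_set U)) = U" by simp
 show ?thesis
  unfolding weight_plus_variation_def
 proof (rule emeasure_measure_of[OF refl sub])
  have sa: "sigma_sets U ?S = ?S" using sets.sigma_sets_eq[of "borel_of (top_of_set U)"] by simp
  let ?f = "\<lambda>A. emeasure mu A + emeasure nu A"
  have "countably_additive ?S ?f"
  proof (rule countably_additiveI)
   fix B :: "nat \<Rightarrow> (real^'n) set" assume B: "range B \<subseteq> ?S" "disjoint_family B"
   have "(\<Sum>i. ?f (B i)) = (\<Sum>i. emeasure mu (B i)) + (\<Sum>i. emeasure nu (B i))"
    by (rule suminf_add[symmetric]) auto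
   also have "\<dots> = emeasure mu (\<Union>i. B i) + emeasure nu (\<Union>i. B i)"
    using B by (simp add: suminf_emeasure sets_mu sets_nu)
   finally show "(\<Sum>i. ?f (B i)) = ?f (\<Union>i. B i)" .
  qed
  then show "countably_additive (sets (measure_of U ?S ?f)) ?f" "positive (sets (measure_of U ?S ?f)) ?f"
   using sub sa by (simp_all add: sets_measure_of positive_def)
  show "A \<in> sets (measure_of U ?S ?f)" using A sub sa by (simp add: sets_measure_of sets_mu)
 qed
qed

lemma sets_weight_plus: "sets (weight_plus_variation U V) = sets mu"
 and space_weight_plus: "space (weight_plus_variation U V) = U"
proof -
 have sub: "sets (borel_of (top_of_set U)) \<subseteq> Pow U" using sets.space_closed[of "borel_of (top_of_set U)"] by simp
 show "sets (weight_plus_variation U V) = sets mu" "space (weight_plus_variation U V) = U"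
  using sub sets.sigma_sets_eq[of "borel_of (top_of_set U)"]
  by (simp_all add: weight_plus_variation_def sets_measure_of space_measure_of sets_mu)
qed

lemma null_weight_plus:
 assumes "A \<in> null_sets (weight_plus_variation U V)"
 shows "A \<in> null_sets mu" "A \<in> null_sets nu"
 using assms emeasure_weight_plus[of A] by (auto simp: null_sets_def sets_weight_plus sets_mu sets_nu)

lemma weight_plus_transfer:
 shows "(AE z in weight_plus_variation U V. P z) \<Longrightarrow> (AE z in mu. P z)"
  and "(AE z in weight_plus_variation U V. P z) \<Longrightarrow> (AE z in nu. P z)"
  and "f \<in> borel_measurable (completion (weight_plus_variation U V)) \<Longrightarrow> f \<in> \<M>"
  and "f \<in> borel_measurable (completion (weight_plus_variation U V)) \<Longrightarrow> f \<in> \<N>"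
proof -
 have s: "sets mu = sets (weight_plus_variation U V)" "sets nu = sets (weight_plus_variation U V)"
  by (simp_all add: sets_weight_plus sets_mu sets_nu)
 show "(AE z in weight_plus_variation U V. P z) \<Longrightarrow> (AE z in mu. P z)"
  by (rule AE_completion_subset(1)[OF s(1) null_weight_plus(1)])
 show "(AE z in weight_plus_variation U V. P z) \<Longrightarrow> (AE z in nu. P z)"
  by (rule AE_completion_subset(1)[OF s(2) null_weight_plus(2)])
 show "f \<in> borel_measurable (completion (weight_plus_variation U V)) \<Longrightarrow> f \<in> \<M>"
  by (rule AE_completion_subset(2)[OF s(1) null_weight_plus(1)])
 show "f \<in> borel_measurable (completion (weight_plus_variation U V)) \<Longrightarrow> f \<in> \<N>"
  by (rule AE_completion_subset(2)[OF s(2) null_weight_plus(2)])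
qed

lemma first_variation_ext_cong:
 assumes "AE z in nu. g z = g' z"
 shows "\<delta> g = \<delta> g'"
proof -
 have "L1_dist \<nu> h g = L1_dist \<nu> h g'" for h
  by (rule nn_integral_cong_AE, unfold AE_completion_iff) (use assms in eventually_elim, simp)
 then show ?thesis unfolding first_variation_ext_def by simp
qed

text \<open>Weak derivatives see \<open>f\<close> only up to sets that are null for both measures.\<close>

lemma weak_diff_cong:
 fixes f f' :: "real^'n \<Rightarrow> 'b::euclidean_space"
 assumes W: "weak_diff f F" and mu: "AE z in mu. f z = f' z" and nu: "AE z in nu. f z = f' z"
  and m: "f' \<in> \<M>" "f' \<in> \<N>"
 shows "weak_diff f' F"
proof -
 note fm = weak_diffD(1)[OF W] and Fm = weak_diffD(3)[OF W]
 have mu': "AE z in \<mu>. f z = f' z" unfolding AE_completion_iff by (rule mu)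
 have 1: "(\<integral>\<^sup>+z. ennreal (norm (F z) * indicator {z\<in>K. norm (f' z) \<le> s} z) \<partial>\<mu>)
   = (\<integral>\<^sup>+z. ennreal (norm (F z) * indicator {z\<in>K. norm (f z) \<le> s} z) \<partial>\<mu>)" for K s
  by (rule nn_integral_cong_AE) (use mu' in eventually_elim, simp add: indicator_def)
 have 2: "\<delta> (\<lambda>z. \<eta> (f' z) *\<^sub>R \<theta> z) = \<delta> (\<lambda>z. \<eta> (f z) *\<^sub>R \<theta> z)" for \<eta> :: "'b \<Rightarrow> real" and \<theta>
  by (rule first_variation_ext_cong) (use nu in eventually_elim, simp)
 have 3: "(\<integral>z. \<eta> (f' z) * tdiv \<theta> z \<partial>\<mu>) = (\<integral>z. \<eta> (f z) * tdiv \<theta> z \<partial>\<mu>)"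
  if "\<theta> \<in> test_fields U" "smooth \<eta>" for \<eta> :: "'b \<Rightarrow> real" and \<theta>
 proof (rule integral_cong_AE)
  have t: "tdiv \<theta> \<in> \<M>" using tdiv_integrable[OF that(1)] by simp
  show "(\<lambda>z. \<eta> (f' z) * tdiv \<theta> z) \<in> \<M>"
   by (rule borel_measurable_times[OF smooth_compose_measurable[OF that(2) m(1)] t])
  show "(\<lambda>z. \<eta> (f z) * tdiv \<theta> z) \<in> \<M>"
   by (rule borel_measurable_times[OF smooth_compose_measurable[OF that(2) fm] t])
  show "AE z in \<mu>. \<eta> (f' z) * tdiv \<theta> z = \<eta> (f z) * tdiv \<theta> z"
   using mu' by eventually_elim simp
 qed
 have 4: "(\<integral>z. \<D> \<eta> (f' z) (F z (\<theta> z)) \<partial>\<mu>) = (\<integral>z. \<D> \<eta> (f z) (F z (\<theta> z)) \<partial>\<mu>)"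
  if \<theta>: "\<theta> \<in> test_fields U" and \<eta>: "smooth \<eta>" for \<eta> :: "'b \<Rightarrow> real" and \<theta>
 proof (rule integral_cong_AE)
  show "AE z in \<mu>. \<D> \<eta> (f' z) (F z (\<theta> z)) = \<D> \<eta> (f z) (F z (\<theta> z))"
   using mu' by eventually_elim simp
  have u: "(\<lambda>z. F z (\<theta> z)) \<in> \<M>"
   by (rule blinfun_apply_measurable[OF Fm test_field_measurable_mu[OF \<theta>]])
  show "(\<lambda>z. \<D> \<eta> (f' z) (F z (\<theta> z))) \<in> \<M>"
   by (rule derivative_measurable[OF \<eta> m(1) u])
  show "(\<lambda>z. \<D> \<eta> (f z) (F z (\<theta> z))) \<in> \<M>"
   by (rule derivative_measurable[OF \<eta> fm u])
 qed
 show ?thesis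
  unfolding weak_diff_def
 proof (intro conjI m Fm allI impI)
  show "(\<integral>\<^sup>+z. ennreal (norm (F z) * indicator {z\<in>K. norm (f' z) \<le> s} z) \<partial>\<mu>) < \<infinity>"
   if "compact K" "K \<subseteq> U" for K s unfolding 1 by (rule weak_diffD(4)[OF W that])
  fix \<theta> and \<eta> :: "'b \<Rightarrow> real" and R' assume \<theta>: "\<theta> \<in> test_fields U" and \<eta>: "smooth \<eta>" and R': "0 \<le> R'"
   and 0: "\<forall>y. R' < norm y \<longrightarrow> \<D> \<eta> y = (\<lambda>v. 0)"
  show "\<delta> (\<lambda>z. \<eta> (f' z) *\<^sub>R \<theta> z) = (\<integral>z. \<eta> (f' z) * tdiv \<theta> z \<partial>\<mu>)
     + (\<integral>z. \<D> \<eta> (f' z) (F z (\<theta> z)) \<partial>\<mu>)"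
   unfolding 2 3[OF \<theta> \<eta>] 4[OF \<theta> \<eta>] by (rule weak_diffD(5)[OF W \<theta> \<eta> R']) (use 0 in blast)
 qed
qed

text \<open>The translation between the two notions: the fibre integral is carried out, the norms are
 equivalent, and points outside the domain of \<open>f\<close> are negligible.\<close>

lemma is_weak_derivative_iff:
 fixes f :: "real^'n \<rightharpoonup> 'b::euclidean_space"
 assumes ae: "AE z in mu. z \<in> dom f"
  and m: "(\<lambda>z. the (f z)) \<in> \<M>" "(\<lambda>z. the (f z)) \<in> \<N>"
 shows "is_weak_derivative U V f F \<longleftrightarrow> weak_diff (\<lambda>z. the (f z)) F"
proof -
 have ae': "AE z in \<mu>. z \<in> dom f" unfolding AE_completion_iff by (rule ae)
 let ?hom = "\<lambda>K s. \<integral>\<^sup>+ z\<in>{z \<in> K \<inter> dom f. norm (the (f z)) \<le> s}. ennreal (hom_norm (blinfun_apply (F z))) \<partial>\<mu>"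
 let ?op = "\<lambda>K s. \<integral>\<^sup>+z. ennreal (norm (F z) * indicator {z\<in>K. norm (the (f z)) \<le> s} z) \<partial>\<mu>"
 have op_hom: "?op K s \<le> ?hom K s" for K s
  by (rule nn_integral_mono_AE)
    (use ae' in eventually_elim, auto simp: indicator_def intro!: ennreal_leI norm_le_hom_norm)
 have hom_op: "?hom K s \<le> ennreal (real CARD('n)) * ?op K s" if F: "F \<in> \<M>" "K \<in> sets \<mu>" for K s
 proof -
  have [measurable]: "(\<lambda>z. norm (F z)) \<in> \<M>" by (rule measurable_norm_blinfun[OF F(1)])
  note m(1)[measurable] F(2)[measurable]
  have eq: "indicator {z\<in>K. norm (the (f z)) \<le> s} z = (indicator K z * indicator {..s} (norm (the (f z))) :: real)" for z
   by (auto simp: indicator_def)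
  have "(\<lambda>z. ennreal (norm (F z) * indicator {z\<in>K. norm (the (f z)) \<le> s} z)) \<in> \<M>"
   unfolding eq by measurable
  then have "ennreal (real CARD('n)) * ?op K s = (\<integral>\<^sup>+z. ennreal (real CARD('n)) * ennreal (norm (F z) * indicator {z\<in>K. norm (the (f z)) \<le> s} z) \<partial>\<mu>)"
   by (rule nn_integral_cmult[symmetric])
  moreover have "?hom K s \<le> (\<integral>\<^sup>+z. ennreal (real CARD('n)) * ennreal (norm (F z) * indicator {z\<in>K. norm (the (f z)) \<le> s} z) \<partial>\<mu>)"
   by (rule nn_integral_mono) (auto simp: indicator_def ennreal_mult[symmetric] intro!: ennreal_leI hom_norm_le)
  ultimately show ?thesis by simp
 qed
 have fin: "(\<forall>K s. compact K \<and> K \<subseteq> U \<and> 0 \<le> s \<longrightarrow> ?hom K s < \<infinity>) \<longleftrightarrow> (\<forall>K (s::real). compact K \<longrightarrow> K \<subseteq> U \<longrightarrow> ?op K s < \<infinity>)"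
  if F: "F \<in> \<M>"
 proof (intro iffI allI impI)
  fix K and s :: real assume h: "\<forall>K s. compact K \<and> K \<subseteq> U \<and> 0 \<le> s \<longrightarrow> ?hom K s < \<infinity>" and K: "compact K" "K \<subseteq> U"
  show "?op K s < \<infinity>"
  proof (cases "0 \<le> s")
   case True
   then have "?hom K s < \<infinity>" using h K by blast
   then show ?thesis by (rule le_less_trans[OF op_hom])
  next
   case False
   then have "indicator {z\<in>K. norm (the (f z)) \<le> s} z = (0::real)" for z
    using norm_ge_zero[of "the (f z)"] by (auto simp: indicator_def simp del: norm_ge_zero)
   then show ?thesis by simp
  qed
 next
  fix K and s :: real assume h: "\<forall>K s. compact K \<longrightarrow> K \<subseteq> U \<longrightarrow> ?op K s < \<infinity>" and K: "compact K \<and> K \<subseteq> U \<and> 0 \<le> s"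
  have "K \<in> sets \<mu>" using radon_compact(1)[OF radon_mu open_U] K by simp
  moreover have "ennreal (real CARD('n)) * ?op K s < \<infinity>" using h K by (simp add: ennreal_mult_less_top)
  ultimately show "?hom K s < \<infinity>" by (intro le_less_trans[OF hom_op[OF F]])
 qed
 have int: "(\<integral>(z, S). \<eta> (the (f z)) * hom_inner (orth_proj S) (\<D> \<theta> z) \<partial>completion V)
   = (\<integral>z. \<eta> (the (f z)) * tdiv \<theta> z \<partial>\<mu>)"
  if \<theta>: "\<theta> \<in> test_fields U" and \<eta>: "smooth \<eta>" and R': "0 \<le> R'" "\<forall>y. R' < norm y \<longrightarrow> \<D> \<eta> y = (\<lambda>v. 0)"
  for \<theta> and \<eta> :: "'b \<Rightarrow> real" and R'
 proof -
  have zero: "\<D> \<eta> y = (\<lambda>v. 0)" if "R' < norm y" for y using R'(2) that by blast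
  obtain C where C: "0 \<le> C" "\<And>y. \<bar>\<eta> y\<bar> \<le> C"
   by (rule bounded_of_compact_derivative1[OF \<eta> R'(1) zero]) (assumption, rule that)
  show ?thesis by (rule integral_tdiv(1)[OF \<theta> smooth_compose_measurable[OF \<eta> m(1)] C(2)])
 qed
 have cpt: "compact (closure {y. \<D> \<eta> y \<noteq> (\<lambda>v. 0)}) \<longleftrightarrow> (\<exists>R'\<ge>0. \<forall>y. R' < norm y \<longrightarrow> \<D> \<eta> y = (\<lambda>v. 0))"
  for \<eta> :: "'b \<Rightarrow> real"
  using compact_support_iff_bounded[of "\<lambda>y. \<D> \<eta> y \<noteq> (\<lambda>v. 0)"] by simp
 show ?thesis
 proof
  assume D: "is_weak_derivative U V f F"
  then have F: "F \<in> \<M>" by (simp add: is_weak_derivative_def)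
  show "weak_diff (\<lambda>z. the (f z)) F"
   unfolding weak_diff_def
  proof (intro conjI m F)
   show "\<forall>K s. compact K \<longrightarrow> K \<subseteq> U \<longrightarrow> ?op K s < \<infinity>"
    using D unfolding fin[OF F, symmetric] is_weak_derivative_def by blast
   show "\<forall>\<theta> \<eta> R'. \<theta> \<in> test_fields U \<longrightarrow> smooth \<eta> \<longrightarrow> 0 \<le> R' \<longrightarrow>
    (\<forall>y. R' < norm y \<longrightarrow> \<D> \<eta> y = (\<lambda>v. 0)) \<longrightarrow>
    \<delta> (\<lambda>z. \<eta> (the (f z)) *\<^sub>R \<theta> z) =
     (\<integral>z. \<eta> (the (f z)) * tdiv \<theta> z \<partial>\<mu>)
     + (\<integral>z. \<D> \<eta> (the (f z)) (F z (\<theta> z)) \<partial>\<mu>)"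
   proof (intro allI impI)
    fix \<theta> and \<eta> :: "'b \<Rightarrow> real" and R' assume a: "\<theta> \<in> test_fields U" "smooth \<eta>" "0 \<le> R'"
     "\<forall>y. R' < norm y \<longrightarrow> \<D> \<eta> y = (\<lambda>v. 0)"
    have "compact (closure {y. \<D> \<eta> y \<noteq> (\<lambda>v. 0)})" unfolding cpt using a(3,4) by blast
    then show "\<delta> (\<lambda>z. \<eta> (the (f z)) *\<^sub>R \<theta> z) =
     (\<integral>z. \<eta> (the (f z)) * tdiv \<theta> z \<partial>\<mu>)
     + (\<integral>z. \<D> \<eta> (the (f z)) (F z (\<theta> z)) \<partial>\<mu>)"
     unfolding int[OF a, symmetric] using D a(1,2) unfolding is_weak_derivative_def by blast
   qed
  qed
 next
  assume W: "weak_diff (\<lambda>z. the (f z)) F"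
  note F = weak_diffD(3)[OF W]
  show "is_weak_derivative U V f F"
   unfolding is_weak_derivative_def
  proof (intro conjI F)
   show "\<forall>K s. compact K \<and> K \<subseteq> U \<and> 0 \<le> s \<longrightarrow> ?hom K s < \<infinity>"
    unfolding fin[OF F] using W unfolding weak_diff_def by blast
   show "\<forall>\<theta> (\<eta> :: 'b \<Rightarrow> real). \<theta> \<in> test_fields U \<and> smooth \<eta> \<and>
    compact (closure {y. \<D> \<eta> y \<noteq> (\<lambda>v. 0)}) \<longrightarrow>
    \<delta> (\<lambda>z. \<eta> (the (f z)) *\<^sub>R \<theta> z) =
     (\<integral>(z, S). \<eta> (the (f z)) * hom_inner (orth_proj S) (\<D> \<theta> z) \<partial>completion V) +
     (\<integral>z. \<D> \<eta> (the (f z)) (blinfun_apply (F z) (\<theta> z)) \<partial>\<mu>)"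
   proof (intro allI impI, elim conjE)
    fix \<theta> and \<eta> :: "'b \<Rightarrow> real" assume a: "\<theta> \<in> test_fields U" "smooth \<eta>"
     and c: "compact (closure {y. \<D> \<eta> y \<noteq> (\<lambda>v. 0)})"
    obtain R' where R': "0 \<le> R'" "\<forall>y. R' < norm y \<longrightarrow> \<D> \<eta> y = (\<lambda>v. 0)"
     using c unfolding cpt by blast
    show "\<delta> (\<lambda>z. \<eta> (the (f z)) *\<^sub>R \<theta> z) =
     (\<integral>(z, S). \<eta> (the (f z)) * hom_inner (orth_proj S) (\<D> \<theta> z) \<partial>completion V) +
     (\<integral>z. \<D> \<eta> (the (f z)) (blinfun_apply (F z) (\<theta> z)) \<partial>\<mu>)"
     unfolding int[OF a R'] by (rule weak_diffD(5)[OF W a R'(1)]) (use R'(2) in blast)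
   qed
  qed
 qed
qed

lemma weak_derivative_eqI:
 fixes f :: "real^'n \<rightharpoonup> 'b::euclidean_space"
 assumes "AE z in mu. z \<in> dom f"
  and m: "(\<lambda>z. the (f z)) \<in> \<M>" "(\<lambda>z. the (f z)) \<in> \<N>"
  and W: "weak_diff (\<lambda>z. the (f z)) F"
 shows "AE z in mu. weak_derivative U V f z = F z"
proof -
 have "is_weak_derivative U V f F" using is_weak_derivative_iff[OF assms(1-3)] W by simp
 then have "is_weak_derivative U V f (weak_derivative U V f)" unfolding weak_derivative_def by (rule someI[where P="is_weak_derivative U V f"])
 then have "weak_diff (\<lambda>z. the (f z)) (weak_derivative U V f)" using is_weak_derivative_iff[OF assms(1-3)] by simp
 from weak_diff_unique[OF this W] show ?thesis .
qed

lemma on_domain_weak_derivative: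
 fixes g :: "real^'n \<Rightarrow> 'b::euclidean_space"
 assumes W: "weak_diff g G"
 shows "AE z in mu. weak_derivative U V (on_domain U g) z = G z"
proof (rule weak_derivative_eqI)
 have e: "the (on_domain U g z) = g z" if "z \<in> U" for z using that by (simp add: on_domain_def)
 show "AE z in mu. z \<in> dom (on_domain U g)" by (rule AE_I2) (auto simp: on_domain_def dom_def)
 show m: "(\<lambda>z. the (on_domain U g z)) \<in> \<M>"
  "(\<lambda>z. the (on_domain U g z)) \<in> \<N>"
  by (rule iffD2[OF measurable_cong weak_diffD(1)[OF W]], simp add: e,
    rule iffD2[OF measurable_cong weak_diffD(2)[OF W]], simp add: e)
 show "weak_diff (\<lambda>z. the (on_domain U g z)) G"
  by (rule weak_diff_cong[OF W _ _ m]) (auto intro!: AE_I2 simp: e)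
qed

text \<open>Outside the domain of \<open>f\<close>, the functions \<open>p z (the (f z))\<close> and \<open>the (map_option (p z) (f z))\<close> may
 differ, hence the passage to almost everywhere equal functions.\<close>

lemma weakly_differentiable_map:
 fixes f :: "real^'n \<rightharpoonup> 'b::euclidean_space" and p :: "real^'n \<Rightarrow> 'b \<Rightarrow> 'c::euclidean_space"
 assumes f: "partial_measurable (weight_plus_variation U V) f"
  and p: "(\<lambda>z. p z (the (f z))) \<in> borel_measurable (completion (weight_plus_variation U V))"
  and W: "weak_diff (\<lambda>z. p z (the (f z))) H"
 defines "h \<equiv> \<lambda>z. map_option (p z) (f z)"
 shows "h \<in> weakly_differentiable U V" "AE z in mu. weak_derivative U V h z = H z"
proof -
 let ?W = "weight_plus_variation U V"
 have dom: "dom h = dom f" by (auto simp: h_def dom_def)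
 have e: "p z (the (f z)) = the (h z)" if "z \<in> dom f" for z using that by (auto simp: h_def)
 have f': "dom f \<subseteq> space ?W" "AE z in ?W. z \<in> dom f" using f by (simp_all add: partial_measurable_iff)
 have ae: "AE z in ?W. z \<in> dom h" using f'(2) by (simp add: dom)
 have aee: "AE z in ?W. p z (the (f z)) = the (h z)" using f'(2) by eventually_elim (rule e)
 have hm: "(\<lambda>z. the (h z)) \<in> borel_measurable (completion ?W)"
 proof -
  have d: "dom f \<in> sets (completion ?W)"
   using f unfolding partial_measurable_def by (auto dest!: spec[of _ UNIV])
  have "(\<lambda>z. if z \<in> dom f then p z (the (f z)) else the None) \<in> borel_measurable (completion ?W)"
   by (rule measurable_If_set[OF p borel_measurable_const]) (use d in auto)
  moreover have "(\<lambda>z. if z \<in> dom f then p z (the (f z)) else the None) = (\<lambda>z. the (h z))"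
   using e by (intro ext) (auto simp: h_def domIff)
  ultimately show ?thesis by simp
 qed
 have W': "weak_diff (\<lambda>z. the (h z)) H"
  by (rule weak_diff_cong[OF W weight_plus_transfer(1)[OF aee] weight_plus_transfer(2)[OF aee] weight_plus_transfer(3,4)[OF hm]])
 note iff = is_weak_derivative_iff[OF weight_plus_transfer(1)[OF ae] weight_plus_transfer(3,4)[OF hm]]
 have "partial_measurable ?W h" unfolding partial_measurable_iff dom using f' hm by simp
 then show "h \<in> weakly_differentiable U V" unfolding weakly_differentiable_def using iff W' by blast
 show "AE z in mu. weak_derivative U V h z = H z"
  by (rule weak_derivative_eqI[OF weight_plus_transfer(1)[OF ae] weight_plus_transfer(3,4)[OF hm] W'])
qed

lemma lipschitz_derivative_measurable_weight_plus:
 fixes g :: "real^'n \<Rightarrow> real^'k"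
 assumes L: "lipschitz_derivative g G"
 shows "g \<in> borel_measurable (completion (weight_plus_variation U V))"
proof -
 obtain \<gamma> where "smooth_approximants \<gamma> g G" using L unfolding lipschitz_derivative_def by blast
 note \<gamma> = smooth_approximantsD[OF this]
 have "g \<in> borel_measurable mu"
 proof (rule borel_measurable_LIMSEQ_metric)
  show "\<gamma> i \<in> borel_measurable mu" for i by (intro continuous_measurable_mu smooth_D(3) \<gamma>(1))
  show "(\<lambda>i. \<gamma> i z) \<longlonglongrightarrow> g z" if "z \<in> space mu" for z using \<gamma>(2) that by simp
 qed
 then show ?thesis
  by (intro measurable_completion) (simp add: measurable_cong_sets[OF sets_weight_plus refl])
qed

end

lemma locally_lipschitz_vec:
 fixes g :: "'a::metric_space \<Rightarrow> real"
 assumes "locally_lipschitz_on U g"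
 shows "locally_lipschitz_on U (\<lambda>z. vec (g z) :: real^1)"
proof -
 have "dist (vec a :: real^1) (vec b) = dist a b" for a b :: real
  by (simp add: dist_norm norm_vec_def L2_set_def)
 then show ?thesis using assms unfolding locally_lipschitz_on_def lipschitz_on_def by simp
qed

theorem theorem6p20:
  fixes m :: nat
    and U :: "(real^'n) set"
    and V :: "((real^'n) \<times> (real^'n) set) measure"
    and f :: "real^'n \<rightharpoonup> real^'l"
  assumes "1 \<le> m" and "m \<le> CARD('n)"
    and "open U"
    and "rectifiable_varifold m U V"
    and "radon_measure (top_of_set U) (total_variation U V)"
    and "f \<in> weakly_differentiable U V"
  shows "(AE z in weight U V. z \<in> {z \<in> U. f z = Some 0} \<longrightarrow> weak_derivative U V f z = 0)
    \<and> (\<forall>g :: real^'n \<Rightarrow> real^'k. locally_lipschitz_on U g \<longrightarrow>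
        (let h = (\<lambda>z. map_option (\<lambda>y. (y, g z)) (f z)) in
          h \<in> weakly_differentiable U V \<and>
          (AE z in weight U V. \<forall>v. weak_derivative U V h z v =
            (weak_derivative U V f z v, weak_derivative U V (on_domain U g) z v))))
    \<and> (\<forall>g :: real^'n \<Rightarrow> real^'l. locally_lipschitz_on U g \<longrightarrow>
        (let h = (\<lambda>z. map_option (\<lambda>y. y + g z) (f z)) in
          h \<in> weakly_differentiable U V \<and>
          (AE z in weight U V. weak_derivative U V h z =
            weak_derivative U V f z + weak_derivative U V (on_domain U g) z)))
    \<and> (\<forall>g :: real^'n \<Rightarrow> real.
        L1_loc U (weight U V) (\<lambda>z. the (f z)) \<and>
        L1_loc U (weight U V) (weak_derivative U V f) \<and>
        locally_lipschitz_on U g \<longrightarrow>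
        (let h = (\<lambda>z. map_option (\<lambda>y. g z *\<^sub>R y) (f z)) in
          h \<in> weakly_differentiable U V \<and>
          (AE z in weight U V. \<forall>v. weak_derivative U V h z v =
            weak_derivative U V (on_domain U g) z v *\<^sub>R the (f z) + g z *\<^sub>R weak_derivative U V f z v)))"
proof -
 interpret bv_varifold m U V
  by unfold_locales (use assms in \<open>auto simp: rectifiable_varifold_def\<close>)
 let ?F = "weak_derivative U V f"
 have pm: "partial_measurable (weight_plus_variation U V) f" and ex: "\<exists>F. is_weak_derivative U V f F"
  using assms(6) by (auto simp: weakly_differentiable_def)
 have dom: "AE z in weight_plus_variation U V. z \<in> dom f"
  and fW: "(\<lambda>z. the (f z)) \<in> borel_measurable (completion (weight_plus_variation U V))"
  using pm by (simp_all add: partial_measurable_iff)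
 have "is_weak_derivative U V f ?F" unfolding weak_derivative_def by (rule someI_ex[OF ex])
 then have W: "weak_diff (\<lambda>z. the (f z)) ?F"
  using is_weak_derivative_iff[OF weight_plus_transfer(1)[OF dom] weight_plus_transfer(3,4)[OF fW]] by simp
 have 1: "AE z in weight U V. z \<in> {z \<in> U. f z = Some 0} \<longrightarrow> ?F z = 0"
  using weak_diff_zero_set[OF W] by eventually_elim auto
 have 2: "(\<lambda>z. map_option (\<lambda>y. (y, g z)) (f z)) \<in> weakly_differentiable U V \<and>
   (AE z in weight U V. \<forall>v. weak_derivative U V (\<lambda>z. map_option (\<lambda>y. (y, g z)) (f z)) z v =
      (?F z v, weak_derivative U V (on_domain U g) z v))"
  if g: "locally_lipschitz_on U g" for g :: "real^'n \<Rightarrow> real^'k"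
 proof -
  obtain G where L: "lipschitz_derivative g G" by (rule lipschitz_derivative_exists[OF g]) (rule that)
  obtain H where H: "weak_diff (\<lambda>z. (the (f z), g z)) H" "\<And>z v. blinfun_apply (H z) v = (?F z v, G z v)"
   by (rule weak_diff_pair[OF W L]) (rule that)
  have m: "(\<lambda>z. (the (f z), g z)) \<in> borel_measurable (completion (weight_plus_variation U V))"
   by (intro borel_measurable_Pair fW lipschitz_derivative_measurable_weight_plus[OF L])
  note r = weakly_differentiable_map[OF pm, of "\<lambda>z y. (y, g z)", OF m H(1)]
  show ?thesis
  proof (rule conjI[OF r(1)])
   show "AE z in weight U V. \<forall>v. weak_derivative U V (\<lambda>z. map_option (\<lambda>y. (y, g z)) (f z)) z v =
      (?F z v, weak_derivative U V (on_domain U g) z v)"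
    using r(2) on_domain_weak_derivative[OF weak_diff_lipschitz[OF L]] by eventually_elim (simp add: H(2))
  qed
 qed
 have 3: "(\<lambda>z. map_option (\<lambda>y. y + g z) (f z)) \<in> weakly_differentiable U V \<and>
   (AE z in weight U V. weak_derivative U V (\<lambda>z. map_option (\<lambda>y. y + g z) (f z)) z =
      ?F z + weak_derivative U V (on_domain U g) z)"
  if g: "locally_lipschitz_on U g" for g :: "real^'n \<Rightarrow> real^'l"
 proof -
  obtain G where L: "lipschitz_derivative g G" by (rule lipschitz_derivative_exists[OF g]) (rule that)
  have m: "(\<lambda>z. the (f z) + g z) \<in> borel_measurable (completion (weight_plus_variation U V))"
   by (intro borel_measurable_add fW lipschitz_derivative_measurable_weight_plus[OF L])
  note r = weakly_differentiable_map[OF pm, of "\<lambda>z y. y + g z", OF m weak_diff_add[OF W L]]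
  show ?thesis
  proof (rule conjI[OF r(1)])
   show "AE z in weight U V. weak_derivative U V (\<lambda>z. map_option (\<lambda>y. y + g z) (f z)) z =
      ?F z + weak_derivative U V (on_domain U g) z"
    using r(2) on_domain_weak_derivative[OF weak_diff_lipschitz[OF L]] by eventually_elim simp
  qed
 qed
 have 4: "(\<lambda>z. map_option (\<lambda>y. g z *\<^sub>R y) (f z)) \<in> weakly_differentiable U V \<and>
   (AE z in weight U V. \<forall>v. weak_derivative U V (\<lambda>z. map_option (\<lambda>y. g z *\<^sub>R y) (f z)) z v =
      weak_derivative U V (on_domain U g) z v *\<^sub>R the (f z) + g z *\<^sub>R ?F z v)"
  if f1: "L1_loc U (weight U V) (\<lambda>z. the (f z))" "L1_loc U (weight U V) ?F" and g: "locally_lipschitz_on U g"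
  for g :: "real^'n \<Rightarrow> real"
 proof -
  obtain G where L: "lipschitz_derivative (\<lambda>z. vec (g z) :: real^1) G"
   by (rule lipschitz_derivative_exists[OF locally_lipschitz_vec[OF g]]) (rule that)
  obtain G1 where G1: "weak_diff g G1" "\<And>z v. blinfun_apply (G1 z) v = G z v $ 1"
   using weak_diff_component[OF L] by (auto simp: vec_component)
  obtain H where H: "weak_diff (\<lambda>z. g z *\<^sub>R the (f z)) H"
   "\<And>z v. blinfun_apply (H z) v = (G z v $ 1) *\<^sub>R the (f z) + g z *\<^sub>R ?F z v"
   using weak_diff_product[OF W L f1] by (auto simp: vec_component)
  have gW: "g \<in> borel_measurable (completion (weight_plus_variation U V))"
   using measurable_compose[OF lipschitz_derivative_measurable_weight_plus[OF L]
     borel_measurable_continuous_onI, of "\<lambda>y. y $ 1"]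
   by (simp add: continuous_on_component)
  have m: "(\<lambda>z. g z *\<^sub>R the (f z)) \<in> borel_measurable (completion (weight_plus_variation U V))"
   by (intro borel_measurable_scaleR fW gW)
  note r = weakly_differentiable_map[OF pm, of "\<lambda>z y. g z *\<^sub>R y", OF m H(1)]
  show ?thesis
  proof (rule conjI[OF r(1)])
   show "AE z in weight U V. \<forall>v. weak_derivative U V (\<lambda>z. map_option (\<lambda>y. g z *\<^sub>R y) (f z)) z v =
      weak_derivative U V (on_domain U g) z v *\<^sub>R the (f z) + g z *\<^sub>R ?F z v"
    using r(2) on_domain_weak_derivative[OF G1(1)] by eventually_elim (simp add: H(2) G1(2))
  qed
 qed
 show ?thesis unfolding Let_def using 1 2 3 4 by blast
qed

end
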